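(* Let $n\ge 2$. The number of coadjoint orbits of pre-maximal (submaximal) dimension of the group $U=U(C_n)$ over the finite field $\mathbb{F}_q$ of characteristic $p\ge n$ is a polynomial in $v=q-1$ with non-negative integer coefficients.
   Context: **Lie algebra and group.** Let $C_n^+=\{\varepsilon_i\pm\varepsilon_j : 1\le i<j\le n\}\cup\{2\varepsilon_i : 1\le i\le n\}$, where $\varepsilon_1,\dots,\varepsilon_n$ is the standard basis of $\mathbb{R}^n$. Index rows and columns of $2n\times 2n$ matrices by $1,2,\dots,n,-n,\dots,-2,-1$ (in this order), and let $e_{a,b}$ be the elementary matrices. $\mathfrak{u}=\mathfrak{u}(C_n)\subset\mathfrak{gl}_{2n}(\mathbb{F}_q)$ is the Lie subalgebra with basis $e_\alpha$, $\alpha\in C_n^+$, where $e_{\varepsilon_i-\varepsilon_j}=e_{j,i}-e_{-i,-j}$ and $e_{\varepsilon_i+\varepsilon_j}=e_{-j,i}+e_{-i,j}$ for $i<j$, and $e_{2\varepsilon_i}=e_{-i,i}$. It is a maximal nilpotent subalgebra of the symplectic Lie algebra. $U=U(C_n)=\exp(\mathfrak{u})$ is the corresponding maximal unipotent subgroup (a Sylow $p$-subgroup) of the finite symplectic group, where $\exp(x)=\sum_{k=0}^{2n-1}x^k/k!$ (the exponential map is taken to be a well-defined bijection $\mathfrak{u}\to U$ under the assumption on $p$). $U$ acts on $\mathfrak{u}$ by $x\mapsto gxg^{-1}$, and the coadjoint action on the dual space $\mathfrak{u}^*$ is the dual action $(g.\lambda)(x)=\lambda(g^{-1}xg)$. **Dimension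 of orbits.** The dimension of the coadjoint orbit of $f\in\mathfrak{u}^*$ is the rank of the bilinear form $(x,y)\mapsto f([x,y])$ on $\mathfrak{u}$. An orbit has pre-maximal (submaximal) dimension, i.e. is subregular, if its dimension is the largest value attained by coadjoint orbit dimensions which is strictly smaller than the maximal one. (The maximal dimension is $n(n-1)$, and the pre-maximal one is $n(n-1)-2$.) "Polynomial in $v$" means that for fixed $n$ one polynomial gives the number for all such $q$.
   Formalization: The case n = p = 2 is excluded: exp is undefined there and the maximal unipotent group has 2q²−q such orbits, not q² as for odd q. U is the group of lower unitriangular symplectic matrices, which is exp(u) when p ≥ 2n; the series is undefined for smaller p. *)

theory Defs
  imports
    "HOL-Computational_Algebra.Polynomial"
    "HOL-Algebra.Multiplicative_Group"
    "HOL-Algebra.Module"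
begin

text \<open>
  The ground field is an explicit HOL-Algebra structure, so that a single polynomial can be
  required to work for all finite fields \<open>F :: 'a ring\<close> at once. As soon as \<open>'a\<close> is infinite
  (for instance \<open>nat\<close>), every finite field is isomorphic to some \<open>F :: 'a ring\<close>.
\<close>

definition characteristic :: "('a, 'm) ring_scheme \<Rightarrow> nat" where
  "characteristic F = group.ord (add_monoid F) \<one>\<^bsub>F\<^esub>"


section \<open>Matrices indexed by \<open>1, \<dots>, n, -n, \<dots>, -1\<close>\<close>

definition idx :: "nat \<Rightarrow> int set" where
  "idx n = {1..int n} \<union> {- int n..- 1}"

text \<open>The rank of an index in the order \<open>1, 2, \<dots>, n, -n, \<dots>, -2, -1\<close>.\<close>
definition pos :: "nat \<Rightarrow> int \<Rightarrow> int" where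
  "pos n a = (if a > 0 then a else 2 * int n + 1 + a)"

text \<open>A matrix is a function of two indices that vanishes off \<open>idx n\<close>.\<close>
definition gl :: "('a, 'm) ring_scheme \<Rightarrow> nat \<Rightarrow> ('a, int \<Rightarrow> int \<Rightarrow> 'a) module" where
  "gl F n = \<lparr>
     carrier = {x. (\<forall>a b. x a b \<in> carrier F) \<and> (\<forall>a b. a \<notin> idx n \<or> b \<notin> idx n \<longrightarrow> x a b = \<zero>\<^bsub>F\<^esub>)},
     monoid.mult = (\<lambda>x y a b. \<Oplus>\<^bsub>F\<^esub>c\<in>idx n. x a c \<otimes>\<^bsub>F\<^esub> y c b),
     one = (\<lambda>a b. if a = b \<and> a \<in> idx n then \<one>\<^bsub>F\<^esub> else \<zero>\<^bsub>F\<^esub>),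
     zero = (\<lambda>a b. \<zero>\<^bsub>F\<^esub>),
     add = (\<lambda>x y a b. x a b \<oplus>\<^bsub>F\<^esub> y a b),
     module.smult = (\<lambda>c x a b. c \<otimes>\<^bsub>F\<^esub> x a b)\<rparr>"

definition elem_mat :: "('a, 'm) ring_scheme \<Rightarrow> int \<Rightarrow> int \<Rightarrow> int \<Rightarrow> int \<Rightarrow> 'a" where
  "elem_mat F a b = (\<lambda>i j. if i = a \<and> j = b then \<one>\<^bsub>F\<^esub> else \<zero>\<^bsub>F\<^esub>)"


section \<open>The Lie algebra \<open>\<uu>(C\<^sub>n)\<close>\<close>

text \<open>\<open>Diff i j\<close>, \<open>Sum i j\<close> and \<open>Dbl i\<close> stand for
  \<open>\<epsilon>\<^sub>i - \<epsilon>\<^sub>j\<close>, \<open>\<epsilon>\<^sub>i + \<epsilon>\<^sub>j\<close> and \<open>2 \<epsilon>\<^sub>i\<close>.\<close>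
datatype root = Diff nat nat | Sum nat nat | Dbl nat

definition pos_roots :: "nat \<Rightarrow> root set" where
  "pos_roots n =
     {Diff i j | i j. 1 \<le> i \<and> i < j \<and> j \<le> n} \<union>
     {Sum i j | i j. 1 \<le> i \<and> i < j \<and> j \<le> n} \<union>
     {Dbl i | i. 1 \<le> i \<and> i \<le> n}"

fun root_vec :: "('a, 'm) ring_scheme \<Rightarrow> nat \<Rightarrow> root \<Rightarrow> int \<Rightarrow> int \<Rightarrow> 'a" where
  "root_vec F n (Diff i j) =
     elem_mat F (int j) (int i) \<ominus>\<^bsub>gl F n\<^esub> elem_mat F (- int i) (- int j)"
| "root_vec F n (Sum i j) =
     elem_mat F (- int j) (int i) \<oplus>\<^bsub>gl F n\<^esub> elem_mat F (- int i) (int j)"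
| "root_vec F n (Dbl i) = elem_mat F (- int i) (int i)"

definition lie_u :: "('a, 'm) ring_scheme \<Rightarrow> nat \<Rightarrow> (int \<Rightarrow> int \<Rightarrow> 'a) set" where
  "lie_u F n =
     {\<Oplus>\<^bsub>gl F n\<^esub>\<alpha>\<in>pos_roots n. c \<alpha> \<odot>\<^bsub>gl F n\<^esub> root_vec F n \<alpha> | c. c \<in> pos_roots n \<rightarrow> carrier F}"

definition bracket ::
  "('a, 'm) ring_scheme \<Rightarrow> nat \<Rightarrow> (int \<Rightarrow> int \<Rightarrow> 'a) \<Rightarrow> (int \<Rightarrow> int \<Rightarrow> 'a) \<Rightarrow> (int \<Rightarrow> int \<Rightarrow> 'a)" where
  "bracket F n x y = x \<otimes>\<^bsub>gl F n\<^esub> y \<ominus>\<^bsub>gl F n\<^esub> y \<otimes>\<^bsub>gl F n\<^esub> x"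


section \<open>The group \<open>U(C\<^sub>n)\<close>\<close>

definition mat_transpose :: "(int \<Rightarrow> int \<Rightarrow> 'a) \<Rightarrow> int \<Rightarrow> int \<Rightarrow> 'a" where
  "mat_transpose x = (\<lambda>a b. x b a)"

text \<open>The Gram matrix of the alternating form with \<open>\<langle>e\<^sub>i, e\<^sub>-\<^sub>i\<rangle> = 1 = - \<langle>e\<^sub>-\<^sub>i, e\<^sub>i\<rangle>\<close> for \<open>i > 0\<close>,
  with respect to which the elements of \<open>lie_u F n\<close> are skew.\<close>
definition symp_form :: "('a, 'm) ring_scheme \<Rightarrow> nat \<Rightarrow> int \<Rightarrow> int \<Rightarrow> 'a" where
  "symp_form F n =
     (\<lambda>a b. if a \<in> idx n \<and> b = - a then (if a > 0 then \<one>\<^bsub>F\<^esub> else \<ominus>\<^bsub>F\<^esub> \<one>\<^bsub>F\<^esub>) else \<zero>\<^bsub>F\<^esub>)"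

text \<open>
  \<open>U(C\<^sub>n)\<close> as the maximal unipotent subgroup of the symplectic group: the lower unitriangular
  symplectic matrices. This is \<open>exp(\<uu>)\<close> whenever the exponential series makes sense on \<open>\<uu>\<close>,
  i.e. whenever the characteristic is at least \<open>2 n\<close>; see \<open>mat_exp_bij_betw\<close> below. In smaller
  characteristic the denominators \<open>k!\<close> vanish, and only the present description is available.
\<close>
definition group_U :: "('a, 'm) ring_scheme \<Rightarrow> nat \<Rightarrow> (int \<Rightarrow> int \<Rightarrow> 'a) set" where
  "group_U F n =
     {g \<in> carrier (gl F n).
        (\<forall>a\<in>idx n. g a a = \<one>\<^bsub>F\<^esub>) \<and>
        (\<forall>a\<in>idx n. \<forall>b\<in>idx n. pos n a < pos n b \<longrightarrow> g a b = \<zero>\<^bsub>F\<^esub>) \<and>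
        mat_transpose g \<otimes>\<^bsub>gl F n\<^esub> symp_form F n \<otimes>\<^bsub>gl F n\<^esub> g = symp_form F n}"

definition mat_exp :: "('a, 'm) ring_scheme \<Rightarrow> nat \<Rightarrow> (int \<Rightarrow> int \<Rightarrow> 'a) \<Rightarrow> int \<Rightarrow> int \<Rightarrow> 'a" where
  "mat_exp F n x =
     (\<Oplus>\<^bsub>gl F n\<^esub>k\<in>{..2 * n - 1}.
        inv\<^bsub>F\<^esub> ([(fact k :: nat)] \<cdot>\<^bsub>F\<^esub> \<one>\<^bsub>F\<^esub>) \<odot>\<^bsub>gl F n\<^esub> (x [^]\<^bsub>gl F n\<^esub> k))"


section \<open>Coadjoint orbits\<close>

definition dual_u :: "('a, 'm) ring_scheme \<Rightarrow> nat \<Rightarrow> ((int \<Rightarrow> int \<Rightarrow> 'a) \<Rightarrow> 'a) set" where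
  "dual_u F n =
     {f \<in> lie_u F n \<rightarrow>\<^sub>E carrier F.
        (\<forall>x\<in>lie_u F n. \<forall>y\<in>lie_u F n. f (x \<oplus>\<^bsub>gl F n\<^esub> y) = f x \<oplus>\<^bsub>F\<^esub> f y) \<and>
        (\<forall>c\<in>carrier F. \<forall>x\<in>lie_u F n. f (c \<odot>\<^bsub>gl F n\<^esub> x) = c \<otimes>\<^bsub>F\<^esub> f x)}"

definition coadj ::
  "('a, 'm) ring_scheme \<Rightarrow> nat \<Rightarrow> (int \<Rightarrow> int \<Rightarrow> 'a) \<Rightarrow> ((int \<Rightarrow> int \<Rightarrow> 'a) \<Rightarrow> 'a)
     \<Rightarrow> ((int \<Rightarrow> int \<Rightarrow> 'a) \<Rightarrow> 'a)" where
  "coadj F n g f = (\<lambda>x\<in>lie_u F n. f (inv\<^bsub>gl F n\<^esub> g \<otimes>\<^bsub>gl F n\<^esub> x \<otimes>\<^bsub>gl F n\<^esub> g))"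

definition coadj_orbit ::
  "('a, 'm) ring_scheme \<Rightarrow> nat \<Rightarrow> ((int \<Rightarrow> int \<Rightarrow> 'a) \<Rightarrow> 'a) \<Rightarrow> ((int \<Rightarrow> int \<Rightarrow> 'a) \<Rightarrow> 'a) set" where
  "coadj_orbit F n f = (\<lambda>g. coadj F n g f) ` group_U F n"

definition rows_indep :: "('a, 'm) ring_scheme \<Rightarrow> 'i set \<Rightarrow> 'j set \<Rightarrow> ('i \<Rightarrow> 'j \<Rightarrow> 'a) \<Rightarrow> bool" where
  "rows_indep F A T m \<longleftrightarrow>
     (\<forall>c\<in>A \<rightarrow> carrier F.
        (\<forall>t\<in>T. (\<Oplus>\<^bsub>F\<^esub>s\<in>A. c s \<otimes>\<^bsub>F\<^esub> m s t) = \<zero>\<^bsub>F\<^esub>) \<longrightarrow> (\<forall>s\<in>A. c s = \<zero>\<^bsub>F\<^esub>))"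

text \<open>Rank of a matrix with rows indexed by \<open>S\<close> and columns indexed by \<open>T\<close>, both finite.\<close>
definition matrix_rank :: "('a, 'm) ring_scheme \<Rightarrow> 'i set \<Rightarrow> 'j set \<Rightarrow> ('i \<Rightarrow> 'j \<Rightarrow> 'a) \<Rightarrow> nat" where
  "matrix_rank F S T m = Max {card A | A. A \<subseteq> S \<and> rows_indep F A T m}"

text \<open>Dimension of the orbit of \<open>f\<close>: the rank of the bilinear form \<open>(x, y) \<mapsto> f [x, y]\<close>, that is,
  of its Gram matrix in the basis \<open>e\<^sub>\<alpha>\<close> of \<open>\<uu>\<close>.\<close>
definition orbit_dim :: "('a, 'm) ring_scheme \<Rightarrow> nat \<Rightarrow> ((int \<Rightarrow> int \<Rightarrow> 'a) \<Rightarrow> 'a) \<Rightarrow> nat" where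
  "orbit_dim F n f =
     matrix_rank F (pos_roots n) (pos_roots n)
       (\<lambda>\<alpha> \<beta>. f (bracket F n (root_vec F n \<alpha>) (root_vec F n \<beta>)))"

definition max_dim :: "('a, 'm) ring_scheme \<Rightarrow> nat \<Rightarrow> nat" where
  "max_dim F n = Max (orbit_dim F n ` dual_u F n)"

definition submax_dim :: "('a, 'm) ring_scheme \<Rightarrow> nat \<Rightarrow> nat" where
  "submax_dim F n = Max {d \<in> orbit_dim F n ` dual_u F n. d < max_dim F n}"

text \<open>
  The orbits of submaximal dimension. For odd \<open>q\<close> one polynomial counts them; for \<open>n = 2\<close> this is
  \<open>(v + 1)\<^sup>2\<close>, whereas over the field with two elements the count for \<open>n = 2\<close> is \<open>6\<close> instead of \<open>4\<close>.
  Under the hypothesis \<open>n \<le> p\<close>, the pair \<open>n = p = 2\<close> is the only one in characteristic \<open>2\<close>.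
\<close>
definition submax_orbits ::
  "('a, 'm) ring_scheme \<Rightarrow> nat \<Rightarrow> ((int \<Rightarrow> int \<Rightarrow> 'a) \<Rightarrow> 'a) set set" where
  "submax_orbits F n = {coadj_orbit F n f | f. f \<in> dual_u F n \<and> orbit_dim F n f = submax_dim F n}"

section \<open>The exponential map\<close>

lemma finite_idx [simp, intro]: "finite (idx n)"
  by (simp add: idx_def)

lemma idx_uminus [simp]: "- a \<in> idx n \<longleftrightarrow> a \<in> idx n"
  by (auto simp: idx_def)

lemma idx_not_0: "a \<in> idx n \<Longrightarrow> a \<noteq> 0"
  by (auto simp: idx_def)

lemma pos_bounds: "a \<in> idx n \<Longrightarrow> 1 \<le> pos n a \<and> pos n a \<le> 2 * int n"
  by (auto simp: idx_def pos_def)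

lemma pos_uminus: "a \<in> idx n \<Longrightarrow> pos n (- a) = 2 * int n + 1 - pos n a"
  by (auto simp: idx_def pos_def)

lemma pos_inj: "a \<in> idx n \<Longrightarrow> b \<in> idx n \<Longrightarrow> pos n a = pos n b \<longleftrightarrow> a = b"
  by (auto simp: idx_def pos_def)

lemma gl_sel:
  "\<zero>\<^bsub>gl F n\<^esub> = (\<lambda>a b. \<zero>\<^bsub>F\<^esub>)"
  "\<one>\<^bsub>gl F n\<^esub> = (\<lambda>a b. if a = b \<and> a \<in> idx n then \<one>\<^bsub>F\<^esub> else \<zero>\<^bsub>F\<^esub>)"
  "x \<oplus>\<^bsub>gl F n\<^esub> y = (\<lambda>a b. x a b \<oplus>\<^bsub>F\<^esub> y a b)"
  "x \<otimes>\<^bsub>gl F n\<^esub> y = (\<lambda>a b. \<Oplus>\<^bsub>F\<^esub>c\<in>idx n. x a c \<otimes>\<^bsub>F\<^esub> y c b)"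
  "c \<odot>\<^bsub>gl F n\<^esub> x = (\<lambda>a b. c \<otimes>\<^bsub>F\<^esub> x a b)"
  by (simp_all add: gl_def)

lemma gl_carrier:
  "x \<in> carrier (gl F n) \<longleftrightarrow>
     (\<forall>a b. x a b \<in> carrier F) \<and> (\<forall>a b. a \<notin> idx n \<or> b \<notin> idx n \<longrightarrow> x a b = \<zero>\<^bsub>F\<^esub>)"
  by (simp add: gl_def)

lemma gl_entry: "x \<in> carrier (gl F n) \<Longrightarrow> x a b \<in> carrier F"
  by (simp add: gl_carrier)

lemma gl_off: "x \<in> carrier (gl F n) \<Longrightarrow> a \<notin> idx n \<or> b \<notin> idx n \<Longrightarrow> x a b = \<zero>\<^bsub>F\<^esub>"
  by (auto simp: gl_carrier)

lemma (in ring) finsum_swap: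
  assumes "finite A" "finite B" "\<And>i j. i \<in> A \<Longrightarrow> j \<in> B \<Longrightarrow> f i j \<in> carrier R"
  shows "(\<Oplus>i\<in>A. \<Oplus>j\<in>B. f i j) = (\<Oplus>j\<in>B. \<Oplus>i\<in>A. f i j)"
  using assms(1,3)
proof (induction A rule: finite_induct)
  case empty
  then show ?case by simp
next
  case (insert x A)
  have "(\<Oplus>i\<in>insert x A. \<Oplus>j\<in>B. f i j) = (\<Oplus>j\<in>B. f x j) \<oplus> (\<Oplus>i\<in>A. \<Oplus>j\<in>B. f i j)"
    using insert by (intro finsum_insert) (auto intro!: finsum_closed)
  also have "\<dots> = (\<Oplus>j\<in>B. f x j) \<oplus> (\<Oplus>j\<in>B. \<Oplus>i\<in>A. f i j)"
    using insert by simp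
  also have "\<dots> = (\<Oplus>j\<in>B. f x j \<oplus> (\<Oplus>i\<in>A. f i j))"
    using insert by (intro finsum_addf [symmetric]) (auto intro!: finsum_closed)
  also have "\<dots> = (\<Oplus>j\<in>B. \<Oplus>i\<in>insert x A. f i j)"
    using insert by (intro finsum_cong') (auto intro!: finsum_closed)
  finally show ?case .
qed

lemma (in ring) finsum_delta:
  assumes "finite A" "i \<in> A" "\<And>j. j \<in> A \<Longrightarrow> j \<noteq> i \<Longrightarrow> f j = \<zero>" "f i \<in> carrier R"
  shows "(\<Oplus>j\<in>A. f j) = f i"
proof -
  have "(\<Oplus>j\<in>A. f j) = (\<Oplus>j\<in>A. if i = j then f i else \<zero>)"
    using assms by (intro finsum_cong') auto
  also have "\<dots> = f i"
    using finsum_singleton[OF assms(2) assms(1), of "\<lambda>_. f i"] assms by simp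
  finally show ?thesis .
qed

lemma (in ring) gl_ring: "ring (gl R n)"
proof (rule ringI)
  show "abelian_group (gl R n)"
  proof (rule abelian_groupI)
    fix x assume x: "x \<in> carrier (gl R n)"
    show "\<exists>y\<in>carrier (gl R n). y \<oplus>\<^bsub>gl R n\<^esub> x = \<zero>\<^bsub>gl R n\<^esub>"
      using x by (intro bexI [of _ "\<lambda>a b. \<ominus> x a b"])
        (auto simp: gl_carrier gl_sel l_neg)
  qed (auto simp: gl_carrier gl_sel a_ac)
  show "monoid (gl R n)"
  proof (rule monoidI)
    fix x y assume x: "x \<in> carrier (gl R n)" and y: "y \<in> carrier (gl R n)"
    show "x \<otimes>\<^bsub>gl R n\<^esub> y \<in> carrier (gl R n)"
      using x y by (auto simp: gl_carrier gl_sel intro!: finsum_closed add.finprod_one_eqI)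
    show "\<one>\<^bsub>gl R n\<^esub> \<otimes>\<^bsub>gl R n\<^esub> x = x"
    proof (intro ext)
      fix a b
      show "(\<one>\<^bsub>gl R n\<^esub> \<otimes>\<^bsub>gl R n\<^esub> x) a b = x a b"
      proof (cases "a \<in> idx n")
        case True
        then show ?thesis using x
          by (subst gl_sel, subst finsum_delta [where i = a]) (auto simp: gl_sel gl_entry)
      next
        case False
        then have *: "x a b = \<zero>" using x by (simp add: gl_off)
        show ?thesis using x False unfolding * 
          by (auto simp: gl_sel gl_entry intro!: add.finprod_one_eqI)
      qed
    qed
    show "x \<otimes>\<^bsub>gl R n\<^esub> \<one>\<^bsub>gl R n\<^esub> = x"
    proof (intro ext)
      fix a b
      show "(x \<otimes>\<^bsub>gl R n\<^esub> \<one>\<^bsub>gl R n\<^esub>) a b = x a b"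
      proof (cases "b \<in> idx n")
        case True
        then show ?thesis using x
          by (subst gl_sel, subst finsum_delta [where i = b]) (auto simp: gl_sel gl_entry)
      next
        case False
        then have *: "x a b = \<zero>" using x by (simp add: gl_off)
        show ?thesis using x False unfolding * 
          by (auto simp: gl_sel gl_entry intro!: add.finprod_one_eqI)
      qed
    qed
    fix z assume z: "z \<in> carrier (gl R n)"
    note e = x[THEN gl_entry] y[THEN gl_entry] z[THEN gl_entry]
    show "x \<otimes>\<^bsub>gl R n\<^esub> y \<otimes>\<^bsub>gl R n\<^esub> z = x \<otimes>\<^bsub>gl R n\<^esub> (y \<otimes>\<^bsub>gl R n\<^esub> z)"
    proof (intro ext)
      fix a b
      have "(x \<otimes>\<^bsub>gl R n\<^esub> y \<otimes>\<^bsub>gl R n\<^esub> z) a b =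
          (\<Oplus>c\<in>idx n. (\<Oplus>d\<in>idx n. x a d \<otimes> y d c) \<otimes> z c b)"
        by (simp add: gl_sel)
      also have "\<dots> = (\<Oplus>c\<in>idx n. \<Oplus>d\<in>idx n. x a d \<otimes> y d c \<otimes> z c b)"
        using e by (intro finsum_cong' finsum_ldistr) (auto intro!: finsum_closed)
      also have "\<dots> = (\<Oplus>d\<in>idx n. \<Oplus>c\<in>idx n. x a d \<otimes> y d c \<otimes> z c b)"
        using e by (intro finsum_swap) auto
      also have "\<dots> = (\<Oplus>d\<in>idx n. \<Oplus>c\<in>idx n. x a d \<otimes> (y d c \<otimes> z c b))"
        using e by (intro finsum_cong') (auto intro!: finsum_closed simp: m_assoc)
      also have "\<dots> = (\<Oplus>d\<in>idx n. x a d \<otimes> (\<Oplus>c\<in>idx n. y d c \<otimes> z c b))"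
        using e by (intro finsum_cong' finsum_rdistr [symmetric]) (auto intro!: finsum_closed)
      also have "\<dots> = (x \<otimes>\<^bsub>gl R n\<^esub> (y \<otimes>\<^bsub>gl R n\<^esub> z)) a b"
        by (simp add: gl_sel)
      finally show "(x \<otimes>\<^bsub>gl R n\<^esub> y \<otimes>\<^bsub>gl R n\<^esub> z) a b = (x \<otimes>\<^bsub>gl R n\<^esub> (y \<otimes>\<^bsub>gl R n\<^esub> z)) a b" .
    qed
  qed (auto simp: gl_carrier gl_sel)
  fix x y z assume x: "x \<in> carrier (gl R n)" and y: "y \<in> carrier (gl R n)" and z: "z \<in> carrier (gl R n)"
  note e = x[THEN gl_entry] y[THEN gl_entry] z[THEN gl_entry]
  show "(x \<oplus>\<^bsub>gl R n\<^esub> y) \<otimes>\<^bsub>gl R n\<^esub> z = x \<otimes>\<^bsub>gl R n\<^esub> z \<oplus>\<^bsub>gl R n\<^esub> y \<otimes>\<^bsub>gl R n\<^esub> z"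
    using e by (auto simp: gl_sel l_distr fun_eq_iff intro!: finsum_addf)
  show "z \<otimes>\<^bsub>gl R n\<^esub> (x \<oplus>\<^bsub>gl R n\<^esub> y) = z \<otimes>\<^bsub>gl R n\<^esub> x \<oplus>\<^bsub>gl R n\<^esub> z \<otimes>\<^bsub>gl R n\<^esub> y"
    using e by (auto simp: gl_sel r_distr fun_eq_iff intro!: finsum_addf)
qed

lemma (in ring) gl_minus:
  assumes x: "x \<in> carrier (gl R n)"
  shows "\<ominus>\<^bsub>gl R n\<^esub> x = (\<lambda>a b. \<ominus> x a b)"
proof -
  interpret M: ring "gl R n" by (rule gl_ring)
  show ?thesis
    using x by (intro M.minus_equality) (auto simp: gl_carrier gl_sel l_neg)
qed

lemma (in ring) gl_diff:
  assumes "x \<in> carrier (gl R n)" "y \<in> carrier (gl R n)"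
  shows "x \<ominus>\<^bsub>gl R n\<^esub> y = (\<lambda>a b. x a b \<ominus> y a b)"
  using assms by (simp add: a_minus_def gl_minus) (simp add: gl_sel)

lemma (in ring) gl_smult_closed:
  "c \<in> carrier R \<Longrightarrow> x \<in> carrier (gl R n) \<Longrightarrow> c \<odot>\<^bsub>gl R n\<^esub> x \<in> carrier (gl R n)"
  by (auto simp: gl_carrier gl_sel)

lemma (in ring) gl_finsum:
  assumes "finite A" "\<And>k. k \<in> A \<Longrightarrow> f k \<in> carrier (gl R n)"
  shows "(\<Oplus>\<^bsub>gl R n\<^esub>k\<in>A. f k) a b = (\<Oplus>k\<in>A. f k a b)"
  using assms
proof (induction A rule: finite_induct)
  case empty
  interpret M: ring "gl R n" by (rule gl_ring)
  show ?case by (simp add: gl_sel)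
next
  case (insert x A)
  interpret M: ring "gl R n" by (rule gl_ring)
  have "(\<Oplus>\<^bsub>gl R n\<^esub>k\<in>insert x A. f k) = f x \<oplus>\<^bsub>gl R n\<^esub> (\<Oplus>\<^bsub>gl R n\<^esub>k\<in>A. f k)"
    using insert by (intro M.finsum_insert) auto
  moreover have "(\<Oplus>k\<in>insert x A. f k a b) = f x a b \<oplus> (\<Oplus>k\<in>A. f k a b)"
    using insert by (intro finsum_insert) (auto intro: gl_entry)
  ultimately show ?case using insert by (simp add: gl_sel)
qed

lemma (in cring) gl_smult_mult:
  assumes "c \<in> carrier R" "d \<in> carrier R" "x \<in> carrier (gl R n)" "y \<in> carrier (gl R n)"
  shows "(c \<odot>\<^bsub>gl R n\<^esub> x) \<otimes>\<^bsub>gl R n\<^esub> (d \<odot>\<^bsub>gl R n\<^esub> y) = (c \<otimes> d) \<odot>\<^bsub>gl R n\<^esub> (x \<otimes>\<^bsub>gl R n\<^esub> y)"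
proof (intro ext)
  fix a b
  note e = assms(1,2) assms(3,4)[THEN gl_entry]
  show "((c \<odot>\<^bsub>gl R n\<^esub> x) \<otimes>\<^bsub>gl R n\<^esub> (d \<odot>\<^bsub>gl R n\<^esub> y)) a b = ((c \<otimes> d) \<odot>\<^bsub>gl R n\<^esub> (x \<otimes>\<^bsub>gl R n\<^esub> y)) a b"
    using e by (simp add: gl_sel finsum_rdistr) (auto intro!: finsum_cong' simp: m_ac)
qed

subsection \<open>Strictly triangular matrices\<close>

definition tri :: "('a, 'm) ring_scheme \<Rightarrow> nat \<Rightarrow> nat \<Rightarrow> (int \<Rightarrow> int \<Rightarrow> 'a) set" where
  "tri F n j = {x \<in> carrier (gl F n).
     \<forall>a\<in>idx n. \<forall>b\<in>idx n. pos n a < pos n b + int j \<longrightarrow> x a b = \<zero>\<^bsub>F\<^esub>}"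

lemma tri_carrier: "x \<in> tri F n j \<Longrightarrow> x \<in> carrier (gl F n)"
  by (simp add: tri_def)

lemma tri_mono: "x \<in> tri F n j \<Longrightarrow> i \<le> j \<Longrightarrow> x \<in> tri F n i"
  by (auto simp: tri_def)

lemma tri_top:
  assumes "x \<in> tri F n j" "2 * n \<le> j"
  shows "x = \<zero>\<^bsub>gl F n\<^esub>"
proof (intro ext)
  fix a b
  show "x a b = \<zero>\<^bsub>gl F n\<^esub> a b"
  proof (cases "a \<in> idx n \<and> b \<in> idx n")
    case True
    then have "pos n a < pos n b + int j"
      using pos_bounds[of a n] pos_bounds[of b n] assms(2) by linarith
    then show ?thesis using True assms(1) by (auto simp: tri_def gl_sel)
  next
    case False
    then show ?thesis using gl_off[OF tri_carrier[OF assms(1)]] by (auto simp: gl_sel)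
  qed
qed

context ring
begin

lemma tri_add: "x \<in> tri R n j \<Longrightarrow> y \<in> tri R n j \<Longrightarrow> x \<oplus>\<^bsub>gl R n\<^esub> y \<in> tri R n j"
  by (auto simp: tri_def gl_carrier gl_sel)

lemma tri_zero: "\<zero>\<^bsub>gl R n\<^esub> \<in> tri R n j"
  by (auto simp: tri_def gl_carrier gl_sel)

lemma tri_minus: "x \<in> tri R n j \<Longrightarrow> \<ominus>\<^bsub>gl R n\<^esub> x \<in> tri R n j"
  using gl_minus[of x n] by (auto simp: tri_def gl_carrier)

lemma tri_smult: "c \<in> carrier R \<Longrightarrow> x \<in> tri R n j \<Longrightarrow> c \<odot>\<^bsub>gl R n\<^esub> x \<in> tri R n j"
  by (auto simp: tri_def gl_carrier gl_sel)

lemma tri_finsum: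
  assumes "finite A" "\<And>k. k \<in> A \<Longrightarrow> f k \<in> tri R n j"
  shows "(\<Oplus>\<^bsub>gl R n\<^esub>k\<in>A. f k) \<in> tri R n j"
  using assms
proof (induction A rule: finite_induct)
  case empty
  interpret M: ring "gl R n" by (rule gl_ring)
  show ?case by (simp add: tri_zero)
next
  case (insert x A)
  interpret M: ring "gl R n" by (rule gl_ring)
  have "(\<Oplus>\<^bsub>gl R n\<^esub>k\<in>insert x A. f k) = f x \<oplus>\<^bsub>gl R n\<^esub> (\<Oplus>\<^bsub>gl R n\<^esub>k\<in>A. f k)"
    using insert tri_carrier by (intro M.finsum_insert) (blast | auto)+
  then show ?case using insert by (simp add: tri_add)
qed

lemma tri_mult:
  assumes x: "x \<in> tri R n j" and y: "y \<in> tri R n k"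
  shows "x \<otimes>\<^bsub>gl R n\<^esub> y \<in> tri R n (j + k)"
proof -
  interpret M: ring "gl R n" by (rule gl_ring)
  have "(x \<otimes>\<^bsub>gl R n\<^esub> y) a b = \<zero>"
    if "a \<in> idx n" "b \<in> idx n" "pos n a < pos n b + int (j + k)" for a b
  proof -
    have "x a c \<otimes> y c b = \<zero>" if c: "c \<in> idx n" for c
    proof (cases "pos n a < pos n c + int j")
      case True
      then have "x a c = \<zero>" using x c that \<open>a \<in> idx n\<close> by (auto simp: tri_def)
      then show ?thesis using gl_entry[OF tri_carrier[OF y]] by simp
    next
      case False
      then have "pos n c < pos n b + int k" using \<open>pos n a < pos n b + int (j + k)\<close> by simp
      then have "y c b = \<zero>" using y c \<open>b \<in> idx n\<close> by (auto simp: tri_def)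
      then show ?thesis using gl_entry[OF tri_carrier[OF x]] by simp
    qed
    then show ?thesis by (auto simp: gl_sel intro!: add.finprod_one_eqI)
  qed
  then show ?thesis
    using x y by (auto simp: tri_def)
qed

lemma tri_pow:
  assumes x: "x \<in> tri R n 1"
  shows "x [^]\<^bsub>gl R n\<^esub> k \<in> tri R n k"
proof (induction k)
  case 0
  have "\<one>\<^bsub>gl R n\<^esub> \<in> tri R n 0"
    by (auto simp: tri_def gl_carrier gl_sel)
  then show ?case using monoid.nat_pow_0[OF ring.is_monoid[OF gl_ring]] by simp
next
  case (Suc k)
  then show ?case
    using tri_mult[OF Suc x] monoid.nat_pow_Suc[OF ring.is_monoid[OF gl_ring]] by simp
qed

lemma tri_pow_diff:
  assumes x: "x \<in> tri R n 1" and y: "y \<in> tri R n 1" and d: "x \<ominus>\<^bsub>gl R n\<^esub> y \<in> tri R n j"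
  shows "x [^]\<^bsub>gl R n\<^esub> Suc k \<ominus>\<^bsub>gl R n\<^esub> y [^]\<^bsub>gl R n\<^esub> Suc k \<in> tri R n (j + k)"
proof (induction k)
  case 0
  interpret M: ring "gl R n" by (rule gl_ring)
  show ?case using d x y by (simp add: tri_carrier)
next
  case (Suc k)
  interpret M: ring "gl R n" by (rule gl_ring)
  define X Y where "X = x [^]\<^bsub>gl R n\<^esub> Suc k" and "Y = y [^]\<^bsub>gl R n\<^esub> Suc k"
  have c: "x \<in> carrier (gl R n)" "y \<in> carrier (gl R n)" using x y by (auto simp: tri_carrier)
  then have C: "X \<in> carrier (gl R n)" "Y \<in> carrier (gl R n)" by (auto simp: X_def Y_def)
  have "X \<otimes>\<^bsub>gl R n\<^esub> x \<ominus>\<^bsub>gl R n\<^esub> Y \<otimes>\<^bsub>gl R n\<^esub> y =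
      (X \<ominus>\<^bsub>gl R n\<^esub> Y) \<otimes>\<^bsub>gl R n\<^esub> x \<oplus>\<^bsub>gl R n\<^esub> Y \<otimes>\<^bsub>gl R n\<^esub> (x \<ominus>\<^bsub>gl R n\<^esub> y)"
    using c C by algebra
  moreover have "(X \<ominus>\<^bsub>gl R n\<^esub> Y) \<otimes>\<^bsub>gl R n\<^esub> x \<in> tri R n ((j + k) + 1)"
    using Suc x unfolding X_def Y_def by (intro tri_mult)
  moreover have "Y \<otimes>\<^bsub>gl R n\<^esub> (x \<ominus>\<^bsub>gl R n\<^esub> y) \<in> tri R n (Suc k + j)"
    using y d unfolding Y_def by (intro tri_mult tri_pow)
  ultimately have "X \<otimes>\<^bsub>gl R n\<^esub> x \<ominus>\<^bsub>gl R n\<^esub> Y \<otimes>\<^bsub>gl R n\<^esub> y \<in> tri R n (j + Suc k)"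
    by (simp add: tri_add add.commute)
  then show ?case using c by (simp add: X_def Y_def)
qed

end

subsection \<open>The exponential of a strictly triangular matrix\<close>

lemma (in ring) add_pow_one_mult:
  "([i] \<cdot> \<one>) \<otimes> ([j] \<cdot> \<one>) = [(i * j :: nat)] \<cdot> \<one>"
  by (simp add: add_pow_ldistr add.nat_pow_pow mult.commute)

lemma (in ring) add_pow_one_mult_int:
  "([i] \<cdot> \<one>) \<otimes> ([j] \<cdot> \<one>) = [(i * j :: int)] \<cdot> \<one>"
  by (simp add: add_pow_ldistr_int add.int_pow_pow mult.commute)

lemma (in ring) add_pow_int_of_nat: "[int k] \<cdot> a = [k] \<cdot> a"
  by (simp add: add_pow_int_ge)

lemma (in ring) finsum_add_pow_int:
  assumes "finite A"
  shows "(\<Oplus>i\<in>A. [(z i :: int)] \<cdot> \<one>) = [(\<Sum>i\<in>A. z i)] \<cdot> \<one>"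
  using assms
proof (induction A rule: finite_induct)
  case empty
  then show ?case by (simp add: add_pow_int_ge)
next
  case (insert x A)
  have "(\<Oplus>i\<in>insert x A. [(z i :: int)] \<cdot> \<one>) = [z x] \<cdot> \<one> \<oplus> (\<Oplus>i\<in>A. [z i] \<cdot> \<one>)"
    using insert by (intro finsum_insert) auto
  then show ?case using insert add.int_pow_mult[of \<one> "z x"] by (simp add: add_pow_def)
qed

lemma (in ring) neg_one_pow: "(\<ominus> \<one>) [^] (i :: nat) = [((- 1) ^ i :: int)] \<cdot> \<one>"
proof (induction i)
  case 0
  then show ?case by (simp add: add_pow_int_ge)
next
  case (Suc i)
  have "[(- 1 :: int)] \<cdot> \<one> = \<ominus> \<one>" by (simp add: add_pow_int_lt)
  then show ?case using Suc add_pow_one_mult_int[of "(- 1) ^ i" "- 1"] by simp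
qed

lemma (in ring) gl_neg_pow:
  assumes x: "x \<in> carrier (gl R n)"
  shows "(\<ominus>\<^bsub>gl R n\<^esub> x) [^]\<^bsub>gl R n\<^esub> (k :: nat) = ((\<ominus> \<one>) [^] k) \<odot>\<^bsub>gl R n\<^esub> (x [^]\<^bsub>gl R n\<^esub> k)"
proof (induction k)
  case 0
  interpret M: ring "gl R n" by (rule gl_ring)
  show ?case by (auto simp: gl_sel fun_eq_iff)
next
  case (Suc k)
  interpret M: ring "gl R n" by (rule gl_ring)
  have X: "x [^]\<^bsub>gl R n\<^esub> k \<in> carrier (gl R n)" using x by simp
  have "(\<ominus>\<^bsub>gl R n\<^esub> x) [^]\<^bsub>gl R n\<^esub> Suc k =
      \<ominus>\<^bsub>gl R n\<^esub> ((((\<ominus> \<one>) [^] k) \<odot>\<^bsub>gl R n\<^esub> (x [^]\<^bsub>gl R n\<^esub> k)) \<otimes>\<^bsub>gl R n\<^esub> x)"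
    using x X Suc by (simp add: M.r_minus gl_smult_closed)
  also have "\<dots> = \<ominus>\<^bsub>gl R n\<^esub> (((\<ominus> \<one>) [^] k) \<odot>\<^bsub>gl R n\<^esub> (x [^]\<^bsub>gl R n\<^esub> k \<otimes>\<^bsub>gl R n\<^esub> x))"
    using x[THEN gl_entry] X[THEN gl_entry]
    by (intro arg_cong[of _ _ "a_inv (gl R n)"] ext)
      (auto simp: gl_sel finsum_rdistr m_assoc intro!: finsum_cong')
  also have "\<dots> = ((\<ominus> \<one>) [^] Suc k) \<odot>\<^bsub>gl R n\<^esub> (x [^]\<^bsub>gl R n\<^esub> k \<otimes>\<^bsub>gl R n\<^esub> x)"
    using M.m_closed[OF X x, THEN gl_entry] M.m_closed[OF X x]
    by (subst gl_minus[OF gl_smult_closed]) (auto simp: gl_sel(5) l_minus r_minus m_assoc)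
  finally show ?case using x by simp
qed

context field
begin

definition exp_ok :: "nat \<Rightarrow> bool" where
  "exp_ok n \<longleftrightarrow> n \<ge> 1 \<and> (\<forall>k<2 * n. [(fact k :: nat)] \<cdot> \<one> \<noteq> \<zero>)"

definition ifact :: "nat \<Rightarrow> 'a" where
  "ifact k = inv ([(fact k :: nat)] \<cdot> \<one>)"

lemma ifact:
  assumes "exp_ok n" "k < 2 * n"
  shows "ifact k \<in> carrier R" "([(fact k :: nat)] \<cdot> \<one>) \<otimes> ifact k = \<one>"
    "ifact k \<otimes> ([(fact k :: nat)] \<cdot> \<one>) = \<one>"
proof -
  have "[(fact k :: nat)] \<cdot> \<one> \<in> Units R"
    using assms by (simp add: exp_ok_def field_Units)
  then show "ifact k \<in> carrier R" "([(fact k :: nat)] \<cdot> \<one>) \<otimes> ifact k = \<one>"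
    "ifact k \<otimes> ([(fact k :: nat)] \<cdot> \<one>) = \<one>"
    by (auto simp: ifact_def)
qed

lemma ifact_0_1:
  assumes "exp_ok n"
  shows "ifact 0 = \<one>" "ifact (Suc 0) = \<one>"
  by (simp_all add: ifact_def add_pow_def)

lemma mat_exp_eq:
  "mat_exp R n x = (\<Oplus>\<^bsub>gl R n\<^esub>k\<in>{..2 * n - 1}. ifact k \<odot>\<^bsub>gl R n\<^esub> (x [^]\<^bsub>gl R n\<^esub> k))"
  by (simp add: mat_exp_def ifact_def)

lemma ifact_mult:
  assumes g: "exp_ok n" and k: "k < 2 * n" "i \<le> k"
  shows "ifact i \<otimes> ifact (k - i) = ifact k \<otimes> ([(k choose i)] \<cdot> \<one>)"
proof -
  define A B C D where "A = [(fact i :: nat)] \<cdot> \<one>" and "B = [(fact (k - i) :: nat)] \<cdot> \<one>"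
    and "C = [(fact k :: nat)] \<cdot> \<one>" and "D = [(k choose i)] \<cdot> \<one>"
  have "A \<otimes> B \<otimes> D = C"
    using binomial_fact_lemma[OF k(2)] by (simp add: A_def B_def C_def D_def add_pow_one_mult)
  moreover have c: "A \<in> carrier R" "B \<in> carrier R" "C \<in> carrier R" "D \<in> carrier R"
    by (auto simp: A_def B_def C_def D_def)
  moreover note ifact[OF g, of i, folded A_def] ifact[OF g, of "k - i", folded B_def]
    ifact[OF g, of k, folded C_def]
  ultimately have i: "ifact i \<in> carrier R" "A \<otimes> ifact i = \<one>" "ifact (k - i) \<in> carrier R"
    "B \<otimes> ifact (k - i) = \<one>" "ifact k \<in> carrier R" "ifact k \<otimes> C = \<one>" "A \<otimes> B \<otimes> D = C"
    using k by auto
  have "ifact i \<otimes> ifact (k - i) = (ifact k \<otimes> (A \<otimes> B \<otimes> D)) \<otimes> (ifact i \<otimes> ifact (k - i))"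
    using i by simp
  also have "\<dots> = ifact k \<otimes> ((A \<otimes> ifact i) \<otimes> (B \<otimes> ifact (k - i)) \<otimes> D)"
    using i(1,3,5) c by algebra
  also have "\<dots> = ifact k \<otimes> D" using i c by simp
  finally show ?thesis by (simp add: D_def)
qed

lemma exp_term_tri:
  assumes "exp_ok n" "k \<le> 2 * n - 1" "x \<in> tri R n 1"
  shows "ifact k \<odot>\<^bsub>gl R n\<^esub> (x [^]\<^bsub>gl R n\<^esub> k) \<in> tri R n k"
  using assms by (intro tri_smult tri_pow ifact(1)[of n]) (auto simp: exp_ok_def)

lemma exp_neg_mult:
  assumes g: "exp_ok n" and x: "x \<in> tri R n 1"
  shows "mat_exp R n (\<ominus>\<^bsub>gl R n\<^esub> x) \<otimes>\<^bsub>gl R n\<^esub> mat_exp R n x = \<one>\<^bsub>gl R n\<^esub>"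
proof -
  interpret M: ring "gl R n" by (rule gl_ring)
  let ?M = "gl R n"
  define L where "L = 2 * n - 1"
  have L: "k \<le> L \<longleftrightarrow> k < 2 * n" for k using g by (auto simp: L_def exp_ok_def)
  define f where "f = (\<lambda>k. if k \<le> L then ifact k \<odot>\<^bsub>?M\<^esub> ((\<ominus>\<^bsub>?M\<^esub> x) [^]\<^bsub>?M\<^esub> k) else \<zero>\<^bsub>?M\<^esub>)"
  define h where "h = (\<lambda>k. if k \<le> L then ifact k \<odot>\<^bsub>?M\<^esub> (x [^]\<^bsub>?M\<^esub> k) else \<zero>\<^bsub>?M\<^esub>)"
  have ft: "f k \<in> tri R n k" for k
    using exp_term_tri[OF g _ tri_minus[OF x]] by (auto simp: f_def L_def tri_zero)
  have ht: "h k \<in> tri R n k" for k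
    using exp_term_tri[OF g _ x] by (auto simp: h_def L_def tri_zero)
  note fc = ft[THEN tri_carrier] note hc = ht[THEN tri_carrier]
  have xc: "x \<in> carrier ?M" using x by (rule tri_carrier)
  have inner: "(\<Oplus>\<^bsub>?M\<^esub>i\<in>{..k}. f i \<otimes>\<^bsub>?M\<^esub> h (k - i)) = (if k = 0 then \<one>\<^bsub>?M\<^esub> else \<zero>\<^bsub>?M\<^esub>)" for k
  proof (cases "k \<le> L")
    case False
    have "f i \<otimes>\<^bsub>?M\<^esub> h (k - i) = \<zero>\<^bsub>?M\<^esub>" if "i \<in> {..k}" for i
      using tri_mult[OF ft[of i] ht[of "k - i"]] that False L[of k] by (intro tri_top) auto
    then show ?thesis using False by (auto intro: M.add.finprod_one_eqI)
  next
    case k: True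
    have X: "x [^]\<^bsub>?M\<^esub> k \<in> carrier ?M" using xc by simp
    have t: "f i \<otimes>\<^bsub>?M\<^esub> h (k - i) =
        (ifact k \<otimes> [((- 1) ^ i * int (k choose i))] \<cdot> \<one>) \<odot>\<^bsub>?M\<^esub> (x [^]\<^bsub>?M\<^esub> k)" if i: "i \<le> k" for i
    proof -
      have c: "ifact i \<in> carrier R" "ifact (k - i) \<in> carrier R" "ifact k \<in> carrier R"
        using ifact(1)[OF g] i k L by auto
      have "f i \<otimes>\<^bsub>?M\<^esub> h (k - i) = (ifact i \<odot>\<^bsub>?M\<^esub> ((\<ominus> \<one>) [^] i \<odot>\<^bsub>?M\<^esub> (x [^]\<^bsub>?M\<^esub> i))) \<otimes>\<^bsub>?M\<^esub>
          (ifact (k - i) \<odot>\<^bsub>?M\<^esub> (x [^]\<^bsub>?M\<^esub> (k - i)))"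
        using i k xc diff_le_self[of k i, THEN order_trans, OF k]
        by (simp add: f_def h_def gl_neg_pow)
      also have "ifact i \<odot>\<^bsub>?M\<^esub> ((\<ominus> \<one>) [^] i \<odot>\<^bsub>?M\<^esub> (x [^]\<^bsub>?M\<^esub> i)) =
          (ifact i \<otimes> (\<ominus> \<one>) [^] i) \<odot>\<^bsub>?M\<^esub> (x [^]\<^bsub>?M\<^esub> i)"
        using c gl_entry[OF M.nat_pow_closed[OF xc, of i]] by (auto simp: gl_sel(5) m_assoc)
      also have "\<dots> \<otimes>\<^bsub>?M\<^esub> (ifact (k - i) \<odot>\<^bsub>?M\<^esub> (x [^]\<^bsub>?M\<^esub> (k - i))) =
          ((ifact i \<otimes> (\<ominus> \<one>) [^] i) \<otimes> ifact (k - i)) \<odot>\<^bsub>?M\<^esub> (x [^]\<^bsub>?M\<^esub> i \<otimes>\<^bsub>?M\<^esub> x [^]\<^bsub>?M\<^esub> (k - i))"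
        using c xc by (intro gl_smult_mult) auto
      also have "x [^]\<^bsub>?M\<^esub> i \<otimes>\<^bsub>?M\<^esub> x [^]\<^bsub>?M\<^esub> (k - i) = x [^]\<^bsub>?M\<^esub> k"
        using i xc by (simp add: M.nat_pow_mult)
      also have "(ifact i \<otimes> (\<ominus> \<one>) [^] i) \<otimes> ifact (k - i) = (ifact i \<otimes> ifact (k - i)) \<otimes> (\<ominus> \<one>) [^] i"
        using c by (simp add: m_ac)
      also have "\<dots> = ifact k \<otimes> ([(k choose i)] \<cdot> \<one> \<otimes> (\<ominus> \<one>) [^] i)"
        using c ifact_mult[OF g _ i] k L by (simp add: m_assoc)
      also have "[(k choose i)] \<cdot> \<one> \<otimes> (\<ominus> \<one>) [^] i = [((- 1) ^ i * int (k choose i))] \<cdot> \<one>"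
        unfolding neg_one_pow add_pow_int_of_nat[symmetric] add_pow_one_mult_int
        by (simp only: mult.commute)
      finally show ?thesis .
    qed
    have ck: "ifact k \<in> carrier R" using ifact(1)[OF g] k L by auto
    have "(\<Oplus>\<^bsub>?M\<^esub>i\<in>{..k}. f i \<otimes>\<^bsub>?M\<^esub> h (k - i)) =
       (\<Oplus>\<^bsub>?M\<^esub>i\<in>{..k}. (ifact k \<otimes> [((- 1) ^ i * int (k choose i))] \<cdot> \<one>) \<odot>\<^bsub>?M\<^esub> (x [^]\<^bsub>?M\<^esub> k))"
      using t X ck by (intro M.finsum_cong') (auto intro!: gl_smult_closed)
    also have "\<dots> = (ifact k \<otimes> [(\<Sum>i\<le>k. (- 1) ^ i * int (k choose i))] \<cdot> \<one>) \<odot>\<^bsub>?M\<^esub> (x [^]\<^bsub>?M\<^esub> k)"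
      (is "?l = ?r")
    proof (intro ext)
      fix a b
      have e: "(x [^]\<^bsub>?M\<^esub> k) a b \<in> carrier R" using X by (rule gl_entry)
      have "?l a b = (\<Oplus>i\<in>{..k}. (ifact k \<otimes> [((- 1) ^ i * int (k choose i))] \<cdot> \<one>) \<otimes> (x [^]\<^bsub>?M\<^esub> k) a b)"
        using X ck by (subst gl_finsum) (auto intro!: gl_smult_closed, simp add: gl_sel)
      also have "\<dots> = (ifact k \<otimes> (\<Oplus>i\<in>{..k}. [((- 1) ^ i * int (k choose i))] \<cdot> \<one>)) \<otimes> (x [^]\<^bsub>?M\<^esub> k) a b"
        using e ck by (simp add: finsum_ldistr finsum_rdistr)
      finally show "?l a b = ?r a b"
        by (simp add: finsum_add_pow_int gl_sel)
    qed
    also have "\<dots> = (if k = 0 then \<one>\<^bsub>?M\<^esub> else \<zero>\<^bsub>?M\<^esub>)"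
    proof (cases "k = 0")
      case True
      then show ?thesis using ifact_0_1[OF g] xc
        by (auto simp: gl_sel add_pow_int_ge fun_eq_iff)
    next
      case False
      then have "(\<Sum>i\<le>k. (- 1) ^ i * int (k choose i)) = 0"
        using choose_alternating_sum[of k, where ?'a = int] by simp
      then have z: "[(\<Sum>i\<le>k. (- 1) ^ i * int (k choose i))] \<cdot> \<one> = \<zero>"
        by (simp add: add_pow_int_ge)
      show ?thesis unfolding z using ck X[THEN gl_entry] False by (auto simp: gl_sel)
    qed
    finally show ?thesis .
  qed
  have "mat_exp R n (\<ominus>\<^bsub>?M\<^esub> x) \<otimes>\<^bsub>?M\<^esub> mat_exp R n x = (\<Oplus>\<^bsub>?M\<^esub>i\<in>{..L}. f i) \<otimes>\<^bsub>?M\<^esub> (\<Oplus>\<^bsub>?M\<^esub>i\<in>{..L}. h i)"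
  proof -
    have "mat_exp R n (\<ominus>\<^bsub>?M\<^esub> x) = (\<Oplus>\<^bsub>?M\<^esub>i\<in>{..L}. f i)"
      unfolding mat_exp_eq L_def[symmetric] using fc by (intro M.finsum_cong') (auto simp: f_def)
    moreover have "mat_exp R n x = (\<Oplus>\<^bsub>?M\<^esub>i\<in>{..L}. h i)"
      unfolding mat_exp_eq L_def[symmetric] using hc by (intro M.finsum_cong') (auto simp: h_def)
    ultimately show ?thesis by simp
  qed
  also have "\<dots> = (\<Oplus>\<^bsub>?M\<^esub>k\<in>{..L + L}. \<Oplus>\<^bsub>?M\<^esub>i\<in>{..k}. f i \<otimes>\<^bsub>?M\<^esub> h (k - i))"
    using fc hc by (intro M.cauchy_product [symmetric] bound.intro) (auto simp: f_def h_def)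
  also have "\<dots> = (if (0::nat) = 0 then \<one>\<^bsub>?M\<^esub> else \<zero>\<^bsub>?M\<^esub>)"
    unfolding inner by (rule M.finsum_delta) auto
  finally show ?thesis by simp
qed

lemma exp_inj:
  assumes g: "exp_ok n" and x: "x \<in> tri R n 1" and y: "y \<in> tri R n 1"
    and eq: "mat_exp R n x = mat_exp R n y"
  shows "x = y"
proof -
  interpret M: ring "gl R n" by (rule gl_ring)
  let ?M = "gl R n"
  note xc = x[THEN tri_carrier] and yc = y[THEN tri_carrier]
  have n: "n \<ge> 1" using g by (simp add: exp_ok_def)
  have split: "mat_exp R n z = \<one>\<^bsub>?M\<^esub> \<oplus>\<^bsub>?M\<^esub> (z \<oplus>\<^bsub>?M\<^esub>
      (\<Oplus>\<^bsub>?M\<^esub>k\<in>{2..2 * n - 1}. ifact k \<odot>\<^bsub>?M\<^esub> (z [^]\<^bsub>?M\<^esub> k)))" if z: "z \<in> tri R n 1" for z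
  proof -
    note zc = z[THEN tri_carrier]
    have s: "{..2 * n - 1} = insert 0 (insert 1 {2..2 * n - 1})" using n by auto
    have c: "ifact k \<odot>\<^bsub>?M\<^esub> (z [^]\<^bsub>?M\<^esub> k) \<in> carrier ?M" if "k \<le> 2 * n - 1" for k
      using exp_term_tri[OF g that z] by (rule tri_carrier)
    have 0: "ifact 0 \<odot>\<^bsub>?M\<^esub> (z [^]\<^bsub>?M\<^esub> (0::nat)) = \<one>\<^bsub>?M\<^esub>"
      using ifact_0_1[OF g] by (auto simp: gl_sel fun_eq_iff)
    have 1: "ifact 1 \<odot>\<^bsub>?M\<^esub> (z [^]\<^bsub>?M\<^esub> (1::nat)) = z"
      using ifact_0_1[OF g] zc zc[THEN gl_entry] by (auto simp: gl_sel(5) fun_eq_iff)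
    have "(\<Oplus>\<^bsub>?M\<^esub>k\<in>insert 0 (insert 1 {2..2 * n - 1}). ifact k \<odot>\<^bsub>?M\<^esub> (z [^]\<^bsub>?M\<^esub> k)) =
       ifact 0 \<odot>\<^bsub>?M\<^esub> (z [^]\<^bsub>?M\<^esub> (0::nat)) \<oplus>\<^bsub>?M\<^esub>
       (\<Oplus>\<^bsub>?M\<^esub>k\<in>insert 1 {2..2 * n - 1}. ifact k \<odot>\<^bsub>?M\<^esub> (z [^]\<^bsub>?M\<^esub> k))"
      using c c[of 0] c[of 1] n by (intro M.finsum_insert) auto
    also have "(\<Oplus>\<^bsub>?M\<^esub>k\<in>insert 1 {2..2 * n - 1}. ifact k \<odot>\<^bsub>?M\<^esub> (z [^]\<^bsub>?M\<^esub> k)) =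
       ifact 1 \<odot>\<^bsub>?M\<^esub> (z [^]\<^bsub>?M\<^esub> (1::nat)) \<oplus>\<^bsub>?M\<^esub>
       (\<Oplus>\<^bsub>?M\<^esub>k\<in>{2..2 * n - 1}. ifact k \<odot>\<^bsub>?M\<^esub> (z [^]\<^bsub>?M\<^esub> k))"
      using c c[of 1] n by (intro M.finsum_insert) auto
    finally show ?thesis unfolding mat_exp_eq s 0 1 .
  qed
  define S where "S = (\<lambda>z. \<Oplus>\<^bsub>?M\<^esub>k\<in>{2..2 * n - 1}. ifact k \<odot>\<^bsub>?M\<^esub> (z [^]\<^bsub>?M\<^esub> k))"
  have Sc: "S z \<in> carrier ?M" if "z \<in> tri R n 1" for z
    unfolding S_def using exp_term_tri[OF g _ that, THEN tri_carrier] by (intro M.finsum_closed) auto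
  have sp: "mat_exp R n z = \<one>\<^bsub>?M\<^esub> \<oplus>\<^bsub>?M\<^esub> (z \<oplus>\<^bsub>?M\<^esub> S z)" if "z \<in> tri R n 1" for z
    using split[OF that] by (simp only: S_def)
  have e: "x \<oplus>\<^bsub>?M\<^esub> S x = y \<oplus>\<^bsub>?M\<^esub> S y"
    using eq xc yc Sc[OF x] Sc[OF y] unfolding sp[OF x] sp[OF y] by simp
  have step: "x \<ominus>\<^bsub>?M\<^esub> y \<in> tri R n (Suc j)" if j: "x \<ominus>\<^bsub>?M\<^esub> y \<in> tri R n j" for j
  proof -
    have t: "(ifact k \<odot>\<^bsub>?M\<^esub> (y [^]\<^bsub>?M\<^esub> k)) \<ominus>\<^bsub>?M\<^esub> (ifact k \<odot>\<^bsub>?M\<^esub> (x [^]\<^bsub>?M\<^esub> k)) \<in> tri R n (Suc j)"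
      if k: "k \<in> {2..2 * n - 1}" for k
    proof -
      have c: "ifact k \<in> carrier R" using ifact(1)[OF g] k by auto
      have j': "y \<ominus>\<^bsub>?M\<^esub> x \<in> tri R n j"
        using tri_minus[OF j] xc yc by (simp add: M.minus_eq M.minus_add M.a_comm)
      have p: "y [^]\<^bsub>?M\<^esub> k \<ominus>\<^bsub>?M\<^esub> x [^]\<^bsub>?M\<^esub> k \<in> tri R n (Suc j)"
      proof -
        obtain i where i: "k = Suc i" "1 \<le> i" using k by (cases k) auto
        show ?thesis
          unfolding i(1) using tri_pow_diff[OF y x j', of i] by (rule tri_mono) (use i in auto)
      qed
      have pc: "y [^]\<^bsub>?M\<^esub> k \<in> carrier ?M" "x [^]\<^bsub>?M\<^esub> k \<in> carrier ?M" using xc yc by auto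
      have "(ifact k \<odot>\<^bsub>?M\<^esub> (y [^]\<^bsub>?M\<^esub> k)) \<ominus>\<^bsub>?M\<^esub> (ifact k \<odot>\<^bsub>?M\<^esub> (x [^]\<^bsub>?M\<^esub> k)) =
          ifact k \<odot>\<^bsub>?M\<^esub> (y [^]\<^bsub>?M\<^esub> k \<ominus>\<^bsub>?M\<^esub> x [^]\<^bsub>?M\<^esub> k)"
        using c pc pc[THEN gl_entry]
        by (simp add: gl_diff gl_smult_closed) (simp add: gl_sel minus_eq r_distr r_minus)
      then show ?thesis using tri_smult[OF c p] by simp
    qed
    have "x \<ominus>\<^bsub>?M\<^esub> y = S y \<ominus>\<^bsub>?M\<^esub> S x"
    proof -
      note c = xc yc Sc[OF x] Sc[OF y]
      have "x \<ominus>\<^bsub>?M\<^esub> y = (x \<oplus>\<^bsub>?M\<^esub> S x) \<ominus>\<^bsub>?M\<^esub> S x \<ominus>\<^bsub>?M\<^esub> y"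
        using c by algebra
      also have "\<dots> = (y \<oplus>\<^bsub>?M\<^esub> S y) \<ominus>\<^bsub>?M\<^esub> S x \<ominus>\<^bsub>?M\<^esub> y" using e by simp
      also have "\<dots> = S y \<ominus>\<^bsub>?M\<^esub> S x" using c by algebra
      finally show ?thesis .
    qed
    also have "\<dots> = (\<Oplus>\<^bsub>?M\<^esub>k\<in>{2..2 * n - 1}.
        (ifact k \<odot>\<^bsub>?M\<^esub> (y [^]\<^bsub>?M\<^esub> k)) \<ominus>\<^bsub>?M\<^esub> (ifact k \<odot>\<^bsub>?M\<^esub> (x [^]\<^bsub>?M\<^esub> k)))"
    proof -
      have c: "ifact k \<odot>\<^bsub>?M\<^esub> (z [^]\<^bsub>?M\<^esub> k) \<in> carrier ?M" if "k \<in> {2..2 * n - 1}" "z \<in> tri R n 1" for k z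
        using exp_term_tri[OF g _ that(2)] that(1) by (auto intro: tri_carrier)
      let ?D = "\<Oplus>\<^bsub>?M\<^esub>k\<in>{2..2 * n - 1}.
        (ifact k \<odot>\<^bsub>?M\<^esub> (y [^]\<^bsub>?M\<^esub> k)) \<ominus>\<^bsub>?M\<^esub> (ifact k \<odot>\<^bsub>?M\<^esub> (x [^]\<^bsub>?M\<^esub> k))"
      have "?D \<oplus>\<^bsub>?M\<^esub> S x = (\<Oplus>\<^bsub>?M\<^esub>k\<in>{2..2 * n - 1}.
        ((ifact k \<odot>\<^bsub>?M\<^esub> (y [^]\<^bsub>?M\<^esub> k)) \<ominus>\<^bsub>?M\<^esub> (ifact k \<odot>\<^bsub>?M\<^esub> (x [^]\<^bsub>?M\<^esub> k))) \<oplus>\<^bsub>?M\<^esub> (ifact k \<odot>\<^bsub>?M\<^esub> (x [^]\<^bsub>?M\<^esub> k)))"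
        unfolding S_def using c x y by (intro M.finsum_addf [symmetric]) auto
      also have "\<dots> = S y"
        unfolding S_def using c x y by (intro M.finsum_cong') (auto simp: M.minus_eq M.a_assoc M.l_neg)
      finally have *: "?D \<oplus>\<^bsub>?M\<^esub> S x = S y" .
      have Dc: "?D \<in> carrier ?M" using c x y by (intro M.finsum_closed) auto
      show ?thesis unfolding *[symmetric] using Dc Sc[OF x] by (simp add: M.minus_eq M.a_assoc M.r_neg)
    qed
    also have "\<dots> \<in> tri R n (Suc j)" using t by (intro tri_finsum) auto
    finally show ?thesis .
  qed
  have "x \<ominus>\<^bsub>?M\<^esub> y \<in> tri R n j" for j
  proof (induction j)
    case 0
    show ?case using tri_mono[OF tri_add[OF x tri_minus[OF y]], of 0] by (simp add: M.minus_eq)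
  qed (rule step)
  from tri_top[OF this order_refl] have "x \<ominus>\<^bsub>?M\<^esub> y = \<zero>\<^bsub>?M\<^esub>" .
  then show ?thesis using xc yc by simp
qed

end

subsection \<open>The symplectic involution\<close>

definition adj :: "('a, 'm) ring_scheme \<Rightarrow> (int \<Rightarrow> int \<Rightarrow> 'a) \<Rightarrow> int \<Rightarrow> int \<Rightarrow> 'a" where
  "adj F x = (\<lambda>a b. if (a > 0) = (b > 0) then x (- b) (- a) else \<ominus>\<^bsub>F\<^esub> x (- b) (- a))"

lemma (in ring) finsum_idx_uminus:
  assumes "\<And>c. c \<in> idx n \<Longrightarrow> f c \<in> carrier R"
  shows "(\<Oplus>c\<in>idx n. f (- c)) = (\<Oplus>c\<in>idx n. f c)"
proof -
  have "x \<in> uminus ` idx n" if "x \<in> idx n" for x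
    using that by (intro image_eqI [of _ _ "- x"]) auto
  then have "uminus ` idx n = idx n"
    by auto
  then show ?thesis
    using assms finsum_reindex[of f uminus "idx n"] by simp
qed

context cring
begin

lemma adj_closed: "x \<in> carrier (gl R n) \<Longrightarrow> adj R x \<in> carrier (gl R n)"
  by (auto simp: gl_carrier adj_def)

lemma adj_one: "adj R \<one>\<^bsub>gl R n\<^esub> = \<one>\<^bsub>gl R n\<^esub>"
  by (auto simp: adj_def gl_sel fun_eq_iff)

lemma adj_smult:
  "c \<in> carrier R \<Longrightarrow> x \<in> carrier (gl R n) \<Longrightarrow> adj R (c \<odot>\<^bsub>gl R n\<^esub> x) = c \<odot>\<^bsub>gl R n\<^esub> adj R x"
  by (auto simp: adj_def gl_sel fun_eq_iff r_minus gl_entry)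

lemma adj_mult:
  assumes x: "x \<in> carrier (gl R n)" and y: "y \<in> carrier (gl R n)"
  shows "adj R (x \<otimes>\<^bsub>gl R n\<^esub> y) = adj R y \<otimes>\<^bsub>gl R n\<^esub> adj R x"
proof (intro ext)
  fix a b :: int
  note e = x[THEN gl_entry] y[THEN gl_entry]
  define s where "s = (if (a > 0) = (b > 0) then \<one> else \<ominus> \<one>)"
  have sc: "s \<in> carrier R" by (simp add: s_def)
  have "adj R (x \<otimes>\<^bsub>gl R n\<^esub> y) a b = s \<otimes> (\<Oplus>c\<in>idx n. x (- b) c \<otimes> y c (- a))"
    using e by (auto simp: adj_def s_def gl_sel l_minus)
  also have "\<dots> = s \<otimes> (\<Oplus>c\<in>idx n. x (- b) (- c) \<otimes> y (- c) (- a))"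
    using e by (subst finsum_idx_uminus[of n "\<lambda>c. x (- b) c \<otimes> y c (- a)"]) auto
  also have "\<dots> = (\<Oplus>c\<in>idx n. s \<otimes> (x (- b) (- c) \<otimes> y (- c) (- a)))"
    using e sc by (intro finsum_rdistr) auto
  also have "\<dots> = (\<Oplus>c\<in>idx n. adj R y a c \<otimes> adj R x c b)"
    using e by (intro finsum_cong') (auto simp: adj_def s_def l_minus r_minus m_comm)
  finally show "adj R (x \<otimes>\<^bsub>gl R n\<^esub> y) a b = (adj R y \<otimes>\<^bsub>gl R n\<^esub> adj R x) a b"
    by (simp add: gl_sel)
qed

lemma adj_pow:
  assumes x: "x \<in> carrier (gl R n)"
  shows "adj R (x [^]\<^bsub>gl R n\<^esub> (k :: nat)) = adj R x [^]\<^bsub>gl R n\<^esub> k"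
proof (induction k)
  case 0
  interpret M: ring "gl R n" by (rule gl_ring)
  show ?case by (simp add: adj_one)
next
  case (Suc k)
  interpret M: ring "gl R n" by (rule gl_ring)
  show ?case using Suc x adj_closed[OF x]
    by (simp add: adj_mult) (simp flip: M.nat_pow_Suc2)
qed

lemma adj_finsum:
  assumes "finite A" "\<And>k. k \<in> A \<Longrightarrow> f k \<in> carrier (gl R n)"
  shows "adj R (\<Oplus>\<^bsub>gl R n\<^esub>k\<in>A. f k) = (\<Oplus>\<^bsub>gl R n\<^esub>k\<in>A. adj R (f k))"
  using assms
proof (induction A rule: finite_induct)
  case empty
  interpret M: ring "gl R n" by (rule gl_ring)
  show ?case by (auto simp: adj_def gl_sel fun_eq_iff)
next
  case (insert x A)
  interpret M: ring "gl R n" by (rule gl_ring)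
  have s: "(\<Oplus>\<^bsub>gl R n\<^esub>k\<in>A. f k) \<in> carrier (gl R n)"
    using insert by (intro M.finsum_closed) auto
  have "adj R (\<Oplus>\<^bsub>gl R n\<^esub>k\<in>insert x A. f k) = adj R (f x \<oplus>\<^bsub>gl R n\<^esub> (\<Oplus>\<^bsub>gl R n\<^esub>k\<in>A. f k))"
    using insert by (subst M.finsum_insert) auto
  also have "\<dots> = adj R (f x) \<oplus>\<^bsub>gl R n\<^esub> adj R (\<Oplus>\<^bsub>gl R n\<^esub>k\<in>A. f k)"
    using insert.prems[of x] s
    by (auto simp: adj_def gl_sel(3) fun_eq_iff minus_add gl_entry a_comm)
  also have "\<dots> = (\<Oplus>\<^bsub>gl R n\<^esub>k\<in>insert x A. adj R (f k))"
    using insert by (subst M.finsum_insert) (auto simp: adj_closed)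
  finally show ?case .
qed

lemma adj_add:
  assumes "x \<in> carrier (gl R n)" "y \<in> carrier (gl R n)"
  shows "adj R (x \<oplus>\<^bsub>gl R n\<^esub> y) a b = adj R x a b \<oplus> adj R y a b"
  using assms[THEN gl_entry] by (auto simp: adj_def gl_sel minus_add a_comm)

lemma adj_tri: "x \<in> tri R n j \<Longrightarrow> adj R x \<in> tri R n j"
  using pos_uminus[of _ n] by (auto simp: tri_def adj_closed) (auto simp: adj_def)

lemma symp_iff_adj:
  assumes g: "g \<in> carrier (gl R n)"
  shows "mat_transpose g \<otimes>\<^bsub>gl R n\<^esub> symp_form R n \<otimes>\<^bsub>gl R n\<^esub> g = symp_form R n \<longleftrightarrow>
    adj R g \<otimes>\<^bsub>gl R n\<^esub> g = \<one>\<^bsub>gl R n\<^esub>"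
proof -
  interpret M: ring "gl R n" by (rule gl_ring)
  note e = g[THEN gl_entry]
  define s where "s = (\<lambda>a :: int. if a > 0 then \<one> else \<ominus> \<one>)"
  have s: "s a \<in> carrier R" "s a \<otimes> s a = \<one>" for a by (auto simp: s_def l_minus)
  have sm: "s (- a) = \<ominus> s a" if "a \<noteq> 0" for a using that by (auto simp: s_def)
  let ?W = "mat_transpose g \<otimes>\<^bsub>gl R n\<^esub> symp_form R n \<otimes>\<^bsub>gl R n\<^esub> g"
  let ?V = "adj R g \<otimes>\<^bsub>gl R n\<^esub> g"
  have Jc: "symp_form R n \<in> carrier (gl R n)" by (auto simp: gl_carrier symp_form_def)
  have Tc: "mat_transpose g \<in> carrier (gl R n)" using g by (auto simp: gl_carrier mat_transpose_def)
  have inner: "(mat_transpose g \<otimes>\<^bsub>gl R n\<^esub> symp_form R n) a c = \<ominus> (s c \<otimes> g (- c) a)"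
    if c: "c \<in> idx n" for a c
  proof -
    have "(mat_transpose g \<otimes>\<^bsub>gl R n\<^esub> symp_form R n) a c =
        (\<Oplus>d\<in>idx n. g d a \<otimes> symp_form R n d c)"
      by (simp add: gl_sel mat_transpose_def)
    also have "\<dots> = g (- c) a \<otimes> symp_form R n (- c) c"
      using c e Jc[THEN gl_entry] by (intro finsum_delta) (auto simp: symp_form_def)
    also have "\<dots> = \<ominus> (s c \<otimes> g (- c) a)"
      using c e idx_not_0[OF c] by (auto simp: symp_form_def s_def l_minus r_minus)
    finally show ?thesis .
  qed
  have rel: "?W (- a) b = \<ominus> (s a \<otimes> ?V a b)" if a: "a \<in> idx n" for a b
  proof -
    have "?W (- a) b = (\<Oplus>c\<in>idx n. \<ominus> (s c \<otimes> g (- c) (- a)) \<otimes> g c b)"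
      unfolding gl_sel(4)[of _ _ "mat_transpose g \<otimes>\<^bsub>gl R n\<^esub> symp_form R n"]
      using e s by (intro finsum_cong') (auto simp: inner)
    also have "\<dots> = (\<Oplus>c\<in>idx n. \<ominus> s a \<otimes> (adj R g a c \<otimes> g c b))"
      using e s by (intro finsum_cong') (auto simp: adj_def s_def l_minus r_minus m_assoc)
    also have "\<dots> = \<ominus> s a \<otimes> ?V a b"
      unfolding gl_sel(4) using e adj_closed[OF g, THEN gl_entry] s by (intro finsum_rdistr [symmetric]) auto
    also have "\<dots> = \<ominus> (s a \<otimes> ?V a b)"
      using s M.m_closed[OF adj_closed[OF g] g, THEN gl_entry] by (simp add: l_minus)
    finally show ?thesis .
  qed
  have J: "symp_form R n (- a) b = \<ominus> (s a \<otimes> \<one>\<^bsub>gl R n\<^esub> a b)" if a: "a \<in> idx n" for a b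
    using a idx_not_0[OF a] by (auto simp: symp_form_def s_def gl_sel)
  have Wc: "?W \<in> carrier (gl R n)" and Vc: "?V \<in> carrier (gl R n)"
    using g Jc Tc adj_closed[OF g] by auto
  have canc: "\<ominus> (s a \<otimes> v) = \<ominus> (s a \<otimes> w) \<longleftrightarrow> v = w" if "v \<in> carrier R" "w \<in> carrier R" for a v w
    by (metis a_inv_inj l_one m_assoc m_closed minus_minus s that)
  show ?thesis
  proof
    assume W: "?W = symp_form R n"
    show "?V = \<one>\<^bsub>gl R n\<^esub>"
    proof (intro ext)
      fix a b
      show "?V a b = \<one>\<^bsub>gl R n\<^esub> a b"
      proof (cases "a \<in> idx n")
        case True
        have "\<ominus> (s a \<otimes> ?V a b) = \<ominus> (s a \<otimes> \<one>\<^bsub>gl R n\<^esub> a b)"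
          using rel[OF True] J[OF True] W by simp
        then show ?thesis using canc gl_entry[OF Vc] gl_entry[OF M.one_closed] by blast
      next
        case False
        then show ?thesis using gl_off[OF Vc] gl_off[OF M.one_closed] by simp
      qed
    qed
  next
    assume V: "?V = \<one>\<^bsub>gl R n\<^esub>"
    show "?W = symp_form R n"
    proof (intro ext)
      fix a b
      show "?W a b = symp_form R n a b"
      proof (cases "a \<in> idx n")
        case True
        then show ?thesis using rel[of "- a" b] J[of "- a" b] V by simp
      next
        case False
        then show ?thesis using gl_off[OF Wc] gl_off[OF Jc] by simp
      qed
    qed
  qed
qed

end

lemma group_U_eq:
  assumes "cring F"
  shows "group_U F n = {g \<in> carrier (gl F n).
    g \<ominus>\<^bsub>gl F n\<^esub> \<one>\<^bsub>gl F n\<^esub> \<in> tri F n 1 \<and> adj F g \<otimes>\<^bsub>gl F n\<^esub> g = \<one>\<^bsub>gl F n\<^esub>}"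
proof -
  interpret cring F by fact
  interpret M: ring "gl F n" by (rule gl_ring)
  have "(\<forall>a\<in>idx n. g a a = \<one>\<^bsub>F\<^esub>) \<and>
        (\<forall>a\<in>idx n. \<forall>b\<in>idx n. pos n a < pos n b \<longrightarrow> g a b = \<zero>\<^bsub>F\<^esub>) \<longleftrightarrow>
     g \<ominus>\<^bsub>gl F n\<^esub> \<one>\<^bsub>gl F n\<^esub> \<in> tri F n 1" if g: "g \<in> carrier (gl F n)" for g
  proof -
    have "g \<ominus>\<^bsub>gl F n\<^esub> \<one>\<^bsub>gl F n\<^esub> \<in> tri F n 1 \<longleftrightarrow>
      (\<forall>a\<in>idx n. \<forall>b\<in>idx n. pos n a \<le> pos n b \<longrightarrow> g a b = \<one>\<^bsub>gl F n\<^esub> a b)"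
      using g M.minus_closed[OF g M.one_closed]
        gl_entry[OF g] gl_entry[OF M.one_closed]
      by (auto simp: tri_def gl_diff zless_add1_eq less_le_not_le)
    also have "\<dots> \<longleftrightarrow> (\<forall>a\<in>idx n. g a a = \<one>\<^bsub>F\<^esub>) \<and>
        (\<forall>a\<in>idx n. \<forall>b\<in>idx n. pos n a < pos n b \<longrightarrow> g a b = \<zero>\<^bsub>F\<^esub>)"
      using pos_inj[of _ n] by (fastforce simp: gl_sel le_less)
    finally show ?thesis by simp
  qed
  then show ?thesis
    by (auto simp: group_U_def symp_iff_adj)
qed


subsection \<open>\<open>\<uu>(C\<^sub>n)\<close> as the strictly triangular skew matrices\<close>

lemma finite_pos_roots [simp, intro]: "finite (pos_roots n)"
proof -
  have "pos_roots n \<subseteq> case_prod Diff ` ({..n} \<times> {..n}) \<union> case_prod Sum ` ({..n} \<times> {..n}) \<union> Dbl ` {..n}"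
    by (auto simp: pos_roots_def)
  then show ?thesis by (rule finite_subset) auto
qed

lemma (in ring) elem_mat_closed: "a \<in> idx n \<Longrightarrow> b \<in> idx n \<Longrightarrow> elem_mat R a b \<in> carrier (gl R n)"
  by (auto simp: gl_carrier elem_mat_def)

lemma (in ring) root_vec_Diff:
  assumes "Diff i j \<in> pos_roots n"
  shows "root_vec R n (Diff i j) = (\<lambda>a b. if a = int j \<and> b = int i then \<one>
    else if a = - int i \<and> b = - int j then \<ominus> \<one> else \<zero>)"
proof -
  have *: "int i \<in> idx n" "int j \<in> idx n" "i \<ge> 1"
    using assms by (auto simp: pos_roots_def idx_def)
  show ?thesis
    using * by (simp add: gl_diff elem_mat_closed) (auto simp: elem_mat_def fun_eq_iff minus_eq)
qed

lemma (in ring) root_vec_Sum: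
  assumes "Sum i j \<in> pos_roots n"
  shows "root_vec R n (Sum i j) = (\<lambda>a b. if (a = - int j \<and> b = int i) \<or> (a = - int i \<and> b = int j)
    then \<one> else \<zero>)"
  using assms by (auto simp: elem_mat_def fun_eq_iff gl_sel pos_roots_def)

lemma (in ring) root_vec_Dbl:
  "root_vec R n (Dbl i) = (\<lambda>a b. if a = - int i \<and> b = int i then \<one> else \<zero>)"
  by (auto simp: elem_mat_def fun_eq_iff)

definition skew :: "('a, 'm) ring_scheme \<Rightarrow> nat \<Rightarrow> (int \<Rightarrow> int \<Rightarrow> 'a) set" where
  "skew F n = {x \<in> tri F n 1. adj F x = \<ominus>\<^bsub>gl F n\<^esub> x}"

context cring
begin

lemma root_vec_skew:
  assumes "\<alpha> \<in> pos_roots n"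
  shows "root_vec R n \<alpha> \<in> skew R n"
proof -
  have *: "root_vec R n \<alpha> \<in> tri R n 1 \<and> adj R (root_vec R n \<alpha>) = (\<lambda>a b. \<ominus> root_vec R n \<alpha> a b)"
  proof (cases \<alpha>)
    case (Diff i j)
    with assms have ij: "1 \<le> i" "i < j" "j \<le> n" by (auto simp: pos_roots_def)
    show ?thesis
      using ij root_vec_Diff[OF assms[unfolded Diff]] unfolding Diff
      by (auto simp: tri_def gl_carrier adj_def fun_eq_iff idx_def pos_def)
  next
    case (Sum i j)
    with assms have ij: "1 \<le> i" "i < j" "j \<le> n" by (auto simp: pos_roots_def)
    show ?thesis
      using ij root_vec_Sum[OF assms[unfolded Sum]] unfolding Sum
      by (auto simp: tri_def gl_carrier adj_def fun_eq_iff idx_def pos_def)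
  next
    case (Dbl i)
    with assms have ij: "1 \<le> i" "i \<le> n" by (auto simp: pos_roots_def)
    show ?thesis
      using ij root_vec_Dbl[of n i] unfolding Dbl
      by (auto simp: tri_def gl_carrier adj_def fun_eq_iff idx_def pos_def)
  qed
  then show ?thesis
    using gl_minus[OF tri_carrier[OF conjunct1[OF *]]] by (simp add: skew_def)
qed

lemma skew_entrywise:
  "x \<in> skew R n \<longleftrightarrow> x \<in> tri R n 1 \<and> (\<forall>a b. adj R x a b = \<ominus> x a b)"
  using gl_minus[OF tri_carrier, of x n 1] by (auto simp: skew_def fun_eq_iff)

lemma skew_add: "x \<in> skew R n \<Longrightarrow> y \<in> skew R n \<Longrightarrow> x \<oplus>\<^bsub>gl R n\<^esub> y \<in> skew R n"
  unfolding skew_entrywise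
  using gl_entry[OF tri_carrier, of x R n 1] gl_entry[OF tri_carrier, of y R n 1]
  by (auto simp: tri_add adj_add tri_carrier) (simp add: gl_sel minus_add a_comm)

lemma skew_smult: "c \<in> carrier R \<Longrightarrow> x \<in> skew R n \<Longrightarrow> c \<odot>\<^bsub>gl R n\<^esub> x \<in> skew R n"
  unfolding skew_entrywise
  by (auto simp: tri_smult adj_smult tri_carrier) (auto simp: gl_sel r_minus gl_entry[OF tri_carrier])

lemma skew_finsum:
  assumes "finite A" "\<And>k. k \<in> A \<Longrightarrow> f k \<in> skew R n"
  shows "(\<Oplus>\<^bsub>gl R n\<^esub>k\<in>A. f k) \<in> skew R n"
  using assms
proof (induction A rule: finite_induct)
  case empty
  interpret M: ring "gl R n" by (rule gl_ring)
  show ?case unfolding skew_entrywise by (auto simp: tri_zero) (auto simp: adj_def gl_sel)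
next
  case (insert x A)
  interpret M: ring "gl R n" by (rule gl_ring)
  have "(\<Oplus>\<^bsub>gl R n\<^esub>k\<in>insert x A. f k) = f x \<oplus>\<^bsub>gl R n\<^esub> (\<Oplus>\<^bsub>gl R n\<^esub>k\<in>A. f k)"
    using insert by (intro M.finsum_insert) (auto simp: skew_def dest: tri_carrier)
  then show ?case using insert by (simp add: skew_add)
qed

definition root_of :: "int \<Rightarrow> int \<Rightarrow> root" where
  "root_of a b = (if a > 0 then Diff (nat b) (nat a) else if b < 0 then Diff (nat (- a)) (nat (- b))
     else if - a = b then Dbl (nat b) else if - a < b then Sum (nat (- a)) (nat b)
     else Sum (nat b) (nat (- a)))"

definition root_coeff :: "(int \<Rightarrow> int \<Rightarrow> 'a) \<Rightarrow> root \<Rightarrow> 'a" where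
  "root_coeff x \<alpha> = (case \<alpha> of Diff i j \<Rightarrow> x (int j) (int i) | Sum i j \<Rightarrow> x (- int j) (int i)
     | Dbl i \<Rightarrow> x (- int i) (int i))"

lemma root_of_unique:
  assumes "\<alpha> \<in> pos_roots n" "root_vec R n \<alpha> a b \<noteq> \<zero>"
  shows "\<alpha> = root_of a b"
proof (cases \<alpha>)
  case (Diff i j)
  with assms(1) have "1 \<le> i" "i < j" by (auto simp: pos_roots_def)
  then show ?thesis using assms(2) root_vec_Diff[OF assms(1)[unfolded Diff]] unfolding Diff
    by (auto simp: root_of_def split: if_splits)
next
  case (Sum i j)
  with assms(1) have "1 \<le> i" "i < j" by (auto simp: pos_roots_def)
  then show ?thesis using assms(2) root_vec_Sum[OF assms(1)[unfolded Sum]] unfolding Sum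
    by (auto simp: root_of_def split: if_splits)
next
  case (Dbl i)
  with assms(1) have "1 \<le> i" by (auto simp: pos_roots_def)
  then show ?thesis using assms(2) root_vec_Dbl[of n i] unfolding Dbl
    by (auto simp: root_of_def split: if_splits)
qed

lemma root_of_coeff:
  assumes x: "x \<in> skew R n" and a: "a \<in> idx n" and b: "b \<in> idx n" and p: "pos n b < pos n a"
  shows "root_of a b \<in> pos_roots n \<and>
    root_coeff x (root_of a b) \<otimes> root_vec R n (root_of a b) a b = x a b"
proof -
  have e: "x c d \<in> carrier R" for c d
    using x by (auto simp: skew_def tri_def gl_carrier)
  have s: "adj R x a b = \<ominus> x a b" using x by (simp add: skew_entrywise)
  consider (1) "a > 0" "b > 0" "b < a" | (2) "a < 0" "b < 0" "b < a"
    | (3) "a < 0" "b > 0" "- a = b" | (4) "a < 0" "b > 0" "- a < b" | (5) "a < 0" "b > 0" "b < - a"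
    using a b p by (auto simp: idx_def pos_def split: if_splits) linarith+
  then show ?thesis
  proof cases
    case 1
    then have r: "root_of a b = Diff (nat b) (nat a)" by (simp add: root_of_def)
    have m: "Diff (nat b) (nat a) \<in> pos_roots n" using 1 a b by (auto simp: pos_roots_def idx_def)
    show ?thesis using 1 m e unfolding r root_vec_Diff[OF m] by (simp add: root_coeff_def)
  next
    case 2
    then have r: "root_of a b = Diff (nat (- a)) (nat (- b))" by (simp add: root_of_def)
    have m: "Diff (nat (- a)) (nat (- b)) \<in> pos_roots n" using 2 a b by (auto simp: pos_roots_def idx_def)
    have "x (- b) (- a) = \<ominus> x a b" using s 2 by (simp add: adj_def)
    then show ?thesis using 2 m e unfolding r root_vec_Diff[OF m] by (simp add: root_coeff_def l_minus r_minus)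
  next
    case 3
    then have r: "root_of a b = Dbl (nat b)" by (simp add: root_of_def)
    have m: "Dbl (nat b) \<in> pos_roots n" using 3 a b by (auto simp: pos_roots_def idx_def)
    show ?thesis using 3 m e unfolding r root_vec_Dbl by (auto simp: root_coeff_def)
  next
    case 4
    then have r: "root_of a b = Sum (nat (- a)) (nat b)" by (simp add: root_of_def)
    have m: "Sum (nat (- a)) (nat b) \<in> pos_roots n" using 4 a b by (auto simp: pos_roots_def idx_def)
    have "\<ominus> x (- b) (- a) = \<ominus> x a b" using s 4 by (simp add: adj_def)
    then have "x (- b) (- a) = x a b" using e by (metis minus_minus)
    then show ?thesis using 4 m e unfolding r root_vec_Sum[OF m] by (simp add: root_coeff_def)
  next
    case 5
    then have r: "root_of a b = Sum (nat b) (nat (- a))" by (simp add: root_of_def)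
    have m: "Sum (nat b) (nat (- a)) \<in> pos_roots n" using 5 a b by (auto simp: pos_roots_def idx_def)
    show ?thesis using 5 m e unfolding r root_vec_Sum[OF m] by (simp add: root_coeff_def)
  qed
qed

lemma lie_u_eq: "lie_u R n = skew R n"
proof (intro equalityI subsetI)
  fix x assume "x \<in> lie_u R n"
  then show "x \<in> skew R n"
    by (auto simp: lie_u_def intro!: skew_finsum skew_smult root_vec_skew)
next
  fix x assume x: "x \<in> skew R n"
  interpret M: ring "gl R n" by (rule gl_ring)
  have e: "x c d \<in> carrier R" for c d
    using x by (auto simp: skew_def tri_def gl_carrier)
  have c: "root_coeff x \<in> pos_roots n \<rightarrow> carrier R"
    using e by (auto simp: root_coeff_def split: root.splits)
  have rc: "root_vec R n \<alpha> \<in> carrier (gl R n)" if "\<alpha> \<in> pos_roots n" for \<alpha>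
    using root_vec_skew[OF that] by (auto simp: skew_def dest: tri_carrier)
  have "x = (\<Oplus>\<^bsub>gl R n\<^esub>\<alpha>\<in>pos_roots n. root_coeff x \<alpha> \<odot>\<^bsub>gl R n\<^esub> root_vec R n \<alpha>)"
  proof (intro ext)
    fix a b
    have "(\<Oplus>\<^bsub>gl R n\<^esub>\<alpha>\<in>pos_roots n. root_coeff x \<alpha> \<odot>\<^bsub>gl R n\<^esub> root_vec R n \<alpha>) a b =
        (\<Oplus>\<alpha>\<in>pos_roots n. root_coeff x \<alpha> \<otimes> root_vec R n \<alpha> a b)"
      using c rc by (subst gl_finsum) (auto intro!: gl_smult_closed, simp add: gl_sel)
    also have "\<dots> = x a b"
    proof (cases "a \<in> idx n \<and> b \<in> idx n \<and> pos n b < pos n a")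
      case True
      then have ro: "root_of a b \<in> pos_roots n"
        "root_coeff x (root_of a b) \<otimes> root_vec R n (root_of a b) a b = x a b"
        using root_of_coeff[OF x] by auto
      have "(\<Oplus>\<alpha>\<in>pos_roots n. root_coeff x \<alpha> \<otimes> root_vec R n \<alpha> a b) =
          root_coeff x (root_of a b) \<otimes> root_vec R n (root_of a b) a b"
      proof (rule finsum_delta)
        show "root_coeff x \<alpha> \<otimes> root_vec R n \<alpha> a b = \<zero>" if "\<alpha> \<in> pos_roots n" "\<alpha> \<noteq> root_of a b" for \<alpha>
        proof -
          have "root_vec R n \<alpha> a b = \<zero>" using root_of_unique[of \<alpha> n a b] that by blast
          then show ?thesis using funcset_mem[OF c that(1)] by simp
        qed
      qed (use ro e in auto)
      with ro show ?thesis by simp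
    next
      case False
      have z: "y a b = \<zero>" if "y \<in> tri R n 1" for y
        using False that gl_off[OF tri_carrier[OF that], of a b] by (fastforce simp: tri_def not_less)
      have "root_coeff x \<alpha> \<otimes> root_vec R n \<alpha> a b = \<zero>" if "\<alpha> \<in> pos_roots n" for \<alpha>
        using root_vec_skew[OF that] z[of "root_vec R n \<alpha>"] funcset_mem[OF c that] by (simp add: skew_def)
      then have "(\<Oplus>\<alpha>\<in>pos_roots n. root_coeff x \<alpha> \<otimes> root_vec R n \<alpha> a b) = \<zero>"
        by (auto intro: add.finprod_one_eqI)
      also have "\<dots> = x a b" using z[of x] x by (simp add: skew_def)
      finally show ?thesis .
    qed
    finally show "x a b =
      (\<Oplus>\<^bsub>gl R n\<^esub>\<alpha>\<in>pos_roots n. root_coeff x \<alpha> \<odot>\<^bsub>gl R n\<^esub> root_vec R n \<alpha>) a b" by simp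
  qed
  then show "x \<in> lie_u R n" using c unfolding lie_u_def by blast
qed

end

subsection \<open>\<open>exp\<close> maps \<open>\<uu>(C\<^sub>n)\<close> bijectively onto \<open>U(C\<^sub>n)\<close>\<close>

lemma finite_gl:
  assumes "finite (carrier F)"
  shows "finite (carrier (gl F n))"
proof -
  let ?S = "{f :: int \<times> int \<Rightarrow> _. \<forall>p. (p \<in> idx n \<times> idx n \<longrightarrow> f p \<in> carrier F) \<and> (p \<notin> idx n \<times> idx n \<longrightarrow> f p = \<zero>\<^bsub>F\<^esub>)}"
  have "finite ?S" using assms by (intro finite_set_of_finite_funs) auto
  then have "finite (curry ` ?S)" by (rule finite_imageI)
  moreover have "carrier (gl F n) \<subseteq> curry ` ?S"
  proof
    fix x assume "x \<in> carrier (gl F n)"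
    then have "x = curry (case_prod x)" "case_prod x \<in> ?S" by (auto simp: gl_carrier)
    then show "x \<in> curry ` ?S" by blast
  qed
  ultimately show ?thesis by (rule finite_subset [rotated])
qed

context field
begin

lemma exp_unitriangular:
  assumes g: "exp_ok n" and x: "x \<in> tri R n 1"
  shows "mat_exp R n x \<in> carrier (gl R n)" "mat_exp R n x \<ominus>\<^bsub>gl R n\<^esub> \<one>\<^bsub>gl R n\<^esub> \<in> tri R n 1"
proof -
  interpret M: ring "gl R n" by (rule gl_ring)
  let ?M = "gl R n"
  have t: "ifact k \<odot>\<^bsub>?M\<^esub> (x [^]\<^bsub>?M\<^esub> k) \<in> tri R n k" if "k \<le> 2 * n - 1" for k
    using exp_term_tri[OF g that x] .
  have s: "{..2 * n - 1} = insert 0 {1..2 * n - 1}" by auto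
  have 0: "ifact 0 \<odot>\<^bsub>?M\<^esub> (x [^]\<^bsub>?M\<^esub> (0::nat)) = \<one>\<^bsub>?M\<^esub>"
    using ifact_0_1[OF g] by (auto simp: gl_sel fun_eq_iff)
  define S where "S = (\<Oplus>\<^bsub>?M\<^esub>k\<in>{1..2 * n - 1}. ifact k \<odot>\<^bsub>?M\<^esub> (x [^]\<^bsub>?M\<^esub> k))"
  have S: "S \<in> tri R n 1"
    unfolding S_def using t by (intro tri_finsum) (auto intro: tri_mono)
  have E: "mat_exp R n x = \<one>\<^bsub>?M\<^esub> \<oplus>\<^bsub>?M\<^esub> S"
    unfolding mat_exp_eq s S_def 0[symmetric]
    using t[THEN tri_carrier] t[of 0, THEN tri_carrier] by (intro M.finsum_insert) auto
  note Sc = S[THEN tri_carrier]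
  show "mat_exp R n x \<in> carrier ?M" using E Sc by simp
  have "mat_exp R n x \<ominus>\<^bsub>?M\<^esub> \<one>\<^bsub>?M\<^esub> = S" unfolding E using Sc M.one_closed by algebra
  then show "mat_exp R n x \<ominus>\<^bsub>?M\<^esub> \<one>\<^bsub>?M\<^esub> \<in> tri R n 1" using S by simp
qed

lemma exp_surj:
  assumes g: "exp_ok n" and fin: "finite (carrier R)"
    and h: "h \<in> carrier (gl R n)" "h \<ominus>\<^bsub>gl R n\<^esub> \<one>\<^bsub>gl R n\<^esub> \<in> tri R n 1"
  shows "\<exists>x\<in>tri R n 1. mat_exp R n x = h"
proof -
  interpret M: ring "gl R n" by (rule gl_ring)
  define E where "E = (\<lambda>x. mat_exp R n x \<ominus>\<^bsub>gl R n\<^esub> \<one>\<^bsub>gl R n\<^esub>)"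
  have shift: "y = (y \<ominus>\<^bsub>gl R n\<^esub> \<one>\<^bsub>gl R n\<^esub>) \<oplus>\<^bsub>gl R n\<^esub> \<one>\<^bsub>gl R n\<^esub>" if "y \<in> carrier (gl R n)" for y
    using that by (simp add: M.minus_eq M.a_assoc M.l_neg)
  have inj: "inj_on E (tri R n 1)"
  proof (rule inj_onI)
    fix x y assume x: "x \<in> tri R n 1" and y: "y \<in> tri R n 1" and e: "E x = E y"
    have "mat_exp R n x = mat_exp R n y"
      using shift[OF exp_unitriangular(1)[OF g x]] shift[OF exp_unitriangular(1)[OF g y]] e
      by (simp add: E_def)
    then show "x = y" using exp_inj[OF g x y] by simp
  qed
  have "finite (tri R n 1)"
    using finite_gl[OF fin, of n] by (rule rev_finite_subset) (auto simp: tri_def)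
  moreover have "E ` tri R n 1 \<subseteq> tri R n 1"
    using exp_unitriangular(2)[OF g] by (auto simp: E_def)
  ultimately have "E ` tri R n 1 = tri R n 1"
    using inj by (intro endo_inj_surj)
  then obtain x where x: "x \<in> tri R n 1" "E x = h \<ominus>\<^bsub>gl R n\<^esub> \<one>\<^bsub>gl R n\<^esub>"
    using h(2) by (metis imageE)
  then have "mat_exp R n x = h"
    using shift[OF exp_unitriangular(1)[OF g x(1)]] shift[OF h(1)] by (simp add: E_def)
  with x(1) show ?thesis by blast
qed

lemma adj_exp:
  assumes g: "exp_ok n" and x: "x \<in> tri R n 1"
  shows "adj R (mat_exp R n x) = mat_exp R n (adj R x)"
proof -
  interpret M: ring "gl R n" by (rule gl_ring)
  note xc = x[THEN tri_carrier]
  have i: "ifact k \<in> carrier R" if "k \<in> {..2 * n - 1}" for k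
    using ifact(1)[OF g, of k] g that by (auto simp: exp_ok_def)
  have "adj R (mat_exp R n x) =
      (\<Oplus>\<^bsub>gl R n\<^esub>k\<in>{..2 * n - 1}. adj R (ifact k \<odot>\<^bsub>gl R n\<^esub> (x [^]\<^bsub>gl R n\<^esub> k)))"
    unfolding mat_exp_eq using i xc by (intro adj_finsum) (auto intro!: gl_smult_closed)
  also have "\<dots> = mat_exp R n (adj R x)"
    unfolding mat_exp_eq using i xc adj_closed[OF xc]
    by (intro M.finsum_cong') (auto simp: adj_smult adj_pow intro!: gl_smult_closed)
  finally show ?thesis .
qed

lemma exp_ok_if_characteristic:
  assumes "n \<ge> 1" "2 * n \<le> characteristic R"
  shows "exp_ok n"
proof -
  have nz: "[k] \<cdot> \<one> \<noteq> \<zero>" if "0 < k" "k < characteristic R" for k :: nat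
  proof
    assume "[k] \<cdot> \<one> = \<zero>"
    then have "characteristic R dvd k"
      using group.pow_eq_id[OF a_group, of \<one> k] by (simp add: characteristic_def add_pow_def)
    then show False using that by (auto dest: dvd_imp_le)
  qed
  have "[(fact k :: nat)] \<cdot> \<one> \<noteq> \<zero>" if "k < 2 * n" for k
    using that
  proof (induction k)
    case 0
    then show ?case by (simp add: add_pow_def)
  next
    case (Suc k)
    have "[(fact (Suc k) :: nat)] \<cdot> \<one> = ([Suc k] \<cdot> \<one>) \<otimes> ([(fact k :: nat)] \<cdot> \<one>)"
      by (simp only: add_pow_one_mult fact_Suc of_nat_id)
    moreover have "[Suc k] \<cdot> \<one> \<noteq> \<zero>" using Suc.prems assms by (intro nz) auto
    ultimately show ?case using Suc by (simp add: integral_iff)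
  qed
  then show ?thesis using assms by (simp add: exp_ok_def)
qed

end

theorem mat_exp_bij_betw:
  assumes "field F" "finite (carrier F)" "n \<ge> 1" "2 * n \<le> characteristic F"
  shows "bij_betw (mat_exp F n) (lie_u F n) (group_U F n)"
proof -
  interpret field F by fact
  interpret M: ring "gl F n" by (rule gl_ring)
  let ?M = "gl F n"
  have g: "exp_ok n" using assms by (intro exp_ok_if_characteristic)
  have U: "group_U F n = {g \<in> carrier ?M. g \<ominus>\<^bsub>?M\<^esub> \<one>\<^bsub>?M\<^esub> \<in> tri F n 1 \<and> adj F g \<otimes>\<^bsub>?M\<^esub> g = \<one>\<^bsub>?M\<^esub>}"
    by (rule group_U_eq) (rule is_cring)
  have inj: "inj_on (mat_exp F n) (tri F n 1)"
    using exp_inj[OF g] by (auto intro!: inj_onI)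
  have "mat_exp F n ` skew F n = group_U F n"
  proof (intro equalityI subsetI)
    fix h assume "h \<in> mat_exp F n ` skew F n"
    then obtain x where x: "x \<in> tri F n 1" "adj F x = \<ominus>\<^bsub>?M\<^esub> x" and h: "h = mat_exp F n x"
      by (auto simp: skew_def)
    show "h \<in> group_U F n"
      using exp_unitriangular[OF g x(1)] adj_exp[OF g x(1)] exp_neg_mult[OF g x(1)] x(2)
      by (simp add: U h)
  next
    fix h assume "h \<in> group_U F n"
    then have h: "h \<in> carrier ?M" "h \<ominus>\<^bsub>?M\<^esub> \<one>\<^bsub>?M\<^esub> \<in> tri F n 1" "adj F h \<otimes>\<^bsub>?M\<^esub> h = \<one>\<^bsub>?M\<^esub>"
      by (auto simp: U)
    obtain x where x: "x \<in> tri F n 1" "mat_exp F n x = h"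
      using exp_surj[OF g assms(2) h(1,2)] by blast
    define h' where "h' = mat_exp F n (\<ominus>\<^bsub>?M\<^esub> x)"
    have h': "h' \<in> carrier ?M"
      using exp_unitriangular(1)[OF g tri_minus[OF x(1)]] by (simp add: h'_def)
    have "h \<otimes>\<^bsub>?M\<^esub> h' = \<one>\<^bsub>?M\<^esub>"
      using exp_neg_mult[OF g tri_minus[OF x(1)]] x tri_carrier[OF x(1)] by (simp add: h'_def)
    then have "adj F h = h'"
      using h h' adj_closed[OF h(1)] M.m_assoc[of "adj F h" h h'] by simp
    then have "mat_exp F n (adj F x) = mat_exp F n (\<ominus>\<^bsub>?M\<^esub> x)"
      using adj_exp[OF g x(1)] x(2) by (simp add: h'_def)
    then have "adj F x = \<ominus>\<^bsub>?M\<^esub> x"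
      by (rule exp_inj[OF g adj_tri[OF x(1)] tri_minus[OF x(1)]])
    then show "h \<in> mat_exp F n ` skew F n" using x by (auto simp: skew_def)
  qed
  moreover have "inj_on (mat_exp F n) (skew F n)"
    by (rule inj_on_subset[OF inj]) (auto simp: skew_def)
  ultimately show ?thesis
    unfolding lie_u_eq by (simp add: bij_betw_def)
qed

end

theory Submission
  imports Defs
begin

text \<open>
  The Cayley transform \<open>x \<mapsto> (1 - x)\<^sup>-\<^sup>1 (1 + x)\<close> maps \<open>\<uu>\<close> bijectively to \<open>U\<close> and, for every
  \<open>f \<in> \<uu>\<^sup>*\<close>, the radical of \<open>(x, y) \<mapsto> f [x, y]\<close> to the stabiliser of \<open>f\<close>. Hence in every odd
  characteristic an orbit of dimension \<open>d\<close> has \<open>q\<^sup>d\<close> elements, and it suffices to count the forms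
  \<open>f\<close> of each rank.

  Write \<open>\<uu> = \<nn> \<oplus> S\<close> with \<open>\<nn>\<close> spanned by the root vectors of the \<open>\<epsilon>\<^sub>i - \<epsilon>\<^sub>j\<close> (strictly lower
  triangular matrices) and \<open>S\<close> the abelian ideal of symmetric matrices. The restriction of \<open>f\<close> to
  \<open>S\<close> is a symmetric matrix \<open>\<sigma>\<close>; let \<open>K\<close> be its stabiliser, consisting of the \<open>x \<in> \<nn>\<close> with
  \<open>x \<sigma>\<close> skew-symmetric. The radical of \<open>f\<close> has dimension \<open>n + dim K + r\<close>, where \<open>r\<close> is the
  dimension of the radical of \<open>f [x, y]\<close> on \<open>K\<close>. As \<open>K\<close> is a nilpotent Lie algebra, \<open>r > 0\<close>
  unless \<open>K = 0\<close>. So \<open>f\<close> is regular iff \<open>K = 0\<close>, and subregular iff \<open>dim K = 1\<close>.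

  The symmetric matrices with \<open>dim K \<le> 1\<close> are counted by Gaussian elimination. If the first row of
  \<open>\<sigma>\<close> has its first nonzero entry in column \<open>p\<close>, then passing to the Schur complement of the
  indices \<open>1, p\<close> lowers \<open>dim K\<close> by the number of indices strictly between \<open>1\<close> and \<open>p\<close>; if the row
  vanishes, deleting the index \<open>1\<close> lowers \<open>dim K\<close> by \<open>n - 1\<close>. The resulting recursion has
  nonnegative coefficients in \<open>v = q - 1\<close>.
\<close>

section \<open>Kernels of matrices over a finite field\<close>

text \<open>The exponential series divides by factorials up to \<open>(2 n - 1)!\<close>, which
  vanish in the field when n <= p < 2n. The Cayley transform replaces it because it only inverts
  \<open>1 - x\<close>, which is unitriangular, while its inverse map only inverts
  \<open>1 + g\<close>, which is twice a unitriangular matrix. Thus an invertible 2 suffices.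

  All dimensions are recorded as cardinalities: a space of dimension d has q^d elements, and linear
  isomorphisms become bijections of finite sets.

  That dim K alone detects subregularity rests on a gap. A nonzero central element of K lies in the
  radical of the form on K, so the corank of f is n for K = 0, exactly n + 2 for dim K = 1, and at
  least n + 3 otherwise; n + 1 never occurs.

  The variable v = q - 1 enters through the pivots, each of which has q - 1 nonzero values. All
  other entries contribute powers of q, most of which cancel against the orbit size; those that
  survive are powers of v + 1, so the coefficients stay nonnegative.\<close>

definition vecs :: "('a, 'm) ring_scheme \<Rightarrow> 'i set \<Rightarrow> ('i \<Rightarrow> 'a) set" where
  "vecs F A = {c. (\<forall>i. c i \<in> carrier F) \<and> (\<forall>i. i \<notin> A \<longrightarrow> c i = \<zero>\<^bsub>F\<^esub>)}"

text \<open>The linear relations between the rows of \<open>m\<close>. Since relations are total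
  functions that vanish off the index set, a relation between fewer rows is literally a relation
  between more rows.\<close>

definition lker :: "('a, 'm) ring_scheme \<Rightarrow> 'i set \<Rightarrow> 'j set \<Rightarrow> ('i \<Rightarrow> 'j \<Rightarrow> 'a) \<Rightarrow> ('i \<Rightarrow> 'a) set" where
  "lker F S T m = {c \<in> vecs F S. \<forall>t\<in>T. (\<Oplus>\<^bsub>F\<^esub>s\<in>S. c s \<otimes>\<^bsub>F\<^esub> m s t) = \<zero>\<^bsub>F\<^esub>}"

lemma vecs_closed: "c \<in> vecs F A \<Longrightarrow> c i \<in> carrier F"
  and vecs_off: "c \<in> vecs F A \<Longrightarrow> i \<notin> A \<Longrightarrow> c i = \<zero>\<^bsub>F\<^esub>"
  by (auto simp: vecs_def)

lemma lker_vecs: "c \<in> lker F S T m \<Longrightarrow> c \<in> vecs F S"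
  by (simp add: lker_def)

lemma lker_eq: "c \<in> lker F S T m \<Longrightarrow> t \<in> T \<Longrightarrow> (\<Oplus>\<^bsub>F\<^esub>s\<in>S. c s \<otimes>\<^bsub>F\<^esub> m s t) = \<zero>\<^bsub>F\<^esub>"
  by (simp add: lker_def)

lemma card_vecs:
  assumes "finite A" "\<zero>\<^bsub>F\<^esub> \<in> carrier F"
  shows "card (vecs F A) = card (carrier F) ^ card A"
proof -
  have "bij_betw (\<lambda>c. restrict c A) (vecs F A) (A \<rightarrow>\<^sub>E carrier F)"
  proof (rule bij_betw_byWitness[where f' = "\<lambda>c i. if i \<in> A then c i else \<zero>\<^bsub>F\<^esub>"])
    show "\<forall>a\<in>vecs F A. (\<lambda>i. if i \<in> A then restrict a A i else \<zero>\<^bsub>F\<^esub>) = a"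
      by (auto simp: vecs_def fun_eq_iff)
  qed (use assms in \<open>auto simp: vecs_def fun_eq_iff PiE_def extensional_def Pi_def\<close>)
  then show ?thesis using assms(1) by (simp add: bij_betw_same_card card_funcsetE)
qed

lemma finite_vecs:
  assumes "finite A" "finite (carrier F)"
  shows "finite (vecs F A)"
  using finite_set_of_finite_funs[OF assms, of "\<zero>\<^bsub>F\<^esub>"]
  by (rule rev_finite_subset) (auto simp: vecs_def)

lemma finite_lker:
  assumes "finite S" "finite (carrier F)"
  shows "finite (lker F S T m)"
  using finite_vecs[OF assms] by (rule rev_finite_subset) (auto simp: lker_def)

context field
begin

lemma finsum_mono_neutral:
  assumes "finite B" "A \<subseteq> B" "\<And>i. i \<in> B \<Longrightarrow> f i \<in> carrier R" "\<And>i. i \<in> B - A \<Longrightarrow> f i = \<zero>"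
  shows "(\<Oplus>i\<in>B. f i) = (\<Oplus>i\<in>A. f i)"
  by (rule add.finprod_mono_neutral_cong_left[symmetric]) (use assms in auto)

lemma field_inv_closed: "x \<in> carrier R \<Longrightarrow> x \<noteq> \<zero> \<Longrightarrow> inv x \<in> carrier R"
  and field_l_inv: "x \<in> carrier R \<Longrightarrow> x \<noteq> \<zero> \<Longrightarrow> inv x \<otimes> x = \<one>"
  and field_r_inv: "x \<in> carrier R \<Longrightarrow> x \<noteq> \<zero> \<Longrightarrow> x \<otimes> inv x = \<one>"
  using field_Units by auto

lemma vecs_add: "c \<in> vecs R A \<Longrightarrow> d \<in> vecs R A \<Longrightarrow> (\<lambda>i. c i \<oplus> d i) \<in> vecs R A"
  by (auto simp: vecs_def)

lemma vecs_smult: "k \<in> carrier R \<Longrightarrow> d \<in> vecs R A \<Longrightarrow> (\<lambda>i. k \<otimes> d i) \<in> vecs R A"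
  by (auto simp: vecs_def)

lemma vecs_mono: "c \<in> vecs R A \<Longrightarrow> A \<subseteq> B \<Longrightarrow> c \<in> vecs R B"
  by (auto simp: vecs_def)

lemma lker_add:
  assumes "finite S" "\<And>s t. s \<in> S \<Longrightarrow> t \<in> T \<Longrightarrow> m s t \<in> carrier R"
    "c \<in> lker R S T m" "d \<in> lker R S T m"
  shows "(\<lambda>i. c i \<oplus> d i) \<in> lker R S T m"
proof -
  have "(\<Oplus>s\<in>S. (c s \<oplus> d s) \<otimes> m s t) = (\<Oplus>s\<in>S. c s \<otimes> m s t) \<oplus> (\<Oplus>s\<in>S. d s \<otimes> m s t)"
    if t: "t \<in> T" for t
  proof -
    note mc = assms(2)[OF _ t] and cc = vecs_closed[OF lker_vecs[OF assms(3)]]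
      and dc = vecs_closed[OF lker_vecs[OF assms(4)]]
    have "(\<Oplus>s\<in>S. (c s \<oplus> d s) \<otimes> m s t) = (\<Oplus>s\<in>S. c s \<otimes> m s t \<oplus> d s \<otimes> m s t)"
      using mc cc dc by (intro finsum_cong') (auto simp: l_distr)
    also have "\<dots> = (\<Oplus>s\<in>S. c s \<otimes> m s t) \<oplus> (\<Oplus>s\<in>S. d s \<otimes> m s t)"
      using mc cc dc by (intro finsum_addf) auto
    finally show ?thesis .
  qed
  then show ?thesis using assms(3,4) by (auto simp: lker_def vecs_add)
qed

lemma lker_smult:
  assumes "finite S" "\<And>s t. s \<in> S \<Longrightarrow> t \<in> T \<Longrightarrow> m s t \<in> carrier R"
    "c \<in> lker R S T m" "k \<in> carrier R"
  shows "(\<lambda>i. k \<otimes> c i) \<in> lker R S T m"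
proof -
  have "(\<Oplus>s\<in>S. (k \<otimes> c s) \<otimes> m s t) = k \<otimes> (\<Oplus>s\<in>S. c s \<otimes> m s t)" if "t \<in> T" for t
    using assms(1,4) assms(2)[OF _ that] vecs_closed[OF lker_vecs[OF assms(3)]]
    by (subst finsum_rdistr) (auto simp: m_assoc intro!: finsum_cong')
  then show ?thesis using assms(3,4) by (auto simp: lker_def vecs_smult)
qed

text \<open>Allows the row set to be enlarged one row at a time while kernels are compared as sets
  of functions.\<close>

lemma lker_mono_iff:
  assumes "finite S" "A \<subseteq> S" "\<And>s t. s \<in> S \<Longrightarrow> t \<in> T \<Longrightarrow> m s t \<in> carrier R" "c \<in> vecs R A"
  shows "c \<in> lker R S T m \<longleftrightarrow> c \<in> lker R A T m"
proof -
  have "(\<Oplus>s\<in>S. c s \<otimes> m s t) = (\<Oplus>s\<in>A. c s \<otimes> m s t)" if "t \<in> T" for t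
    using assms that by (intro finsum_mono_neutral) (auto simp: vecs_def)
  then show ?thesis using assms vecs_mono[OF assms(4,2)] by (simp add: lker_def)
qed

lemma zero_lker:
  assumes "\<And>s t. s \<in> S \<Longrightarrow> t \<in> T \<Longrightarrow> m s t \<in> carrier R"
  shows "(\<lambda>_. \<zero>) \<in> lker R S T m"
proof -
  have "(\<Oplus>s\<in>S. \<zero> \<otimes> m s t) = \<zero>" if "t \<in> T" for t
    by (rule add.finprod_one_eqI) (simp add: assms that)
  then show ?thesis by (simp add: lker_def vecs_def)
qed

section \<open>Kernel size and rank\<close>

lemma rows_indep_iff_lker:
  assumes "finite A" "\<And>s t. s \<in> A \<Longrightarrow> t \<in> T \<Longrightarrow> m s t \<in> carrier R"
  shows "rows_indep R A T m \<longleftrightarrow> lker R A T m = {\<lambda>_. \<zero>}"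
proof
  assume r: "rows_indep R A T m"
  have "c = (\<lambda>_. \<zero>)" if c: "c \<in> lker R A T m" for c
  proof
    fix i
    show "c i = \<zero>"
      using r c by (cases "i \<in> A") (auto simp: rows_indep_def lker_def vecs_def)
  qed
  moreover have "(\<lambda>_. \<zero>) \<in> lker R A T m"
    using assms(2) by (rule zero_lker)
  ultimately show "lker R A T m = {\<lambda>_. \<zero>}" by blast
next
  assume l: "lker R A T m = {\<lambda>_. \<zero>}"
  show "rows_indep R A T m"
    unfolding rows_indep_def
  proof (intro ballI impI)
    fix c s assume c: "c \<in> A \<rightarrow> carrier R" "\<forall>t\<in>T. (\<Oplus>s\<in>A. c s \<otimes> m s t) = \<zero>" and s: "s \<in> A"
    have "(\<Oplus>s\<in>A. (if s \<in> A then c s else \<zero>) \<otimes> m s t) = (\<Oplus>s\<in>A. c s \<otimes> m s t)" if "t \<in> T" for t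
      using assms c that by (intro finsum_cong') auto
    then have "(\<lambda>i. if i \<in> A then c i else \<zero>) \<in> lker R A T m"
      using c by (auto simp: lker_def vecs_def Pi_def)
    then have "(\<lambda>i. if i \<in> A then c i else \<zero>) = (\<lambda>_. \<zero>)" using l by blast
    then show "c s = \<zero>" using s by metis
  qed
qed

text \<open>The relation \<open>e\<close> shows that row \<open>s\<close> depends on the rows in
  \<open>A\<close>. Scaled to \<open>d\<close> with \<open>d s = \<one>\<close> it splits the
  coefficient map \<open>c \<mapsto> c s\<close>, whose kernel consists of the relations supported
  on \<open>A\<close>; every relation is uniquely a multiple of \<open>d\<close> plus one of
  those.\<close>

lemma card_lker_insert:
  assumes fin: "finite A" "finite (carrier R)" and s: "s \<notin> A"
    and m: "\<And>r t. r \<in> insert s A \<Longrightarrow> t \<in> T \<Longrightarrow> m r t \<in> carrier R"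
    and e: "e \<in> lker R (insert s A) T m" "e s \<noteq> \<zero>"
  shows "card (lker R (insert s A) T m) = card (carrier R) * card (lker R A T m)"
proof -
  let ?S = "insert s A"
  define d where "d = (\<lambda>i. inv (e s) \<otimes> e i)"
  have ec: "e i \<in> carrier R" for i using e by (auto simp: lker_def vecs_def)
  have d: "d \<in> lker R ?S T m"
    unfolding d_def using fin m e field_inv_closed[OF ec e(2)] by (intro lker_smult) auto
  have ds: "d s = \<one>" using field_l_inv[OF ec e(2)] by (simp add: d_def)
  have dc: "d i \<in> carrier R" for i using d by (auto simp: lker_def vecs_def)
  have off: "c \<in> lker R A T m \<longleftrightarrow> c \<in> lker R ?S T m \<and> c s = \<zero>" for c
  proof
    assume c: "c \<in> lker R A T m"
    then show "c \<in> lker R ?S T m \<and> c s = \<zero>"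
      using lker_mono_iff[of ?S A T m c] fin m s by (auto dest: lker_vecs vecs_off)
  next
    assume c: "c \<in> lker R ?S T m \<and> c s = \<zero>"
    then have "c \<in> vecs R A" using lker_vecs[of c R ?S T m] by (auto simp: vecs_def)
    then show "c \<in> lker R A T m"
      using lker_mono_iff[of ?S A T m c] c fin m by blast
  qed
  have "bij_betw (\<lambda>(k, c) i. k \<otimes> d i \<oplus> c i) (carrier R \<times> lker R A T m) (lker R ?S T m)"
  proof (rule bij_betw_byWitness[where f' = "\<lambda>c. (c s, \<lambda>i. \<ominus> c s \<otimes> d i \<oplus> c i)"])
    show "\<forall>p\<in>carrier R \<times> lker R A T m. ((case p of (k, c) \<Rightarrow> (\<lambda>i. k \<otimes> d i \<oplus> c i)) s,
      \<lambda>i. \<ominus> (case p of (k, c) \<Rightarrow> (\<lambda>i. k \<otimes> d i \<oplus> c i)) s \<otimes> d i \<oplus> (case p of (k, c) \<Rightarrow> (\<lambda>i. k \<otimes> d i \<oplus> c i)) i) = p"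
    proof safe
      fix k c assume k: "k \<in> carrier R" and c: "c \<in> lker R A T m"
      have cc: "c i \<in> carrier R" for i using c by (auto simp: lker_def vecs_def)
      have cs: "c s = \<zero>" using c off by blast
      show "k \<otimes> d s \<oplus> c s = k" using k ds cs by simp
      show "(\<lambda>i. \<ominus> (k \<otimes> d s \<oplus> c s) \<otimes> d i \<oplus> (k \<otimes> d i \<oplus> c i)) = c"
        using k ds cs dc cc by (auto simp: l_minus a_assoc[symmetric] l_neg)
    qed
    show "\<forall>c\<in>lker R ?S T m. (case (c s, \<lambda>i. \<ominus> c s \<otimes> d i \<oplus> c i) of (k, c) \<Rightarrow> (\<lambda>i. k \<otimes> d i \<oplus> c i)) = c"
    proof safe
      fix c assume "c \<in> lker R ?S T m"
      then have cc: "c i \<in> carrier R" for i by (auto simp: lker_def vecs_def)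
      show "(\<lambda>i. c s \<otimes> d i \<oplus> (\<ominus> c s \<otimes> d i \<oplus> c i)) = c"
        using dc cc by (auto simp: l_minus a_assoc[symmetric] r_neg)
    qed
    show "(\<lambda>(k, c) i. k \<otimes> d i \<oplus> c i) ` (carrier R \<times> lker R A T m) \<subseteq> lker R ?S T m"
      using fin m d off by (auto intro!: lker_add lker_smult)
    show "(\<lambda>c. (c s, \<lambda>i. \<ominus> c s \<otimes> d i \<oplus> c i)) ` lker R ?S T m \<subseteq> carrier R \<times> lker R A T m"
    proof safe
      fix c assume c: "c \<in> lker R ?S T m"
      then show cc: "c s \<in> carrier R" by (auto simp: lker_def vecs_def)
      show "(\<lambda>i. \<ominus> c s \<otimes> d i \<oplus> c i) \<in> lker R A T m"
        unfolding off using fin m d c cc ds by (auto intro!: lker_add lker_smult simp: l_neg)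
    qed
  qed
  then show ?thesis by (simp add: bij_betw_same_card[symmetric] card_cartesian_product)
qed

text \<open>Rank and nullity in terms of cardinalities. Start from an independent row set
  \<open>A\<close> of maximal size, which has only the zero relation; by maximality each further row
  depends on \<open>A\<close>, so adding it multiplies the number of relations by q.\<close>

lemma card_lker_rank:
  assumes fin: "finite S" "finite (carrier R)"
    and m: "\<And>s t. s \<in> S \<Longrightarrow> t \<in> T \<Longrightarrow> m s t \<in> carrier R"
  shows "card (lker R S T m) = card (carrier R) ^ (card S - matrix_rank R S T m)"
    and "matrix_rank R S T m \<le> card S"
proof -
  let ?X = "{card A | A. A \<subseteq> S \<and> rows_indep R A T m}"
  have finX: "finite ?X"
    by (rule finite_subset[of _ "card ` Pow S"]) (use fin in auto)
  have "rows_indep R {} T m" by (auto simp: rows_indep_def)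
  then have "?X \<noteq> {}" by blast
  then have "Max ?X \<in> ?X" using finX by (rule Max_in[rotated])
  then obtain A where A: "A \<subseteq> S" "rows_indep R A T m" "matrix_rank R S T m = card A"
    unfolding matrix_rank_def by auto
  have finA: "finite A" using A fin finite_subset by blast
  have mx: "card B \<le> card A" if "B \<subseteq> S" "rows_indep R B T m" for B
    using that finX A(3) unfolding matrix_rank_def by (metis (mono_tags, lifting) Max_ge mem_Collect_eq)
  show le: "matrix_rank R S T m \<le> card S" using A fin by (simp add: card_mono)
  have lA: "lker R A T m = {\<lambda>_. \<zero>}"
    using rows_indep_iff_lker[OF finA, of T m] A m by blast
  \<comment> \<open>The dependence is found over \<open>A\<close> and carried to the larger
    \<open>B\<close>. Its coefficient at \<open>s\<close> is nonzero because \<open>A\<close> itself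
    is independent.\<close>
  have dep: "\<exists>e\<in>lker R (insert s B) T m. e s \<noteq> \<zero>" if s: "s \<in> S - A" and B: "A \<subseteq> B" "B \<subseteq> S" for s B
  proof -
    have "\<not> rows_indep R (insert s A) T m"
      using mx[of "insert s A"] s A finA by auto
    then have "lker R (insert s A) T m \<noteq> {\<lambda>_. \<zero>}"
      using rows_indep_iff_lker[of "insert s A" T m] finA A s m by blast
    moreover have "(\<lambda>_. \<zero>) \<in> lker R (insert s A) T m"
      by (rule zero_lker) (use m s A in auto)
    ultimately obtain e where e: "e \<in> lker R (insert s A) T m" "e \<noteq> (\<lambda>_. \<zero>)" by blast
    have "e s \<noteq> \<zero>"
    proof
      assume z: "e s = \<zero>"
      have "e \<in> vecs R A" using lker_vecs[OF e(1)] z by (auto simp: vecs_def)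
      then have "e \<in> lker R A T m"
        using lker_mono_iff[of "insert s A" A T m e] e finA A s m by blast
      then show False using lA e by auto
    qed
    moreover have "e \<in> lker R (insert s B) T m"
    proof (subst lker_mono_iff[of _ "insert s A"])
      show "finite (insert s B)" using B fin finite_subset by blast
    qed (use B s m e in \<open>auto dest: lker_vecs\<close>)
    ultimately show ?thesis by blast
  qed
  have "card (lker R (A \<union> C) T m) = card (carrier R) ^ card C" if "finite C" "C \<subseteq> S - A" for C
    using that
  proof (induction C rule: finite_induct)
    case empty
    then show ?case by (simp add: lA)
  next
    case (insert s C)
    obtain e where e: "e \<in> lker R (insert s (A \<union> C)) T m" "e s \<noteq> \<zero>"
      using dep[of s "A \<union> C"] insert A by auto
    have "card (lker R (insert s (A \<union> C)) T m) = card (carrier R) * card (lker R (A \<union> C) T m)"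
      by (rule card_lker_insert[OF _ _ _ _ e]) (use insert A finA fin m in auto)
    then show ?case using insert by simp
  qed
  from this[of "S - A"] have "card (lker R S T m) = card (carrier R) ^ card (S - A)"
    using A fin by (simp add: Un_absorb1)
  then show "card (lker R S T m) = card (carrier R) ^ (card S - matrix_rank R S T m)"
    using A fin finA by (simp add: card_Diff_subset)
qed

text \<open>Gaussian elimination. Column \<open>b\<close> determines the coefficient
  \<open>c a\<close> from the others; substituting it into the remaining columns produces the Schur
  complement. Hence dropping the coefficient at \<open>a\<close> is a bijection between the two
  kernels.\<close>

lemma card_lker_pivot:
  assumes fin: "finite S" and m: "\<And>s t. s \<in> S \<Longrightarrow> t \<in> T \<Longrightarrow> m s t \<in> carrier R"
    and a: "a \<in> S" and b: "b \<in> T" and nz: "m a b \<noteq> \<zero>"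
  shows "card (lker R S T m) =
    card (lker R (S - {a}) (T - {b}) (\<lambda>i j. m i j \<ominus> m i b \<otimes> inv (m a b) \<otimes> m a j))"
proof -
  define v where "v = inv (m a b)"
  have v: "v \<in> carrier R" "v \<otimes> m a b = \<one>"
    using field_inv_closed field_l_inv m[OF a b] nz by (auto simp: v_def)
  let ?S = "S - {a}" and ?T = "T - {b}"
  define m' where "m' = (\<lambda>i j. m i j \<ominus> m i b \<otimes> v \<otimes> m a j)"
  have m'c: "m' i j \<in> carrier R" if "i \<in> S" "j \<in> T" for i j
    using that m a b v by (simp add: m'_def)
  define u where "u = (\<lambda>c. \<Oplus>i\<in>?S. c i \<otimes> m i b)"
  have uc: "u c \<in> carrier R" if "\<And>i. c i \<in> carrier R" for c
    using that m b by (auto simp: u_def intro!: finsum_closed)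
  have ins: "(\<Oplus>i\<in>S. c i \<otimes> m i t) = c a \<otimes> m a t \<oplus> (\<Oplus>i\<in>?S. c i \<otimes> m i t)"
    if "t \<in> T" "\<And>i. c i \<in> carrier R" for c t
  proof -
    have "S = insert a ?S" using a by auto
    then have "(\<Oplus>i\<in>S. c i \<otimes> m i t) = (\<Oplus>i\<in>insert a ?S. c i \<otimes> m i t)" by simp
    also have "\<dots> = c a \<otimes> m a t \<oplus> (\<Oplus>i\<in>?S. c i \<otimes> m i t)"
      using that m a fin by (intro finsum_insert) auto
    finally show ?thesis .
  qed
  have red: "(\<Oplus>i\<in>?S. c i \<otimes> m' i t) = (\<Oplus>i\<in>?S. c i \<otimes> m i t) \<oplus> \<ominus> (u c \<otimes> v) \<otimes> m a t"
    if t: "t \<in> T" and c: "\<And>i. c i \<in> carrier R" for c t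
  proof -
    have "(\<Oplus>i\<in>?S. c i \<otimes> m' i t) = (\<Oplus>i\<in>?S. c i \<otimes> m i t \<oplus> (c i \<otimes> m i b) \<otimes> (\<ominus> v \<otimes> m a t))"
    proof (rule finsum_cong')
      fix i assume "i \<in> ?S"
      then have "c i \<in> carrier R" "m i t \<in> carrier R" "m i b \<in> carrier R" "m a t \<in> carrier R"
        using c m t a b by auto
      then show "c i \<otimes> m' i t = c i \<otimes> m i t \<oplus> (c i \<otimes> m i b) \<otimes> (\<ominus> v \<otimes> m a t)"
        unfolding m'_def using v(1) by algebra
    qed (use c m t a b v in auto)
    also have "\<dots> = (\<Oplus>i\<in>?S. c i \<otimes> m i t) \<oplus> (\<Oplus>i\<in>?S. (c i \<otimes> m i b) \<otimes> (\<ominus> v \<otimes> m a t))"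
      using c m t a b v by (intro finsum_addf) auto
    also have "(\<Oplus>i\<in>?S. (c i \<otimes> m i b) \<otimes> (\<ominus> v \<otimes> m a t)) = u c \<otimes> (\<ominus> v \<otimes> m a t)"
      unfolding u_def using c m t a b v fin by (intro finsum_ldistr[symmetric]) auto
    also have "\<dots> = \<ominus> (u c \<otimes> v) \<otimes> m a t"
      using uc[of c] c m[OF a t] v(1) by algebra
    finally show ?thesis .
  qed
  have key: "c \<in> lker R S T m \<longleftrightarrow> c \<in> vecs R S \<and> c a = \<ominus> (u c \<otimes> v) \<and> c(a := \<zero>) \<in> lker R ?S ?T m'" for c
  proof (cases "c \<in> vecs R S")
    case c: True
    then have cc: "c i \<in> carrier R" for i by (simp add: vecs_def)
    have cc': "(c(a := \<zero>)) i \<in> carrier R" for i using cc by simp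
    have same: "(\<Oplus>i\<in>?S. (c(a := \<zero>)) i \<otimes> m' i t) = (\<Oplus>i\<in>?S. c i \<otimes> m' i t)" if "t \<in> T" for t
      using that cc m'c by (intro finsum_cong') auto
    have b_iff: "(\<Oplus>i\<in>S. c i \<otimes> m i b) = \<zero> \<longleftrightarrow> c a = \<ominus> (u c \<otimes> v)"
    proof -
      have A: "(\<Oplus>i\<in>S. c i \<otimes> m i b) = c a \<otimes> m a b \<oplus> u c"
        using ins[OF b cc] by (simp add: u_def)
      have "c a = \<ominus> (u c \<otimes> v)" if e: "c a \<otimes> m a b \<oplus> u c = \<zero>"
      proof -
        have "\<ominus> (u c \<otimes> v) = (c a \<otimes> m a b \<oplus> u c) \<otimes> v \<ominus> u c \<otimes> v"
          unfolding e using uc[OF cc] v(1) by algebra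
        also have "\<dots> = c a \<otimes> (v \<otimes> m a b)" using uc[OF cc] v(1) cc[of a] m[OF a b] by algebra
        finally show ?thesis using v cc by simp
      qed
      moreover have "c a \<otimes> m a b \<oplus> u c = \<zero>" if e: "c a = \<ominus> (u c \<otimes> v)"
      proof -
        have "c a \<otimes> m a b \<oplus> u c = \<ominus> (u c \<otimes> (v \<otimes> m a b)) \<oplus> u c"
          unfolding e using uc[OF cc] v(1) m[OF a b] by algebra
        then show ?thesis using v uc[OF cc] by (simp add: l_neg)
      qed
      ultimately show ?thesis using A by auto
    qed
    have t_iff: "(\<Oplus>i\<in>S. c i \<otimes> m i t) = (\<Oplus>i\<in>?S. c i \<otimes> m' i t)"
      if "t \<in> T" "c a = \<ominus> (u c \<otimes> v)" for t
    proof -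
      have "(\<Oplus>i\<in>?S. c i \<otimes> m i t) \<in> carrier R" using cc m that by (intro finsum_closed) auto
      then show ?thesis
        unfolding ins[OF that(1) cc] red[OF that(1) cc] that(2)[symmetric]
        using cc[of a] m[OF a that(1)] by (simp add: a_comm)
    qed
    have v': "c(a := \<zero>) \<in> vecs R ?S" using c by (auto simp: vecs_def)
    show ?thesis
    proof
      assume k: "c \<in> lker R S T m"
      then have e: "c a = \<ominus> (u c \<otimes> v)" using b b_iff by (simp add: lker_def)
      then show "c \<in> vecs R S \<and> c a = \<ominus> (u c \<otimes> v) \<and> c(a := \<zero>) \<in> lker R ?S ?T m'"
        using c k v' same t_iff unfolding lker_def by auto
    next
      assume k: "c \<in> vecs R S \<and> c a = \<ominus> (u c \<otimes> v) \<and> c(a := \<zero>) \<in> lker R ?S ?T m'"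
      then have "(\<Oplus>i\<in>S. c i \<otimes> m i t) = \<zero>" if "t \<in> T" for t
        using that b_iff t_iff[of t] same[of t] by (cases "t = b") (auto simp: lker_def)
      then show "c \<in> lker R S T m" using c by (simp add: lker_def)
    qed
  qed (auto simp: lker_def)
  have ua: "u (c(a := x)) = u c" if "\<And>i. c i \<in> carrier R" for c x
    unfolding u_def using that m b by (intro finsum_cong') auto
  have "bij_betw (\<lambda>c. c(a := \<zero>)) (lker R S T m) (lker R ?S ?T m')"
  proof (rule bij_betw_byWitness[where f' = "\<lambda>c. c(a := \<ominus> (u c \<otimes> v))"])
    show "\<forall>c\<in>lker R S T m. (c(a := \<zero>))(a := \<ominus> (u (c(a := \<zero>)) \<otimes> v)) = c"
    proof
      fix c assume c: "c \<in> lker R S T m"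
      then have "\<And>i. c i \<in> carrier R" by (auto simp: lker_def vecs_def)
      then show "(c(a := \<zero>))(a := \<ominus> (u (c(a := \<zero>)) \<otimes> v)) = c"
        using c key[of c] ua[of c] by (simp add: fun_upd_idem)
    qed
    show "\<forall>c\<in>lker R ?S ?T m'. (c(a := \<ominus> (u c \<otimes> v)))(a := \<zero>) = c"
      by (auto simp: lker_def vecs_def fun_eq_iff)
    show "(\<lambda>c. c(a := \<zero>)) ` lker R S T m \<subseteq> lker R ?S ?T m'"
      using key by blast
    show "(\<lambda>c. c(a := \<ominus> (u c \<otimes> v))) ` lker R ?S ?T m' \<subseteq> lker R S T m"
    proof safe
      fix c assume c: "c \<in> lker R ?S ?T m'"
      then have cc: "\<And>i. c i \<in> carrier R" and ca: "c a = \<zero>" by (auto simp: lker_def vecs_def)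
      then have "c(a := \<ominus> (u c \<otimes> v)) \<in> vecs R S"
        using lker_vecs[OF c] v uc[of c] a by (auto simp: vecs_def)
      moreover have "(c(a := \<ominus> (u c \<otimes> v)))(a := \<zero>) = c" using ca by auto
      ultimately show "c(a := \<ominus> (u c \<otimes> v)) \<in> lker R S T m"
        unfolding key using c ua[OF cc] by simp
    qed
  qed
  then show ?thesis by (simp add: bij_betw_same_card m'_def v_def)
qed

text \<open>Row rank equals column rank, in terms of numbers of kernel vectors.\<close>

lemma card_lker_transpose:
  assumes "finite S" "finite T" "\<And>s t. s \<in> S \<Longrightarrow> t \<in> T \<Longrightarrow> m s t \<in> carrier R"
  shows "card (carrier R) ^ card T * card (lker R S T m) =
    card (carrier R) ^ card S * card (lker R T S (\<lambda>t s. m s t))"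
  using assms
proof (induction "card S" arbitrary: S T m)
  case 0
  then have "S = {}" by simp
  have "lker R {} T m = {\<lambda>_. \<zero>}" by (auto simp: lker_def vecs_def)
  moreover have "lker R T {} (\<lambda>t s. m s t) = vecs R T" by (simp add: lker_def)
  ultimately show ?case using 0 \<open>S = {}\<close> by (simp add: card_vecs)
next
  case (Suc k)
  show ?case
  proof (cases "\<exists>a\<in>S. \<exists>b\<in>T. m a b \<noteq> \<zero>")
    case False
    have z: "(\<Oplus>s\<in>S. c s \<otimes> m s t) = \<zero>" if "t \<in> T" "\<And>i. c i \<in> carrier R" for c t
      using False that by (intro add.finprod_one_eqI) auto
    have z': "(\<Oplus>t\<in>T. c t \<otimes> m s t) = \<zero>" if "s \<in> S" "\<And>i. c i \<in> carrier R" for c s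
      using False that by (intro add.finprod_one_eqI) auto
    have "lker R S T m = vecs R S" "lker R T S (\<lambda>t s. m s t) = vecs R T"
      using z z' by (auto simp: lker_def vecs_def)
    then show ?thesis using Suc.prems by (simp add: card_vecs)
  next
    case True
    then obtain a b where ab: "a \<in> S" "b \<in> T" "m a b \<noteq> \<zero>" by blast
    define m' where "m' = (\<lambda>i j. m i j \<ominus> m i b \<otimes> inv (m a b) \<otimes> m a j)"
    have v: "inv (m a b) \<in> carrier R" using ab Suc.prems by (intro field_inv_closed) auto
    have 1: "card (lker R S T m) = card (lker R (S - {a}) (T - {b}) m')"
      unfolding m'_def using ab Suc.prems by (intro card_lker_pivot) auto
    have "card (lker R T S (\<lambda>t s. m s t)) =
        card (lker R (T - {b}) (S - {a}) (\<lambda>j i. m i j \<ominus> m a j \<otimes> inv (m a b) \<otimes> m i b))"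
      using ab Suc.prems by (intro card_lker_pivot) auto
    \<comment> \<open>The Schur complement of the transpose is the transpose of the Schur
      complement.\<close>
    also have "lker R (T - {b}) (S - {a}) (\<lambda>j i. m i j \<ominus> m a j \<otimes> inv (m a b) \<otimes> m i b) =
        lker R (T - {b}) (S - {a}) (\<lambda>j i. m' i j)"
    proof -
      have "m i j \<ominus> m a j \<otimes> inv (m a b) \<otimes> m i b = m' i j" if "i \<in> S" "j \<in> T" for i j
        unfolding m'_def using that ab v Suc.prems(3) by (simp add: m_ac)
      then have "(\<Oplus>j\<in>T - {b}. c j \<otimes> (m i j \<ominus> m a j \<otimes> inv (m a b) \<otimes> m i b)) =
          (\<Oplus>j\<in>T - {b}. c j \<otimes> m' i j)" if "i \<in> S" "\<And>j. c j \<in> carrier R" for c i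
        using that ab v Suc.prems(3) by (intro finsum_cong') (auto simp: m'_def)
      then show ?thesis by (auto simp: lker_def vecs_def)
    qed
    finally have 2: "card (lker R T S (\<lambda>t s. m s t)) = card (lker R (T - {b}) (S - {a}) (\<lambda>j i. m' i j))" .
    have "card (carrier R) ^ card (T - {b}) * card (lker R (S - {a}) (T - {b}) m') =
      card (carrier R) ^ card (S - {a}) * card (lker R (T - {b}) (S - {a}) (\<lambda>t s. m' s t))"
      by (rule Suc.hyps) (use Suc ab v in \<open>auto simp: m'_def\<close>)
    moreover have "card T = Suc (card (T - {b}))" "card S = Suc (card (S - {a}))"
      using ab Suc.prems by (metis card_Suc_Diff1)+
    ultimately show ?thesis unfolding 1 2 by (simp add: mult.assoc)
  qed
qed

text \<open>Fredholm alternative: append \<open>\<nu>\<close> to \<open>m\<close> as a further column and compare kernels.\<close>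

lemma solvable_if_orthogonal_lker:
  assumes fin: "finite A" "finite B" "finite (carrier R)"
    and m: "\<And>a b. a \<in> A \<Longrightarrow> b \<in> B \<Longrightarrow> m a b \<in> carrier R"
    and \<nu>: "\<And>a. a \<in> A \<Longrightarrow> \<nu> a \<in> carrier R"
    and orth: "\<And>c. c \<in> lker R A B m \<Longrightarrow> (\<Oplus>a\<in>A. c a \<otimes> \<nu> a) = \<zero>"
  shows "\<exists>d\<in>vecs R B. \<forall>a\<in>A. (\<Oplus>b\<in>B. d b \<otimes> m a b) = \<nu> a"
proof -
  let ?B = "insert None (Some ` B)"
  define m' where "m' = (\<lambda>a ob. case ob of None \<Rightarrow> \<nu> a | Some b \<Rightarrow> m a b)"
  have m'c: "m' a b \<in> carrier R" if "a \<in> A" "b \<in> ?B" for a b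
    using that m \<nu> by (auto simp: m'_def)
  have K: "lker R A ?B m' = lker R A B m"
    using orth by (auto simp: lker_def m'_def)
  have re: "(\<Oplus>x\<in>Some ` B. c x \<otimes> m' a x) = (\<Oplus>b\<in>B. c (Some b) \<otimes> m a b)"
    if "a \<in> A" "\<And>i. c i \<in> carrier R" for c a
    using that m by (subst finsum_reindex) (auto simp: m'_def)
  have full: "(\<Oplus>x\<in>?B. c x \<otimes> m' a x) = c None \<otimes> \<nu> a \<oplus> (\<Oplus>b\<in>B. c (Some b) \<otimes> m a b)"
    if "a \<in> A" "\<And>i. c i \<in> carrier R" for c a
  proof -
    have "(\<Oplus>x\<in>?B. c x \<otimes> m' a x) = c None \<otimes> m' a None \<oplus> (\<Oplus>x\<in>Some ` B. c x \<otimes> m' a x)"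
      using that fin m'c by (intro finsum_insert) auto
    then show ?thesis unfolding re[OF that] by (simp add: m'_def)
  qed
  let ?q = "card (carrier R)"
  have qpos: "?q > 1"
  proof -
    have "card {\<zero>, \<one>} \<le> ?q" using fin by (intro card_mono) auto
    then show ?thesis by simp
  qed
  let ?L = "card (lker R ?B A (\<lambda>b a. m' a b))" and ?L' = "card (lker R B A (\<lambda>b a. m a b))"
  have "?q ^ card A * ?L = ?q ^ card ?B * card (lker R A B m)"
    using card_lker_transpose[of A ?B m'] K fin m'c by simp
  also have "\<dots> = ?q * (?q ^ card B * card (lker R A B m))"
    using fin by (simp add: card_image mult.assoc)
  also have "?q ^ card B * card (lker R A B m) = ?q ^ card A * ?L'"
    using card_lker_transpose[of A B m] fin m by simp
  finally have "?q ^ card A * ?L = ?q ^ card A * (?q * ?L')"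
    by (simp only: mult.left_commute)
  then have eq: "card (lker R ?B A (\<lambda>b a. m' a b)) = ?q * card (lker R B A (\<lambda>b a. m a b))"
    using qpos by (subst (asm) nat_mult_eq_cancel1) simp_all
  have "(\<lambda>_. \<zero>) \<in> lker R B A (\<lambda>b a. m a b)"
    using m by (intro zero_lker)
  then have pos: "card (lker R B A (\<lambda>b a. m a b)) > 0"
    using finite_lker[OF fin(2,3)] by (auto simp: card_gt_0_iff)
  \<comment> \<open>If all these vectors vanished at \<open>None\<close>, forgetting that entry
    would embed the larger kernel into the smaller one, contrary to the factor \<open>?q\<close>
    between their sizes.\<close>
  have "\<exists>c\<in>lker R ?B A (\<lambda>b a. m' a b). c None \<noteq> \<zero>"
  proof (rule ccontr)
    assume n: "\<not> ?thesis"
    have "(\<lambda>c. c \<circ> Some) ` lker R ?B A (\<lambda>b a. m' a b) \<subseteq> lker R B A (\<lambda>b a. m a b)"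
    proof safe
      fix c assume c: "c \<in> lker R ?B A (\<lambda>b a. m' a b)"
      then have cc: "\<And>i. c i \<in> carrier R" by (auto simp: lker_def vecs_def)
      have c0: "c None = \<zero>" using n c by blast
      have "(\<Oplus>b\<in>B. (c \<circ> Some) b \<otimes> m a b) = \<zero>" if "a \<in> A" for a
      proof -
        have "(\<Oplus>b\<in>B. c (Some b) \<otimes> m a b) \<in> carrier R" using cc m that by (intro finsum_closed) auto
        then show ?thesis using lker_eq[OF c that] full[OF that cc] c0 \<nu>[OF that] by simp
      qed
      then show "c \<circ> Some \<in> lker R B A (\<lambda>b a. m a b)"
        using lker_vecs[OF c] by (auto simp: lker_def vecs_def)
    qed
    moreover have "inj_on (\<lambda>c. c \<circ> Some) (lker R ?B A (\<lambda>b a. m' a b))"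
    proof (rule inj_onI)
      fix c d assume c: "c \<in> lker R ?B A (\<lambda>b a. m' a b)" and d: "d \<in> lker R ?B A (\<lambda>b a. m' a b)"
        and e: "c \<circ> Some = d \<circ> Some"
      show "c = d"
      proof
        fix x
        have "c None = \<zero>" "d None = \<zero>" using n c d by blast+
        then show "c x = d x" using fun_cong[OF e] by (cases x) auto
      qed
    qed
    ultimately have "card (lker R ?B A (\<lambda>b a. m' a b)) \<le> card (lker R B A (\<lambda>b a. m a b))"
      using card_inj_on_le finite_lker[OF fin(2,3)] by blast
    then show False using eq pos qpos by simp
  qed
  then obtain c where c: "c \<in> lker R ?B A (\<lambda>b a. m' a b)" "c None \<noteq> \<zero>" by blast
  then have cc: "\<And>i. c i \<in> carrier R" by (auto simp: lker_def vecs_def)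
  \<comment> \<open>Scaled so that the coefficient of \<open>\<nu>\<close> becomes -1; the other
    entries then solve the system.\<close>
  define k where "k = \<ominus> (inv (c None))"
  have k: "k \<in> carrier R" "k \<otimes> c None = \<ominus> \<one>"
    using field_inv_closed[OF cc c(2)] field_l_inv[OF cc c(2)] cc by (auto simp: k_def l_minus)
  have gen: "k \<otimes> s = k \<otimes> (x \<otimes> y \<oplus> s) \<ominus> (k \<otimes> x) \<otimes> y"
    if "k \<in> carrier R" "x \<in> carrier R" "y \<in> carrier R" "s \<in> carrier R" for k x y s
    using that by algebra
  show ?thesis
  proof (intro bexI ballI)
    show "(\<lambda>b. k \<otimes> c (Some b)) \<in> vecs R B"
      using k lker_vecs[OF c(1)] by (auto simp: vecs_def)
    fix a assume a: "a \<in> A"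
    let ?s = "\<Oplus>b\<in>B. c (Some b) \<otimes> m a b"
    have s: "?s \<in> carrier R" using cc m a by (intro finsum_closed) auto
    have e: "c None \<otimes> \<nu> a \<oplus> ?s = \<zero>" using lker_eq[OF c(1) a] full[OF a cc] by simp
    have "(\<Oplus>b\<in>B. k \<otimes> c (Some b) \<otimes> m a b) = k \<otimes> ?s"
      using cc k m a fin by (subst finsum_rdistr) (auto simp: m_assoc intro!: finsum_cong')
    also have "\<dots> = k \<otimes> (c None \<otimes> \<nu> a \<oplus> ?s) \<ominus> (k \<otimes> c None) \<otimes> \<nu> a"
      using gen[OF k(1) cc \<nu>[OF a] s] .
    also have "\<dots> = \<nu> a" unfolding e k(2) using k(1) \<nu>[OF a] by (simp add: l_minus minus_eq)
    finally show "(\<Oplus>b\<in>B. k \<otimes> c (Some b) \<otimes> m a b) = \<nu> a" .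
  qed
qed


text \<open>Counts the radical of a form with an isotropic subspace spanned by \<open>S\<close>. A
  vector with components c on \<open>N\<close> and d on \<open>S\<close> is in it iff c pairs to
  zero with \<open>S\<close> and d solves an inhomogeneous system whose right-hand side depends on
  c. By the Fredholm alternative the system is solvable iff c lies in \<open>K0\<close>, and its
  solutions form a coset of the transposed kernel, whose size follows from
  \<open>card_lker_transpose\<close>.\<close>

lemma card_lker_block:
  assumes fin: "finite N" "finite S" "finite (carrier R)" and dis: "N \<inter> S = {}"
    and G: "\<And>a b. a \<in> N \<union> S \<Longrightarrow> b \<in> N \<union> S \<Longrightarrow> G a b \<in> carrier R"
    and SS: "\<And>a b. a \<in> S \<Longrightarrow> b \<in> S \<Longrightarrow> G a b = \<zero>"
    and SN: "\<And>a b. a \<in> S \<Longrightarrow> b \<in> N \<Longrightarrow> G a b = \<ominus> G b a"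
  defines "K0 \<equiv> {c \<in> lker R N S G. \<forall>c'\<in>lker R N S G. (\<Oplus>b\<in>N. c' b \<otimes> (\<Oplus>a\<in>N. c a \<otimes> G a b)) = \<zero>}"
  shows "card (lker R (N \<union> S) (N \<union> S) G) * card (carrier R) ^ card N =
    card K0 * card (lker R N S G) * card (carrier R) ^ card S"
proof -
  define K where "K = lker R N S G"
  define S0 where "S0 = lker R S N (\<lambda>s b. G b s)"
  define \<nu> where "\<nu> = (\<lambda>c b. \<Oplus>a\<in>N. c a \<otimes> G a b)"
  define cut where "cut = (\<lambda>r i. if i \<in> N then r i else \<zero> :: 'a)"
  have nuc: "\<nu> c b \<in> carrier R" if "\<And>i. c i \<in> carrier R" "b \<in> N \<union> S" for c b
    using that G by (auto simp: \<nu>_def intro!: finsum_closed)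
  have nu_cong: "\<nu> c b = \<nu> c' b" if "\<And>i. i \<in> N \<Longrightarrow> c i = c' i" "\<And>i. c' i \<in> carrier R" "b \<in> N \<union> S" for c c' b
    unfolding \<nu>_def using that G by (intro finsum_cong') auto
  have S0: "card (carrier R) ^ card S * card K = card (carrier R) ^ card N * card S0"
    unfolding K_def S0_def using fin G by (intro card_lker_transpose) auto
  have split: "(\<Oplus>a\<in>N \<union> S. r a \<otimes> G a b) = \<nu> r b \<oplus> (\<Oplus>s\<in>S. r s \<otimes> G s b)"
    if "\<And>i. r i \<in> carrier R" "b \<in> N \<union> S" for r b
    unfolding \<nu>_def using that G fin dis by (intro finsum_Un_disjoint) auto
  have rad_iff: "r \<in> lker R (N \<union> S) (N \<union> S) G \<longleftrightarrow>
      r \<in> vecs R (N \<union> S) \<and> cut r \<in> K \<and> (\<forall>b\<in>N. (\<Oplus>s\<in>S. r s \<otimes> G b s) = \<nu> r b)" for r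
  proof (cases "r \<in> vecs R (N \<union> S)")
    case r: True
    then have rc: "r i \<in> carrier R" for i by (rule vecs_closed)
    have 1: "(\<Oplus>a\<in>N \<union> S. r a \<otimes> G a b) = \<zero> \<longleftrightarrow> \<nu> (cut r) b = \<zero>" if b: "b \<in> S" for b
    proof -
      have "(\<Oplus>s\<in>S. r s \<otimes> G s b) = \<zero>"
        using SS[OF _ b] rc by (intro add.finprod_one_eqI) auto
      moreover have "\<nu> (cut r) b = \<nu> r b" using rc b by (intro nu_cong) (auto simp: cut_def)
      ultimately show ?thesis using split[OF rc, of b] nuc[OF rc, of b] b by simp
    qed
    have 2: "(\<Oplus>a\<in>N \<union> S. r a \<otimes> G a b) = \<zero> \<longleftrightarrow> (\<Oplus>s\<in>S. r s \<otimes> G b s) = \<nu> r b" if b: "b \<in> N" for b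
    proof -
      let ?p = "\<Oplus>s\<in>S. r s \<otimes> G b s"
      have pc: "?p \<in> carrier R" using rc G b by (intro finsum_closed) auto
      have "(\<Oplus>s\<in>S. r s \<otimes> G s b) = (\<Oplus>s\<in>S. (\<ominus> \<one>) \<otimes> (r s \<otimes> G b s))"
        using rc G b SN by (intro finsum_cong') (auto simp: r_minus l_minus)
      also have "\<dots> = \<ominus> \<one> \<otimes> ?p"
        using rc G b fin by (intro finsum_rdistr[symmetric]) auto
      finally have "(\<Oplus>a\<in>N \<union> S. r a \<otimes> G a b) = \<nu> r b \<ominus> ?p"
        using split[OF rc, of b] b pc by (simp add: l_minus minus_eq)
      moreover have "\<nu> r b \<ominus> ?p = \<zero> \<longleftrightarrow> ?p = \<nu> r b"
        using pc nuc[OF rc, of b] b by auto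
      ultimately show ?thesis by simp
    qed
    have "cut r \<in> vecs R N" using rc by (auto simp: vecs_def cut_def)
    then have "cut r \<in> K \<longleftrightarrow> (\<forall>b\<in>S. \<nu> (cut r) b = \<zero>)" by (simp add: K_def lker_def \<nu>_def)
    then show ?thesis using r 1 2 by (auto simp: lker_def)
  qed (simp add: lker_def)
  define sol where "sol = (\<lambda>c d. d \<in> vecs R S \<and> (\<forall>b\<in>N. (\<Oplus>s\<in>S. d s \<otimes> G b s) = \<nu> c b))"
  have Kc: "c i \<in> carrier R" if "c \<in> K" for c i using that by (auto simp: K_def lker_def vecs_def)
  have K0_iff: "c \<in> K0 \<longleftrightarrow> c \<in> K \<and> (\<exists>d. sol c d)" for c
  proof
    assume "c \<in> K0"
    then have c: "c \<in> K" "\<And>c'. c' \<in> K \<Longrightarrow> (\<Oplus>b\<in>N. c' b \<otimes> \<nu> c b) = \<zero>"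
      by (auto simp: K0_def K_def \<nu>_def)
    have "\<exists>d\<in>vecs R S. \<forall>a\<in>N. (\<Oplus>b\<in>S. d b \<otimes> G a b) = \<nu> c a"
      using fin G nuc Kc[OF c(1)] c(2) unfolding K_def by (intro solvable_if_orthogonal_lker) auto
    then show "c \<in> K \<and> (\<exists>d. sol c d)" using c by (auto simp: sol_def)
  next
    assume "c \<in> K \<and> (\<exists>d. sol c d)"
    then obtain d where c: "c \<in> K" and d: "d \<in> vecs R S" "\<And>b. b \<in> N \<Longrightarrow> (\<Oplus>s\<in>S. d s \<otimes> G b s) = \<nu> c b"
      by (auto simp: sol_def)
    have dc: "d i \<in> carrier R" for i using d(1) by (rule vecs_closed)
    have "(\<Oplus>b\<in>N. c' b \<otimes> \<nu> c b) = \<zero>" if c': "c' \<in> K" for c'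
    proof -
      have "(\<Oplus>b\<in>N. c' b \<otimes> \<nu> c b) = (\<Oplus>b\<in>N. \<Oplus>s\<in>S. c' b \<otimes> (d s \<otimes> G b s))"
        using Kc[OF c'] G dc fin
        by (intro finsum_cong') (auto simp: d(2)[symmetric] intro!: finsum_rdistr finsum_closed)
      also have "\<dots> = (\<Oplus>s\<in>S. \<Oplus>b\<in>N. c' b \<otimes> (d s \<otimes> G b s))"
        using Kc[OF c'] G dc fin by (intro finsum_swap) auto
      also have "\<dots> = (\<Oplus>s\<in>S. d s \<otimes> (\<Oplus>b\<in>N. c' b \<otimes> G b s))"
      proof (rule finsum_cong')
        fix s assume s: "s \<in> S"
        show "(\<Oplus>b\<in>N. c' b \<otimes> (d s \<otimes> G b s)) = d s \<otimes> (\<Oplus>b\<in>N. c' b \<otimes> G b s)"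
          using Kc[OF c'] G dc fin s by (subst finsum_rdistr) (auto intro!: finsum_cong' simp: m_lcomm)
      qed (use Kc[OF c'] G dc in \<open>auto intro!: finsum_closed\<close>)
      also have "\<dots> = \<zero>"
        using dc lker_eq[OF c'[unfolded K_def]] by (intro add.finprod_one_eqI) auto
      finally show ?thesis .
    qed
    then show "c \<in> K0" using c by (auto simp: K0_def K_def \<nu>_def)
  qed
  \<comment> \<open>One particular solution for every \<open>c \<in> K0\<close>; all others differ
    from it by an element of \<open>S0\<close>.\<close>
  define dd where "dd = (\<lambda>c. SOME d. sol c d)"
  have dd: "sol c (dd c)" if "c \<in> K0" for c
    using that unfolding K0_iff dd_def by (simp add: someI_ex)
  have ddc: "dd c i \<in> carrier R" if "c \<in> K0" for c i
    using dd[OF that] by (auto simp: sol_def vecs_def)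
  have sum_add: "(\<Oplus>s\<in>S. (d s \<oplus> e s) \<otimes> G b s) = (\<Oplus>s\<in>S. d s \<otimes> G b s) \<oplus> (\<Oplus>s\<in>S. e s \<otimes> G b s)"
    if "b \<in> N" "\<And>i. d i \<in> carrier R" "\<And>i. e i \<in> carrier R" for b d e
  proof -
    have "(\<Oplus>s\<in>S. (d s \<oplus> e s) \<otimes> G b s) = (\<Oplus>s\<in>S. d s \<otimes> G b s \<oplus> e s \<otimes> G b s)"
      using that G by (intro finsum_cong') (auto simp: l_distr)
    also have "\<dots> = (\<Oplus>s\<in>S. d s \<otimes> G b s) \<oplus> (\<Oplus>s\<in>S. e s \<otimes> G b s)"
      using that G by (intro finsum_addf) auto
    finally show ?thesis .
  qed
  let ?f = "\<lambda>(c, s) i. if i \<in> N then c i else dd c i \<oplus> s i"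
  let ?g = "\<lambda>r. (cut r, \<lambda>i. if i \<in> S then r i \<ominus> dd (cut r) i else \<zero>)"
  have "bij_betw ?f (K0 \<times> S0) (lker R (N \<union> S) (N \<union> S) G)"
  proof (rule bij_betw_byWitness[where f' = ?g])
    have ctc: "cut (?f (c, s)) = c" if "c \<in> K0" for c s
      using that by (auto simp: cut_def K0_def lker_def vecs_def)
    show "\<forall>p\<in>K0 \<times> S0. ?g (?f p) = p"
    proof (intro ballI)
      fix p assume "p \<in> K0 \<times> S0"
      then obtain c s where p: "p = (c, s)" "c \<in> K0" "s \<in> S0" by auto
      have sc: "s i \<in> carrier R" for i using p(3) by (auto simp: S0_def lker_def vecs_def)
      have "(if i \<in> S then ?f (c, s) i \<ominus> dd (cut (?f (c, s))) i else \<zero>) = s i" for i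
        unfolding ctc[OF p(2)] using p sc[of i] ddc[OF p(2), of i] dis
        by (auto simp: S0_def lker_def vecs_def minus_eq a_ac r_neg r_neg1 r_neg2)
      then show "?g (?f p) = p" using ctc[OF p(2)] p(1) by auto
    qed
    show "\<forall>r\<in>lker R (N \<union> S) (N \<union> S) G. ?f (?g r) = r"
    proof (intro ballI)
      fix r assume r: "r \<in> lker R (N \<union> S) (N \<union> S) G"
      have rc: "r i \<in> carrier R" for i using r by (auto simp: lker_def vecs_def)
      have k: "cut r \<in> K" "\<forall>b\<in>N. (\<Oplus>s\<in>S. r s \<otimes> G b s) = \<nu> r b" "r \<in> vecs R (N \<union> S)"
        using r rad_iff by auto
      have "sol (cut r) (\<lambda>i. if i \<in> S then r i else \<zero>)"
      proof -
        have "(\<Oplus>s\<in>S. (if s \<in> S then r s else \<zero>) \<otimes> G b s) = (\<Oplus>s\<in>S. r s \<otimes> G b s)" if "b \<in> N" for b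
          using rc G that by (intro finsum_cong') auto
        moreover have "\<nu> (cut r) b = \<nu> r b" if "b \<in> N" for b
          using that rc by (intro nu_cong) (auto simp: cut_def)
        ultimately show ?thesis using k rc by (auto simp: sol_def vecs_def)
      qed
      then have c0: "cut r \<in> K0" using k K0_iff by blast
      have dv: "dd (cut r) i = \<zero>" if "i \<notin> S" for i using dd[OF c0] that by (auto simp: sol_def vecs_def)
      have "?f (?g r) i = r i" for i
      proof -
        have "dd (cut r) i \<oplus> (r i \<ominus> dd (cut r) i) = r i"
          using rc[of i] ddc[OF c0, of i] by algebra
        then show ?thesis
          using rc[of i] dv[of i] vecs_off[OF k(3), of i] by (simp add: cut_def[THEN fun_cong, of r])
      qed
      then show "?f (?g r) = r" by blast
    qed
    show "?f ` (K0 \<times> S0) \<subseteq> lker R (N \<union> S) (N \<union> S) G"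
    proof (intro image_subsetI)
      fix p assume "p \<in> K0 \<times> S0"
      then obtain c s where p: "p = (c, s)" "c \<in> K0" "s \<in> S0" by auto
      note d = dd[OF p(2)]
      have sc: "s i \<in> carrier R" for i using p(3) by (auto simp: S0_def lker_def vecs_def)
      have cc: "c i \<in> carrier R" for i using p(2) Kc K0_iff by blast
      have v: "?f (c, s) \<in> vecs R (N \<union> S)"
        using cc sc ddc[OF p(2)] d p(3) by (auto simp: vecs_def sol_def S0_def lker_def)
      have "(\<Oplus>i\<in>S. ?f (c, s) i \<otimes> G b i) = \<nu> (?f (c, s)) b" if b: "b \<in> N" for b
      proof -
        have "(\<Oplus>i\<in>S. ?f (c, s) i \<otimes> G b i) = (\<Oplus>i\<in>S. (dd c i \<oplus> s i) \<otimes> G b i)"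
          using sc ddc[OF p(2)] G b dis by (intro finsum_cong') auto
        also have "\<dots> = (\<Oplus>i\<in>S. dd c i \<otimes> G b i) \<oplus> (\<Oplus>i\<in>S. s i \<otimes> G b i)"
          using b ddc[OF p(2)] sc by (rule sum_add)
        also have "(\<Oplus>i\<in>S. s i \<otimes> G b i) = \<zero>" using p(3) b by (simp add: S0_def lker_def)
        also have "(\<Oplus>i\<in>S. dd c i \<otimes> G b i) = \<nu> c b" using d b by (simp add: sol_def)
        also have "\<nu> c b \<oplus> \<zero> = \<nu> c b" using nuc[OF cc, of b] b by simp
        also have "\<dots> = \<nu> (?f (c, s)) b"
          using cc sc ddc[OF p(2)] b by (intro nu_cong) auto
        finally show ?thesis .
      qed
      moreover have "cut (?f (c, s)) \<in> K" unfolding ctc[OF p(2)] using p(2) K0_iff by blast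
      ultimately show "?f p \<in> lker R (N \<union> S) (N \<union> S) G" unfolding p(1) rad_iff using v by blast
    qed
    show "?g ` lker R (N \<union> S) (N \<union> S) G \<subseteq> K0 \<times> S0"
    proof (intro image_subsetI)
      fix r assume r: "r \<in> lker R (N \<union> S) (N \<union> S) G"
      have rc: "r i \<in> carrier R" for i using r by (auto simp: lker_def vecs_def)
      have k: "cut r \<in> K" "\<forall>b\<in>N. (\<Oplus>s\<in>S. r s \<otimes> G b s) = \<nu> r b"
        using r rad_iff by auto
      define r' where "r' = (\<lambda>i. if i \<in> S then r i else \<zero>)"
      have nr: "\<nu> (cut r) b = \<nu> r b" if "b \<in> N" for b
        using that rc by (intro nu_cong) (auto simp: cut_def)
      have sr: "(\<Oplus>s\<in>S. r' s \<otimes> G b s) = \<nu> r b" if "b \<in> N" for b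
      proof -
        have "(\<Oplus>s\<in>S. r' s \<otimes> G b s) = (\<Oplus>s\<in>S. r s \<otimes> G b s)"
          using rc G that by (intro finsum_cong') (auto simp: r'_def)
        then show ?thesis using k that by simp
      qed
      have "sol (cut r) r'" using sr nr rc by (auto simp: sol_def vecs_def r'_def)
      then have c0: "cut r \<in> K0" using k K0_iff by blast
      note d = dd[OF c0]
      define e where "e = (\<lambda>i. if i \<in> S then r i \<ominus> dd (cut r) i else \<zero>)"
      have ec: "e i \<in> carrier R" for i using rc ddc[OF c0] by (simp add: e_def)
      have "(\<Oplus>s\<in>S. e s \<otimes> G b s) = \<zero>" if b: "b \<in> N" for b
      proof -
        have "\<nu> r b = (\<Oplus>s\<in>S. (dd (cut r) s \<oplus> e s) \<otimes> G b s)"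
          unfolding sr[OF b, symmetric] using rc ddc[OF c0] G b
          by (intro finsum_cong') (auto simp: e_def r'_def minus_eq a_ac r_neg r_neg1 r_neg2)
        also have "\<dots> = \<nu> r b \<oplus> (\<Oplus>s\<in>S. e s \<otimes> G b s)"
          using sum_add[OF b ddc[OF c0] ec] d b nr by (simp add: sol_def)
        finally have "\<nu> r b \<oplus> (\<Oplus>s\<in>S. e s \<otimes> G b s) = \<nu> r b \<oplus> \<zero>" using nuc[OF rc, of b] b by simp
        moreover have "(\<Oplus>s\<in>S. e s \<otimes> G b s) \<in> carrier R" using ec G b by (intro finsum_closed) auto
        moreover have "\<nu> r b \<in> carrier R" using nuc[OF rc, of b] b by simp
        ultimately show ?thesis using r_neg1 zero_closed by metis
      qed
      then have "e \<in> S0" using ec by (auto simp: S0_def lker_def vecs_def e_def)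
      then show "?g r \<in> K0 \<times> S0" using c0 unfolding e_def by simp
    qed
  qed
  then have "card (lker R (N \<union> S) (N \<union> S) G) = card K0 * card S0"
    by (simp add: bij_betw_same_card[symmetric] card_cartesian_product)
  then show ?thesis using S0 by (simp add: K_def mult_ac)
qed

end

section \<open>Stabilisers of symmetric matrices\<close>

definition symm :: "('a, 'm) ring_scheme \<Rightarrow> nat set \<Rightarrow> (nat \<Rightarrow> nat \<Rightarrow> 'a) set" where
  "symm F I = {\<sigma>. (\<forall>i j. \<sigma> i j \<in> carrier F) \<and> (\<forall>i j. \<sigma> i j = \<sigma> j i) \<and> (\<forall>i j. i \<notin> I \<longrightarrow> \<sigma> i j = \<zero>\<^bsub>F\<^esub>)}"

definition strict_lower :: "('a, 'm) ring_scheme \<Rightarrow> nat set \<Rightarrow> (nat \<Rightarrow> nat \<Rightarrow> 'a) set" where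
  "strict_lower F I = {x. (\<forall>j i. x j i \<in> carrier F) \<and>
     (\<forall>j i. \<not> (j \<in> I \<and> i \<in> I \<and> i < j) \<longrightarrow> x j i = \<zero>\<^bsub>F\<^esub>)}"

definition row_mult :: "('a, 'm) ring_scheme \<Rightarrow> nat set \<Rightarrow> (nat \<Rightarrow> 'a) \<Rightarrow> (nat \<Rightarrow> nat \<Rightarrow> 'a) \<Rightarrow> nat \<Rightarrow> 'a" where
  "row_mult F I x \<sigma> k = (\<Oplus>\<^bsub>F\<^esub>i\<in>I. x i \<otimes>\<^bsub>F\<^esub> \<sigma> i k)"

text \<open>The stabiliser of the symmetric matrix \<open>\<sigma>\<close> under the infinitesimal action
  \<open>\<sigma> \<mapsto> x \<sigma> + (x \<sigma>)\<^sup>T\<close> of strictly lower triangular matrices.\<close>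
definition stab :: "('a, 'm) ring_scheme \<Rightarrow> nat set \<Rightarrow> (nat \<Rightarrow> nat \<Rightarrow> 'a) \<Rightarrow> (nat \<Rightarrow> nat \<Rightarrow> 'a) set" where
  "stab F I \<sigma> = {x \<in> strict_lower F I. \<forall>j\<in>I. \<forall>k\<in>I.
     row_mult F I (x j) \<sigma> k \<oplus>\<^bsub>F\<^esub> row_mult F I (x k) \<sigma> j = \<zero>\<^bsub>F\<^esub>}"

lemma strict_lower_closed: "x \<in> strict_lower F I \<Longrightarrow> x j i \<in> carrier F"
  and strict_lower_off: "x \<in> strict_lower F I \<Longrightarrow> \<not> (j \<in> I \<and> i \<in> I \<and> i < j) \<Longrightarrow> x j i = \<zero>\<^bsub>F\<^esub>"
  by (auto simp: strict_lower_def)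

lemma symm_closed: "\<sigma> \<in> symm F I \<Longrightarrow> \<sigma> i j \<in> carrier F"
  and symm_off: "\<sigma> \<in> symm F I \<Longrightarrow> i \<notin> I \<or> j \<notin> I \<Longrightarrow> \<sigma> i j = \<zero>\<^bsub>F\<^esub>"
  and symm_sym: "\<sigma> \<in> symm F I \<Longrightarrow> \<sigma> i j = \<sigma> j i"
  by (auto simp: symm_def)

lemma stab_lower: "x \<in> stab F I \<sigma> \<Longrightarrow> x \<in> strict_lower F I"
  by (simp add: stab_def)

lemma stab_skew: "x \<in> stab F I \<sigma> \<Longrightarrow> j \<in> I \<Longrightarrow> k \<in> I \<Longrightarrow>
    row_mult F I (x j) \<sigma> k \<oplus>\<^bsub>F\<^esub> row_mult F I (x k) \<sigma> j = \<zero>\<^bsub>F\<^esub>"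
  by (simp add: stab_def)

context field
begin

lemma row_mult_closed:
  assumes "\<And>i. x i \<in> carrier R" "\<And>i. \<sigma> i k \<in> carrier R"
  shows "row_mult R I x \<sigma> k \<in> carrier R"
  using assms by (auto simp: row_mult_def intro!: finsum_closed)

lemma row_mult_cong:
  assumes "\<And>i. i \<in> I \<Longrightarrow> x i = y i" "\<And>i. y i \<in> carrier R" "\<And>i. \<sigma> i k \<in> carrier R"
  shows "row_mult R I x \<sigma> k = row_mult R I y \<sigma> k"
  unfolding row_mult_def using assms by (intro finsum_cong') auto

lemma row_mult_zero:
  assumes "\<And>i. i \<in> I \<Longrightarrow> x i \<otimes> \<sigma> i k = \<zero>"
  shows "row_mult R I x \<sigma> k = \<zero>"
  unfolding row_mult_def using assms by (intro add.finprod_one_eqI) auto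

lemma row_mult_remove:
  assumes "finite I" "l \<in> I" "\<And>i. x i \<in> carrier R" "\<And>i. \<sigma> i k \<in> carrier R"
  shows "row_mult R I x \<sigma> k = x l \<otimes> \<sigma> l k \<oplus> row_mult R (I - {l}) x \<sigma> k"
proof -
  have "row_mult R (insert l (I - {l})) x \<sigma> k = x l \<otimes> \<sigma> l k \<oplus> row_mult R (I - {l}) x \<sigma> k"
    unfolding row_mult_def using assms by (intro finsum_insert) auto
  then show ?thesis using assms(2) by (simp add: insert_absorb)
qed

lemma row_mult_add:
  assumes "\<And>i. x i \<in> carrier R" "\<And>i. y i \<in> carrier R" "\<And>i. \<sigma> i k \<in> carrier R"
  shows "row_mult R I (\<lambda>i. x i \<oplus> y i) \<sigma> k = row_mult R I x \<sigma> k \<oplus> row_mult R I y \<sigma> k"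
proof -
  have "row_mult R I (\<lambda>i. x i \<oplus> y i) \<sigma> k = (\<Oplus>i\<in>I. x i \<otimes> \<sigma> i k \<oplus> y i \<otimes> \<sigma> i k)"
    unfolding row_mult_def using assms by (intro finsum_cong') (auto simp: l_distr)
  also have "\<dots> = row_mult R I x \<sigma> k \<oplus> row_mult R I y \<sigma> k"
    unfolding row_mult_def using assms by (intro finsum_addf) auto
  finally show ?thesis .
qed

lemma row_mult_smult:
  assumes "finite I" "c \<in> carrier R" "\<And>i. x i \<in> carrier R" "\<And>i. \<sigma> i k \<in> carrier R"
  shows "row_mult R I (\<lambda>i. c \<otimes> x i) \<sigma> k = c \<otimes> row_mult R I x \<sigma> k"
proof -
  have "row_mult R I (\<lambda>i. c \<otimes> x i) \<sigma> k = (\<Oplus>i\<in>I. c \<otimes> (x i \<otimes> \<sigma> i k))"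
    unfolding row_mult_def using assms by (intro finsum_cong') (auto simp: m_assoc)
  also have "\<dots> = c \<otimes> row_mult R I x \<sigma> k"
    unfolding row_mult_def using assms by (intro finsum_rdistr[symmetric]) auto
  finally show ?thesis .
qed

text \<open>Column operations pass through the product. Two correction columns are what a Schur
  complement with two pivot indices requires; with one pivot the second coefficient is zero.\<close>

lemma row_mult_col:
  assumes "finite I" "\<And>i. x i \<in> carrier R" "\<And>i j. \<sigma> i j \<in> carrier R" "a \<in> carrier R" "b \<in> carrier R"
    and "\<And>i. i \<in> I \<Longrightarrow> \<tau> i k = \<sigma> i k \<oplus> a \<otimes> \<sigma> i r \<oplus> b \<otimes> \<sigma> i s"
  shows "row_mult R I x \<tau> k = row_mult R I x \<sigma> k \<oplus> a \<otimes> row_mult R I x \<sigma> r \<oplus> b \<otimes> row_mult R I x \<sigma> s"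
proof -
  have "row_mult R I x \<tau> k =
      (\<Oplus>i\<in>I. (x i \<otimes> \<sigma> i k \<oplus> a \<otimes> (x i \<otimes> \<sigma> i r)) \<oplus> b \<otimes> (x i \<otimes> \<sigma> i s))"
    unfolding row_mult_def
  proof (rule finsum_cong')
    fix i assume "i \<in> I"
    then show "x i \<otimes> \<tau> i k = (x i \<otimes> \<sigma> i k \<oplus> a \<otimes> (x i \<otimes> \<sigma> i r)) \<oplus> b \<otimes> (x i \<otimes> \<sigma> i s)"
      using assms(2)[of i] assms(3)[of i k] assms(3)[of i r] assms(3)[of i s] assms(4,5)
      by (simp add: assms(6) r_distr m_lcomm a_assoc)
  qed (use assms in auto)
  also have "\<dots> = (\<Oplus>i\<in>I. x i \<otimes> \<sigma> i k \<oplus> a \<otimes> (x i \<otimes> \<sigma> i r)) \<oplus> (\<Oplus>i\<in>I. b \<otimes> (x i \<otimes> \<sigma> i s))"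
    using assms by (intro finsum_addf) auto
  also have "(\<Oplus>i\<in>I. x i \<otimes> \<sigma> i k \<oplus> a \<otimes> (x i \<otimes> \<sigma> i r)) =
      (\<Oplus>i\<in>I. x i \<otimes> \<sigma> i k) \<oplus> (\<Oplus>i\<in>I. a \<otimes> (x i \<otimes> \<sigma> i r))"
    using assms by (intro finsum_addf) auto
  also have "(\<Oplus>i\<in>I. a \<otimes> (x i \<otimes> \<sigma> i r)) = a \<otimes> row_mult R I x \<sigma> r"
    unfolding row_mult_def using assms by (intro finsum_rdistr[symmetric]) auto
  also have "(\<Oplus>i\<in>I. b \<otimes> (x i \<otimes> \<sigma> i s)) = b \<otimes> row_mult R I x \<sigma> s"
    unfolding row_mult_def using assms by (intro finsum_rdistr[symmetric]) auto
  finally show ?thesis by (simp add: row_mult_def)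
qed

subsection \<open>Elimination of the first index\<close>

text \<open>Row and column \<open>l\<close> are cleared, not removed, so the result is again a total
  function and lies in \<open>symm R (I - {l})\<close>.\<close>

definition schur1 :: "nat \<Rightarrow> (nat \<Rightarrow> nat \<Rightarrow> 'a) \<Rightarrow> nat \<Rightarrow> nat \<Rightarrow> 'a" where
  "schur1 l \<sigma> i k = (if i = l \<or> k = l then \<zero> else \<sigma> i k \<ominus> \<sigma> i l \<otimes> inv (\<sigma> l l) \<otimes> \<sigma> l k)"

lemma schur1_symm:
  assumes "\<sigma> \<in> symm R I" "\<sigma> l l \<noteq> \<zero>"
  shows "schur1 l \<sigma> \<in> symm R (I - {l})"
proof -
  have c: "\<sigma> i j \<in> carrier R" for i j using assms by (auto simp: symm_def)
  have s: "\<sigma> i j = \<sigma> j i" for i j using assms by (auto simp: symm_def)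
  have v: "inv (\<sigma> l l) \<in> carrier R" using c assms(2) by (intro field_inv_closed)
  have "schur1 l \<sigma> i k = schur1 l \<sigma> k i" for i k
    using c v s[of i k] s[of i l] s[of k l] by (simp add: schur1_def m_ac)
  then show ?thesis
    using c v symm_off[OF assms(1)] by (auto simp: symm_def schur1_def minus_eq)
qed

text \<open>Row \<open>l\<close> of x vanishes because \<open>l\<close> is the least index. The
  skewness condition for the pair (j, l) therefore says that column \<open>l\<close> of x \<sigma>
  is zero, which determines \<open>x j l\<close> from the rest of row j. For such rows the remaining
  products with \<sigma> are the products with the Schur complement, so forgetting column
  \<open>l\<close> is a bijection.\<close>

lemma card_stab_schur1:
  assumes fin: "finite I" and l: "l \<in> I" "\<And>i. i \<in> I \<Longrightarrow> l \<le> i"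
    and \<sigma>: "\<sigma> \<in> symm R I" and nz: "\<sigma> l l \<noteq> \<zero>"
  shows "card (stab R I \<sigma>) = card (stab R (I - {l}) (schur1 l \<sigma>))"
proof -
  let ?I = "I - {l}" and ?\<tau> = "schur1 l \<sigma>"
  define v where "v = inv (\<sigma> l l)"
  have sc: "\<sigma> i j \<in> carrier R" for i j using \<sigma> by (rule symm_closed)
  have v: "v \<in> carrier R" "v \<otimes> \<sigma> l l = \<one>"
    using field_inv_closed[OF sc nz] field_l_inv[OF sc nz] by (auto simp: v_def)
  have tc: "?\<tau> i j \<in> carrier R" for i j
    using schur1_symm[OF \<sigma> nz] by (rule symm_closed)
  define A where "A x = row_mult R ?I x \<sigma> l" for x
  have Ac: "A x \<in> carrier R" if "\<And>i. x i \<in> carrier R" for x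
    unfolding A_def using that sc by (intro row_mult_closed)
  have first: "row_mult R I x \<sigma> l = \<zero> \<longleftrightarrow> x l = \<ominus> (A x \<otimes> v)" if x: "\<And>i. x i \<in> carrier R" for x
  proof -
    have e: "row_mult R I x \<sigma> l = x l \<otimes> \<sigma> l l \<oplus> A x"
      unfolding A_def using fin l(1) x sc by (rule row_mult_remove)
    have 1: "x l = (x l \<otimes> \<sigma> l l \<oplus> A x) \<otimes> v \<ominus> A x \<otimes> v"
    proof -
      have "(x l \<otimes> \<sigma> l l \<oplus> A x) \<otimes> v \<ominus> A x \<otimes> v = x l \<otimes> (v \<otimes> \<sigma> l l)"
        using x[of l] sc[of l l] Ac[OF x] v(1) by algebra
      then show ?thesis using x v(2) by simp
    qed
    have 2: "(\<ominus> (A x \<otimes> v)) \<otimes> \<sigma> l l \<oplus> A x = \<zero>"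
    proof -
      have "(\<ominus> (A x \<otimes> v)) \<otimes> \<sigma> l l \<oplus> A x = \<ominus> (A x \<otimes> (v \<otimes> \<sigma> l l)) \<oplus> A x"
        using x[of l] sc[of l l] Ac[OF x] v(1) by algebra
      then show ?thesis using Ac[OF x] v(2) by (simp add: l_neg)
    qed
    show ?thesis unfolding e using 1 2 Ac[OF x] v(1) x[of l] by (auto simp: minus_eq)
  qed
  have rest: "row_mult R I x \<sigma> k = row_mult R ?I x ?\<tau> k"
    if x: "\<And>i. x i \<in> carrier R" and z: "row_mult R I x \<sigma> l = \<zero>" and k: "k \<noteq> l" for x k
  proof -
    have "row_mult R ?I x ?\<tau> k = row_mult R ?I x \<sigma> k \<oplus> \<ominus> (v \<otimes> \<sigma> l k) \<otimes> row_mult R ?I x \<sigma> l \<oplus> \<zero> \<otimes> row_mult R ?I x \<sigma> l"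
      using x sc fin v(1) k by (intro row_mult_col) (auto simp: schur1_def v_def minus_eq l_minus r_minus m_ac)
    also have "\<dots> = row_mult R ?I x \<sigma> k \<oplus> x l \<otimes> \<sigma> l k"
      using x[of l] Ac[OF x] first[OF x] z v(1) sc[of l k] row_mult_closed[of x \<sigma> k ?I, OF x sc]
      by (simp add: A_def[symmetric] l_minus r_minus m_ac)
    also have "\<dots> = row_mult R I x \<sigma> k"
      using row_mult_remove[where k = k, OF fin l(1) x sc] x[of l] sc[of l k] row_mult_closed[of x \<sigma> k ?I, OF x sc]
      by (simp add: a_comm)
    finally show ?thesis by simp
  qed
  have low0: "x l i = \<zero>" if "x \<in> strict_lower R I" for x i
    using that l(2)[of i] by (intro strict_lower_off) auto
  have key: "x \<in> stab R I \<sigma> \<longleftrightarrow> x \<in> strict_lower R I \<and> (\<forall>j\<in>?I. x j l = \<ominus> (A (x j) \<otimes> v)) \<and>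
      (\<forall>j\<in>?I. \<forall>k\<in>?I. row_mult R ?I (x j) ?\<tau> k \<oplus> row_mult R ?I (x k) ?\<tau> j = \<zero>)" for x
  proof (cases "x \<in> strict_lower R I")
    case x: True
    have xc: "x j i \<in> carrier R" for i j using x by (rule strict_lower_closed)
    have r0: "row_mult R I (x l) \<sigma> k = \<zero>" for k
      using low0[OF x] sc by (intro row_mult_zero) simp
    have zero: "row_mult R I (x j) \<sigma> l = \<zero> \<longleftrightarrow> x j l = \<ominus> (A (x j) \<otimes> v)" for j
      using xc by (rule first)
    have rc: "row_mult R I (x j) \<sigma> k \<in> carrier R" for j k using xc sc by (rule row_mult_closed)
    have "x \<in> stab R I \<sigma> \<longleftrightarrow> (\<forall>j\<in>?I. row_mult R I (x j) \<sigma> l = \<zero>) \<and>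
        (\<forall>j\<in>?I. \<forall>k\<in>?I. row_mult R I (x j) \<sigma> k \<oplus> row_mult R I (x k) \<sigma> j = \<zero>)"
    proof
      assume "x \<in> stab R I \<sigma>"
      then have s: "row_mult R I (x j) \<sigma> k \<oplus> row_mult R I (x k) \<sigma> j = \<zero>" if "j \<in> I" "k \<in> I" for j k
        using that by (rule stab_skew)
      then show "(\<forall>j\<in>?I. row_mult R I (x j) \<sigma> l = \<zero>) \<and>
        (\<forall>j\<in>?I. \<forall>k\<in>?I. row_mult R I (x j) \<sigma> k \<oplus> row_mult R I (x k) \<sigma> j = \<zero>)"
        using s[OF _ l(1)] r0 rc by auto
    next
      assume h: "(\<forall>j\<in>?I. row_mult R I (x j) \<sigma> l = \<zero>) \<and>
        (\<forall>j\<in>?I. \<forall>k\<in>?I. row_mult R I (x j) \<sigma> k \<oplus> row_mult R I (x k) \<sigma> j = \<zero>)"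
      have "row_mult R I (x j) \<sigma> k \<oplus> row_mult R I (x k) \<sigma> j = \<zero>" if "j \<in> I" "k \<in> I" for j k
        using h r0 that by (cases "j = l"; cases "k = l") auto
      then show "x \<in> stab R I \<sigma>" using x by (simp add: stab_def)
    qed
    also have "\<dots> \<longleftrightarrow> (\<forall>j\<in>?I. x j l = \<ominus> (A (x j) \<otimes> v)) \<and>
      (\<forall>j\<in>?I. \<forall>k\<in>?I. row_mult R ?I (x j) ?\<tau> k \<oplus> row_mult R ?I (x k) ?\<tau> j = \<zero>)"
      using zero rest[OF xc] by (intro conj_cong) auto
    finally show ?thesis using x by simp
  qed (simp add: stab_def)
  let ?f = "\<lambda>x j i. if i = l then \<zero> else x j i"
  let ?g = "\<lambda>x j i. if i = l then (if j \<in> ?I then \<ominus> (A (x j) \<otimes> v) else \<zero>) else x j i"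
  have A_cong: "A x = A y" if "\<And>i. i \<in> ?I \<Longrightarrow> x i = y i" "\<And>i. y i \<in> carrier R" for x y
    unfolding A_def using that sc by (intro row_mult_cong) auto
  have t_cong: "row_mult R ?I x ?\<tau> k = row_mult R ?I y ?\<tau> k"
    if "\<And>i. i \<in> ?I \<Longrightarrow> x i = y i" "\<And>i. y i \<in> carrier R" for x y k
    using that tc by (intro row_mult_cong) auto
  have "bij_betw ?f (stab R I \<sigma>) (stab R ?I ?\<tau>)"
  proof (rule bij_betw_byWitness[where f' = ?g])
    show "\<forall>x\<in>stab R I \<sigma>. ?g (?f x) = x"
    proof
      fix x assume x: "x \<in> stab R I \<sigma>"
      then have x': "x \<in> strict_lower R I" by (rule stab_lower)
      have xc: "x j i \<in> carrier R" for i j using x' by (rule strict_lower_closed)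
      have "A (?f x j) = A (x j)" for j using xc by (intro A_cong) auto
      then have "?g (?f x) j i = x j i" for j i
        using x key[of x] strict_lower_off[OF x', of j l] by auto
      then show "?g (?f x) = x" by blast
    qed
    show "\<forall>x\<in>stab R ?I ?\<tau>. ?f (?g x) = x"
      by (auto simp: stab_def strict_lower_def fun_eq_iff)
    show "?f ` stab R I \<sigma> \<subseteq> stab R ?I ?\<tau>"
    proof (intro image_subsetI)
      fix x assume x: "x \<in> stab R I \<sigma>"
      then have x': "x \<in> strict_lower R I" by (rule stab_lower)
      have xc: "x j i \<in> carrier R" for i j using x' by (rule strict_lower_closed)
      have "?f x \<in> strict_lower R ?I"
        using x' low0[OF x'] by (auto simp: strict_lower_def)
      moreover have "row_mult R ?I (?f x j) ?\<tau> k = row_mult R ?I (x j) ?\<tau> k" for j k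
        using xc by (intro t_cong) auto
      ultimately show "?f x \<in> stab R ?I ?\<tau>" using x key[of x] by (simp add: stab_def)
    qed
    show "?g ` stab R ?I ?\<tau> \<subseteq> stab R I \<sigma>"
    proof (intro image_subsetI)
      fix x assume x: "x \<in> stab R ?I ?\<tau>"
      then have x': "x \<in> strict_lower R ?I" by (rule stab_lower)
      have xc: "x j i \<in> carrier R" for i j using x' by (rule strict_lower_closed)
      have gc: "?g x j i \<in> carrier R" for j i using xc Ac[of "x j"] v by auto
      have "?g x \<in> strict_lower R I"
        using gc strict_lower_off[OF x'] l by (auto simp: strict_lower_def) (metis le_neq_implies_less)+
      moreover have "A (?g x j) = A (x j)" for j using xc by (intro A_cong) auto
      moreover have "row_mult R ?I (?g x j) ?\<tau> k = row_mult R ?I (x j) ?\<tau> k" for j k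
        using xc by (intro t_cong) auto
      ultimately show "?g x \<in> stab R I \<sigma>" using x unfolding key by (simp add: stab_def)
    qed
  qed
  then show ?thesis by (rule bij_betw_same_card)
qed

text \<open>Column \<open>l\<close> of x only meets the zero row of \<sigma>, so its
  \<open>card I - 1\<close> entries below the diagonal are free. The conditions involving the index
  \<open>l\<close> hold automatically.\<close>

lemma card_stab_zero_row:
  assumes fin: "finite I" "finite (carrier R)" and l: "l \<in> I" "\<And>i. i \<in> I \<Longrightarrow> l \<le> i"
    and \<sigma>: "\<sigma> \<in> symm R (I - {l})"
  shows "card (stab R I \<sigma>) = card (carrier R) ^ (card I - 1) * card (stab R (I - {l}) \<sigma>)"
proof -
  let ?I = "I - {l}"
  have sc: "\<sigma> i j \<in> carrier R" for i j using \<sigma> by (rule symm_closed)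
  have s0: "\<sigma> l i = \<zero>" "\<sigma> i l = \<zero>" for i using \<sigma> by (auto simp: symm_def)
  have rm: "row_mult R I x \<sigma> k = row_mult R ?I x \<sigma> k" if x: "\<And>i. x i \<in> carrier R" for x k
    using row_mult_remove[where k = k, OF fin(1) l(1) x sc] s0 x row_mult_closed[of x \<sigma> k ?I, OF x sc] by simp
  have rl: "row_mult R ?I x \<sigma> l = \<zero>" if x: "\<And>i. x i \<in> carrier R" for x
    using x s0 by (intro row_mult_zero) auto
  let ?f = "\<lambda>x. (\<lambda>j i. if i = l then \<zero> else x j i, \<lambda>j. x j l)"
  let ?g = "\<lambda>(x, y) j i. if i = l then y j else x j i"
  have cong: "row_mult R ?I x \<sigma> k = row_mult R ?I y \<sigma> k"
    if "\<And>i. i \<in> ?I \<Longrightarrow> x i = y i" "\<And>i. y i \<in> carrier R" for x y k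
    using that sc by (intro row_mult_cong) auto
  have low0: "x l i = \<zero>" if "x \<in> strict_lower R I" for x i
    using that l(2)[of i] by (intro strict_lower_off) auto
  have "bij_betw ?f (stab R I \<sigma>) (stab R ?I \<sigma> \<times> vecs R ?I)"
  proof (rule bij_betw_byWitness[where f' = ?g])
    show "\<forall>x\<in>stab R I \<sigma>. ?g (?f x) = x" by (auto simp: fun_eq_iff)
    show "\<forall>p\<in>stab R ?I \<sigma> \<times> vecs R ?I. ?f (?g p) = p"
      by (auto simp: stab_def strict_lower_def fun_eq_iff)
    show "?f ` stab R I \<sigma> \<subseteq> stab R ?I \<sigma> \<times> vecs R ?I"
    proof (intro image_subsetI)
      fix x assume x: "x \<in> stab R I \<sigma>"
      then have x': "x \<in> strict_lower R I" by (rule stab_lower)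
      have xc: "x j i \<in> carrier R" for i j using x' by (rule strict_lower_closed)
      have 1: "(\<lambda>j i. if i = l then \<zero> else x j i) \<in> strict_lower R ?I"
        using x' low0[OF x'] by (auto simp: strict_lower_def)
      have 2: "row_mult R ?I (\<lambda>i. if i = l then \<zero> else x j i) \<sigma> k = row_mult R I (x j) \<sigma> k" for j k
        unfolding rm[OF xc] using xc by (intro cong) auto
      have 3: "(\<lambda>j. x j l) \<in> vecs R ?I"
        using xc strict_lower_off[OF x', of _ l] by (auto simp: vecs_def)
      show "?f x \<in> stab R ?I \<sigma> \<times> vecs R ?I"
        using 1 3 stab_skew[OF x] by (simp add: stab_def 2)
    qed
    show "?g ` (stab R ?I \<sigma> \<times> vecs R ?I) \<subseteq> stab R I \<sigma>"
    proof (intro image_subsetI)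
      fix p assume "p \<in> stab R ?I \<sigma> \<times> vecs R ?I"
      then obtain x y where p: "p = (x, y)" and x: "x \<in> stab R ?I \<sigma>" and y: "y \<in> vecs R ?I" by auto
      then have x': "x \<in> strict_lower R ?I" by (auto dest: stab_lower)
      have xc: "x j i \<in> carrier R" for i j using x' by (rule strict_lower_closed)
      have gc: "(if i = l then y j else x j i) \<in> carrier R" for j i using xc vecs_closed[OF y] by simp
      have 1: "(\<lambda>j i. if i = l then y j else x j i) \<in> strict_lower R I"
        using gc strict_lower_off[OF x'] l vecs_off[OF y] by (auto simp: strict_lower_def) (metis le_neq_implies_less)+
      have 2: "row_mult R I (\<lambda>i. if i = l then y j else x j i) \<sigma> k = row_mult R ?I (x j) \<sigma> k" for j k
        unfolding rm[OF gc] using xc by (intro cong) auto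
      have 3: "row_mult R ?I (x j) \<sigma> k \<oplus> row_mult R ?I (x k) \<sigma> j = \<zero>" if "j \<in> I" "k \<in> I" for j k
      proof -
        have "row_mult R ?I (x l) \<sigma> k = \<zero>" for k
          using sc strict_lower_off[OF x', of l] by (intro row_mult_zero) simp
        then show ?thesis using that stab_skew[OF x] rl[OF xc] by (cases "j = l"; cases "k = l") auto
      qed
      show "?g p \<in> stab R I \<sigma>"
        using 1 3 by (simp add: p stab_def 2)
    qed
  qed
  then show ?thesis using fin l by (simp add: bij_betw_same_card card_cartesian_product card_vecs)
qed

text \<open>Schur complement with respect to the 2 by 2 block at \<open>l\<close> and
  \<open>p\<close>, written out for \<open>\<sigma> l l = \<zero>\<close>. With d =
  \<open>\<sigma> l p\<close> and e = \<open>\<sigma> p p\<close> the block has rows (0, d) and (d,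
  e), and its inverse has rows (-e/d^2, 1/d) and (1/d, 0).\<close>

definition schur2 :: "nat \<Rightarrow> nat \<Rightarrow> (nat \<Rightarrow> nat \<Rightarrow> 'a) \<Rightarrow> nat \<Rightarrow> nat \<Rightarrow> 'a" where
  "schur2 l p \<sigma> i k = (if i \<in> {l, p} \<or> k \<in> {l, p} then \<zero> else
     \<sigma> i k \<oplus> \<ominus> (inv (\<sigma> l p)) \<otimes> (\<sigma> i l \<otimes> \<sigma> p k \<oplus> \<sigma> i p \<otimes> \<sigma> l k)
       \<oplus> \<sigma> p p \<otimes> inv (\<sigma> l p) \<otimes> inv (\<sigma> l p) \<otimes> (\<sigma> i l \<otimes> \<sigma> l k))"

lemma schur2_symm:
  assumes "\<sigma> \<in> symm R I" "\<sigma> l p \<noteq> \<zero>"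
  shows "schur2 l p \<sigma> \<in> symm R (I - {l, p})"
proof -
  have c: "\<sigma> i j \<in> carrier R" for i j using assms by (auto simp: symm_def)
  have s: "\<sigma> i j = \<sigma> j i" for i j using assms by (auto simp: symm_def)
  have v: "inv (\<sigma> l p) \<in> carrier R" using c assms(2) by (intro field_inv_closed)
  have "schur2 l p \<sigma> i k = schur2 l p \<sigma> k i" for i k
    unfolding schur2_def s[of k i] s[of k l] s[of l i] s[of k p] s[of p i] using c v by (simp add: m_ac a_ac)
  moreover have "schur2 l p \<sigma> i k \<in> carrier R" for i k
    using c v by (simp add: schur2_def)
  moreover have "schur2 l p \<sigma> i k = \<zero>" if "i \<notin> I - {l, p}" for i k
    using c v that symm_off[OF assms(1)] by (auto simp: schur2_def)
  ultimately show ?thesis by (simp add: symm_def)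
qed

text \<open>In \<open>ext\<close>, the entries of a row at the pivot positions \<open>p\<close> and \<open>l\<close> are solved for.
  After that the row of \<open>x \<sigma>\<close> is the row for the Schur complement up to a multiple of row \<open>l\<close>
  of \<open>\<sigma>\<close>, and the shift by a multiple of row \<open>p\<close> of \<open>x\<close> removes the latter.\<close>

lemma card_stab_schur2:
  assumes fin: "finite I" "finite (carrier R)" and two: "\<one> \<oplus> \<one> \<noteq> \<zero>"
    and l: "l \<in> I" "\<And>i. i \<in> I \<Longrightarrow> l \<le> i" and p: "p \<in> I" "l < p"
    and \<sigma>: "\<sigma> \<in> symm R I" and z: "\<And>i. i < p \<Longrightarrow> \<sigma> l i = \<zero>" and nz: "\<sigma> l p \<noteq> \<zero>"
  shows "card (stab R I \<sigma>) =
    card (carrier R) ^ card (I \<inter> {l<..<p}) * card (stab R (I - {l, p}) (schur2 l p \<sigma>))"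
proof -
  let ?J = "I - {l, p}" and ?\<tau> = "schur2 l p \<sigma>" and ?B = "I \<inter> {l<..<p}"
  define v d e where "v = inv (\<sigma> l p)" and "d = \<sigma> l p" and "e = \<sigma> p p"
  have sc: "\<sigma> i j \<in> carrier R" for i j using \<sigma> by (rule symm_closed)
  have ss: "\<sigma> i j = \<sigma> j i" for i j using \<sigma> by (rule symm_sym)
  have de: "d \<in> carrier R" "e \<in> carrier R" using sc by (auto simp: d_def e_def)
  have v: "v \<in> carrier R" "v \<otimes> d = \<one>"
    using field_inv_closed[OF sc nz] field_l_inv[OF sc nz] by (auto simp: v_def d_def)
  have tc: "?\<tau> i j \<in> carrier R" for i j
    using schur2_symm[OF \<sigma> nz] by (rule symm_closed)
  \<comment> \<open>Serves the condition for the pair (p, p), which reads 2 (x \<sigma>)_pp =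
    0.\<close>
  have dbl: "a = \<zero>" if "a \<in> carrier R" "a \<oplus> a = \<zero>" for a
  proof -
    have "(\<one> \<oplus> \<one>) \<otimes> a = \<zero>" using that by (simp add: l_distr)
    then show ?thesis using two that integral_iff[of "\<one> \<oplus> \<one>" a] by simp
  qed
  define m where "m x k = row_mult R I x \<sigma> k" for x k
  define nn where "nn x k = row_mult R ?J x ?\<tau> k" for x k
  define C where "C x k = row_mult R ?J x \<sigma> k" for x k
  have Cc: "C x k \<in> carrier R" if "\<And>i. x i \<in> carrier R" for x k
    unfolding C_def using that sc by (intro row_mult_closed)
  have mc: "m x k \<in> carrier R" if "\<And>i. x i \<in> carrier R" for x k
    unfolding m_def using that sc by (intro row_mult_closed)
  have nc: "nn x k \<in> carrier R" if "\<And>i. x i \<in> carrier R" for x k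
    unfolding nn_def using that tc by (intro row_mult_closed)
  have C_cong: "C x k = C y k" if "\<And>i. i \<in> ?J \<Longrightarrow> x i = y i" "\<And>i. y i \<in> carrier R" for x y k
    unfolding C_def using that sc by (intro row_mult_cong) auto
  have n_cong: "nn x k = nn y k" if "\<And>i. i \<in> ?J \<Longrightarrow> x i = y i" "\<And>i. y i \<in> carrier R" for x y k
    unfolding nn_def using that tc by (intro row_mult_cong) auto
  have m_split: "m x k = x l \<otimes> \<sigma> l k \<oplus> (x p \<otimes> \<sigma> p k \<oplus> C x k)" if x: "\<And>i. x i \<in> carrier R" for x k
  proof -
    have "m x k = x l \<otimes> \<sigma> l k \<oplus> row_mult R (I - {l}) x \<sigma> k"
      unfolding m_def using fin l x sc by (intro row_mult_remove)
    also have "row_mult R (I - {l}) x \<sigma> k = x p \<otimes> \<sigma> p k \<oplus> row_mult R (I - {l} - {p}) x \<sigma> k"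
      using fin p x sc by (intro row_mult_remove) auto
    also have "I - {l} - {p} = ?J" by auto
    finally show ?thesis by (simp add: C_def)
  qed
  have ml: "m x l = x p \<otimes> d \<oplus> C x l" if x: "\<And>i. x i \<in> carrier R" for x
    using m_split[where x = x, OF x, of l] z[of l] p x[of l] x[of p] de Cc[where x = x, OF x, of l] ss[of p l] by (simp add: d_def)
  have mp: "m x p = x l \<otimes> d \<oplus> (x p \<otimes> e \<oplus> C x p)" if x: "\<And>i. x i \<in> carrier R" for x
    using m_split[where x = x, OF x, of p] by (simp add: d_def e_def)
  have nk: "nn x k = C x k \<oplus> (\<ominus> v \<otimes> \<sigma> p k \<oplus> e \<otimes> v \<otimes> v \<otimes> \<sigma> l k) \<otimes> C x l \<oplus> (\<ominus> v \<otimes> \<sigma> l k) \<otimes> C x p"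
    if x: "\<And>i. x i \<in> carrier R" and k: "k \<in> ?J" for x k
    unfolding nn_def C_def
  proof (rule row_mult_col)
    fix i assume i: "i \<in> ?J"
    have "\<sigma> i k \<oplus> \<ominus> v \<otimes> (\<sigma> i l \<otimes> \<sigma> p k \<oplus> \<sigma> i p \<otimes> \<sigma> l k) \<oplus> e \<otimes> v \<otimes> v \<otimes> (\<sigma> i l \<otimes> \<sigma> l k) =
      \<sigma> i k \<oplus> (\<ominus> v \<otimes> \<sigma> p k \<oplus> e \<otimes> v \<otimes> v \<otimes> \<sigma> l k) \<otimes> \<sigma> i l \<oplus> (\<ominus> v \<otimes> \<sigma> l k) \<otimes> \<sigma> i p"
      using sc[of i k] sc[of i l] sc[of p k] sc[of i p] sc[of l k] v(1) de(2) by algebra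
    then show "?\<tau> i k = \<sigma> i k \<oplus> (\<ominus> v \<otimes> \<sigma> p k \<oplus> e \<otimes> v \<otimes> v \<otimes> \<sigma> l k) \<otimes> \<sigma> i l \<oplus> (\<ominus> v \<otimes> \<sigma> l k) \<otimes> \<sigma> i p"
      using i k by (simp add: schur2_def v_def e_def)
  qed (use fin x sc v de in auto)
  have rel: "m x k = nn x k \<oplus> v \<otimes> \<sigma> l k \<otimes> m x p"
    if x: "\<And>i. x i \<in> carrier R" and k: "k \<in> ?J" and 0: "m x l = \<zero>" for x k
  proof -
    \<comment> \<open>The products \<open>v \<otimes> d\<close> are kept, so that this is an
      identity in free variables; once \<open>v \<otimes> d = \<one>\<close> is inserted, the last
      summand vanishes and the rest is the expansion of \<open>m x k\<close>.\<close>
    have gen: "(c \<oplus> (\<ominus> v \<otimes> t \<oplus> e \<otimes> v \<otimes> v \<otimes> s) \<otimes> \<ominus> (xp \<otimes> d) \<oplus> (\<ominus> v \<otimes> s) \<otimes> cp)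
        \<oplus> v \<otimes> s \<otimes> (xl \<otimes> d \<oplus> (xp \<otimes> e \<oplus> cp)) =
      (v \<otimes> d) \<otimes> (xl \<otimes> s) \<oplus> ((v \<otimes> d) \<otimes> (xp \<otimes> t) \<oplus> c)
        \<oplus> (e \<otimes> v \<otimes> s \<otimes> xp \<ominus> (v \<otimes> d) \<otimes> (e \<otimes> v \<otimes> s \<otimes> xp))"
      if "xl \<in> carrier R" "xp \<in> carrier R" "s \<in> carrier R" "t \<in> carrier R" "c \<in> carrier R"
        "cp \<in> carrier R" for xl xp s t c cp
      using that v(1) de by algebra
    have xc: "x l \<in> carrier R" "x p \<in> carrier R" using x by auto
    have cl: "C x l = \<ominus> (x p \<otimes> d)"
      using 0 ml[where x = x, OF x] xc de Cc[where x = x, OF x] by (metis m_closed minus_equality minus_minus)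
    show ?thesis
      unfolding m_split[where x = x, OF x, of k] nk[where x = x, OF x k] mp[where x = x, OF x] cl
        gen[OF xc sc[of l k] sc[of p k] Cc[where x = x, OF x, of k] Cc[where x = x, OF x, of p]] v(2)
      using xc sc[of l k] sc[of p k] Cc[where x = x, OF x, of k] v(1) de by (simp add: minus_eq r_neg)
  qed
  \<comment> \<open>Completes \<open>y\<close> to the row whose product with \<sigma> is zero in
    column \<open>l\<close> and equals \<open>\<beta>\<close> in column \<open>p\<close>.\<close>
  define ext where "ext y \<beta> = (\<lambda>i. if i = p then \<ominus> (C y l \<otimes> v)
      else if i = l then (\<beta> \<oplus> C y l \<otimes> v \<otimes> e \<ominus> C y p) \<otimes> v else y i)" for y \<beta>
  have lp: "l \<noteq> p" using p by simp
  have ext_c: "ext y \<beta> i \<in> carrier R" if "\<And>i. y i \<in> carrier R" "\<beta> \<in> carrier R" for y \<beta> i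
    using that Cc[of y] v de by (simp add: ext_def)
  have ext_C: "C (ext y \<beta>) k = C y k" if "\<And>i. y i \<in> carrier R" for y \<beta> k
    using that by (intro C_cong) (auto simp: ext_def)
  have ext_n: "nn (ext y \<beta>) k = nn y k" if "\<And>i. y i \<in> carrier R" for y \<beta> k
    using that by (intro n_cong) (auto simp: ext_def)
  have ext_iff: "m x l = \<zero> \<and> m x p = \<beta> \<longleftrightarrow> x l = ext x \<beta> l \<and> x p = ext x \<beta> p"
    if x: "\<And>i. x i \<in> carrier R" and b: "\<beta> \<in> carrier R" for x \<beta>
  proof -
    have solve: "a \<otimes> d \<oplus> c = b \<longleftrightarrow> a = (b \<ominus> c) \<otimes> v"
      if "a \<in> carrier R" "b \<in> carrier R" "c \<in> carrier R" for a b c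
    proof
      assume "a \<otimes> d \<oplus> c = b"
      moreover have "(a \<otimes> d \<oplus> c \<ominus> c) \<otimes> v = a \<otimes> (v \<otimes> d)" using that v(1) de(1) by algebra
      ultimately show "a = (b \<ominus> c) \<otimes> v" using that v(2) by simp
    next
      assume a: "a = (b \<ominus> c) \<otimes> v"
      have "(b \<ominus> c) \<otimes> v \<otimes> d \<oplus> c = (b \<ominus> c) \<otimes> (v \<otimes> d) \<oplus> c" using that v(1) de(1) by algebra
      also have "\<dots> = b" using that v(2) by (simp add: minus_eq a_assoc l_neg)
      finally show "a \<otimes> d \<oplus> c = b" using a by simp
    qed
    have 1: "m x l = \<zero> \<longleftrightarrow> x p = \<ominus> (C x l \<otimes> v)"
      unfolding ml[where x = x, OF x] using solve[OF x zero_closed Cc[where x = x, OF x, of l]] Cc[where x = x, OF x, of l] v(1)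
      by (simp add: minus_eq l_minus)
    have "m x p = \<beta> \<longleftrightarrow> x l = (\<beta> \<ominus> (x p \<otimes> e \<oplus> C x p)) \<otimes> v"
      unfolding mp[where x = x, OF x] using x[of p] x[of l] de(2) Cc[where x = x, OF x, of p] b by (intro solve) auto
    moreover have "\<beta> \<ominus> (x p \<otimes> e \<oplus> C x p) = \<beta> \<oplus> C x l \<otimes> v \<otimes> e \<ominus> C x p" if "x p = \<ominus> (C x l \<otimes> v)"
      unfolding that using b Cc[where x = x, OF x, of p] Cc[where x = x, OF x, of l] v(1) de(2) by algebra
    ultimately show ?thesis using 1 lp by (auto simp: ext_def)
  qed
  have low0: "x l i = \<zero>" if "x \<in> strict_lower R I" for x i
    using that l(2)[of i] by (intro strict_lower_off) auto
  \<comment> \<open>The stabiliser conditions sorted by pairs: (j, l) makes column \<open>l\<close>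
    of x \<sigma> vanish, (p, p) makes its entry at p vanish, (j, p) prescribes column
    \<open>p\<close> in terms of row \<open>p\<close> of x, and (j, k) is skewness of the rows x_j -
    v \<sigma>_lj x_p with respect to the Schur complement.\<close>
  let ?ok = "\<lambda>x. x \<in> strict_lower R I \<and> x p = ext (x p) \<zero> \<and>
     (\<forall>j\<in>?J. x j = ext (x j) (\<ominus> nn (x p) j)) \<and>
     (\<forall>j\<in>?J. \<forall>k\<in>?J. (nn (x j) k \<ominus> v \<otimes> \<sigma> l j \<otimes> nn (x p) k) \<oplus> (nn (x k) j \<ominus> v \<otimes> \<sigma> l k \<otimes> nn (x p) j) = \<zero>)"
  have ext_eq: "x = ext x \<beta> \<longleftrightarrow> x l = ext x \<beta> l \<and> x p = ext x \<beta> p" for x \<beta>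
    by (auto simp: ext_def fun_eq_iff)
  have key: "x \<in> stab R I \<sigma> \<longleftrightarrow> ?ok x" for x
  proof (cases "x \<in> strict_lower R I")
    case x: True
    have xc: "x j i \<in> carrier R" for i j using x by (rule strict_lower_closed)
    have mxc: "m (x j) k \<in> carrier R" and nxc: "nn (x j) k \<in> carrier R" for j k
      using xc by (auto intro: mc nc)
    have r0: "m (x l) k = \<zero>" for k
      unfolding m_def using low0[OF x] sc by (intro row_mult_zero) simp
    have n0: "\<ominus> nn (x p) j \<in> carrier R" for j using nxc by simp
    have ok1: "x p = ext (x p) \<zero> \<longleftrightarrow> m (x p) l = \<zero> \<and> m (x p) p = \<zero>"
      unfolding ext_eq using ext_iff[where x = "x p", OF xc zero_closed] by simp
    have ok2: "x j = ext (x j) (\<ominus> nn (x p) j) \<longleftrightarrow> m (x j) l = \<zero> \<and> m (x j) p = \<ominus> nn (x p) j" for j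
      unfolding ext_eq using ext_iff[where x = "x j", OF xc n0] by simp
    \<comment> \<open>By \<open>rel\<close> the correction to \<open>m (x j) k\<close> carries the
      factor \<sigma>_lk and that to \<open>m (x k) j\<close> the factor \<sigma>_lj. Since column
      \<open>p\<close> is given by row \<open>p\<close> of x, exchanging the two corrections turns
      each into the shift of a row by a multiple of x_p.\<close>
    have swap: "m (x j) k \<oplus> m (x k) j =
       (nn (x j) k \<ominus> v \<otimes> \<sigma> l j \<otimes> nn (x p) k) \<oplus> (nn (x k) j \<ominus> v \<otimes> \<sigma> l k \<otimes> nn (x p) j)"
      if jk: "j \<in> ?J" "k \<in> ?J" and 0: "m (x j) l = \<zero>" "m (x k) l = \<zero>"
        "m (x j) p = \<ominus> nn (x p) j" "m (x k) p = \<ominus> nn (x p) k" for j k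
      unfolding rel[where x = "x j", OF xc jk(2) 0(1)] rel[where x = "x k", OF xc jk(1) 0(2)] 0(3,4)
      using nxc[of j k] nxc[of k j] nxc[of p j] nxc[of p k] v(1) sc[of l j] sc[of l k] by algebra
    show ?thesis
    proof
      assume "x \<in> stab R I \<sigma>"
      then have s: "m (x j) k \<oplus> m (x k) j = \<zero>" if "j \<in> I" "k \<in> I" for j k
        unfolding m_def using that by (rule stab_skew)
      have 1: "m (x j) l = \<zero>" if "j \<in> I" for j
        using s[OF that l(1)] r0 mxc by simp
      have 2: "m (x p) p = \<zero>" by (rule dbl[OF mxc s[OF p(1) p(1)]])
      have 3: "m (x p) j = nn (x p) j" if "j \<in> ?J" for j
        using rel[where x = "x p", OF xc that 1[OF p(1)]] 2 nxc sc v by simp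
      have 4: "m (x j) p = \<ominus> nn (x p) j" if "j \<in> ?J" for j
        using s[of j p] that p(1) 3[OF that] mxc nxc by (simp add: minus_equality)
      have 5: "(nn (x j) k \<ominus> v \<otimes> \<sigma> l j \<otimes> nn (x p) k) \<oplus> (nn (x k) j \<ominus> v \<otimes> \<sigma> l k \<otimes> nn (x p) j) = \<zero>"
        if jk: "j \<in> ?J" "k \<in> ?J" for j k
        using swap[OF jk 1 1 4[OF jk(1)] 4[OF jk(2)]] s jk by simp
      have "x p = ext (x p) \<zero>" using ok1 1[OF p(1)] 2 by blast
      moreover have "\<forall>j\<in>?J. x j = ext (x j) (\<ominus> nn (x p) j)" using ok2 1 4 by blast
      ultimately show "?ok x" using x 5 by blast
    next
      assume ok: "?ok x"
      then have 1: "m (x j) l = \<zero>" if "j \<in> I" for j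
        using ok1 ok2[of j] r0[of l] that by (cases "j = l"; cases "j = p") auto
      have 2: "m (x p) p = \<zero>" using ok ok1 by blast
      have 3: "m (x p) j = nn (x p) j" if "j \<in> ?J" for j
        using rel[where x = "x p", OF xc that 1[OF p(1)]] 2 nxc sc v by simp
      have 4: "m (x j) p = \<ominus> nn (x p) j" if "j \<in> ?J" for j
        using ok ok2 that by blast
      have "m (x j) k \<oplus> m (x k) j = \<zero>" if j: "j \<in> I" and k: "k \<in> I" for j k
      proof -
        consider "j = l" | "k = l" | "j = p" "k = p" | "j = p" "k \<in> ?J" | "k = p" "j \<in> ?J" | "j \<in> ?J" "k \<in> ?J"
          using j k by blast
        then show ?thesis
        proof cases
          case 6
          then show ?thesis using swap[of j k] 1 4 ok j k by auto
        qed (use 1 2 3 4 r0 j k nxc in \<open>auto simp: r_neg l_neg\<close>)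
      qed
      then show "x \<in> stab R I \<sigma>" using x by (simp add: stab_def m_def)
    qed
  qed (simp add: stab_def)
  \<comment> \<open>\<open>?y x\<close> will lie in the stabiliser of the Schur complement.
    \<open>?w x\<close> collects the entries of row \<open>p\<close> strictly between
    \<open>l\<close> and \<open>p\<close>; they are unconstrained and give the power of q.\<close>
  let ?y = "\<lambda>x j i. if j \<in> ?J \<and> i \<in> ?J then x j i \<ominus> v \<otimes> \<sigma> l j \<otimes> x p i else \<zero>"
  let ?w = "\<lambda>x i. if i \<in> ?B then x p i else \<zero>"
  let ?f = "\<lambda>x. (?y x, ?w x)"
  define g where "g = (\<lambda>(y, w) j. if j = p then ext w \<zero>
    else if j \<in> ?J then ext (\<lambda>i. y j i \<oplus> v \<otimes> \<sigma> l j \<otimes> w i) (\<ominus> nn w j) else (\<lambda>_. \<zero>))"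
  \<comment> \<open>Column \<open>l\<close> of \<sigma> is zero above \<open>p\<close>. Hence the
    entry that \<open>ext\<close> puts at \<open>p\<close> vanishes for rows supported before
    \<open>p\<close>, which keeps the completed rows strictly lower triangular.\<close>
  have Cl0: "C y l = \<zero>" if "\<And>i. p \<le> i \<Longrightarrow> i \<in> ?J \<Longrightarrow> y i = \<zero>" "\<And>i. y i \<in> carrier R" for y
    unfolding C_def
  proof (rule row_mult_zero)
    fix i assume "i \<in> ?J"
    then show "y i \<otimes> \<sigma> i l = \<zero>"
      using that z[of i] ss[of i l] sc by (cases "i < p") auto
  qed
  have g_ok: "g (y, w) \<in> stab R I \<sigma> \<and> ?f (g (y, w)) = (y, w)"
    if y: "y \<in> stab R ?J ?\<tau>" and w: "w \<in> vecs R ?B" for y w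
  proof -
    have y': "y \<in> strict_lower R ?J" using y by (rule stab_lower)
    have yc: "y j i \<in> carrier R" for j i using y' by (rule strict_lower_closed)
    have wc: "w i \<in> carrier R" for i using w by (rule vecs_closed)
    have w0: "w i = \<zero>" if "i \<notin> ?B" for i using vecs_off[OF w that] .
    define x where "x = g (y, w)"
    define h where "h j = (\<lambda>i. y j i \<oplus> v \<otimes> \<sigma> l j \<otimes> w i)" for j
    have hc: "h j i \<in> carrier R" for j i using yc wc v(1) sc by (simp add: h_def)
    have nw: "\<ominus> nn w j \<in> carrier R" for j using nc[of w, OF wc] by simp
    have xp: "x p = ext w \<zero>" by (simp add: x_def g_def)
    have xj: "x j = ext (h j) (\<ominus> nn w j)" if "j \<in> ?J" for j using that by (auto simp: x_def g_def h_def)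
    have xo: "x j = (\<lambda>_. \<zero>)" if "j \<noteq> p" "j \<notin> ?J" for j using that by (auto simp: x_def g_def)
    have xc: "x j i \<in> carrier R" for j i
      using ext_c[where y = "h j", OF hc nw] ext_c[where y = w, OF wc zero_closed] xp xj xo by (cases "j = p"; cases "j \<in> ?J") auto
    \<comment> \<open>The shift does not leave the lower triangle: it is nonzero only if
      \<open>p \<le> j\<close>, and \<open>w\<close> is supported on indices below
      \<open>p\<close>.\<close>
    have h0: "h j i = \<zero>" if "j \<in> ?J" "\<not> (i \<in> ?J \<and> i < j)" for j i
    proof -
      have "y j i = \<zero>" using that by (intro strict_lower_off[OF y']) auto
      moreover have "\<sigma> l j \<otimes> w i = \<zero>"
        using that z[of j] w0[of i] wc sc by (cases "j < p") auto
      ultimately show ?thesis using v sc wc by (simp add: h_def m_assoc)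
    qed
    have low: "x \<in> strict_lower R I"
      unfolding strict_lower_def
    proof (intro CollectI conjI allI impI)
      show "x j i \<in> carrier R" for j i by (rule xc)
      fix j i assume ji: "\<not> (j \<in> I \<and> i \<in> I \<and> i < j)"
      consider "j = p" | "j \<in> ?J" | "j \<noteq> p" "j \<notin> ?J" by blast
      then show "x j i = \<zero>"
      proof cases
        case 1
        have "C w l = \<zero>" using w0 wc by (intro Cl0) auto
        then show ?thesis using ji p l w0[of i] 1 v(1) by (auto simp: xp ext_def)
      next
        case 2
        then have "l < j" using l(2)[of j] by auto
        moreover have "C (h j) l = \<zero>" if "j < p" using 2 h0 that hc by (intro Cl0) auto
        ultimately show ?thesis using ji 2 p(1) l(1) h0[OF 2, of i] v(1) by (auto simp: xj[OF 2] ext_def)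
      qed (use xo in auto)
    qed
    have nxp: "nn (x p) k = nn w k" for k unfolding xp using wc by (rule ext_n)
    have nxj: "nn (x j) k = nn (y j) k \<oplus> v \<otimes> \<sigma> l j \<otimes> nn w k" if "j \<in> ?J" for j k
    proof -
      have "nn (x j) k = nn (h j) k" unfolding xj[OF that] using hc by (rule ext_n)
      also have "\<dots> = nn (y j) k \<oplus> nn (\<lambda>i. v \<otimes> \<sigma> l j \<otimes> w i) k"
        unfolding h_def nn_def using yc wc v(1) sc tc by (intro row_mult_add) auto
      also have "nn (\<lambda>i. v \<otimes> \<sigma> l j \<otimes> w i) k = v \<otimes> \<sigma> l j \<otimes> nn w k"
        unfolding nn_def using fin wc v(1) sc tc by (intro row_mult_smult) auto
      finally show ?thesis .
    qed
    have e1: "x p = ext (x p) \<zero>"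
      using ext_C[where y = w, OF wc] by (simp add: xp ext_def fun_eq_iff)
    have e2: "x j = ext (x j) (\<ominus> nn (x p) j)" if "j \<in> ?J" for j
      using ext_C[where y = "h j", OF hc] by (simp add: nxp xj[OF that] ext_def fun_eq_iff)
    have e3: "(nn (x j) k \<ominus> v \<otimes> \<sigma> l j \<otimes> nn (x p) k) \<oplus> (nn (x k) j \<ominus> v \<otimes> \<sigma> l k \<otimes> nn (x p) j) = \<zero>"
      if jk: "j \<in> ?J" "k \<in> ?J" for j k
    proof -
      have "(nn (x j) k \<ominus> v \<otimes> \<sigma> l j \<otimes> nn (x p) k) \<oplus> (nn (x k) j \<ominus> v \<otimes> \<sigma> l k \<otimes> nn (x p) j)
        = nn (y j) k \<oplus> nn (y k) j"
        unfolding nxj[OF jk(1)] nxj[OF jk(2)] nxp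
        using nc[of "y j" k, OF yc] nc[of "y k" j, OF yc] nc[of w j, OF wc] nc[of w k, OF wc] v(1) sc[of l j] sc[of l k]
        by algebra
      also have "\<dots> = \<zero>" using stab_skew[OF y jk] by (simp add: nn_def)
      finally show ?thesis .
    qed
    have "x \<in> stab R I \<sigma>" unfolding key using low e1 e2 e3 by blast
    moreover have "?w x = w" using w0 lp by (auto simp: xp ext_def fun_eq_iff)
    moreover have "?y x j i = y j i" for j i
    proof (cases "j \<in> ?J \<and> i \<in> ?J")
      case True
      then have "x j i = y j i \<oplus> v \<otimes> \<sigma> l j \<otimes> w i" "x p i = w i"
        by (auto simp: xj xp ext_def h_def)
      moreover have "y j i \<oplus> v \<otimes> \<sigma> l j \<otimes> w i \<ominus> v \<otimes> \<sigma> l j \<otimes> w i = y j i"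
        using yc[of j i] wc[of i] v(1) sc[of l j] by algebra
      ultimately show ?thesis using True by simp
    next
      case False
      then show ?thesis using strict_lower_off[OF y', of j i] by auto
    qed
    ultimately show ?thesis unfolding x_def by blast
  qed
  have "bij_betw ?f (stab R I \<sigma>) (stab R ?J ?\<tau> \<times> vecs R ?B)"
  proof (rule bij_betw_byWitness[where f' = g])
    show "\<forall>a\<in>stab R ?J ?\<tau> \<times> vecs R ?B. ?f (g a) = a" using g_ok by auto
    show "g ` (stab R ?J ?\<tau> \<times> vecs R ?B) \<subseteq> stab R I \<sigma>" using g_ok by auto
    have xx: "?y x \<in> strict_lower R ?J \<and> ?w x \<in> vecs R ?B \<and> x p i = (if i \<in> ?J then ?w x i else x p i)
        \<and> (\<forall>j\<in>?J. \<forall>k. nn (?y x j) k = nn (x j) k \<ominus> v \<otimes> \<sigma> l j \<otimes> nn (x p) k)"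
      if x: "x \<in> strict_lower R I" for x i
    proof -
      have xc: "x j i \<in> carrier R" for i j using x by (rule strict_lower_closed)
      have x0: "x j i = \<zero>" if "\<not> (j \<in> I \<and> i \<in> I \<and> i < j)" for i j using strict_lower_off[OF x that] .
      have 1: "\<sigma> l j \<otimes> x p i = \<zero>" if "\<not> i < j" for i j
        using that x0[of p i] z[of j] sc xc by (cases "i < p") auto
      have A: "?y x \<in> strict_lower R ?J"
        using xc v sc x0 1 by (auto simp: strict_lower_def m_assoc minus_eq)
      have B: "x p i = (if i \<in> ?J then ?w x i else x p i)" for i
        using x0[of p i] l(2)[of i] by auto
      have D: "nn (?y x j) k = nn (x j) k \<ominus> v \<otimes> \<sigma> l j \<otimes> nn (x p) k" if "j \<in> ?J" for j k
      proof -
        have "nn (?y x j) k = nn (\<lambda>i. x j i \<oplus> (\<ominus> (v \<otimes> \<sigma> l j)) \<otimes> x p i) k"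
          using that xc v(1) sc by (intro n_cong) (auto simp: minus_eq l_minus)
        also have "\<dots> = nn (x j) k \<oplus> nn (\<lambda>i. (\<ominus> (v \<otimes> \<sigma> l j)) \<otimes> x p i) k"
          unfolding nn_def using xc v(1) sc tc by (intro row_mult_add) auto
        also have "nn (\<lambda>i. (\<ominus> (v \<otimes> \<sigma> l j)) \<otimes> x p i) k = (\<ominus> (v \<otimes> \<sigma> l j)) \<otimes> nn (x p) k"
          unfolding nn_def using fin xc v(1) sc tc by (intro row_mult_smult) auto
        finally show ?thesis using nc[of "x p" k, OF xc] v(1) sc by (simp add: l_minus minus_eq)
      qed
      have E: "?w x \<in> vecs R ?B" using xc by (auto simp: vecs_def)
      show ?thesis using A B[of i] D E by blast
    qed
    show "?f ` stab R I \<sigma> \<subseteq> stab R ?J ?\<tau> \<times> vecs R ?B"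
    proof (intro image_subsetI)
      fix x assume x: "x \<in> stab R I \<sigma>"
      then have x': "x \<in> strict_lower R I" by (rule stab_lower)
      note xx' = xx[OF x']
      have yn: "nn (?y x j) k = nn (x j) k \<ominus> v \<otimes> \<sigma> l j \<otimes> nn (x p) k" if "j \<in> ?J" for j k
        using xx' that by blast
      have "nn (?y x j) k \<oplus> nn (?y x k) j = \<zero>" if jk: "j \<in> ?J" "k \<in> ?J" for j k
        unfolding yn[OF jk(1)] yn[OF jk(2)] using x jk unfolding key by blast
      then show "?f x \<in> stab R ?J ?\<tau> \<times> vecs R ?B"
        using xx' by (simp add: stab_def nn_def)
    qed
    show "\<forall>x\<in>stab R I \<sigma>. g (?f x) = x"
    proof
      fix x assume x: "x \<in> stab R I \<sigma>"
      then have x': "x \<in> strict_lower R I" by (rule stab_lower)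
      note xx' = xx[OF x'] and ok = x[unfolded key]
      have xc: "x j i \<in> carrier R" for i j using x' by (rule strict_lower_closed)
      have wc: "?w x i \<in> carrier R" for i using xc by simp
      have wJ: "?w x i = x p i" if "i \<in> ?J" for i using xx'[of i] that by simp
      have ext_cong: "ext a \<beta> = ext b \<beta>"
        if "\<And>i. i \<in> ?J \<Longrightarrow> a i = b i" "\<And>i. b i \<in> carrier R" "\<And>i. i \<notin> I \<Longrightarrow> a i = b i" for a b \<beta>
        using C_cong[of a b, OF that(1,2)] that(1,3) by (auto simp: ext_def fun_eq_iff)
      have "g (?f x) j = x j" for j
      proof -
        consider "j = p" | "j \<in> ?J" | "j \<noteq> p" "j \<notin> ?J" by blast
        then show ?thesis
        proof cases
          case 1
          have "ext (?w x) \<zero> = ext (x p) \<zero>"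
          proof (rule ext_cong)
            show "?w x i = x p i" if "i \<in> ?J" for i by (rule wJ[OF that])
            show "?w x i = x p i" if "i \<notin> I" for i using strict_lower_off[OF x', of p i] that by simp
          qed (rule xc)
          then show ?thesis using 1 ok by (simp add: g_def)
        next
          case 2
          have "nn (?w x) j = nn (x p) j" using wJ xc by (intro n_cong) auto
          moreover have "ext (\<lambda>i. ?y x j i \<oplus> v \<otimes> \<sigma> l j \<otimes> ?w x i) (\<ominus> nn (x p) j) = ext (x j) (\<ominus> nn (x p) j)"
          proof (rule ext_cong)
            show "?y x j i \<oplus> v \<otimes> \<sigma> l j \<otimes> ?w x i = x j i" if "i \<in> ?J" for i
            proof -
              have "x j i \<ominus> v \<otimes> \<sigma> l j \<otimes> x p i \<oplus> v \<otimes> \<sigma> l j \<otimes> x p i = x j i"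
                using xc[of j i] xc[of p i] v(1) sc[of l j] by algebra
              then show ?thesis using 2 that wJ[OF that] by simp
            qed
            show "?y x j i \<oplus> v \<otimes> \<sigma> l j \<otimes> ?w x i = x j i" if "i \<notin> I" for i
              using strict_lower_off[OF x', of j i] that v(1) sc by auto
          qed (rule xc)
          ultimately show ?thesis using 2 ok by (simp add: g_def)
        next
          case 3
          have "x j = (\<lambda>_. \<zero>)"
          proof
            fix i show "x j i = \<zero>"
              using 3 low0[OF x', of i] strict_lower_off[OF x', of j i] by (cases "j = l") auto
          qed
          then show ?thesis using 3 by (auto simp: g_def)
        qed
      qed
      then show "g (?f x) = x" by blast
    qed
  qed
  then have "card (stab R I \<sigma>) = card (stab R ?J ?\<tau>) * card (vecs R ?B)"
    by (simp add: bij_betw_same_card card_cartesian_product)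
  then show ?thesis using fin by (simp add: card_vecs mult.commute)
qed

end

text \<open>Counts the symmetric matrices with trivial stabiliser, divided by q^(n choose 2). Only a
  first pivot at the first or the second index skips no index; it has v values and leaves n - 1 or n
  - 2 indices. For n = 1 every one of the q = v + 1 matrices qualifies.\<close>

fun regular_poly :: "nat \<Rightarrow> nat poly" where
  "regular_poly 0 = 1"
| "regular_poly (Suc 0) = [:1, 1:]"
| "regular_poly (Suc (Suc n)) = [:0, 1:] * (regular_poly (Suc n) + regular_poly n)"

text \<open>Counts the symmetric matrices whose stabiliser has q elements, divided by q^((n choose
  2) - 2). The third summand comes from a pivot at the third index, which skips one index and must
  leave a trivial stabiliser; its factor q = v + 1 is what remains of q^2 after one free entry of
  the pivot row is lost. For n = 2 the only contribution is a vanishing first row.\<close>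

fun subregular_poly :: "nat \<Rightarrow> nat poly" where
  "subregular_poly 0 = 0"
| "subregular_poly (Suc 0) = 0"
| "subregular_poly (Suc (Suc 0)) = [:1, 1:] ^ 2"
| "subregular_poly (Suc (Suc (Suc n))) =
     [:0, 1:] * (subregular_poly (Suc (Suc n)) + subregular_poly (Suc n) + [:1, 1:] * regular_poly (Suc n))"

text \<open>With the next lemma this guarantees that regular and subregular forms exist over every
  admissible field, so that the two largest dimensions are attained.\<close>

lemma poly_regular_pos: "v > 0 \<Longrightarrow> poly (regular_poly n) v > 0"
  by (induction n rule: regular_poly.induct) auto

lemma poly_subregular_pos: "v > 0 \<Longrightarrow> n \<ge> 2 \<Longrightarrow> poly (subregular_poly n) v > 0"
  by (induction n rule: subregular_poly.induct) (auto simp: poly_regular_pos)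

context field
begin

subsection \<open>Counting symmetric matrices by the size of their stabilisers\<close>

lemma card_vecs_nonzero:
  assumes fin: "finite A" "finite (carrier R)" and p: "p \<in> A"
  shows "card {u \<in> vecs R A. u p \<noteq> \<zero>} = (card (carrier R) - 1) * card (carrier R) ^ (card A - 1)"
proof -
  have "bij_betw (\<lambda>u. (u p, u(p := \<zero>))) {u \<in> vecs R A. u p \<noteq> \<zero>} ((carrier R - {\<zero>}) \<times> vecs R (A - {p}))"
    by (rule bij_betw_byWitness[where f' = "\<lambda>(a, u). u(p := a)"])
      (use p in \<open>auto simp: vecs_def fun_eq_iff\<close>)
  then have "card {u \<in> vecs R A. u p \<noteq> \<zero>} = card (carrier R - {\<zero>}) * card (vecs R (A - {p}))"
    by (simp add: bij_betw_same_card card_cartesian_product)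
  then show ?thesis using fin p by (simp add: card_vecs card_Diff_singleton)
qed

text \<open>A matrix with a nonzero entry at (l, l) is recovered from its row \<open>l\<close> and
  its Schur complement, and both can be prescribed freely.\<close>

lemma card_schur1:
  assumes fin: "finite I" "finite (carrier R)" and l: "l \<in> I"
  shows "card {\<sigma> \<in> symm R I. \<sigma> l l \<noteq> \<zero> \<and> P (schur1 l \<sigma>)} =
    (card (carrier R) - 1) * card (carrier R) ^ (card I - 1) * card {\<tau> \<in> symm R (I - {l}). P \<tau>}"
proof -
  let ?g = "\<lambda>(u, \<tau>) i k. if i = l then u k else if k = l then u i else \<tau> i k \<oplus> u i \<otimes> inv (u l) \<otimes> u k"
  have g: "?g (u, \<tau>) \<in> symm R I \<and> schur1 l (?g (u, \<tau>)) = \<tau>"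
    if u: "u \<in> vecs R I" "u l \<noteq> \<zero>" and \<tau>: "\<tau> \<in> symm R (I - {l})" for u \<tau>
  proof -
    have uc: "u i \<in> carrier R" and tc: "\<tau> i k \<in> carrier R" for i k
      using u \<tau> by (auto simp: vecs_def symm_def)
    have v: "inv (u l) \<in> carrier R" using uc u(2) by (intro field_inv_closed)
    have "?g (u, \<tau>) \<in> symm R I"
      unfolding symm_def
    proof (intro CollectI conjI allI impI)
      fix i k
      show "?g (u, \<tau>) i k = ?g (u, \<tau>) k i"
        using uc v symm_sym[OF \<tau>, of i k] by (simp add: m_ac)
      show "?g (u, \<tau>) i k = \<zero>" if "i \<notin> I"
        using that l uc v vecs_off[OF u(1), of i] symm_off[OF \<tau>, of i k] by auto
    qed (use uc tc v in auto)
    moreover have "schur1 l (?g (u, \<tau>)) i k = \<tau> i k" for i k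
    proof -
      have "\<tau> i k \<oplus> u i \<otimes> inv (u l) \<otimes> u k \<ominus> u i \<otimes> inv (u l) \<otimes> u k = \<tau> i k"
        using tc[of i k] uc[of i] uc[of k] v by algebra
      then show ?thesis using symm_off[OF \<tau>, of i k] by (auto simp: schur1_def)
    qed
    ultimately show ?thesis by blast
  qed
  have "bij_betw (\<lambda>\<sigma>. (\<sigma> l, schur1 l \<sigma>)) {\<sigma> \<in> symm R I. \<sigma> l l \<noteq> \<zero> \<and> P (schur1 l \<sigma>)}
      ({u \<in> vecs R I. u l \<noteq> \<zero>} \<times> {\<tau> \<in> symm R (I - {l}). P \<tau>})"
  proof (rule bij_betw_byWitness[where f' = ?g])
    show "\<forall>\<sigma>\<in>{\<sigma> \<in> symm R I. \<sigma> l l \<noteq> \<zero> \<and> P (schur1 l \<sigma>)}. ?g (\<sigma> l, schur1 l \<sigma>) = \<sigma>"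
    proof (intro ballI ext)
      fix \<sigma> i k assume "\<sigma> \<in> {\<sigma> \<in> symm R I. \<sigma> l l \<noteq> \<zero> \<and> P (schur1 l \<sigma>)}"
      then have \<sigma>: "\<sigma> \<in> symm R I" "\<sigma> l l \<noteq> \<zero>" by auto
      have sc: "\<sigma> i j \<in> carrier R" for i j using \<sigma>(1) by (rule symm_closed)
      have v: "inv (\<sigma> l l) \<in> carrier R" using sc \<sigma>(2) by (intro field_inv_closed)
      have "\<sigma> i k \<ominus> \<sigma> i l \<otimes> inv (\<sigma> l l) \<otimes> \<sigma> l k \<oplus> \<sigma> i l \<otimes> inv (\<sigma> l l) \<otimes> \<sigma> l k = \<sigma> i k"
        using sc[of i k] sc[of i l] sc[of l k] v by algebra
      then show "?g (\<sigma> l, schur1 l \<sigma>) i k = \<sigma> i k"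
        using symm_sym[OF \<sigma>(1), of l i] by (auto simp: schur1_def)
    qed
    show "\<forall>p\<in>{u \<in> vecs R I. u l \<noteq> \<zero>} \<times> {\<tau> \<in> symm R (I - {l}). P \<tau>}. (\<lambda>\<sigma>. (\<sigma> l, schur1 l \<sigma>)) (?g p) = p"
    proof
      fix p assume "p \<in> {u \<in> vecs R I. u l \<noteq> \<zero>} \<times> {\<tau> \<in> symm R (I - {l}). P \<tau>}"
      then obtain u \<tau> where p: "p = (u, \<tau>)" "u \<in> vecs R I" "u l \<noteq> \<zero>" "\<tau> \<in> symm R (I - {l})" by auto
      then show "(\<lambda>\<sigma>. (\<sigma> l, schur1 l \<sigma>)) (?g p) = p" using g[OF p(2-4)] by (auto simp: fun_eq_iff)
    qed
    show "(\<lambda>\<sigma>. (\<sigma> l, schur1 l \<sigma>)) ` {\<sigma> \<in> symm R I. \<sigma> l l \<noteq> \<zero> \<and> P (schur1 l \<sigma>)}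
      \<subseteq> {u \<in> vecs R I. u l \<noteq> \<zero>} \<times> {\<tau> \<in> symm R (I - {l}). P \<tau>}"
      using schur1_symm by (auto simp: vecs_def symm_closed symm_off)
    show "?g ` ({u \<in> vecs R I. u l \<noteq> \<zero>} \<times> {\<tau> \<in> symm R (I - {l}). P \<tau>})
      \<subseteq> {\<sigma> \<in> symm R I. \<sigma> l l \<noteq> \<zero> \<and> P (schur1 l \<sigma>)}"
    proof (intro image_subsetI)
      fix p assume "p \<in> {u \<in> vecs R I. u l \<noteq> \<zero>} \<times> {\<tau> \<in> symm R (I - {l}). P \<tau>}"
      then obtain u \<tau> where p: "p = (u, \<tau>)" "u \<in> vecs R I" "u l \<noteq> \<zero>" "\<tau> \<in> symm R (I - {l})" "P \<tau>" by auto
      then show "?g p \<in> {\<sigma> \<in> symm R I. \<sigma> l l \<noteq> \<zero> \<and> P (schur1 l \<sigma>)}"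
        using g[OF p(2-4)] by auto
    qed
  qed
  then show ?thesis
    using card_vecs_nonzero[OF fin l] by (simp add: bij_betw_same_card card_cartesian_product)
qed

text \<open>The matrix is recovered from row \<open>l\<close>, row \<open>p\<close> without its
  entry at \<open>l\<close>, and the Schur complement. Row \<open>l\<close> has a nonzero pivot and
  free entries beyond \<open>p\<close>; in row \<open>p\<close> the entry at \<open>l\<close> is the
  pivot again by symmetry, and the other \<open>card I - 1\<close> entries are free.\<close>

lemma card_schur2:
  assumes fin: "finite I" "finite (carrier R)" and l: "l \<in> I" and p: "p \<in> I" "l < p"
  shows "card {\<sigma> \<in> symm R I. (\<forall>i<p. \<sigma> l i = \<zero>) \<and> \<sigma> l p \<noteq> \<zero> \<and> P (schur2 l p \<sigma>)} =
    (card (carrier R) - 1) * card (carrier R) ^ (card (I \<inter> {p<..}) + (card I - 1))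
      * card {\<tau> \<in> symm R (I - {l, p}). P \<tau>}"
proof -
  let ?J = "I - {l, p}"
  let ?X = "{\<sigma> \<in> symm R I. (\<forall>i<p. \<sigma> l i = \<zero>) \<and> \<sigma> l p \<noteq> \<zero> \<and> P (schur2 l p \<sigma>)}"
  let ?U = "{u \<in> vecs R (I \<inter> {p..}). u p \<noteq> \<zero>}"
  let ?W = "vecs R (I - {l})"
  let ?Y = "?U \<times> ?W \<times> {\<tau> \<in> symm R ?J. P \<tau>}"
  define corr where "corr u w i k = \<ominus> (inv (u p)) \<otimes> (u i \<otimes> w k \<oplus> w i \<otimes> u k)
       \<oplus> w p \<otimes> inv (u p) \<otimes> inv (u p) \<otimes> (u i \<otimes> u k)" for u w :: "nat \<Rightarrow> 'a" and i k
  let ?f = "\<lambda>\<sigma>. (\<sigma> l, (\<sigma> p)(l := \<zero>), schur2 l p \<sigma>)"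
  let ?g = "\<lambda>(u, w, \<tau>) i k. if i = l then u k else if k = l then u i else
     if i = p then w k else if k = p then w i else \<tau> i k \<ominus> corr u w i k"
  have lp: "l \<noteq> p" using p by simp
  have corr_c: "corr u w i k \<in> carrier R"
    if "\<And>i. u i \<in> carrier R" "\<And>i. w i \<in> carrier R" "u p \<noteq> \<zero>" for u w i k
    using that field_inv_closed[of "u p"] by (simp add: corr_def)
  have schur2_corr: "schur2 l p \<sigma> i k = \<sigma> i k \<oplus> corr u w i k"
    if ik: "i \<notin> {l, p}" "k \<notin> {l, p}" and \<sigma>: "\<sigma> \<in> symm R I" "\<sigma> l p \<noteq> \<zero>"
      and u: "\<And>i. i \<noteq> l \<Longrightarrow> u i = \<sigma> l i" and w: "\<And>i. i \<noteq> l \<Longrightarrow> w i = \<sigma> p i" for \<sigma> u w i k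
  proof -
    have sc: "\<sigma> i j \<in> carrier R" for i j using \<sigma>(1) by (rule symm_closed)
    have v: "inv (\<sigma> l p) \<in> carrier R" using sc \<sigma>(2) by (intro field_inv_closed)
    have "u i = \<sigma> i l" "u k = \<sigma> l k" "w i = \<sigma> i p" "w k = \<sigma> p k" "w p = \<sigma> p p" "u p = \<sigma> l p"
      using ik u w symm_sym[OF \<sigma>(1)] lp by auto
    then show ?thesis using ik sc v by (simp add: schur2_def corr_def a_assoc)
  qed
  have g: "?g (u, w, \<tau>) \<in> symm R I \<and> schur2 l p (?g (u, w, \<tau>)) = \<tau>"
    if u: "u \<in> vecs R (I \<inter> {p..})" "u p \<noteq> \<zero>" and w: "w \<in> ?W" and \<tau>: "\<tau> \<in> symm R ?J" for u w \<tau>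
  proof -
    have uc: "u i \<in> carrier R" and wc: "w i \<in> carrier R" and tc: "\<tau> i k \<in> carrier R" for i k
      using u w \<tau> by (auto simp: vecs_def symm_def)
    have v: "inv (u p) \<in> carrier R" using uc u(2) by (intro field_inv_closed)
    have cs: "corr u w i k = corr u w k i" for i k
      using uc wc v by (simp add: corr_def m_ac a_ac)
    have u0: "u l = \<zero>" using vecs_off[OF u(1), of l] p by auto
    have S: "?g (u, w, \<tau>) \<in> symm R I"
      unfolding symm_def
    proof (intro CollectI conjI allI impI)
      fix i k
      show "?g (u, w, \<tau>) i k \<in> carrier R" using uc wc tc corr_c[where u = u and w = w, OF uc wc u(2)] by simp
      show "?g (u, w, \<tau>) i k = ?g (u, w, \<tau>) k i"
        using cs[of i k] symm_sym[OF \<tau>, of i k] by simp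
      show "?g (u, w, \<tau>) i k = \<zero>" if "i \<notin> I"
        using that l p uc wc v vecs_off[OF u(1), of i] vecs_off[OF w, of i] symm_off[OF \<tau>, of i k]
        by (auto simp: corr_def minus_eq)
    qed
    have "schur2 l p (?g (u, w, \<tau>)) i k = \<tau> i k" for i k
    proof (cases "i \<in> {l, p} \<or> k \<in> {l, p}")
      case True
      then show ?thesis using symm_off[OF \<tau>, of i k] by (auto simp: schur2_def)
    next
      case False
      have "schur2 l p (?g (u, w, \<tau>)) i k = ?g (u, w, \<tau>) i k \<oplus> corr u w i k"
        by (rule schur2_corr[OF _ _ S]) (use False u lp in auto)
      also have "\<dots> = \<tau> i k \<ominus> corr u w i k \<oplus> corr u w i k" using False by simp
      also have "\<dots> = \<tau> i k" using tc[of i k] corr_c[where u = u and w = w, OF uc wc u(2), of i k] by algebra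
      finally show ?thesis .
    qed
    then show ?thesis using S by blast
  qed
  have "bij_betw ?f ?X ?Y"
  proof (rule bij_betw_byWitness[where f' = ?g])
    show "\<forall>\<sigma>\<in>?X. ?g (?f \<sigma>) = \<sigma>"
    proof (intro ballI ext)
      fix \<sigma> i k assume "\<sigma> \<in> ?X"
      then have \<sigma>: "\<sigma> \<in> symm R I" "\<sigma> l p \<noteq> \<zero>" by auto
      have sc: "\<sigma> i j \<in> carrier R" for i j using \<sigma>(1) by (rule symm_closed)
      show "?g (?f \<sigma>) i k = \<sigma> i k"
      proof (cases "i \<in> {l, p} \<or> k \<in> {l, p}")
        case True
        then show ?thesis using symm_sym[OF \<sigma>(1), of l i] symm_sym[OF \<sigma>(1), of p i] by auto
      next
        case False
        let ?c = "corr (\<sigma> l) ((\<sigma> p)(l := \<zero>)) i k"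
        have "?c \<in> carrier R" using sc \<sigma>(2) by (intro corr_c) auto
        then have "\<sigma> i k \<oplus> ?c \<ominus> ?c = \<sigma> i k" using sc[of i k] by (simp add: minus_eq a_assoc r_neg)
        moreover have "schur2 l p \<sigma> i k = \<sigma> i k \<oplus> ?c"
          using False \<sigma> by (intro schur2_corr) auto
        ultimately show ?thesis using False by simp
      qed
    qed
    show "\<forall>y\<in>?Y. ?f (?g y) = y"
    proof
      fix y assume "y \<in> ?Y"
      then obtain u w \<tau> where y: "y = (u, w, \<tau>)" "u \<in> vecs R (I \<inter> {p..})" "u p \<noteq> \<zero>" "w \<in> ?W" "\<tau> \<in> symm R ?J"
        by auto
      have "w l = \<zero>" using vecs_off[OF y(4)] by simp
      then have "?g (u, w, \<tau>) l = u" "(?g (u, w, \<tau>) p)(l := \<zero>) = w" using lp by (auto simp: fun_eq_iff)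
      then show "?f (?g y) = y" using g[OF y(2-5)] y(1) by simp
    qed
    show "?f ` ?X \<subseteq> ?Y"
      using schur2_symm p by (auto simp: vecs_def symm_closed symm_off not_le)
    show "?g ` ?Y \<subseteq> ?X"
    proof (intro image_subsetI)
      fix y assume "y \<in> ?Y"
      then obtain u w \<tau> where y: "y = (u, w, \<tau>)" "u \<in> vecs R (I \<inter> {p..})" "u p \<noteq> \<zero>" "w \<in> ?W" "\<tau> \<in> symm R ?J" "P \<tau>"
        by auto
      have "u i = \<zero>" if "i < p" for i using vecs_off[OF y(2), of i] that by auto
      then show "?g y \<in> ?X" using g[OF y(2-5)] y by auto
    qed
  qed
  then have "card ?X = card ?U * (card ?W * card {\<tau> \<in> symm R ?J. P \<tau>})"
    by (simp add: bij_betw_same_card card_cartesian_product)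
  moreover have "card ?U = (card (carrier R) - 1) * card (carrier R) ^ (card (I \<inter> {p..}) - 1)"
    using fin p by (intro card_vecs_nonzero) auto
  moreover have "card (I \<inter> {p..}) = Suc (card (I \<inter> {p<..}))"
  proof -
    have "I \<inter> {p..} = insert p (I \<inter> {p<..})" using p by auto
    then show ?thesis using fin by simp
  qed
  moreover have "card ?W = card (carrier R) ^ (card I - 1)"
    using fin l by (simp add: card_vecs)
  ultimately show ?thesis by (simp add: power_add)
qed

lemma card_carrier_gt_1: "finite (carrier R) \<Longrightarrow> card (carrier R) > 1"
  using card_mono[of "carrier R" "{\<zero>, \<one>}"] by simp

lemma stab_trivial:
  assumes "\<And>i j. i \<in> I \<Longrightarrow> j \<in> I \<Longrightarrow> i = j" and \<sigma>: "\<sigma> \<in> symm R I"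
  shows "stab R I \<sigma> = {\<lambda>_ _. \<zero>}"
proof -
  have "strict_lower R I = {\<lambda>_ _. \<zero>}"
    using assms(1) by (fastforce simp: strict_lower_def fun_eq_iff)
  moreover have "row_mult R I (\<lambda>_. \<zero>) \<sigma> k = \<zero>" for k
    using symm_closed[OF \<sigma>] by (intro row_mult_zero) simp
  ultimately show ?thesis by (auto simp: stab_def)
qed

lemma finite_stab:
  assumes "finite I" "finite (carrier R)"
  shows "finite (stab R I \<sigma>)"
proof -
  have "finite (vecs R (I \<times> I))" using assms by (intro finite_vecs) auto
  then have "finite (curry ` vecs R (I \<times> I))" by (rule finite_imageI)
  moreover have "stab R I \<sigma> \<subseteq> curry ` vecs R (I \<times> I)"
  proof
    fix x assume "x \<in> stab R I \<sigma>"
    then have "x = curry (case_prod x)" "case_prod x \<in> vecs R (I \<times> I)"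
      by (auto simp: stab_def strict_lower_def vecs_def)
    then show "x \<in> curry ` vecs R (I \<times> I)" by blast
  qed
  ultimately show ?thesis by (rule finite_subset[rotated])
qed

lemma card_stab_pos:
  assumes "finite I" "finite (carrier R)" "\<sigma> \<in> symm R I"
  shows "card (stab R I \<sigma>) > 0"
proof -
  have "row_mult R I (\<lambda>_. \<zero>) \<sigma> k = \<zero>" for k
    using symm_closed[OF assms(3)] by (intro row_mult_zero) simp
  then have "(\<lambda>_ _. \<zero>) \<in> stab R I \<sigma>" by (auto simp: stab_def strict_lower_def)
  then show ?thesis using finite_stab[OF assms(1,2)] by (auto simp: card_gt_0_iff)
qed

lemma card_symm_singleton:
  "card (symm R {l}) = card (carrier R)"
proof -
  have "bij_betw (\<lambda>\<sigma>. \<sigma> l l) (symm R {l}) (carrier R)"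
    by (rule bij_betw_byWitness[where f' = "\<lambda>a i j. if i = l \<and> j = l then a else \<zero>"])
      (auto simp: symm_def fun_eq_iff, metis+)
  then show ?thesis by (rule bij_betw_same_card)
qed

lemma finite_symm:
  assumes "finite I" "finite (carrier R)"
  shows "finite (symm R I)"
proof -
  have "finite (curry ` vecs R (I \<times> I))" using assms by (intro finite_imageI finite_vecs) auto
  moreover have "symm R I \<subseteq> curry ` vecs R (I \<times> I)"
  proof
    fix x assume x: "x \<in> symm R I"
    then have "x = curry (case_prod x)" "case_prod x \<in> vecs R (I \<times> I)"
      using symm_off[OF x] by (auto simp: symm_closed[OF x] vecs_def)
    then show "x \<in> curry ` vecs R (I \<times> I)" by blast
  qed
  ultimately show ?thesis by (rule finite_subset[rotated])
qed

text \<open>Formulated for arbitrary finite index sets, since elimination removes indices from the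
  middle. The factor \<open>q ^ 2\<close> stands on the left because \<open>n choose 2\<close> is
  smaller than 2 for n at most 2.\<close>

theorem card_symm_with_stab:
  assumes fc: "finite (carrier R)" and two: "\<one> \<oplus> \<one> \<noteq> \<zero>"
  defines "q \<equiv> card (carrier R)"
  assumes "finite I" "card I = n"
  shows "card {\<sigma> \<in> symm R I. card (stab R I \<sigma>) = 1} = poly (regular_poly n) (q - 1) * q ^ (n choose 2)"
    and "card {\<sigma> \<in> symm R I. card (stab R I \<sigma>) = q} * q ^ 2 =
      poly (subregular_poly n) (q - 1) * q ^ (n choose 2)"
proof -
  have q1: "q > 1" using card_carrier_gt_1[OF fc] by (simp add: q_def)
  have "card {\<sigma> \<in> symm R I. card (stab R I \<sigma>) = 1} = poly (regular_poly n) (q - 1) * q ^ (n choose 2) \<and>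
    card {\<sigma> \<in> symm R I. card (stab R I \<sigma>) = q} * q ^ 2 =
      poly (subregular_poly n) (q - 1) * q ^ (n choose 2)"
    using assms(4,5)
  proof (induction n arbitrary: I rule: less_induct)
    case (less n)
    consider "n = 0" | "n = 1" | "n \<ge> 2" by linarith
    then show ?case
    proof cases
      case 1
      then have I: "I = {}" using less.prems by simp
      have S: "symm R {} = {\<lambda>_ _. \<zero>}" by (auto simp: symm_def fun_eq_iff)
      have K: "stab R {} (\<lambda>_ _. \<zero>) = {\<lambda>_ _. \<zero>}" by (rule stab_trivial) (auto simp: S)
      have E: "{\<sigma> \<in> symm R I. card (stab R I \<sigma>) = 1} = {\<lambda>_ _. \<zero>}"
        "{\<sigma> \<in> symm R I. card (stab R I \<sigma>) = q} = {}"
        using q1 by (auto simp: S I K)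
      show ?thesis unfolding E using 1 by (simp add: numeral_2_eq_2)
    next
      case 2
      then obtain l where I: "I = {l}" using less.prems card_1_singletonE by metis
      have K: "card (stab R {l} \<sigma>) = 1" if "\<sigma> \<in> symm R {l}" for \<sigma>
        using stab_trivial[of "{l}" \<sigma>] that by simp
      then have E: "{\<sigma> \<in> symm R I. card (stab R I \<sigma>) = 1} = symm R {l}"
        "{\<sigma> \<in> symm R I. card (stab R I \<sigma>) = q} = {}"
        using q1 by (auto simp: I)
      show ?thesis unfolding E using 2 q1 by (simp add: card_symm_singleton q_def[symmetric] numeral_2_eq_2)
    next
      case 3
      note fI = less.prems(1)
      have fS: "finite (symm R I)" using fI fc by (rule finite_symm)
      define l where "l = Min I"
      have Ine: "I \<noteq> {}" using 3 less.prems by auto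
      have l: "l \<in> I" "\<And>i. i \<in> I \<Longrightarrow> l \<le> i" using fI Ine by (auto simp: l_def)
      let ?I = "I - {l}"
      have cI: "card ?I = n - 1" using fI l less.prems(2) by simp
      define p where "p = Min ?I"
      have "card ?I \<noteq> 0" using cI 3 by simp
      then have "?I \<noteq> {}" by (intro notI) simp
      then have p: "p \<in> I" "l < p" "\<And>i. i \<in> I \<Longrightarrow> i \<noteq> l \<Longrightarrow> p \<le> i"
        using fI l Min_in[of ?I] by (auto simp: p_def le_neq_implies_less)
      define J where "J p = I - {l, p}" for p
      have cJ: "card (J p') = n - 2" if "p' \<in> I" "l < p'" for p'
        using that l less.prems fI by (simp add: J_def card_Diff_subset)
      have fJ: "finite (J p')" for p' using fI by (simp add: J_def)
      let ?A = "\<lambda>r. {\<sigma> \<in> symm R I. \<sigma> l l \<noteq> \<zero> \<and> card (stab R ?I (schur1 l \<sigma>)) = r}"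
      let ?B = "\<lambda>p r. {\<sigma> \<in> symm R I. (\<forall>i<p. \<sigma> l i = \<zero>) \<and> \<sigma> l p \<noteq> \<zero> \<and> card (stab R (J p) (schur2 l p \<sigma>)) = r}"
      have cls: "(\<sigma> l l \<noteq> \<zero> \<and> card (stab R I \<sigma>) = card (stab R ?I (schur1 l \<sigma>))) \<or>
          (\<exists>p\<in>I. l < p \<and> (\<forall>i<p. \<sigma> l i = \<zero>) \<and> \<sigma> l p \<noteq> \<zero>) \<or> \<sigma> \<in> symm R ?I"
        if \<sigma>: "\<sigma> \<in> symm R I" for \<sigma>
      proof (cases "\<exists>i. \<sigma> l i \<noteq> \<zero>")
        case True
        define p where "p = (LEAST i. \<sigma> l i \<noteq> \<zero>)"
        have p: "\<sigma> l p \<noteq> \<zero>" "\<And>i. i < p \<Longrightarrow> \<sigma> l i = \<zero>"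
          using True LeastI_ex[OF True] not_less_Least unfolding p_def by blast+
        have "p \<in> I" using symm_off[OF \<sigma>] p by blast
        show ?thesis
        proof (cases "p = l")
          case True
          then show ?thesis using p card_stab_schur1[OF fI l \<sigma>] by simp
        next
          case False
          then have "l < p" using l(2)[OF \<open>p \<in> I\<close>] by simp
          then show ?thesis using p \<open>p \<in> I\<close> by blast
        qed
      next
        case False
        then have "\<sigma> l i = \<zero>" "\<sigma> i l = \<zero>" for i using symm_sym[OF \<sigma>, of i l] by auto
        then have "\<sigma> \<in> symm R ?I" using \<sigma> by (auto simp: symm_def)
        then show ?thesis by blast
      qed
      have KA: "card (stab R I \<sigma>) = card (stab R ?I (schur1 l \<sigma>))" if "\<sigma> \<in> symm R I" "\<sigma> l l \<noteq> \<zero>" for \<sigma>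
        using card_stab_schur1[OF fI l that] .
      have KB: "card (stab R I \<sigma>) = q ^ card (I \<inter> {l<..<p'}) * card (stab R (J p') (schur2 l p' \<sigma>))"
        if "\<sigma> \<in> symm R I" "p' \<in> I" "l < p'" "\<forall>i<p'. \<sigma> l i = \<zero>" "\<sigma> l p' \<noteq> \<zero>" for \<sigma> p'
        unfolding J_def q_def using that two fI fc l by (intro card_stab_schur2) auto
      have KB0: "card (stab R (J p') (schur2 l p' \<sigma>)) > 0" if "\<sigma> \<in> symm R I" "\<sigma> l p' \<noteq> \<zero>" for \<sigma> p'
        using schur2_symm[OF that] fJ fc unfolding J_def[symmetric] by (intro card_stab_pos) auto
      have KC: "card (stab R I \<sigma>) = q ^ (n - 1) * card (stab R ?I \<sigma>)" if "\<sigma> \<in> symm R ?I" for \<sigma>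
        using card_stab_zero_row[OF fI fc l that] less.prems(2) by (simp add: q_def)
      have KC0: "card (stab R ?I \<sigma>) > 0" if "\<sigma> \<in> symm R ?I" for \<sigma>
        using that fI fc by (intro card_stab_pos) auto
      \<comment> \<open>\<open>p\<close> is the second smallest index, hence the only off-diagonal
        pivot position that skips nothing.\<close>
      have b0: "I \<inter> {l<..<p'} = {} \<longleftrightarrow> p' = p" if "p' \<in> I" "l < p'" for p'
      proof
        assume e: "I \<inter> {l<..<p'} = {}"
        have "p \<le> p'" using p(3)[of p'] that by auto
        moreover have "\<not> p < p'" using e p(1,2) by auto
        ultimately show "p' = p" by simp
      next
        assume "p' = p"
        then show "I \<inter> {l<..<p'} = {}" using p(3) by fastforce
      qed
      have cA: "card (?A r) = (q - 1) * q ^ (n - 1) * card {\<tau> \<in> symm R ?I. card (stab R ?I \<tau>) = r}" for r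
        using card_schur1[OF fI fc l(1), of "\<lambda>\<tau>. card (stab R ?I \<tau>) = r"] less.prems(2) by (simp add: q_def)
      have cB: "card (?B p' r) = (q - 1) * q ^ (card (I \<inter> {p'<..}) + (n - 1)) *
          card {\<tau> \<in> symm R (J p'). card (stab R (J p') \<tau>) = r}" if "p' \<in> I" "l < p'" for p' r
        using card_schur2[OF fI fc l(1) that, of "\<lambda>\<tau>. card (stab R (J p') \<tau>) = r"] less.prems(2)
        by (simp add: q_def J_def)
      have up: "card (I \<inter> {p'<..}) = n - 2 - card (I \<inter> {l<..<p'})" if "p' \<in> I" "l < p'" for p'
      proof -
        have "J p' = (I \<inter> {l<..<p'}) \<union> (I \<inter> {p'<..})"
          using that l(2) by (force simp: J_def)
        then have "card (J p') = card (I \<inter> {l<..<p'}) + card (I \<inter> {p'<..})"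
          using fI by (simp, subst card_Un_disjoint) auto
        then show ?thesis using cJ[OF that] by simp
      qed
      have upp: "card (I \<inter> {p<..}) = n - 2" using up[OF p(1,2)] b0[OF p(1,2)] by simp
      obtain m where m: "n = Suc (Suc m)" using 3 that[of "n - 2"] by simp
      have IH1: "card {\<tau> \<in> symm R ?I. card (stab R ?I \<tau>) = 1} = poly (regular_poly (Suc m)) (q - 1) * q ^ (Suc m choose 2)"
        "card {\<tau> \<in> symm R ?I. card (stab R ?I \<tau>) = q} * q ^ 2 = poly (subregular_poly (Suc m)) (q - 1) * q ^ (Suc m choose 2)"
        using less.IH[of "Suc m" ?I] fI cI m by auto
      have IH2: "card {\<tau> \<in> symm R (J p'). card (stab R (J p') \<tau>) = 1} = poly (regular_poly m) (q - 1) * q ^ (m choose 2)"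
        "card {\<tau> \<in> symm R (J p'). card (stab R (J p') \<tau>) = q} * q ^ 2 = poly (subregular_poly m) (q - 1) * q ^ (m choose 2)"
        if "p' \<in> I" "l < p'" for p'
        using less.IH[of m "J p'"] fJ cJ[OF that] m by auto
      have ch: "Suc k choose 2 = k + (k choose 2)" for k by (simp add: numeral_2_eq_2)
      \<comment> \<open>The free entries of the pivot rows together with the exponent from the
        induction hypothesis always add up to \<open>n choose 2\<close>, for either kind of
        pivot.\<close>
      have e1: "Suc m + (Suc m choose 2) = n choose 2" and e2: "m + Suc m + (m choose 2) = n choose 2"
        unfolding m ch by simp_all
      have prod1: "q ^ b * k = 1 \<longleftrightarrow> b = 0 \<and> k = 1" for b k :: nat
        using q1 by auto
      have prodq: "(q ^ b * k = q) = (b = 0 \<and> k = q \<or> b = 1 \<and> k = 1)" if "k > 0" for b k :: nat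
      proof (cases b)
        case (Suc c)
        have "q ^ b * k = q \<longleftrightarrow> q ^ c * k = 1" using q1 Suc by auto
        then show ?thesis using prod1 Suc by auto
      qed simp
      \<comment> \<open>A later pivot contributes a factor q for every skipped index, and a zero row
        contributes q^(n-1) with n at least 2, so neither occurs with a trivial stabiliser.\<close>
      have X1: "{\<sigma> \<in> symm R I. card (stab R I \<sigma>) = 1} = ?A 1 \<union> ?B p 1"
      proof (intro equalityI subsetI)
        fix \<sigma> assume "\<sigma> \<in> {\<sigma> \<in> symm R I. card (stab R I \<sigma>) = 1}"
        then have \<sigma>: "\<sigma> \<in> symm R I" "card (stab R I \<sigma>) = 1" by auto
        from cls[OF \<sigma>(1)] show "\<sigma> \<in> ?A 1 \<union> ?B p 1"
        proof (elim disjE bexE conjE)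
          fix p' assume p': "p' \<in> I" "l < p'" "\<forall>i<p'. \<sigma> l i = \<zero>" "\<sigma> l p' \<noteq> \<zero>"
          have "card (I \<inter> {l<..<p'}) = 0" "card (stab R (J p') (schur2 l p' \<sigma>)) = 1"
            using KB[OF \<sigma>(1) p'] \<sigma>(2) prod1 by auto
          then show ?thesis using b0[OF p'(1,2)] fI \<sigma> p' by auto
        next
          assume "\<sigma> \<in> symm R ?I"
          then show ?thesis using KC[of \<sigma>] \<sigma>(2) prod1 m by auto
        qed (use \<sigma> in auto)
      next
        fix \<sigma> assume "\<sigma> \<in> ?A 1 \<union> ?B p 1"
        then show "\<sigma> \<in> {\<sigma> \<in> symm R I. card (stab R I \<sigma>) = 1}"
          using KA[of \<sigma>] KB[of \<sigma> p] p b0[OF p(1,2)] by auto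
      qed
      have dis: "?A r \<inter> ?B p' s = {}" if "l < p'" for p' r s using that by auto
      have fin: "finite (?A r)" "finite (?B p' r)" for p' r using fS by auto
      have S1: "card {\<sigma> \<in> symm R I. card (stab R I \<sigma>) = 1} = poly (regular_poly n) (q - 1) * q ^ (n choose 2)"
      proof -
        have "card {\<sigma> \<in> symm R I. card (stab R I \<sigma>) = 1} = card (?A 1) + card (?B p 1)"
          unfolding X1 using dis[OF p(2)] fin by (intro card_Un_disjoint) auto
        also have "\<dots> = (q - 1) * poly (regular_poly (Suc m)) (q - 1) * q ^ (Suc m + (Suc m choose 2)) +
            (q - 1) * poly (regular_poly m) (q - 1) * q ^ (m + Suc m + (m choose 2))"
          unfolding cA cB[OF p(1,2)] upp IH1 IH2[OF p(1,2)] by (simp add: m power_add mult_ac)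
        also have "\<dots> = poly (regular_poly n) (q - 1) * q ^ (n choose 2)"
          unfolding e1 e2 by (simp add: m algebra_simps)
        finally show ?thesis .
      qed
      have sAB: "card (?A q) * q ^ 2 = (q - 1) * poly (subregular_poly (Suc m)) (q - 1) * q ^ (n choose 2)"
        "card (?B p q) * q ^ 2 = (q - 1) * poly (subregular_poly m) (q - 1) * q ^ (n choose 2)"
      proof -
        have "card (?A q) * q ^ 2 = (q - 1) * q ^ (n - 1) * (card {\<tau> \<in> symm R ?I. card (stab R ?I \<tau>) = q} * q ^ 2)"
          unfolding cA by (simp only: mult.assoc)
        then show "card (?A q) * q ^ 2 = (q - 1) * poly (subregular_poly (Suc m)) (q - 1) * q ^ (n choose 2)"
          unfolding IH1 e1[symmetric] by (simp add: m power_add mult_ac)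
        have "card (?B p q) * q ^ 2 = (q - 1) * q ^ (n - 2 + (n - 1)) *
            (card {\<tau> \<in> symm R (J p). card (stab R (J p) \<tau>) = q} * q ^ 2)"
          unfolding cB[OF p(1,2)] upp by (simp only: mult.assoc)
        then show "card (?B p q) * q ^ 2 = (q - 1) * poly (subregular_poly m) (q - 1) * q ^ (n choose 2)"
          unfolding IH2[OF p(1,2)] e2[symmetric] by (simp add: m power_add mult_ac)
      qed
      have subAB: "?A q \<union> ?B p q \<subseteq> {\<sigma> \<in> symm R I. card (stab R I \<sigma>) = q}"
      proof
        fix \<sigma> assume "\<sigma> \<in> ?A q \<union> ?B p q"
        then show "\<sigma> \<in> {\<sigma> \<in> symm R I. card (stab R I \<sigma>) = q}"
          using KA[of \<sigma>] KB[of \<sigma> p] p b0[OF p(1,2)] by auto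
      qed
      have three: "card {\<sigma> \<in> symm R I. card (stab R I \<sigma>) = q} * q ^ 2 =
          card (?A q) * q ^ 2 + card (?B p q) * q ^ 2 + card E * q ^ 2"
        if X: "{\<sigma> \<in> symm R I. card (stab R I \<sigma>) = q} = ?A q \<union> ?B p q \<union> E"
          and d: "?A q \<inter> E = {}" "?B p q \<inter> E = {}" and fE: "finite E" for E
      proof -
        have "card (?A q \<union> ?B p q \<union> E) = card (?A q \<union> ?B p q) + card E"
          using fin d fE by (intro card_Un_disjoint) auto
        also have "card (?A q \<union> ?B p q) = card (?A q) + card (?B p q)"
          using dis[OF p(2)] fin by (intro card_Un_disjoint) auto
        finally show ?thesis unfolding X by (simp only: add_mult_distrib)
      qed
      have S2: "card {\<sigma> \<in> symm R I. card (stab R I \<sigma>) = q} * q ^ 2 =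
          poly (subregular_poly n) (q - 1) * q ^ (n choose 2)"
      proof (cases m)
        case 0
        \<comment> \<open>For n = 2 no pivot can skip an index, but a zero first row costs only one
          factor q, so it may be followed by a trivial stabiliser.\<close>
        let ?E = "{\<sigma> \<in> symm R ?I. card (stab R ?I \<sigma>) = 1}"
        have Isub: "\<sigma> \<in> symm R I \<and> (\<forall>i. \<sigma> l i = \<zero>)" if "\<sigma> \<in> symm R ?I" for \<sigma>
          using that by (auto simp: symm_def)
        have X: "{\<sigma> \<in> symm R I. card (stab R I \<sigma>) = q} = ?A q \<union> ?B p q \<union> ?E"
        proof (intro equalityI subsetI)
          fix \<sigma> assume "\<sigma> \<in> {\<sigma> \<in> symm R I. card (stab R I \<sigma>) = q}"
          then have \<sigma>: "\<sigma> \<in> symm R I" "card (stab R I \<sigma>) = q" by auto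
          from cls[OF \<sigma>(1)] show "\<sigma> \<in> ?A q \<union> ?B p q \<union> ?E"
          proof (elim disjE bexE conjE)
            fix p' assume p': "p' \<in> I" "l < p'" "\<forall>i<p'. \<sigma> l i = \<zero>" "\<sigma> l p' \<noteq> \<zero>"
            have "J p' = {}" using cJ[OF p'(1,2)] fJ[of p'] m 0 by simp
            moreover have "I \<inter> {l<..<p'} \<subseteq> J p'" by (auto simp: J_def)
            ultimately have "p' = p" using b0[OF p'(1,2)] by simp
            then show ?thesis using KB[OF \<sigma>(1) p'] \<sigma> p' b0[OF p'(1,2)] by auto
          next
            assume s: "\<sigma> \<in> symm R ?I"
            then show ?thesis using KC[of \<sigma>] \<sigma>(2) prodq[OF KC0[OF s], of "n - 1"] m by auto
          qed (use \<sigma> in auto)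
        next
          fix \<sigma> assume "\<sigma> \<in> ?A q \<union> ?B p q \<union> ?E"
          then show "\<sigma> \<in> {\<sigma> \<in> symm R I. card (stab R I \<sigma>) = q}"
            using subAB KC[of \<sigma>] Isub[of \<sigma>] m 0 by auto
        qed
        have "card {\<sigma> \<in> symm R I. card (stab R I \<sigma>) = q} * q ^ 2 =
          card (?A q) * q ^ 2 + card (?B p q) * q ^ 2 + card ?E * q ^ 2"
        proof (rule three[OF X])
          show "finite ?E" using finite_symm[of ?I] fI fc by simp
        qed (use Isub in auto)
        also have "\<dots> = poly (subregular_poly n) (q - 1) * q ^ (n choose 2)"
        proof -
          have B: "Suc (Suc 0) choose 2 = 1" "Suc 0 choose 2 = 0" by (simp_all add: numeral_2_eq_2)
          obtain v where v: "q = Suc v" using q1 by (cases q) auto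
          show ?thesis unfolding sAB unfolding IH1 m 0 B by (simp add: power2_eq_square v)
        qed
        finally show ?thesis .
      next
        case (Suc k)
        \<comment> \<open>The third smallest index: a pivot there skips exactly \<open>p\<close>.
          From n = 3 on, a zero row costs at least q^2 and is excluded.\<close>
        define r where "r = Min (J p)"
        have "J p \<noteq> {}" using cJ[OF p(1,2)] m Suc by auto
        then have "r \<in> J p" "\<And>i. i \<in> J p \<Longrightarrow> r \<le> i" using fJ by (auto simp: r_def)
        then have r: "r \<in> I" "l < r" "p < r" "\<And>i. i \<in> I \<Longrightarrow> i \<noteq> l \<Longrightarrow> i \<noteq> p \<Longrightarrow> r \<le> i"
          using l p by (auto simp: J_def le_neq_implies_less)
        have b1: "card (I \<inter> {l<..<p'}) = 1 \<longleftrightarrow> p' = r" if p': "p' \<in> I" "l < p'" for p'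
        proof
          assume c: "card (I \<inter> {l<..<p'}) = 1"
          then have "I \<inter> {l<..<p'} \<noteq> {}" by auto
          then have "p' \<noteq> p" using b0[OF p'] by simp
          then have "r \<le> p'" "p < p'" using r(4)[of p'] p(3)[of p'] p' by auto
          moreover have "\<not> r < p'"
          proof
            assume "r < p'"
            then have "{p, r} \<subseteq> I \<inter> {l<..<p'}" using p r \<open>p < p'\<close> by auto
            then have "card {p, r} \<le> card (I \<inter> {l<..<p'})" using fI by (intro card_mono) auto
            then show False using c r(3) by simp
          qed
          ultimately show "p' = r" by simp
        next
          assume "p' = r"
          have "I \<inter> {l<..<r} = {p}"
          proof (intro equalityI subsetI)
            fix i assume i: "i \<in> I \<inter> {l<..<r}"
            then show "i \<in> {p}" using r(4)[of i] by auto
          qed (use p r in auto)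
          then show "card (I \<inter> {l<..<p'}) = 1" using \<open>p' = r\<close> by simp
        qed
        have X: "{\<sigma> \<in> symm R I. card (stab R I \<sigma>) = q} = ?A q \<union> ?B p q \<union> ?B r 1"
        proof (intro equalityI subsetI)
          fix \<sigma> assume "\<sigma> \<in> {\<sigma> \<in> symm R I. card (stab R I \<sigma>) = q}"
          then have \<sigma>: "\<sigma> \<in> symm R I" "card (stab R I \<sigma>) = q" by auto
          from cls[OF \<sigma>(1)] show "\<sigma> \<in> ?A q \<union> ?B p q \<union> ?B r 1"
          proof (elim disjE bexE conjE)
            fix p' assume p': "p' \<in> I" "l < p'" "\<forall>i<p'. \<sigma> l i = \<zero>" "\<sigma> l p' \<noteq> \<zero>"
            have "card (I \<inter> {l<..<p'}) = 0 \<and> card (stab R (J p') (schur2 l p' \<sigma>)) = q \<or>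
              card (I \<inter> {l<..<p'}) = 1 \<and> card (stab R (J p') (schur2 l p' \<sigma>)) = 1"
              unfolding prodq[OF KB0[OF \<sigma>(1) p'(4)], symmetric] KB[OF \<sigma>(1) p', symmetric] by (rule \<sigma>(2))
            then show ?thesis using b0[OF p'(1,2)] b1[OF p'(1,2)] fI \<sigma> p' by auto
          next
            assume s: "\<sigma> \<in> symm R ?I"
            then show ?thesis using KC[of \<sigma>] \<sigma>(2) prodq[OF KC0[OF s], of "n - 1"] m Suc by auto
          qed (use \<sigma> in auto)
        next
          fix \<sigma> assume \<sigma>: "\<sigma> \<in> ?A q \<union> ?B p q \<union> ?B r 1"
          show "\<sigma> \<in> {\<sigma> \<in> symm R I. card (stab R I \<sigma>) = q}"
          proof (cases "\<sigma> \<in> ?B r 1")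
            case True
            then show ?thesis using KB[of \<sigma> r] r b1[OF r(1,2)] by auto
          next
            case False
            then show ?thesis using \<sigma> subAB by blast
          qed
        qed
        have "card {\<sigma> \<in> symm R I. card (stab R I \<sigma>) = q} * q ^ 2 =
          card (?A q) * q ^ 2 + card (?B p q) * q ^ 2 + card (?B r 1) * q ^ 2"
          using dis[OF r(2)] fin r(3) by (intro three[OF X]) auto
        \<comment> \<open>Beyond \<open>r\<close> there is one free entry less than beyond
          \<open>p\<close>, so of the factor \<open>q ^ 2\<close> one q is absorbed and one
          remains.\<close>
        also have "card (?B r 1) * q ^ 2 = (q - 1) * q * poly (regular_poly m) (q - 1) * q ^ (n choose 2)"
        proof -
          have "card (I \<inter> {r<..}) = k" using up[OF r(1,2)] b1[OF r(1,2)] m Suc by simp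
          then have "card (?B r 1) * q ^ 2 =
              (q - 1) * q * poly (regular_poly m) (q - 1) * q ^ (m + Suc m + (m choose 2))"
            unfolding cB[OF r(1,2)] IH2[OF r(1,2)]
            by (simp add: m Suc power_add power2_eq_square mult_ac)
          then show ?thesis unfolding e2 .
        qed
        also have "card (?A q) * q ^ 2 + card (?B p q) * q ^ 2 +
            (q - 1) * q * poly (regular_poly m) (q - 1) * q ^ (n choose 2) =
            poly (subregular_poly n) (q - 1) * q ^ (n choose 2)"
        proof -
          obtain v where v: "q = Suc v" using q1 by (cases q) auto
          show ?thesis unfolding sAB unfolding m Suc subregular_poly.simps poly_mult poly_add v
            by (simp add: algebra_simps)
        qed
        finally show ?thesis .
      qed
      from S1 S2 show ?thesis ..
    qed
  qed
  then show "card {\<sigma> \<in> symm R I. card (stab R I \<sigma>) = 1} = poly (regular_poly n) (q - 1) * q ^ (n choose 2)"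
    "card {\<sigma> \<in> symm R I. card (stab R I \<sigma>) = q} * q ^ 2 =
      poly (subregular_poly n) (q - 1) * q ^ (n choose 2)"
    by auto
qed

end

section \<open>The rank of a linear form on \<open>\<uu>(C\<^sub>n)\<close>\<close>

definition diff_roots :: "nat \<Rightarrow> root set" where
  "diff_roots n = {Diff i j | i j. 1 \<le> i \<and> i < j \<and> j \<le> n}"

definition sum_roots :: "nat \<Rightarrow> root set" where
  "sum_roots n = {Sum i j | i j. 1 \<le> i \<and> i < j \<and> j \<le> n} \<union> {Dbl i | i. 1 \<le> i \<and> i \<le> n}"

lemma pos_roots_split: "pos_roots n = diff_roots n \<union> sum_roots n"
  by (auto simp: pos_roots_def diff_roots_def sum_roots_def)

lemma diff_sum_disjoint: "diff_roots n \<inter> sum_roots n = {}"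
  by (auto simp: diff_roots_def sum_roots_def)

lemma finite_diff_sum [simp]: "finite (diff_roots n)" "finite (sum_roots n)"
  using finite_pos_roots[of n] unfolding pos_roots_split by auto

lemma card_pairs: "card {(i, j). 1 \<le> i \<and> i < j \<and> j \<le> (n :: nat)} = n choose 2"
proof (induction n)
  case 0
  have e: "{(i, j). 1 \<le> i \<and> i < j \<and> j \<le> (0 :: nat)} = {}" by auto
  show ?case unfolding e by (simp add: numeral_2_eq_2)
next
  case (Suc n)
  have f: "finite {(i, j). 1 \<le> i \<and> i < j \<and> j \<le> n}"
    by (rule finite_subset[of _ "{..n} \<times> {..n}"]) auto
  have "{(i, j). 1 \<le> i \<and> i < j \<and> j \<le> Suc n} =
      {(i, j). 1 \<le> i \<and> i < j \<and> j \<le> n} \<union> (\<lambda>i. (i, Suc n)) ` {1..n}"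
    by (auto simp: le_Suc_eq)
  also have "card \<dots> = (n choose 2) + card ((\<lambda>i. (i, Suc n)) ` {1..n})"
    using f Suc by (subst card_Un_disjoint) auto
  also have "card ((\<lambda>i. (i, Suc n)) ` {1..n}) = n" by (subst card_image) (auto intro: inj_onI)
  finally show ?case by (simp add: numeral_2_eq_2)
qed

lemma card_diff_roots: "card (diff_roots n) = n choose 2"
proof -
  have "diff_roots n = case_prod Diff ` {(i, j). 1 \<le> i \<and> i < j \<and> j \<le> n}"
    by (auto simp: diff_roots_def)
  then show ?thesis by (simp add: card_image inj_on_def card_pairs[unfolded One_nat_def])
qed

lemma card_sum_roots: "card (sum_roots n) = (n choose 2) + n"
proof -
  have s: "sum_roots n = case_prod Sum ` {(i, j). 1 \<le> i \<and> i < j \<and> j \<le> n} \<union> Dbl ` {1..n}"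
    by (auto simp: sum_roots_def)
  have "finite (case_prod Sum ` {(i, j). 1 \<le> i \<and> i < j \<and> j \<le> n})"
    using finite_diff_sum(2)[of n] unfolding s by simp
  then have "card (sum_roots n) = card (case_prod Sum ` {(i, j). 1 \<le> i \<and> i < j \<and> j \<le> n}) + card (Dbl ` {1..n})"
    unfolding s by (intro card_Un_disjoint) auto
  then show ?thesis by (simp add: card_image inj_on_def card_pairs[unfolded One_nat_def])
qed

lemma card_pos_roots: "card (pos_roots n) = 2 * (n choose 2) + n"
  unfolding pos_roots_split using diff_sum_disjoint[of n]
  by (simp add: card_Un_disjoint card_diff_roots card_sum_roots)

context field
begin

subsection \<open>Linear forms on \<open>\<uu>(C\<^sub>n)\<close>\<close>

lemma skew_carrier: "x \<in> skew R n \<Longrightarrow> x \<in> carrier (gl R n)"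
  and skew_tri: "x \<in> skew R n \<Longrightarrow> x \<in> tri R n 1"
  and skew_adj: "x \<in> skew R n \<Longrightarrow> adj R x = \<ominus>\<^bsub>gl R n\<^esub> x"
  by (auto simp: skew_def tri_def)

lemma adj_plus:
  assumes "x \<in> carrier (gl R n)" "y \<in> carrier (gl R n)"
  shows "adj R (x \<oplus>\<^bsub>gl R n\<^esub> y) = adj R x \<oplus>\<^bsub>gl R n\<^esub> adj R y"
  using adj_add[OF assms] by (simp add: gl_sel(3) fun_eq_iff)

lemma adj_uminus:
  assumes "x \<in> carrier (gl R n)"
  shows "adj R (\<ominus>\<^bsub>gl R n\<^esub> x) = \<ominus>\<^bsub>gl R n\<^esub> adj R x"
  using assms adj_closed[OF assms] gl_entry[OF assms] by (auto simp: gl_minus adj_def fun_eq_iff)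

lemma adj_minus:
  assumes "x \<in> carrier (gl R n)" "y \<in> carrier (gl R n)"
  shows "adj R (x \<ominus>\<^bsub>gl R n\<^esub> y) = adj R x \<ominus>\<^bsub>gl R n\<^esub> adj R y"
proof -
  interpret M: ring "gl R n" by (rule gl_ring)
  show ?thesis using assms by (simp add: M.minus_eq adj_plus adj_uminus)
qed

lemma adj_adj: "x \<in> carrier (gl R n) \<Longrightarrow> adj R (adj R x) = x"
  using gl_entry[of x R n] gl_off[of x R n] idx_not_0[of _ n]
  by (auto simp: adj_def fun_eq_iff) (metis minus_zero)+

lemma skew_zero: "\<zero>\<^bsub>gl R n\<^esub> \<in> skew R n"
  unfolding skew_entrywise by (auto simp: tri_zero) (auto simp: adj_def gl_sel)

lemma skew_uminus:
  assumes "x \<in> skew R n"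
  shows "\<ominus>\<^bsub>gl R n\<^esub> x \<in> skew R n"
  using tri_minus[OF skew_tri[OF assms]] adj_uminus[OF skew_carrier[OF assms]] skew_adj[OF assms]
  by (simp add: skew_def)

lemma bracket_tri:
  assumes x: "x \<in> tri R n i" and y: "y \<in> tri R n j"
  shows "bracket R n x y \<in> tri R n (i + j)"
proof -
  interpret M: ring "gl R n" by (rule gl_ring)
  show ?thesis
    unfolding bracket_def M.minus_eq
    using tri_mult[OF x y] tri_mult[OF y x] by (intro tri_add tri_minus) (auto simp: add.commute)
qed

lemma bracket_skew:
  assumes x: "x \<in> skew R n" and y: "y \<in> skew R n"
  shows "bracket R n x y \<in> skew R n"
proof -
  interpret M: ring "gl R n" by (rule gl_ring)
  note c = x[THEN skew_carrier] y[THEN skew_carrier]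
  have "adj R (bracket R n x y) = \<ominus>\<^bsub>gl R n\<^esub> bracket R n x y"
    unfolding bracket_def using c
    by (simp add: adj_minus adj_mult skew_adj[OF x] skew_adj[OF y] M.l_minus M.r_minus) algebra
  moreover have "bracket R n x y \<in> tri R n 1"
    using bracket_tri[OF skew_tri[OF x] skew_tri[OF y]] by (rule tri_mono) simp
  ultimately show ?thesis by (simp add: skew_def)
qed

lemma bracket_anti:
  assumes "x \<in> carrier (gl R n)" "y \<in> carrier (gl R n)"
  shows "bracket R n y x = \<ominus>\<^bsub>gl R n\<^esub> bracket R n x y"
proof -
  interpret M: ring "gl R n" by (rule gl_ring)
  show ?thesis unfolding bracket_def using assms by algebra
qed

lemma bracket_add_left:
  assumes "x \<in> carrier (gl R n)" "y \<in> carrier (gl R n)" "z \<in> carrier (gl R n)"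
  shows "bracket R n (x \<oplus>\<^bsub>gl R n\<^esub> y) z = bracket R n x z \<oplus>\<^bsub>gl R n\<^esub> bracket R n y z"
proof -
  interpret M: ring "gl R n" by (rule gl_ring)
  show ?thesis unfolding bracket_def using assms by algebra
qed

lemma bracket_add_right:
  assumes "x \<in> carrier (gl R n)" "y \<in> carrier (gl R n)" "z \<in> carrier (gl R n)"
  shows "bracket R n z (x \<oplus>\<^bsub>gl R n\<^esub> y) = bracket R n z x \<oplus>\<^bsub>gl R n\<^esub> bracket R n z y"
proof -
  interpret M: ring "gl R n" by (rule gl_ring)
  show ?thesis unfolding bracket_def using assms by algebra
qed

lemma bracket_jacobi:
  assumes "x \<in> carrier (gl R n)" "y \<in> carrier (gl R n)" "z \<in> carrier (gl R n)"
  shows "bracket R n (bracket R n x y) z =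
    bracket R n x (bracket R n y z) \<ominus>\<^bsub>gl R n\<^esub> bracket R n y (bracket R n x z)"
proof -
  interpret M: ring "gl R n" by (rule gl_ring)
  show ?thesis unfolding bracket_def using assms by algebra
qed

lemma gl_smult_one_mult:
  assumes "c \<in> carrier R" "x \<in> carrier (gl R n)" "y \<in> carrier (gl R n)"
  shows "(c \<odot>\<^bsub>gl R n\<^esub> x) \<otimes>\<^bsub>gl R n\<^esub> y = c \<odot>\<^bsub>gl R n\<^esub> (x \<otimes>\<^bsub>gl R n\<^esub> y)"
    and "x \<otimes>\<^bsub>gl R n\<^esub> (c \<odot>\<^bsub>gl R n\<^esub> y) = c \<odot>\<^bsub>gl R n\<^esub> (x \<otimes>\<^bsub>gl R n\<^esub> y)"
proof -
  have 1: "\<one> \<odot>\<^bsub>gl R n\<^esub> z = z" if "z \<in> carrier (gl R n)" for z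
    using gl_entry[OF that] by (simp add: gl_sel(5))
  show "(c \<odot>\<^bsub>gl R n\<^esub> x) \<otimes>\<^bsub>gl R n\<^esub> y = c \<odot>\<^bsub>gl R n\<^esub> (x \<otimes>\<^bsub>gl R n\<^esub> y)"
    using gl_smult_mult[OF assms(1) one_closed assms(2,3)] assms by (simp add: 1)
  show "x \<otimes>\<^bsub>gl R n\<^esub> (c \<odot>\<^bsub>gl R n\<^esub> y) = c \<odot>\<^bsub>gl R n\<^esub> (x \<otimes>\<^bsub>gl R n\<^esub> y)"
    using gl_smult_mult[OF one_closed assms(1) assms(2,3)] assms by (simp add: 1)
qed

lemma gl_smult_diff:
  assumes "c \<in> carrier R" "x \<in> carrier (gl R n)" "y \<in> carrier (gl R n)"
  shows "c \<odot>\<^bsub>gl R n\<^esub> (x \<ominus>\<^bsub>gl R n\<^esub> y) = c \<odot>\<^bsub>gl R n\<^esub> x \<ominus>\<^bsub>gl R n\<^esub> c \<odot>\<^bsub>gl R n\<^esub> y"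
  using assms gl_smult_closed[OF assms(1,2)] gl_smult_closed[OF assms(1,3)] gl_entry[OF assms(2)] gl_entry[OF assms(3)]
  by (simp add: gl_diff) (simp add: gl_sel(5) minus_eq r_distr r_minus)

lemma bracket_smult:
  assumes "c \<in> carrier R" "x \<in> carrier (gl R n)" "y \<in> carrier (gl R n)"
  shows "bracket R n (c \<odot>\<^bsub>gl R n\<^esub> x) y = c \<odot>\<^bsub>gl R n\<^esub> bracket R n x y"
    and "bracket R n x (c \<odot>\<^bsub>gl R n\<^esub> y) = c \<odot>\<^bsub>gl R n\<^esub> bracket R n x y"
proof -
  interpret M: ring "gl R n" by (rule gl_ring)
  show "bracket R n (c \<odot>\<^bsub>gl R n\<^esub> x) y = c \<odot>\<^bsub>gl R n\<^esub> bracket R n x y"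
    "bracket R n x (c \<odot>\<^bsub>gl R n\<^esub> y) = c \<odot>\<^bsub>gl R n\<^esub> bracket R n x y"
    unfolding bracket_def using assms by (simp_all add: gl_smult_one_mult gl_smult_diff)
qed

section \<open>Coordinates with respect to the root vectors\<close>

lemma root_coeff_root_vec:
  assumes "\<alpha> \<in> pos_roots n" "\<beta> \<in> pos_roots n"
  shows "root_coeff (root_vec R n \<alpha>) \<beta> = (if \<alpha> = \<beta> then \<one> else \<zero>)"
proof (cases \<alpha>)
  case (Diff i j)
  then have "root_vec R n \<alpha> = (\<lambda>a b. if a = int j \<and> b = int i then \<one>
    else if a = - int i \<and> b = - int j then \<ominus> \<one> else \<zero>)" using root_vec_Diff assms by blast
  then show ?thesis using assms Diff by (cases \<beta>) (auto simp: root_coeff_def pos_roots_def)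
next
  case (Sum i j)
  then have "root_vec R n \<alpha> = (\<lambda>a b. if (a = - int j \<and> b = int i) \<or> (a = - int i \<and> b = int j)
    then \<one> else \<zero>)" using root_vec_Sum assms by blast
  then show ?thesis using assms Sum by (cases \<beta>) (auto simp: root_coeff_def pos_roots_def)
next
  case (Dbl i)
  then show ?thesis using assms root_vec_Dbl[of n i]
    by (cases \<beta>) (auto simp: root_coeff_def pos_roots_def)
qed

text \<open>Inverse to \<open>root_coeff\<close> on \<open>skew R n\<close>, so that linear algebra
  there becomes linear algebra with coefficient functions on the roots.\<close>

definition root_comb :: "nat \<Rightarrow> (root \<Rightarrow> 'a) \<Rightarrow> int \<Rightarrow> int \<Rightarrow> 'a" where
  "root_comb n c = (\<Oplus>\<^bsub>gl R n\<^esub>\<alpha>\<in>pos_roots n. c \<alpha> \<odot>\<^bsub>gl R n\<^esub> root_vec R n \<alpha>)"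

lemma root_comb_skew: "(\<And>\<alpha>. c \<alpha> \<in> carrier R) \<Longrightarrow> root_comb n c \<in> skew R n"
  unfolding root_comb_def by (intro skew_finsum skew_smult root_vec_skew) auto

lemma root_coeff_closed: "x \<in> carrier (gl R n) \<Longrightarrow> root_coeff x \<alpha> \<in> carrier R"
  by (cases \<alpha>) (auto simp: root_coeff_def gl_entry)

lemma root_coeff_comb:
  assumes c: "\<And>\<alpha>. c \<alpha> \<in> carrier R" and \<beta>: "\<beta> \<in> pos_roots n"
  shows "root_coeff (root_comb n c) \<beta> = c \<beta>"
proof -
  obtain a b where ab: "\<And>x :: int \<Rightarrow> int \<Rightarrow> 'a. root_coeff x \<beta> = x a b"
    by (cases \<beta>) (auto simp: root_coeff_def)
  have "root_coeff (root_comb n c) \<beta> = (\<Oplus>\<alpha>\<in>pos_roots n. (c \<alpha> \<odot>\<^bsub>gl R n\<^esub> root_vec R n \<alpha>) a b)"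
    unfolding ab root_comb_def using c skew_carrier[OF root_vec_skew]
    by (intro gl_finsum) (auto intro: gl_smult_closed)
  also have "\<dots> = (\<Oplus>\<alpha>\<in>pos_roots n. if \<beta> = \<alpha> then c \<alpha> else \<zero>)"
    using c root_coeff_root_vec[OF _ \<beta>] unfolding ab by (intro finsum_cong') (auto simp: gl_sel(5))
  also have "\<dots> = c \<beta>" using c \<beta> by (intro finsum_singleton) auto
  finally show ?thesis .
qed

lemma skew_root_comb:
  assumes "x \<in> skew R n"
  shows "root_comb n (root_coeff x) = x"
proof -
  obtain c where c: "c \<in> pos_roots n \<rightarrow> carrier R"
    "x = (\<Oplus>\<^bsub>gl R n\<^esub>\<alpha>\<in>pos_roots n. c \<alpha> \<odot>\<^bsub>gl R n\<^esub> root_vec R n \<alpha>)"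
    using assms unfolding lie_u_eq[symmetric] lie_u_def by blast
  interpret M: ring "gl R n" by (rule gl_ring)
  define c' where "c' \<alpha> = (if \<alpha> \<in> pos_roots n then c \<alpha> else \<zero>)" for \<alpha>
  have c': "c' \<alpha> \<in> carrier R" for \<alpha> using c(1) by (auto simp: c'_def)
  note rv = skew_carrier[OF root_vec_skew]
  have x: "x = root_comb n c'"
    unfolding c(2) root_comb_def using c(1) rv
    by (intro M.finsum_cong') (auto simp: c'_def intro!: gl_smult_closed)
  have "root_coeff x \<alpha> = c' \<alpha>" if "\<alpha> \<in> pos_roots n" for \<alpha>
    unfolding x using c' that by (rule root_coeff_comb)
  then have "root_comb n (root_coeff x) = root_comb n c'"
    unfolding root_comb_def using c' rv by (intro M.finsum_cong') (auto intro!: gl_smult_closed)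
  then show ?thesis unfolding x[symmetric] .
qed

text \<open>Stated for any map that is linear on \<open>skew R n\<close>, because it is applied both
  to a form f and to f composed with the bracket in either argument.\<close>

lemma linear_root_comb:
  assumes cl: "\<And>x. x \<in> skew R n \<Longrightarrow> \<phi> x \<in> carrier R"
    and add: "\<And>x y. x \<in> skew R n \<Longrightarrow> y \<in> skew R n \<Longrightarrow> \<phi> (x \<oplus>\<^bsub>gl R n\<^esub> y) = \<phi> x \<oplus> \<phi> y"
    and sm: "\<And>c x. c \<in> carrier R \<Longrightarrow> x \<in> skew R n \<Longrightarrow> \<phi> (c \<odot>\<^bsub>gl R n\<^esub> x) = c \<otimes> \<phi> x"
    and c: "\<And>\<alpha>. c \<alpha> \<in> carrier R"
  shows "\<phi> (root_comb n c) = (\<Oplus>\<alpha>\<in>pos_roots n. c \<alpha> \<otimes> \<phi> (root_vec R n \<alpha>))"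
proof -
  interpret M: ring "gl R n" by (rule gl_ring)
  have z: "\<phi> \<zero>\<^bsub>gl R n\<^esub> = \<zero>"
    using add[OF skew_zero skew_zero] cl[OF skew_zero] by simp
  have "\<phi> (\<Oplus>\<^bsub>gl R n\<^esub>\<alpha>\<in>A. c \<alpha> \<odot>\<^bsub>gl R n\<^esub> root_vec R n \<alpha>) = (\<Oplus>\<alpha>\<in>A. c \<alpha> \<otimes> \<phi> (root_vec R n \<alpha>))"
    if "finite A" "A \<subseteq> pos_roots n" for A
    using that
  proof (induction A rule: finite_induct)
    case empty
    then show ?case using z by simp
  next
    case (insert \<alpha> A)
    have s: "c \<beta> \<odot>\<^bsub>gl R n\<^esub> root_vec R n \<beta> \<in> skew R n" if "\<beta> \<in> insert \<alpha> A" for \<beta>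
      using that insert.prems c by (intro skew_smult root_vec_skew) auto
    have "(\<Oplus>\<^bsub>gl R n\<^esub>\<beta>\<in>insert \<alpha> A. c \<beta> \<odot>\<^bsub>gl R n\<^esub> root_vec R n \<beta>) =
        c \<alpha> \<odot>\<^bsub>gl R n\<^esub> root_vec R n \<alpha> \<oplus>\<^bsub>gl R n\<^esub> (\<Oplus>\<^bsub>gl R n\<^esub>\<beta>\<in>A. c \<beta> \<odot>\<^bsub>gl R n\<^esub> root_vec R n \<beta>)"
      using insert s[THEN skew_carrier] by (intro M.finsum_insert) auto
    moreover have "(\<Oplus>\<^bsub>gl R n\<^esub>\<beta>\<in>A. c \<beta> \<odot>\<^bsub>gl R n\<^esub> root_vec R n \<beta>) \<in> skew R n"
      using insert s by (intro skew_finsum) auto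
    moreover have "(\<Oplus>\<beta>\<in>insert \<alpha> A. c \<beta> \<otimes> \<phi> (root_vec R n \<beta>)) =
        c \<alpha> \<otimes> \<phi> (root_vec R n \<alpha>) \<oplus> (\<Oplus>\<beta>\<in>A. c \<beta> \<otimes> \<phi> (root_vec R n \<beta>))"
      using insert c cl[OF root_vec_skew] by (intro finsum_insert) auto
    ultimately show ?case using insert s[of \<alpha>] c root_vec_skew[of \<alpha> n] by (simp add: add sm)
  qed
  then show ?thesis unfolding root_comb_def by simp
qed

section \<open>Linear forms and their values on root vectors\<close>

lemma dual_closed: "f \<in> dual_u R n \<Longrightarrow> x \<in> skew R n \<Longrightarrow> f x \<in> carrier R"
  and dual_add: "f \<in> dual_u R n \<Longrightarrow> x \<in> skew R n \<Longrightarrow> y \<in> skew R n \<Longrightarrow>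
    f (x \<oplus>\<^bsub>gl R n\<^esub> y) = f x \<oplus> f y"
  and dual_smult: "f \<in> dual_u R n \<Longrightarrow> c \<in> carrier R \<Longrightarrow> x \<in> skew R n \<Longrightarrow>
    f (c \<odot>\<^bsub>gl R n\<^esub> x) = c \<otimes> f x"
  by (auto simp: dual_u_def lie_u_eq)

lemma dual_zero: "f \<in> dual_u R n \<Longrightarrow> f \<zero>\<^bsub>gl R n\<^esub> = \<zero>"
  using dual_add[OF _ skew_zero skew_zero, of f n] dual_closed[OF _ skew_zero, of f n]
  by (simp add: abelian_monoid.r_zero[OF abelian_group.axioms(1)[OF ring.is_abelian_group[OF gl_ring]]]
    abelian_monoid.zero_closed[OF abelian_group.axioms(1)[OF ring.is_abelian_group[OF gl_ring]]])

lemma dual_uminus: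
  assumes f: "f \<in> dual_u R n" and x: "x \<in> skew R n"
  shows "f (\<ominus>\<^bsub>gl R n\<^esub> x) = \<ominus> f x"
proof -
  interpret M: ring "gl R n" by (rule gl_ring)
  have "f (\<ominus>\<^bsub>gl R n\<^esub> x) \<oplus> f x = f (\<ominus>\<^bsub>gl R n\<^esub> x \<oplus>\<^bsub>gl R n\<^esub> x)"
    by (rule dual_add[symmetric, OF f skew_uminus[OF x] x])
  also have "\<dots> = \<zero>" using dual_zero[OF f] skew_carrier[OF x] by (simp add: M.l_neg)
  finally show ?thesis using dual_closed[OF f x] dual_closed[OF f skew_uminus[OF x]]
    by (simp add: minus_equality)
qed

lemma dual_root_comb:
  assumes f: "f \<in> dual_u R n" and x: "x \<in> skew R n"
  shows "f x = (\<Oplus>\<alpha>\<in>pos_roots n. root_coeff x \<alpha> \<otimes> f (root_vec R n \<alpha>))"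
  using linear_root_comb[of n f "root_coeff x"] skew_root_comb[OF x] dual_closed[OF f] dual_add[OF f]
    dual_smult[OF f] root_coeff_closed[OF skew_carrier[OF x]] by simp

lemma dual_of_root_values:
  assumes h: "h \<in> vecs R (pos_roots n)"
  defines "f \<equiv> \<lambda>x\<in>lie_u R n. \<Oplus>\<alpha>\<in>pos_roots n. root_coeff x \<alpha> \<otimes> h \<alpha>"
  shows "f \<in> dual_u R n" and "\<And>\<alpha>. \<alpha> \<in> pos_roots n \<Longrightarrow> f (root_vec R n \<alpha>) = h \<alpha>"
proof -
  have hc: "h \<alpha> \<in> carrier R" for \<alpha> using h by (rule vecs_closed)
  have rc: "root_coeff x \<alpha> \<in> carrier R" if "x \<in> skew R n" for x \<alpha>
    using root_coeff_closed[OF skew_carrier[OF that]] .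
  have fx: "f x = (\<Oplus>\<alpha>\<in>pos_roots n. root_coeff x \<alpha> \<otimes> h \<alpha>)" if "x \<in> skew R n" for x
    using that by (simp add: f_def lie_u_eq)
  have ra: "root_coeff (x \<oplus>\<^bsub>gl R n\<^esub> y) \<alpha> = root_coeff x \<alpha> \<oplus> root_coeff y \<alpha>" for x y \<alpha>
    by (cases \<alpha>) (auto simp: root_coeff_def gl_sel)
  have rs: "root_coeff (c \<odot>\<^bsub>gl R n\<^esub> y) \<alpha> = c \<otimes> root_coeff y \<alpha>" for c y \<alpha>
    by (cases \<alpha>) (auto simp: root_coeff_def gl_sel)
  have "f (x \<oplus>\<^bsub>gl R n\<^esub> y) = f x \<oplus> f y" if x: "x \<in> skew R n" and y: "y \<in> skew R n" for x y
  proof -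
    have "f (x \<oplus>\<^bsub>gl R n\<^esub> y) = (\<Oplus>\<alpha>\<in>pos_roots n. root_coeff x \<alpha> \<otimes> h \<alpha> \<oplus> root_coeff y \<alpha> \<otimes> h \<alpha>)"
      unfolding fx[OF skew_add[OF x y]] using rc[OF x] rc[OF y] hc
      by (intro finsum_cong') (auto simp: ra l_distr)
    also have "\<dots> = f x \<oplus> f y"
      unfolding fx[OF x] fx[OF y] using rc[OF x] rc[OF y] hc by (intro finsum_addf) auto
    finally show ?thesis .
  qed
  moreover have "f (c \<odot>\<^bsub>gl R n\<^esub> x) = c \<otimes> f x" if c: "c \<in> carrier R" and x: "x \<in> skew R n" for c x
  proof -
    have "f (c \<odot>\<^bsub>gl R n\<^esub> x) = (\<Oplus>\<alpha>\<in>pos_roots n. c \<otimes> (root_coeff x \<alpha> \<otimes> h \<alpha>))"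
      unfolding fx[OF skew_smult[OF c x]] using rc[OF x] c hc
      by (intro finsum_cong') (auto simp: rs m_assoc)
    also have "\<dots> = c \<otimes> f x"
      unfolding fx[OF x] using rc[OF x] c hc by (intro finsum_rdistr[symmetric]) auto
    finally show ?thesis .
  qed
  moreover have "f x \<in> carrier R" if x: "x \<in> skew R n" for x
    unfolding fx[OF x] using rc[OF x] hc by (intro finsum_closed) auto
  moreover have "f \<in> extensional (lie_u R n)" by (simp add: f_def)
  ultimately show "f \<in> dual_u R n" unfolding dual_u_def lie_u_eq by (auto simp: PiE_def)
  show "f (root_vec R n \<alpha>) = h \<alpha>" if \<alpha>: "\<alpha> \<in> pos_roots n" for \<alpha>
  proof -
    have "f (root_vec R n \<alpha>) = (\<Oplus>\<beta>\<in>pos_roots n. if \<alpha> = \<beta> then h \<beta> else \<zero>)"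
      unfolding fx[OF root_vec_skew[OF \<alpha>]] using hc \<alpha> root_coeff_root_vec[OF \<alpha>]
      by (intro finsum_cong') auto
    also have "\<dots> = h \<alpha>" using hc \<alpha> by (intro finsum_singleton) auto
    finally show ?thesis .
  qed
qed

lemma dual_bij:
  "bij_betw (\<lambda>f \<alpha>. if \<alpha> \<in> pos_roots n then f (root_vec R n \<alpha>) else \<zero>) (dual_u R n) (vecs R (pos_roots n))"
proof (rule bij_betw_byWitness[where f' = "\<lambda>h. \<lambda>x\<in>lie_u R n. \<Oplus>\<alpha>\<in>pos_roots n. root_coeff x \<alpha> \<otimes> h \<alpha>"])
  let ?v = "\<lambda>f \<alpha>. if \<alpha> \<in> pos_roots n then f (root_vec R n \<alpha>) else \<zero>"
  let ?d = "\<lambda>h. \<lambda>x\<in>lie_u R n. \<Oplus>\<alpha>\<in>pos_roots n. root_coeff x \<alpha> \<otimes> h \<alpha>"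
  have v: "?v f \<in> vecs R (pos_roots n)" if "f \<in> dual_u R n" for f
    using dual_closed[OF that root_vec_skew] by (auto simp: vecs_def)
  then show "?v ` dual_u R n \<subseteq> vecs R (pos_roots n)" by blast
  show "\<forall>f\<in>dual_u R n. ?d (?v f) = f"
  proof (intro ballI ext)
    fix f x assume f: "f \<in> dual_u R n"
    show "?d (?v f) x = f x"
    proof (cases "x \<in> skew R n")
      case x: True
      have "(\<Oplus>\<alpha>\<in>pos_roots n. root_coeff x \<alpha> \<otimes> ?v f \<alpha>) =
          (\<Oplus>\<alpha>\<in>pos_roots n. root_coeff x \<alpha> \<otimes> f (root_vec R n \<alpha>))"
        using root_coeff_closed[OF skew_carrier[OF x]] dual_closed[OF f root_vec_skew]
        by (intro finsum_cong') auto
      then show ?thesis using dual_root_comb[OF f x] x by (simp add: lie_u_eq)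
    next
      case False
      moreover have "f \<in> extensional (lie_u R n)" using f by (auto simp: dual_u_def PiE_def)
      ultimately show ?thesis by (simp add: lie_u_eq extensional_def)
    qed
  qed
  show "\<forall>h\<in>vecs R (pos_roots n). ?v (?d h) = h"
    using dual_of_root_values(2) vecs_off by (fastforce simp: fun_eq_iff)
  show "?d ` vecs R (pos_roots n) \<subseteq> dual_u R n"
    using dual_of_root_values(1) by blast
qed

subsection \<open>The Gram matrix of a linear form\<close>

definition gram :: "nat \<Rightarrow> ((int \<Rightarrow> int \<Rightarrow> 'a) \<Rightarrow> 'a) \<Rightarrow> root \<Rightarrow> root \<Rightarrow> 'a" where
  "gram n f \<alpha> \<beta> = f (bracket R n (root_vec R n \<alpha>) (root_vec R n \<beta>))"

text \<open>The symmetrised elementary matrices spanning the abelian ideal. For \<open>i = a\<close>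
  this is twice the root vector; this normalisation makes the bracket formulas uniform, without a
  separate case for long roots.\<close>

definition sym_mat :: "nat \<Rightarrow> nat \<Rightarrow> nat \<Rightarrow> int \<Rightarrow> int \<Rightarrow> 'a" where
  "sym_mat n i a = elem_mat R (- int i) (int a) \<oplus>\<^bsub>gl R n\<^esub> elem_mat R (- int a) (int i)"

text \<open>For \<open>i = a\<close> the value is \<open>2 f(e\<^bsub>2\<epsilon>\<^sub>i\<^esub>)\<close>.\<close>
definition sym_part :: "nat \<Rightarrow> ((int \<Rightarrow> int \<Rightarrow> 'a) \<Rightarrow> 'a) \<Rightarrow> nat \<Rightarrow> nat \<Rightarrow> 'a" where
  "sym_part n f i a = (if i \<in> {1..n} \<and> a \<in> {1..n} then f (sym_mat n i a) else \<zero>)"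

lemma elem_mat_mult:
  assumes "a \<in> idx n" "b \<in> idx n" "c \<in> idx n" "d \<in> idx n"
  shows "elem_mat R a b \<otimes>\<^bsub>gl R n\<^esub> elem_mat R c d = (if b = c then elem_mat R a d else \<zero>\<^bsub>gl R n\<^esub>)"
proof (intro ext)
  fix i j
  have "(elem_mat R a b \<otimes>\<^bsub>gl R n\<^esub> elem_mat R c d) i j =
      (\<Oplus>k\<in>idx n. if b = k then (if i = a \<and> b = c \<and> j = d then \<one> else \<zero>) else \<zero>)"
    unfolding gl_sel(4) by (intro finsum_cong') (auto simp: elem_mat_def)
  also have "\<dots> = (if i = a \<and> b = c \<and> j = d then \<one> else \<zero>)"
    using assms by (intro finsum_singleton) auto
  finally show "(elem_mat R a b \<otimes>\<^bsub>gl R n\<^esub> elem_mat R c d) i j =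
      (if b = c then elem_mat R a d else \<zero>\<^bsub>gl R n\<^esub>) i j"
    by (auto simp: elem_mat_def gl_sel(1))
qed

lemma sym_mat_skew:
  assumes "i \<in> {1..n}" "a \<in> {1..n}"
  shows "sym_mat n i a \<in> skew R n"
    and "i < a \<Longrightarrow> sym_mat n i a = root_vec R n (Sum i a)"
    and "sym_mat n i i = root_vec R n (Dbl i) \<oplus>\<^bsub>gl R n\<^esub> root_vec R n (Dbl i)"
    and "sym_mat n i a = sym_mat n a i"
proof -
  interpret M: ring "gl R n" by (rule gl_ring)
  have id: "int i \<in> idx n" "- int i \<in> idx n" "int a \<in> idx n" "- int a \<in> idx n"
    using assms by (auto simp: idx_def)
  note c = elem_mat_closed[OF id(2,3)] elem_mat_closed[OF id(4,1)]
  show s: "sym_mat n i a = sym_mat n a i" using c by (simp add: sym_mat_def M.a_comm)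
  show 1: "i < a \<Longrightarrow> sym_mat n i a = root_vec R n (Sum i a)"
    using c by (simp add: sym_mat_def M.a_comm)
  have 2: "a < i \<Longrightarrow> sym_mat n i a = root_vec R n (Sum a i)"
    using c by (simp add: sym_mat_def M.a_comm)
  show 3: "sym_mat n i i = root_vec R n (Dbl i) \<oplus>\<^bsub>gl R n\<^esub> root_vec R n (Dbl i)"
    by (simp add: sym_mat_def)
  consider "i < a" | "a < i" | "a = i" by linarith
  then show "sym_mat n i a \<in> skew R n"
  proof cases
    case 1
    then show ?thesis using \<open>i < a \<Longrightarrow> _\<close> root_vec_skew[of "Sum i a" n] assms by (simp del: root_vec.simps add: pos_roots_def)
  next
    case 2
    then show ?thesis using \<open>a < i \<Longrightarrow> _\<close> root_vec_skew[of "Sum a i" n] assms by (simp del: root_vec.simps add: pos_roots_def)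
  next
    case 3
    then show ?thesis using \<open>sym_mat n i i = _\<close> root_vec_skew[of "Dbl i" n] assms
      by (simp del: root_vec.simps add: pos_roots_def skew_add)
  qed
qed

lemma sym_part_symm: "f \<in> dual_u R n \<Longrightarrow> sym_part n f \<in> symm R {1..n}"
  using dual_closed[of f n] sym_mat_skew by (auto simp: symm_def sym_part_def)

text \<open>Adding \<epsilon>_i - \<epsilon>_j to \<epsilon>_a + \<epsilon>_b gives a root only if j
  is a or b, in which case i takes its place. If i is also the other index, the result belongs to
  the long root with coefficient 2, as \<open>sym_mat n i i\<close> provides.\<close>

lemma bracket_diff_sum:
  assumes D: "Diff i j \<in> pos_roots n" and S: "Sum a b \<in> pos_roots n"
  shows "bracket R n (root_vec R n (Diff i j)) (root_vec R n (Sum a b)) =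
    \<ominus>\<^bsub>gl R n\<^esub> ((if j = b then sym_mat n i a else \<zero>\<^bsub>gl R n\<^esub>) \<oplus>\<^bsub>gl R n\<^esub>
      (if j = a then sym_mat n i b else \<zero>\<^bsub>gl R n\<^esub>))"
proof -
  interpret M: ring "gl R n" by (rule gl_ring)
  have id: "int i \<in> idx n" "- int i \<in> idx n" "int j \<in> idx n" "- int j \<in> idx n"
      "int a \<in> idx n" "- int a \<in> idx n" "int b \<in> idx n" "- int b \<in> idx n"
    and pos: "i > 0" "j > 0" "a > 0" "b > 0"
    using D S by (auto simp: idx_def pos_roots_def)
  define E1 E2 F1 F2 where "E1 = elem_mat R (int j) (int i)" and "E2 = elem_mat R (- int i) (- int j)"
    and "F1 = elem_mat R (- int b) (int a)" and "F2 = elem_mat R (- int a) (int b)"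
  note d = E1_def E2_def F1_def F2_def
  have c: "E1 \<in> carrier (gl R n)" "E2 \<in> carrier (gl R n)" "F1 \<in> carrier (gl R n)" "F2 \<in> carrier (gl R n)"
    unfolding d using id by (auto intro: elem_mat_closed)
  have z: "E1 \<otimes>\<^bsub>gl R n\<^esub> F1 = \<zero>\<^bsub>gl R n\<^esub>" "E1 \<otimes>\<^bsub>gl R n\<^esub> F2 = \<zero>\<^bsub>gl R n\<^esub>"
    "F1 \<otimes>\<^bsub>gl R n\<^esub> E2 = \<zero>\<^bsub>gl R n\<^esub>" "F2 \<otimes>\<^bsub>gl R n\<^esub> E2 = \<zero>\<^bsub>gl R n\<^esub>"
    unfolding d using id pos by (auto simp: elem_mat_mult)
  have p: "E2 \<otimes>\<^bsub>gl R n\<^esub> F1 = (if j = b then elem_mat R (- int i) (int a) else \<zero>\<^bsub>gl R n\<^esub>)"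
    "E2 \<otimes>\<^bsub>gl R n\<^esub> F2 = (if j = a then elem_mat R (- int i) (int b) else \<zero>\<^bsub>gl R n\<^esub>)"
    "F1 \<otimes>\<^bsub>gl R n\<^esub> E1 = (if j = a then elem_mat R (- int b) (int i) else \<zero>\<^bsub>gl R n\<^esub>)"
    "F2 \<otimes>\<^bsub>gl R n\<^esub> E1 = (if j = b then elem_mat R (- int a) (int i) else \<zero>\<^bsub>gl R n\<^esub>)"
    unfolding d using id pos by (auto simp: elem_mat_mult)
  have "(E1 \<ominus>\<^bsub>gl R n\<^esub> E2) \<otimes>\<^bsub>gl R n\<^esub> (F1 \<oplus>\<^bsub>gl R n\<^esub> F2) \<ominus>\<^bsub>gl R n\<^esub> (F1 \<oplus>\<^bsub>gl R n\<^esub> F2) \<otimes>\<^bsub>gl R n\<^esub> (E1 \<ominus>\<^bsub>gl R n\<^esub> E2) =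
    E1 \<otimes>\<^bsub>gl R n\<^esub> F1 \<oplus>\<^bsub>gl R n\<^esub> E1 \<otimes>\<^bsub>gl R n\<^esub> F2 \<oplus>\<^bsub>gl R n\<^esub> F1 \<otimes>\<^bsub>gl R n\<^esub> E2 \<oplus>\<^bsub>gl R n\<^esub> F2 \<otimes>\<^bsub>gl R n\<^esub> E2 \<ominus>\<^bsub>gl R n\<^esub>
    ((E2 \<otimes>\<^bsub>gl R n\<^esub> F1 \<oplus>\<^bsub>gl R n\<^esub> F2 \<otimes>\<^bsub>gl R n\<^esub> E1) \<oplus>\<^bsub>gl R n\<^esub> (E2 \<otimes>\<^bsub>gl R n\<^esub> F2 \<oplus>\<^bsub>gl R n\<^esub> F1 \<otimes>\<^bsub>gl R n\<^esub> E1))"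
    using c by algebra
  moreover have "root_vec R n (Diff i j) = E1 \<ominus>\<^bsub>gl R n\<^esub> E2" "root_vec R n (Sum a b) = F1 \<oplus>\<^bsub>gl R n\<^esub> F2"
    by (simp_all add: d)
  ultimately have "bracket R n (root_vec R n (Diff i j)) (root_vec R n (Sum a b)) =
      \<zero>\<^bsub>gl R n\<^esub> \<ominus>\<^bsub>gl R n\<^esub> ((E2 \<otimes>\<^bsub>gl R n\<^esub> F1 \<oplus>\<^bsub>gl R n\<^esub> F2 \<otimes>\<^bsub>gl R n\<^esub> E1) \<oplus>\<^bsub>gl R n\<^esub> (E2 \<otimes>\<^bsub>gl R n\<^esub> F2 \<oplus>\<^bsub>gl R n\<^esub> F1 \<otimes>\<^bsub>gl R n\<^esub> E1))"
    unfolding bracket_def z by simp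
  moreover have "E2 \<otimes>\<^bsub>gl R n\<^esub> F1 \<oplus>\<^bsub>gl R n\<^esub> F2 \<otimes>\<^bsub>gl R n\<^esub> E1 = (if j = b then sym_mat n i a else \<zero>\<^bsub>gl R n\<^esub>)"
    "E2 \<otimes>\<^bsub>gl R n\<^esub> F2 \<oplus>\<^bsub>gl R n\<^esub> F1 \<otimes>\<^bsub>gl R n\<^esub> E1 = (if j = a then sym_mat n i b else \<zero>\<^bsub>gl R n\<^esub>)"
    unfolding p by (auto simp: sym_mat_def)
  moreover have "\<zero>\<^bsub>gl R n\<^esub> \<ominus>\<^bsub>gl R n\<^esub> x = \<ominus>\<^bsub>gl R n\<^esub> x" if "x \<in> carrier (gl R n)" for x
    using that by algebra
  moreover have "E2 \<otimes>\<^bsub>gl R n\<^esub> F1 \<oplus>\<^bsub>gl R n\<^esub> F2 \<otimes>\<^bsub>gl R n\<^esub> E1 \<oplus>\<^bsub>gl R n\<^esub> (E2 \<otimes>\<^bsub>gl R n\<^esub> F2 \<oplus>\<^bsub>gl R n\<^esub> F1 \<otimes>\<^bsub>gl R n\<^esub> E1) \<in> carrier (gl R n)"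
    using c by simp
  ultimately show ?thesis by simp
qed

lemma bracket_diff_dbl:
  assumes D: "Diff i j \<in> pos_roots n" and S: "Dbl a \<in> pos_roots n"
  shows "bracket R n (root_vec R n (Diff i j)) (root_vec R n (Dbl a)) =
    \<ominus>\<^bsub>gl R n\<^esub> (if j = a then sym_mat n i a else \<zero>\<^bsub>gl R n\<^esub>)"
proof -
  interpret M: ring "gl R n" by (rule gl_ring)
  have id: "int i \<in> idx n" "- int i \<in> idx n" "int j \<in> idx n" "- int j \<in> idx n"
      "int a \<in> idx n" "- int a \<in> idx n"
    and pos: "i > 0" "j > 0" "a > 0"
    using D S by (auto simp: idx_def pos_roots_def)
  define E1 E2 F where "E1 = elem_mat R (int j) (int i)" and "E2 = elem_mat R (- int i) (- int j)"
    and "F = elem_mat R (- int a) (int a)"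
  note d = E1_def E2_def F_def
  have c: "E1 \<in> carrier (gl R n)" "E2 \<in> carrier (gl R n)" "F \<in> carrier (gl R n)"
    unfolding d using id by (auto intro: elem_mat_closed)
  have z: "E1 \<otimes>\<^bsub>gl R n\<^esub> F = \<zero>\<^bsub>gl R n\<^esub>" "F \<otimes>\<^bsub>gl R n\<^esub> E2 = \<zero>\<^bsub>gl R n\<^esub>"
    unfolding d using id pos by (auto simp: elem_mat_mult)
  have p: "E2 \<otimes>\<^bsub>gl R n\<^esub> F = (if j = a then elem_mat R (- int i) (int a) else \<zero>\<^bsub>gl R n\<^esub>)"
    "F \<otimes>\<^bsub>gl R n\<^esub> E1 = (if j = a then elem_mat R (- int a) (int i) else \<zero>\<^bsub>gl R n\<^esub>)"
    unfolding d using id pos by (auto simp: elem_mat_mult)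
  have "(E1 \<ominus>\<^bsub>gl R n\<^esub> E2) \<otimes>\<^bsub>gl R n\<^esub> F \<ominus>\<^bsub>gl R n\<^esub> F \<otimes>\<^bsub>gl R n\<^esub> (E1 \<ominus>\<^bsub>gl R n\<^esub> E2) =
    E1 \<otimes>\<^bsub>gl R n\<^esub> F \<oplus>\<^bsub>gl R n\<^esub> F \<otimes>\<^bsub>gl R n\<^esub> E2 \<ominus>\<^bsub>gl R n\<^esub> (E2 \<otimes>\<^bsub>gl R n\<^esub> F \<oplus>\<^bsub>gl R n\<^esub> F \<otimes>\<^bsub>gl R n\<^esub> E1)"
    using c by algebra
  moreover have "root_vec R n (Diff i j) = E1 \<ominus>\<^bsub>gl R n\<^esub> E2" "root_vec R n (Dbl a) = F"
    by (simp_all add: d)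
  ultimately have "bracket R n (root_vec R n (Diff i j)) (root_vec R n (Dbl a)) =
      \<zero>\<^bsub>gl R n\<^esub> \<ominus>\<^bsub>gl R n\<^esub> (E2 \<otimes>\<^bsub>gl R n\<^esub> F \<oplus>\<^bsub>gl R n\<^esub> F \<otimes>\<^bsub>gl R n\<^esub> E1)"
    unfolding bracket_def z by simp
  moreover have "E2 \<otimes>\<^bsub>gl R n\<^esub> F \<oplus>\<^bsub>gl R n\<^esub> F \<otimes>\<^bsub>gl R n\<^esub> E1 = (if j = a then sym_mat n i a else \<zero>\<^bsub>gl R n\<^esub>)"
    unfolding p by (auto simp: sym_mat_def)
  moreover have "\<zero>\<^bsub>gl R n\<^esub> \<ominus>\<^bsub>gl R n\<^esub> x = \<ominus>\<^bsub>gl R n\<^esub> x" if "x \<in> carrier (gl R n)" for x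
    using that by algebra
  moreover have "E2 \<otimes>\<^bsub>gl R n\<^esub> F \<oplus>\<^bsub>gl R n\<^esub> F \<otimes>\<^bsub>gl R n\<^esub> E1 \<in> carrier (gl R n)" using c by simp
  ultimately show ?thesis by simp
qed

text \<open>The subalgebra spanned by the \<open>e\<^bsub>\<epsilon>\<^sub>i - \<epsilon>\<^sub>j\<^esub>\<close> and the abelian ideal spanned
  by the other root vectors.\<close>

definition levi :: "nat \<Rightarrow> (int \<Rightarrow> int \<Rightarrow> 'a) set" where
  "levi n = {x \<in> skew R n. \<forall>a b. a < 0 \<and> b > 0 \<longrightarrow> x a b = \<zero>}"

definition rad :: "nat \<Rightarrow> (int \<Rightarrow> int \<Rightarrow> 'a) set" where
  "rad n = {x \<in> skew R n. \<forall>a b. \<not> (a < 0 \<and> b > 0) \<longrightarrow> x a b = \<zero>}"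

lemma levi_skew: "x \<in> levi n \<Longrightarrow> x \<in> skew R n" and rad_skew: "x \<in> rad n \<Longrightarrow> x \<in> skew R n"
  by (auto simp: levi_def rad_def)

lemma root_vec_levi: "\<alpha> \<in> diff_roots n \<Longrightarrow> root_vec R n \<alpha> \<in> levi n"
  using root_vec_skew[of \<alpha> n] root_vec_Diff
  by (auto simp: levi_def diff_roots_def pos_roots_split simp del: root_vec.simps)

lemma root_vec_rad: "\<alpha> \<in> sum_roots n \<Longrightarrow> root_vec R n \<alpha> \<in> rad n"
  using root_vec_skew[of \<alpha> n] root_vec_Sum[of _ _ n] root_vec_Dbl[of n]
  by (auto simp: rad_def sum_roots_def pos_roots_split simp del: root_vec.simps)

lemma bracket_entry:
  assumes "x \<in> carrier (gl R n)" "y \<in> carrier (gl R n)"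
  shows "bracket R n x y a b = (\<Oplus>c\<in>idx n. x a c \<otimes> y c b) \<ominus> (\<Oplus>c\<in>idx n. y a c \<otimes> x c b)"
proof -
  interpret M: ring "gl R n" by (rule gl_ring)
  show ?thesis unfolding bracket_def using assms by (simp add: gl_diff) (simp add: gl_sel(4))
qed

lemma bracket_entry_zero:
  assumes "x \<in> carrier (gl R n)" "y \<in> carrier (gl R n)"
    and "\<And>c. c \<in> idx n \<Longrightarrow> x a c \<otimes> y c b = \<zero>" "\<And>c. c \<in> idx n \<Longrightarrow> y a c \<otimes> x c b = \<zero>"
  shows "bracket R n x y a b = \<zero>"
proof -
  have "(\<Oplus>c\<in>idx n. x a c \<otimes> y c b) = \<zero>" "(\<Oplus>c\<in>idx n. y a c \<otimes> x c b) = \<zero>"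
    using assms(3,4) by (auto intro: add.finprod_one_eqI)
  then show ?thesis using bracket_entry[OF assms(1,2)] by (simp add: minus_eq)
qed

text \<open>All positive indices precede all negative ones, so strict lower triangularity clears the
  whole upper right block. Consequently \<open>levi n\<close> is the block diagonal part and
  \<open>rad n\<close> the lower left block, which is what the bracket relations between them rest
  on.\<close>

lemma skew_upper_zero:
  assumes "x \<in> skew R n" "a > 0" "b < 0"
  shows "x a b = \<zero>"
proof (cases "a \<in> idx n \<and> b \<in> idx n")
  case True
  then have "pos n a < pos n b + int 1" using assms(2,3) by (auto simp: idx_def pos_def)
  then show ?thesis using True skew_tri[OF assms(1)] by (simp add: tri_def)
next
  case False
  then show ?thesis using gl_off[OF skew_carrier[OF assms(1)]] by blast
qed

lemma bracket_levi:
  assumes x: "x \<in> levi n" and y: "y \<in> levi n"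
  shows "bracket R n x y \<in> levi n"
proof -
  note c = x[THEN levi_skew, THEN skew_carrier] y[THEN levi_skew, THEN skew_carrier]
  have "bracket R n x y a b = \<zero>" if "a < 0" "b > 0" for a b
  proof (rule bracket_entry_zero[OF c])
    fix k assume "k \<in> idx n"
    then have "k > 0 \<or> k < 0" using idx_not_0[of k n] by linarith
    then show "x a k \<otimes> y k b = \<zero>" "y a k \<otimes> x k b = \<zero>"
      using x y that c[THEN gl_entry] by (auto simp: levi_def)
  qed
  then show ?thesis using bracket_skew[OF x[THEN levi_skew] y[THEN levi_skew]] by (simp add: levi_def)
qed

lemma bracket_levi_rad:
  assumes x: "x \<in> levi n" and y: "y \<in> rad n"
  shows "bracket R n x y \<in> rad n"
proof -
  note s = levi_skew[OF x] rad_skew[OF y]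
  note c = s[THEN skew_carrier]
  have "bracket R n x y a b = \<zero>" if "\<not> (a < 0 \<and> b > 0)" for a b
  proof (rule bracket_entry_zero[OF c])
    fix k assume "k \<in> idx n"
    then have k: "k > 0 \<or> k < 0" using idx_not_0[of k n] by linarith
    show "x a k \<otimes> y k b = \<zero>"
    proof (cases "k < 0 \<and> b > 0")
      case True
      then have "a \<ge> 0" using that by auto
      then have "x a k = \<zero>"
        using True skew_upper_zero[OF s(1), of a k] gl_off[OF c(1), of a k] idx_not_0[of a n] by (cases "a = 0") auto
      then show ?thesis using c[THEN gl_entry] by simp
    next
      case False
      then show ?thesis using y c[THEN gl_entry] by (auto simp: rad_def)
    qed
    show "y a k \<otimes> x k b = \<zero>"
    proof (cases "a < 0 \<and> k > 0")
      case True
      then have "b \<le> 0" using that by auto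
      then have "x k b = \<zero>"
        using True skew_upper_zero[OF s(1), of k b] gl_off[OF c(1), of k b] idx_not_0[of b n] by (cases "b = 0") auto
      then show ?thesis using c[THEN gl_entry] by simp
    next
      case False
      then show ?thesis using y c[THEN gl_entry] by (auto simp: rad_def)
    qed
  qed
  then show ?thesis using bracket_skew[OF s] by (simp add: rad_def)
qed

text \<open>Already the products of two lower left blocks vanish: the inner index would have to be
  positive and negative at once.\<close>

lemma bracket_rad:
  assumes x: "x \<in> rad n" and y: "y \<in> rad n"
  shows "bracket R n x y = \<zero>\<^bsub>gl R n\<^esub>"
proof (intro ext)
  fix a b
  note c = x[THEN rad_skew, THEN skew_carrier] y[THEN rad_skew, THEN skew_carrier]
  have "bracket R n x y a b = \<zero>"
  proof (rule bracket_entry_zero[OF c])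
    fix k
    show "x a k \<otimes> y k b = \<zero>" "y a k \<otimes> x k b = \<zero>"
      using x y c[THEN gl_entry] by (cases "k < 0"; simp add: rad_def)+
  qed
  then show "bracket R n x y a b = \<zero>\<^bsub>gl R n\<^esub> a b" by (simp add: gl_sel)
qed

section \<open>The blocks of the Gram matrix\<close>

lemma gram_closed:
  assumes "f \<in> dual_u R n" "\<alpha> \<in> pos_roots n" "\<beta> \<in> pos_roots n"
  shows "gram n f \<alpha> \<beta> \<in> carrier R"
  unfolding gram_def by (rule dual_closed[OF assms(1) bracket_skew]) (use assms root_vec_skew in auto)

lemma gram_anti:
  assumes "f \<in> dual_u R n" "\<alpha> \<in> pos_roots n" "\<beta> \<in> pos_roots n"
  shows "gram n f \<beta> \<alpha> = \<ominus> gram n f \<alpha> \<beta>"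
  unfolding gram_def using assms root_vec_skew[of _ n]
  by (simp add: bracket_anti[of "root_vec R n \<alpha>" n "root_vec R n \<beta>"] skew_carrier dual_uminus bracket_skew)

lemma gram_sum_sum:
  assumes "f \<in> dual_u R n" "\<alpha> \<in> sum_roots n" "\<beta> \<in> sum_roots n"
  shows "gram n f \<alpha> \<beta> = \<zero>"
  unfolding gram_def using assms by (simp add: bracket_rad root_vec_rad dual_zero)

lemma gram_diff_sum:
  assumes f: "f \<in> dual_u R n" and D: "Diff i j \<in> pos_roots n" and S: "Sum a b \<in> pos_roots n"
  shows "gram n f (Diff i j) (Sum a b) =
    \<ominus> ((if j = b then sym_part n f i a else \<zero>) \<oplus> (if j = a then sym_part n f i b else \<zero>))"
proof -
  have r: "i \<in> {1..n}" "a \<in> {1..n}" "b \<in> {1..n}" using D S by (auto simp: pos_roots_def)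
  have s: "(if j = b then sym_mat n i a else \<zero>\<^bsub>gl R n\<^esub>) \<in> skew R n"
    "(if j = a then sym_mat n i b else \<zero>\<^bsub>gl R n\<^esub>) \<in> skew R n"
    using sym_mat_skew(1) r skew_zero by auto
  show ?thesis
    unfolding gram_def bracket_diff_sum[OF D S] dual_uminus[OF f skew_add[OF s]] dual_add[OF f s]
    using r dual_zero[OF f] by (auto simp: sym_part_def)
qed

lemma gram_diff_dbl:
  assumes f: "f \<in> dual_u R n" and D: "Diff i j \<in> pos_roots n" and S: "Dbl a \<in> pos_roots n"
  shows "gram n f (Diff i j) (Dbl a) = \<ominus> (if j = a then sym_part n f i a else \<zero>)"
proof -
  have r: "i \<in> {1..n}" "a \<in> {1..n}" using D S by (auto simp: pos_roots_def)
  have s: "(if j = a then sym_mat n i a else \<zero>\<^bsub>gl R n\<^esub>) \<in> skew R n"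
    using sym_mat_skew(1) r skew_zero by auto
  show ?thesis
    unfolding gram_def bracket_diff_dbl[OF D S] dual_uminus[OF f s]
    using r dual_zero[OF f] by (auto simp: sym_part_def)
qed

text \<open>Read the coefficient of \<open>Diff i j\<close> as the entry x_ji of a strictly lower
  triangular x. Pairing with \<open>Sum a b\<close> then gives, up to sign, the entry (a, b) of x
  \<sigma> + (x \<sigma>)^T, whereas pairing with \<open>Dbl a\<close> gives only (x \<sigma>)_aa,
  half of the diagonal entry. The two systems are equivalent since 2 is invertible.\<close>

lemma card_lker_stab:
  assumes f: "f \<in> dual_u R n" and two: "\<one> \<oplus> \<one> \<noteq> \<zero>"
  shows "card (lker R (diff_roots n) (sum_roots n) (gram n f)) = card (stab R {1..n} (sym_part n f))"
proof -
  let ?N = "diff_roots n" and ?S = "sum_roots n" and ?I = "{1..n}"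
  define \<sigma> where "\<sigma> = sym_part n f"
  have \<sigma>: "\<sigma> \<in> symm R ?I" unfolding \<sigma>_def using f by (rule sym_part_symm)
  have sc: "\<sigma> i j \<in> carrier R" for i j using \<sigma> by (rule symm_closed)
  define low where "low c j i = (if 1 \<le> i \<and> i < j \<and> j \<le> n then c (Diff i j) else \<zero>)" for c :: "root \<Rightarrow> 'a" and j i
  define g where "g b a \<alpha> = (case \<alpha> of Diff i j \<Rightarrow> if j = b then \<sigma> i a else \<zero> | _ \<Rightarrow> \<zero>)" for b a \<alpha>
  have gc: "g b a \<alpha> \<in> carrier R" for b a \<alpha> using sc by (cases \<alpha>) (auto simp: g_def)
  have row: "(\<Oplus>\<alpha>\<in>?N. c \<alpha> \<otimes> g b a \<alpha>) = row_mult R ?I (low c b) \<sigma> a"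
    if c: "\<And>\<alpha>. c \<alpha> \<in> carrier R" and b: "b \<in> ?I" for c b a
  proof -
    have "(\<Oplus>\<alpha>\<in>?N. c \<alpha> \<otimes> g b a \<alpha>) = (\<Oplus>\<alpha>\<in>(\<lambda>i. Diff i b) ` {1..<b}. c \<alpha> \<otimes> g b a \<alpha>)"
    proof (rule finsum_mono_neutral)
      show "(\<lambda>i. Diff i b) ` {1..<b} \<subseteq> ?N" using b by (auto simp: diff_roots_def)
      show "c \<alpha> \<otimes> g b a \<alpha> = \<zero>" if "\<alpha> \<in> ?N - (\<lambda>i. Diff i b) ` {1..<b}" for \<alpha>
        using that c by (auto simp: diff_roots_def g_def)
    qed (use c gc in auto)
    also have "\<dots> = (\<Oplus>i\<in>{1..<b}. c (Diff i b) \<otimes> g b a (Diff i b))"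
      using c gc by (subst finsum_reindex) (auto simp: inj_on_def)
    also have "\<dots> = (\<Oplus>i\<in>{1..<b}. low c b i \<otimes> \<sigma> i a)"
      using c sc b by (intro finsum_cong') (auto simp: low_def g_def)
    also have "\<dots> = row_mult R ?I (low c b) \<sigma> a"
      unfolding row_mult_def using c sc b
      by (intro finsum_mono_neutral[symmetric]) (auto simp: low_def)
    finally show ?thesis .
  qed
  have lc: "low c j i \<in> carrier R" if "\<And>\<alpha>. c \<alpha> \<in> carrier R" for c j i using that by (simp add: low_def)
  have rc: "row_mult R ?I (low c j) \<sigma> k \<in> carrier R" if "\<And>\<alpha>. c \<alpha> \<in> carrier R" for c j k
    using lc[of c, OF that] sc by (intro row_mult_closed)
  have neg: "(\<Oplus>\<alpha>\<in>?N. c \<alpha> \<otimes> \<ominus> h \<alpha>) = \<ominus> (\<Oplus>\<alpha>\<in>?N. c \<alpha> \<otimes> h \<alpha>)"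
    if "\<And>\<alpha>. c \<alpha> \<in> carrier R" "\<And>\<alpha>. h \<alpha> \<in> carrier R" for c h
  proof -
    have "(\<Oplus>\<alpha>\<in>?N. c \<alpha> \<otimes> \<ominus> h \<alpha>) = (\<Oplus>\<alpha>\<in>?N. \<ominus> \<one> \<otimes> (c \<alpha> \<otimes> h \<alpha>))"
      using that by (intro finsum_cong') (auto simp: r_minus l_minus)
    also have "\<dots> = \<ominus> \<one> \<otimes> (\<Oplus>\<alpha>\<in>?N. c \<alpha> \<otimes> h \<alpha>)"
      using that by (intro finsum_rdistr[symmetric]) auto
    finally show ?thesis using that by (simp add: l_minus finsum_closed)
  qed
  have gS: "(\<Oplus>\<alpha>\<in>?N. c \<alpha> \<otimes> gram n f \<alpha> (Sum a b)) =
      \<ominus> (row_mult R ?I (low c b) \<sigma> a \<oplus> row_mult R ?I (low c a) \<sigma> b)"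
    if c: "\<And>\<alpha>. c \<alpha> \<in> carrier R" and ab: "Sum a b \<in> ?S" for c a b
  proof -
    have ab': "a \<in> ?I" "b \<in> ?I" "Sum a b \<in> pos_roots n"
      using ab by (auto simp: sum_roots_def pos_roots_def)
    have "(\<Oplus>\<alpha>\<in>?N. c \<alpha> \<otimes> gram n f \<alpha> (Sum a b)) = (\<Oplus>\<alpha>\<in>?N. c \<alpha> \<otimes> \<ominus> (g b a \<alpha> \<oplus> g a b \<alpha>))"
      using c gc gram_diff_sum[OF f _ ab'(3)] ab'
      by (intro finsum_cong') (auto simp: diff_roots_def pos_roots_def g_def \<sigma>_def)
    also have "\<dots> = \<ominus> (\<Oplus>\<alpha>\<in>?N. c \<alpha> \<otimes> (g b a \<alpha> \<oplus> g a b \<alpha>))" using c gc by (intro neg) auto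
    also have "(\<Oplus>\<alpha>\<in>?N. c \<alpha> \<otimes> (g b a \<alpha> \<oplus> g a b \<alpha>)) = (\<Oplus>\<alpha>\<in>?N. c \<alpha> \<otimes> g b a \<alpha> \<oplus> c \<alpha> \<otimes> g a b \<alpha>)"
      using c gc by (intro finsum_cong') (auto simp: r_distr)
    also have "\<dots> = (\<Oplus>\<alpha>\<in>?N. c \<alpha> \<otimes> g b a \<alpha>) \<oplus> (\<Oplus>\<alpha>\<in>?N. c \<alpha> \<otimes> g a b \<alpha>)"
      using c gc by (intro finsum_addf) auto
    finally show ?thesis using row[of c b a] row[of c a b] c ab' by simp
  qed
  have gD: "(\<Oplus>\<alpha>\<in>?N. c \<alpha> \<otimes> gram n f \<alpha> (Dbl a)) = \<ominus> row_mult R ?I (low c a) \<sigma> a"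
    if c: "\<And>\<alpha>. c \<alpha> \<in> carrier R" and a: "Dbl a \<in> ?S" for c a
  proof -
    have a': "a \<in> ?I" "Dbl a \<in> pos_roots n" using a by (auto simp: sum_roots_def pos_roots_def)
    have "(\<Oplus>\<alpha>\<in>?N. c \<alpha> \<otimes> gram n f \<alpha> (Dbl a)) = (\<Oplus>\<alpha>\<in>?N. c \<alpha> \<otimes> \<ominus> (g a a \<alpha>))"
      using c gc gram_diff_dbl[OF f _ a'(2)] a'
      by (intro finsum_cong') (auto simp: diff_roots_def pos_roots_def g_def \<sigma>_def)
    also have "\<dots> = \<ominus> (\<Oplus>\<alpha>\<in>?N. c \<alpha> \<otimes> g a a \<alpha>)" using c gc by (intro neg) auto
    finally show ?thesis using row[of c a a] c a' by simp
  qed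
  have dbl: "x \<oplus> x = \<zero> \<longleftrightarrow> x = \<zero>" if "x \<in> carrier R" for x
  proof -
    have "x \<oplus> x = (\<one> \<oplus> \<one>) \<otimes> x" using that by (simp add: l_distr)
    then show ?thesis using two that integral_iff[of "\<one> \<oplus> \<one>" x] by simp
  qed
  have neg0: "\<ominus> x = \<zero> \<longleftrightarrow> x = \<zero>" if "x \<in> carrier R" for x using that by (metis minus_minus minus_zero)
  have iff: "c \<in> lker R ?N ?S (gram n f) \<longleftrightarrow> low c \<in> stab R ?I \<sigma>" if c: "c \<in> vecs R ?N" for c
  proof -
    have cc: "c \<alpha> \<in> carrier R" for \<alpha> using c by (rule vecs_closed)
    have low: "low c \<in> strict_lower R ?I" using cc by (auto simp: strict_lower_def low_def)
    have "c \<in> lker R ?N ?S (gram n f) \<longleftrightarrow>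
      (\<forall>a b. 1 \<le> a \<and> a < b \<and> b \<le> n \<longrightarrow> row_mult R ?I (low c b) \<sigma> a \<oplus> row_mult R ?I (low c a) \<sigma> b = \<zero>) \<and>
      (\<forall>a\<in>?I. row_mult R ?I (low c a) \<sigma> a = \<zero>)" (is "_ \<longleftrightarrow> ?r")
    proof -
      have "c \<in> lker R ?N ?S (gram n f) \<longleftrightarrow>
        (\<forall>a b. Sum a b \<in> ?S \<longrightarrow> (\<Oplus>\<alpha>\<in>?N. c \<alpha> \<otimes> gram n f \<alpha> (Sum a b)) = \<zero>) \<and>
        (\<forall>a. Dbl a \<in> ?S \<longrightarrow> (\<Oplus>\<alpha>\<in>?N. c \<alpha> \<otimes> gram n f \<alpha> (Dbl a)) = \<zero>)"
        using c by (auto simp: lker_def sum_roots_def)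
      also have "\<dots> \<longleftrightarrow> ?r"
        using gS[of c, OF cc] gD[of c, OF cc] neg0 rc[of c, OF cc]
        by (auto simp: sum_roots_def)
      finally show ?thesis .
    qed
    also have "\<dots> \<longleftrightarrow> (\<forall>j\<in>?I. \<forall>k\<in>?I. row_mult R ?I (low c j) \<sigma> k \<oplus> row_mult R ?I (low c k) \<sigma> j = \<zero>)"
    proof
      assume r: ?r
      show "\<forall>j\<in>?I. \<forall>k\<in>?I. row_mult R ?I (low c j) \<sigma> k \<oplus> row_mult R ?I (low c k) \<sigma> j = \<zero>"
      proof (intro ballI)
        fix j k assume jk: "j \<in> ?I" "k \<in> ?I"
        consider "j < k" | "k < j" | "j = k" by linarith
        then show "row_mult R ?I (low c j) \<sigma> k \<oplus> row_mult R ?I (low c k) \<sigma> j = \<zero>"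
          using r jk a_comm[OF rc rc, of c c j k k j] cc by cases auto
      qed
    next
      assume "\<forall>j\<in>?I. \<forall>k\<in>?I. row_mult R ?I (low c j) \<sigma> k \<oplus> row_mult R ?I (low c k) \<sigma> j = \<zero>"
      then show ?r using dbl[OF rc[of c, OF cc]] by auto
    qed
    also have "\<dots> \<longleftrightarrow> low c \<in> stab R ?I \<sigma>" using low by (simp add: stab_def)
    finally show ?thesis .
  qed
  let ?up = "\<lambda>x \<alpha>. case \<alpha> of Diff i j \<Rightarrow> x j i | _ \<Rightarrow> \<zero>"
  have up: "?up x \<in> vecs R ?N \<and> low (?up x) = x" if x: "x \<in> strict_lower R ?I" for x
  proof
    show "?up x \<in> vecs R ?N"
      unfolding vecs_def
    proof (intro CollectI conjI allI impI)
      fix \<alpha>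
      show "?up x \<alpha> \<in> carrier R" using strict_lower_closed[OF x] by (cases \<alpha>) auto
      show "?up x \<alpha> = \<zero>" if "\<alpha> \<notin> ?N"
        using that strict_lower_off[OF x] by (cases \<alpha>) (auto simp: diff_roots_def)
    qed
    show "low (?up x) = x"
      using strict_lower_off[OF x] by (auto simp: low_def fun_eq_iff)
  qed
  have "bij_betw low (lker R ?N ?S (gram n f)) (stab R ?I \<sigma>)"
  proof (rule bij_betw_byWitness[where f' = ?up])
    show "\<forall>c\<in>lker R ?N ?S (gram n f). ?up (low c) = c"
    proof (intro ballI ext)
      fix c \<alpha> assume "c \<in> lker R ?N ?S (gram n f)"
      then have "c \<in> vecs R ?N" by (rule lker_vecs)
      then show "?up (low c) \<alpha> = c \<alpha>"
        using vecs_off[of c R ?N \<alpha>] by (cases \<alpha>) (auto simp: low_def diff_roots_def)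
    qed
    show "\<forall>x\<in>stab R ?I \<sigma>. low (?up x) = x" using up stab_lower by blast
    show "low ` lker R ?N ?S (gram n f) \<subseteq> stab R ?I \<sigma>" using iff lker_vecs by blast
    show "?up ` stab R ?I \<sigma> \<subseteq> lker R ?N ?S (gram n f)"
    proof (intro image_subsetI)
      fix x assume x: "x \<in> stab R ?I \<sigma>"
      have u: "?up x \<in> vecs R ?N" "low (?up x) = x" using up[OF stab_lower[OF x]] by blast+
      show "?up x \<in> lker R ?N ?S (gram n f)"
        unfolding iff[OF u(1)] u(2) by (rule x)
    qed
  qed
  then show ?thesis unfolding \<sigma>_def by (rule bij_betw_same_card)
qed

section \<open>Forms with prescribed symmetric part\<close>

lemma sym_part_Sum: "1 \<le> i \<Longrightarrow> i < j \<Longrightarrow> j \<le> n \<Longrightarrow> sym_part n f i j = f (root_vec R n (Sum i j))"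
  using sym_mat_skew(2)[of i n j] by (simp add: sym_part_def)

lemma sym_part_Dbl:
  assumes "f \<in> dual_u R n" "1 \<le> i" "i \<le> n"
  shows "sym_part n f i i = f (root_vec R n (Dbl i)) \<oplus> f (root_vec R n (Dbl i))"
proof -
  have "root_vec R n (Dbl i) \<in> skew R n" using assms by (intro root_vec_skew) (auto simp: pos_roots_def)
  then show ?thesis
    using sym_mat_skew(3)[of i n] dual_add[OF assms(1)] assms by (simp add: sym_part_def del: root_vec.simps)
qed

text \<open>A form amounts to arbitrary values on the roots of \<open>diff_roots n\<close> and an
  arbitrary symmetric matrix. The diagonal of that matrix holds twice the values at
  \<open>Dbl i\<close>, which are recovered by halving.\<close>

lemma card_dual_sym_part:
  assumes fin: "finite (carrier R)" and two: "\<one> \<oplus> \<one> \<noteq> \<zero>"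
  shows "card {f \<in> dual_u R n. P (sym_part n f)} =
    card (carrier R) ^ (n choose 2) * card {\<sigma> \<in> symm R {1..n}. P \<sigma>}"
proof -
  let ?N = "diff_roots n"
  let ?v = "\<lambda>f \<alpha>. if \<alpha> \<in> ?N then f (root_vec R n \<alpha>) else \<zero>"
  define F where "F f = (?v f, sym_part n f)" for f
  define half where "half = inv (\<one> \<oplus> \<one>)"
  have half: "half \<in> carrier R" "(\<one> \<oplus> \<one>) \<otimes> half = \<one>"
    using field_inv_closed[OF _ two] field_r_inv[OF _ two] by (auto simp: half_def)
  have hh: "half \<otimes> x \<oplus> half \<otimes> x = x" if "x \<in> carrier R" for x
  proof -
    have "half \<otimes> x \<oplus> half \<otimes> x = ((\<one> \<oplus> \<one>) \<otimes> half) \<otimes> x" using that half(1) by algebra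
    then show ?thesis using that half(2) by simp
  qed
  have dbl: "x = y" if "x \<in> carrier R" "y \<in> carrier R" "x \<oplus> x = y \<oplus> y" for x y
  proof -
    have "half \<otimes> (z \<oplus> z) = z" if "z \<in> carrier R" for z using hh[OF that] that half(1) by (simp only: r_distr)
    then show ?thesis using that by metis
  qed
  have "bij_betw F (dual_u R n) (vecs R ?N \<times> symm R {1..n})"
  proof (rule bij_betw_imageI)
    show "inj_on F (dual_u R n)"
    proof (rule inj_onI)
      fix f g assume f: "f \<in> dual_u R n" and g: "g \<in> dual_u R n" and e: "F f = F g"
      have "f (root_vec R n \<alpha>) = g (root_vec R n \<alpha>)" if \<alpha>: "\<alpha> \<in> pos_roots n" for \<alpha>
      proof (cases \<alpha>)
        case (Diff i j)
        then have "\<alpha> \<in> ?N" using \<alpha> by (auto simp: pos_roots_def diff_roots_def)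
        moreover have "?v f \<alpha> = ?v g \<alpha>" using e by (simp only: F_def prod.inject fun_eq_iff)
        ultimately show ?thesis by simp
      next
        case (Sum i j)
        then have "1 \<le> i" "i < j" "j \<le> n" using \<alpha> by (auto simp: pos_roots_def)
        moreover have "sym_part n f i j = sym_part n g i j" using e by (simp add: F_def)
        ultimately show ?thesis using Sum by (simp only: sym_part_Sum)
      next
        case (Dbl i)
        then have i: "1 \<le> i" "i \<le> n" using \<alpha> by (auto simp: pos_roots_def)
        have "sym_part n f i i = sym_part n g i i" using e by (simp add: F_def)
        then show ?thesis
          using sym_part_Dbl[OF f i] sym_part_Dbl[OF g i] dual_closed[OF f root_vec_skew[OF \<alpha>]]
            dual_closed[OF g root_vec_skew[OF \<alpha>]] Dbl by (simp only: dbl)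
      qed
      then have "(\<lambda>\<alpha>. if \<alpha> \<in> pos_roots n then f (root_vec R n \<alpha>) else \<zero>) =
        (\<lambda>\<alpha>. if \<alpha> \<in> pos_roots n then g (root_vec R n \<alpha>) else \<zero>)" by auto
      then show "f = g" by (rule inj_onD[OF bij_betw_imp_inj_on[OF dual_bij] _ f g])
    qed
    show "F ` dual_u R n = vecs R ?N \<times> symm R {1..n}"
    proof (intro equalityI subsetI)
      fix p assume "p \<in> F ` dual_u R n"
      then obtain f where f: "f \<in> dual_u R n" and p: "p = F f" by blast
      have "?v f \<in> vecs R ?N"
        using dual_closed[OF f root_vec_skew] by (auto simp: vecs_def pos_roots_split)
      then show "p \<in> vecs R ?N \<times> symm R {1..n}" unfolding p F_def using sym_part_symm[OF f] by simp
    next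
      fix p assume "p \<in> vecs R ?N \<times> symm R {1..n}"
      then obtain \<mu> \<sigma> where p: "p = (\<mu>, \<sigma>)" and \<mu>: "\<mu> \<in> vecs R ?N" and \<sigma>: "\<sigma> \<in> symm R {1..n}" by auto
      define h where "h \<alpha> = (if \<alpha> \<in> pos_roots n then (case \<alpha> of Diff i j \<Rightarrow> \<mu> \<alpha> | Sum i j \<Rightarrow> \<sigma> i j | Dbl i \<Rightarrow> half \<otimes> \<sigma> i i) else \<zero>)" for \<alpha>
      have h: "h \<in> vecs R (pos_roots n)"
        unfolding vecs_def h_def using vecs_closed[OF \<mu>] symm_closed[OF \<sigma>] half(1)
        by (auto split: root.split)
      obtain f where f: "f \<in> dual_u R n" and fv: "\<And>\<alpha>. \<alpha> \<in> pos_roots n \<Longrightarrow> f (root_vec R n \<alpha>) = h \<alpha>"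
        using dual_of_root_values[OF h] by blast
      have "?v f = \<mu>"
      proof
        fix \<alpha> show "?v f \<alpha> = \<mu> \<alpha>"
          using fv[of \<alpha>] vecs_off[OF \<mu>, of \<alpha>] by (auto simp: pos_roots_split h_def diff_roots_def)
      qed
      moreover have "sym_part n f = \<sigma>"
      proof (intro ext)
        fix i j
        have lt: "sym_part n f i j = \<sigma> i j" if "1 \<le> i" "i < j" "j \<le> n" for i j
          unfolding sym_part_Sum[OF that] using that by (subst fv) (auto simp: h_def pos_roots_def)
        have eq: "sym_part n f i i = \<sigma> i i" if "1 \<le> i" "i \<le> n" for i
          unfolding sym_part_Dbl[OF f that] using that hh[OF symm_closed[OF \<sigma>]] fv[of "Dbl i"]
          by (simp add: h_def pos_roots_def del: root_vec.simps)
        have S: "sym_part n f \<in> symm R {1..n}" using f by (rule sym_part_symm)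
        show "sym_part n f i j = \<sigma> i j"
        proof (cases "i \<in> {1..n} \<and> j \<in> {1..n}")
          case True
          consider "i < j" | "j < i" | "i = j" by linarith
          then show ?thesis
            using True lt[of i j] lt[of j i] eq[of i] symm_sym[OF S, of i j] symm_sym[OF \<sigma>, of i j] by cases auto
        next
          case False
          then show ?thesis using symm_off[OF S, of i j] symm_off[OF \<sigma>, of i j] by auto
        qed
      qed
      ultimately show "p \<in> F ` dual_u R n" using f unfolding p F_def by blast
    qed
  qed
  then have "bij_betw F {f \<in> dual_u R n. P (sym_part n f)} (vecs R ?N \<times> {\<sigma> \<in> symm R {1..n}. P \<sigma>})"
    unfolding bij_betw_def
  proof (intro conjI)
    assume F: "inj_on F (dual_u R n) \<and> F ` dual_u R n = vecs R ?N \<times> symm R {1..n}"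
    show "inj_on F {f \<in> dual_u R n. P (sym_part n f)}"
      using F by (auto intro: inj_on_subset)
    have "F ` {f \<in> dual_u R n. P (sym_part n f)} = {p \<in> F ` dual_u R n. P (snd p)}"
      by (auto simp: F_def)
    also have "\<dots> = vecs R ?N \<times> {\<sigma> \<in> symm R {1..n}. P \<sigma>}" using F by auto
    finally show "F ` {f \<in> dual_u R n. P (sym_part n f)} = vecs R ?N \<times> {\<sigma> \<in> symm R {1..n}. P \<sigma>}" .
  qed
  then show ?thesis
    using fin by (simp add: bij_betw_same_card card_cartesian_product card_vecs card_diff_roots)
qed

section \<open>The stabiliser as a nilpotent Lie algebra\<close>

lemma dual_bracket_comb_left:
  assumes f: "f \<in> dual_u R n" and y: "y \<in> skew R n" and c: "\<And>\<alpha>. c \<alpha> \<in> carrier R"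
  shows "f (bracket R n (root_comb n c) y) = (\<Oplus>\<alpha>\<in>pos_roots n. c \<alpha> \<otimes> f (bracket R n (root_vec R n \<alpha>) y))"
  using f y c skew_carrier[of _ n]
  by (intro linear_root_comb)
    (auto simp: bracket_add_left bracket_smult intro!: dual_closed[OF f] dual_add[OF f] dual_smult[OF f] bracket_skew)

lemma dual_bracket_comb_right:
  assumes f: "f \<in> dual_u R n" and y: "y \<in> skew R n" and c: "\<And>\<alpha>. c \<alpha> \<in> carrier R"
  shows "f (bracket R n y (root_comb n c)) = (\<Oplus>\<alpha>\<in>pos_roots n. c \<alpha> \<otimes> f (bracket R n y (root_vec R n \<alpha>)))"
  using f y c skew_carrier[of _ n]
  by (intro linear_root_comb)
    (auto simp: bracket_add_right bracket_smult intro!: dual_closed[OF f] dual_add[OF f] dual_smult[OF f] bracket_skew)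

lemma finsum_vecs_diff:
  assumes "c \<in> vecs R (diff_roots n)" "\<And>\<alpha>. \<alpha> \<in> pos_roots n \<Longrightarrow> h \<alpha> \<in> carrier R"
  shows "(\<Oplus>\<alpha>\<in>pos_roots n. c \<alpha> \<otimes> h \<alpha>) = (\<Oplus>\<alpha>\<in>diff_roots n. c \<alpha> \<otimes> h \<alpha>)"
  using assms vecs_closed[OF assms(1)] vecs_off[OF assms(1)]
  by (intro finsum_mono_neutral) (auto simp: pos_roots_split)

text \<open>The left kernel of the pairing with the abelian ideal is a Lie algebra of strictly triangular
  matrices; a nonzero element that lies as deep as possible is central in it.\<close>

lemma exists_central:
  assumes f: "f \<in> dual_u R n"
  defines "K \<equiv> lker R (diff_roots n) (sum_roots n) (gram n f)"
  assumes nz: "K \<noteq> {\<lambda>_. \<zero>}"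
  shows "\<exists>z\<in>K. z \<noteq> (\<lambda>_. \<zero>) \<and> (\<forall>c\<in>K. (\<Oplus>\<beta>\<in>diff_roots n. c \<beta> \<otimes> (\<Oplus>\<alpha>\<in>diff_roots n. z \<alpha> \<otimes> gram n f \<alpha> \<beta>)) = \<zero>)"
proof -
  interpret M: ring "gl R n" by (rule gl_ring)
  \<comment> \<open>The same kernel as a set of matrices instead of coefficient functions, so that
    brackets of its elements can be formed.\<close>
  define K' where "K' = {z \<in> levi n. \<forall>t\<in>sum_roots n. f (bracket R n z (root_vec R n t)) = \<zero>}"
  have K'_rad: "f (bracket R n z s) = \<zero>" if z: "z \<in> K'" and s: "s \<in> rad n" for z s
  proof -
    have zs: "z \<in> skew R n" using z by (auto simp: K'_def levi_skew)
    note ss = rad_skew[OF s]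
    have rc: "root_coeff s \<alpha> \<in> carrier R" for \<alpha> using root_coeff_closed[OF skew_carrier[OF ss]] .
    have "f (bracket R n z s) = (\<Oplus>\<alpha>\<in>pos_roots n. root_coeff s \<alpha> \<otimes> f (bracket R n z (root_vec R n \<alpha>)))"
      using dual_bracket_comb_right[where c = "root_coeff s", OF f zs rc] skew_root_comb[OF ss] by simp
    also have "\<dots> = \<zero>"
    proof (rule add.finprod_one_eqI)
      fix \<alpha> assume \<alpha>: "\<alpha> \<in> pos_roots n"
      have bc: "f (bracket R n z (root_vec R n \<alpha>)) \<in> carrier R"
        by (rule dual_closed[OF f bracket_skew[OF zs root_vec_skew[OF \<alpha>]]])
      show "root_coeff s \<alpha> \<otimes> f (bracket R n z (root_vec R n \<alpha>)) = \<zero>"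
      proof (cases "\<alpha> \<in> sum_roots n")
        case True
        then show ?thesis using z rc by (simp add: K'_def)
      next
        case False
        then have "\<alpha> \<in> diff_roots n" using \<alpha> by (simp add: pos_roots_split)
        then have "root_coeff s \<alpha> = \<zero>" using s by (auto simp: diff_roots_def root_coeff_def rad_def)
        then show ?thesis using bc by simp
      qed
    qed
    finally show ?thesis .
  qed
  \<comment> \<open>By the Jacobi identity and because \<open>rad n\<close> is stable under brackets
    with \<open>levi n\<close>: both resulting terms pair an element of \<open>K'\<close> with one
    of \<open>rad n\<close>.\<close>
  have K'_bracket: "bracket R n z w \<in> K'" if z: "z \<in> K'" and w: "w \<in> K'" for z w
  proof -
    have l: "z \<in> levi n" "w \<in> levi n" using z w by (auto simp: K'_def)
    note sk = l[THEN levi_skew]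
    have "f (bracket R n (bracket R n z w) (root_vec R n t)) = \<zero>" if t: "t \<in> sum_roots n" for t
    proof -
      note r = root_vec_rad[OF t]
      note rs = rad_skew[OF r]
      have s2: "bracket R n z (bracket R n w (root_vec R n t)) \<in> skew R n"
        "bracket R n w (bracket R n z (root_vec R n t)) \<in> skew R n"
        using sk rs by (auto intro!: bracket_skew)
      have "f (bracket R n (bracket R n z w) (root_vec R n t)) =
        f (bracket R n z (bracket R n w (root_vec R n t))) \<oplus> \<ominus> f (bracket R n w (bracket R n z (root_vec R n t)))"
        using sk rs s2 f skew_carrier
        by (simp add: bracket_jacobi M.minus_eq dual_add skew_uminus dual_uminus)
      also have "\<dots> = \<zero>"
        using K'_rad[OF z bracket_levi_rad[OF l(2) r]] K'_rad[OF w bracket_levi_rad[OF l(1) r]] by simp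
      finally show ?thesis .
    qed
    then show ?thesis using bracket_levi[OF l] by (simp add: K'_def)
  qed
  have K_K': "root_comb n c \<in> K'" if c: "c \<in> K" for c
  proof -
    have cv: "c \<in> vecs R (diff_roots n)" using c by (auto simp: K_def lker_def)
    have cc: "c \<alpha> \<in> carrier R" for \<alpha> using cv by (rule vecs_closed)
    have "root_comb n c a b = \<zero>" if ab: "a < 0" "b > 0" for a b
    proof -
      have "root_comb n c a b = (\<Oplus>\<alpha>\<in>pos_roots n. (c \<alpha> \<odot>\<^bsub>gl R n\<^esub> root_vec R n \<alpha>) a b)"
        unfolding root_comb_def using cc skew_carrier[OF root_vec_skew]
        by (intro gl_finsum) (auto intro: gl_smult_closed)
      also have "\<dots> = \<zero>"
      proof (rule add.finprod_one_eqI)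
        fix \<alpha> assume \<alpha>: "\<alpha> \<in> pos_roots n"
        have "root_vec R n \<alpha> a b \<in> carrier R" using gl_entry[OF skew_carrier[OF root_vec_skew[OF \<alpha>]]] .
        moreover have "root_vec R n \<alpha> a b = \<zero>" if "\<alpha> \<in> diff_roots n"
          using root_vec_levi[OF that] ab by (simp add: levi_def)
        ultimately show "(c \<alpha> \<odot>\<^bsub>gl R n\<^esub> root_vec R n \<alpha>) a b = \<zero>"
          using vecs_off[OF cv, of \<alpha>] cc by (cases "\<alpha> \<in> diff_roots n") (auto simp: gl_sel(5))
      qed
      finally show ?thesis .
    qed
    then have "root_comb n c \<in> levi n" using root_comb_skew[where c = c, OF cc] by (simp add: levi_def)
    moreover have "f (bracket R n (root_comb n c) (root_vec R n t)) = \<zero>" if t: "t \<in> sum_roots n" for t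
    proof -
      have ts: "t \<in> pos_roots n" using t by (simp add: pos_roots_split)
      have "f (bracket R n (root_comb n c) (root_vec R n t)) = (\<Oplus>\<alpha>\<in>pos_roots n. c \<alpha> \<otimes> gram n f \<alpha> t)"
        unfolding gram_def using f root_vec_skew[OF ts] cc by (rule dual_bracket_comb_left)
      also have "\<dots> = (\<Oplus>\<alpha>\<in>diff_roots n. c \<alpha> \<otimes> gram n f \<alpha> t)"
        using cv gram_closed[OF f _ ts] by (rule finsum_vecs_diff)
      also have "\<dots> = \<zero>" using c t by (simp add: K_def lker_def)
      finally show ?thesis .
    qed
    ultimately show ?thesis by (simp add: K'_def)
  qed
  define co where "co z \<alpha> = (if \<alpha> \<in> diff_roots n then root_coeff z \<alpha> else \<zero>)" for z \<alpha>
  have K'_K: "co z \<in> K \<and> root_comb n (co z) = z" if z: "z \<in> K'" for z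
  proof -
    have zl: "z \<in> levi n" using z by (simp add: K'_def)
    note zs = levi_skew[OF zl]
    have rc: "root_coeff z \<alpha> \<in> carrier R" for \<alpha> using root_coeff_closed[OF skew_carrier[OF zs]] .
    have cv: "co z \<in> vecs R (diff_roots n)" using rc by (simp add: vecs_def co_def)
    have cc: "co z \<alpha> \<in> carrier R" for \<alpha> using cv by (rule vecs_closed)
    have same: "co z \<alpha> = root_coeff z \<alpha>" if "\<alpha> \<in> pos_roots n" for \<alpha>
      using that zl by (auto simp: co_def pos_roots_split sum_roots_def root_coeff_def levi_def)
    have rz: "root_comb n (co z) = z"
    proof -
      have "root_comb n (co z) = root_comb n (root_coeff z)"
        unfolding root_comb_def using same rc skew_carrier[OF root_vec_skew]
        by (intro M.finsum_cong') (auto intro: gl_smult_closed)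
      then show ?thesis using skew_root_comb[OF zs] by simp
    qed
    have "(\<Oplus>\<alpha>\<in>diff_roots n. co z \<alpha> \<otimes> gram n f \<alpha> t) = \<zero>" if t: "t \<in> sum_roots n" for t
    proof -
      have ts: "t \<in> pos_roots n" using t by (simp add: pos_roots_split)
      have "(\<Oplus>\<alpha>\<in>diff_roots n. co z \<alpha> \<otimes> gram n f \<alpha> t) = (\<Oplus>\<alpha>\<in>pos_roots n. co z \<alpha> \<otimes> gram n f \<alpha> t)"
        using cv gram_closed[OF f _ ts] by (rule finsum_vecs_diff[symmetric])
      also have "\<dots> = f (bracket R n (root_comb n (co z)) (root_vec R n t))"
        unfolding gram_def using f root_vec_skew[OF ts] cc by (rule dual_bracket_comb_left[symmetric])
      also have "\<dots> = \<zero>" unfolding rz using z t by (simp add: K'_def)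
      finally show ?thesis .
    qed
    then show ?thesis using cv rz by (simp add: K_def lker_def)
  qed
  have zeroK: "(\<lambda>_. \<zero>) \<in> K"
    unfolding K_def using gram_closed[OF f] by (intro zero_lker) (auto simp: pos_roots_split)
  then obtain c0 where c0: "c0 \<in> K" "c0 \<noteq> (\<lambda>_. \<zero>)" using nz by blast
  have comb0: "c = (\<lambda>_. \<zero>)" if c: "c \<in> K" and 0: "root_comb n c = \<zero>\<^bsub>gl R n\<^esub>" for c
  proof
    fix \<alpha>
    have cv: "c \<in> vecs R (diff_roots n)" using c by (auto simp: K_def lker_def)
    have cc: "c \<alpha> \<in> carrier R" for \<alpha> using cv by (rule vecs_closed)
    show "c \<alpha> = \<zero>"
    proof (cases "\<alpha> \<in> pos_roots n")
      case True
      have "c \<alpha> = root_coeff (root_comb n c) \<alpha>" using cc True by (rule root_coeff_comb[symmetric])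
      also have "\<dots> = \<zero>" unfolding 0 by (cases \<alpha>) (simp_all add: root_coeff_def gl_sel)
      finally show ?thesis .
    next
      case False
      then show ?thesis using vecs_off[OF cv] by (simp add: pos_roots_split)
    qed
  qed
  have "\<exists>z\<in>K'. z \<noteq> \<zero>\<^bsub>gl R n\<^esub> \<and> (\<forall>w\<in>K'. bracket R n z w = \<zero>\<^bsub>gl R n\<^esub>)"
  proof (rule ccontr)
    assume no: "\<not> ?thesis"
    \<comment> \<open>Without a central element every nonzero z has a nonzero bracket with some w,
      and this bracket lies one diagonal further down. From depth 2 n on only zero is left.\<close>
    have "\<exists>z\<in>K'. z \<noteq> \<zero>\<^bsub>gl R n\<^esub> \<and> z \<in> tri R n j" for j
    proof (induction j)
      case 0
      have "root_comb n c0 \<in> tri R n 0"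
        using K_K'[OF c0(1)] tri_mono[OF skew_tri, of _ n 0] levi_skew by (auto simp: K'_def)
      then show ?case using K_K'[OF c0(1)] comb0[OF c0(1)] c0(2) by blast
    next
      case (Suc j)
      then obtain z where z: "z \<in> K'" "z \<noteq> \<zero>\<^bsub>gl R n\<^esub>" "z \<in> tri R n j" by blast
      then obtain w where w: "w \<in> K'" "bracket R n z w \<noteq> \<zero>\<^bsub>gl R n\<^esub>" using no by blast
      have "w \<in> tri R n 1" using w(1) levi_skew skew_tri by (auto simp: K'_def)
      then have "bracket R n z w \<in> tri R n (Suc j)" using bracket_tri[OF z(3), of w 1] by simp
      then show ?case using K'_bracket[OF z(1) w(1)] w(2) by blast
    qed
    then show False using tri_top[of _ R n "2 * n"] by blast
  qed
  then obtain z where z: "z \<in> K'" "z \<noteq> \<zero>\<^bsub>gl R n\<^esub>" "\<And>w. w \<in> K' \<Longrightarrow> bracket R n z w = \<zero>\<^bsub>gl R n\<^esub>" by blast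
  have zK: "co z \<in> K" "root_comb n (co z) = z" using K'_K[OF z(1)] by auto
  have zs: "z \<in> skew R n" using z(1) by (auto simp: K'_def levi_skew)
  have zv: "co z \<in> vecs R (diff_roots n)" using zK(1) by (simp add: K_def lker_def)
  have zc: "co z \<alpha> \<in> carrier R" for \<alpha> using zv by (rule vecs_closed)
  show ?thesis
  proof (intro bexI[of _ "co z"] conjI ballI)
    show "co z \<noteq> (\<lambda>_. \<zero>)"
    proof
      assume "co z = (\<lambda>_. \<zero>)"
      then have "root_comb n (co z) = \<zero>\<^bsub>gl R n\<^esub>"
        using skew_carrier[OF root_vec_skew, THEN gl_entry] unfolding root_comb_def
        by (intro M.add.finprod_one_eqI) (auto simp: gl_sel fun_eq_iff)
      then show False using zK(2) z(2) by simp
    qed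
    fix c assume c: "c \<in> K"
    have cv: "c \<in> vecs R (diff_roots n)" using c by (auto simp: K_def lker_def)
    have cc: "c \<alpha> \<in> carrier R" for \<alpha> using cv by (rule vecs_closed)
    have inner: "f (bracket R n z (root_vec R n \<beta>)) = (\<Oplus>\<alpha>\<in>diff_roots n. co z \<alpha> \<otimes> gram n f \<alpha> \<beta>)"
      if \<beta>: "\<beta> \<in> pos_roots n" for \<beta>
    proof -
      have "f (bracket R n z (root_vec R n \<beta>)) = (\<Oplus>\<alpha>\<in>pos_roots n. co z \<alpha> \<otimes> gram n f \<alpha> \<beta>)"
        unfolding gram_def using dual_bracket_comb_left[where c = "co z", OF f root_vec_skew[OF \<beta>] zc] zK(2) by simp
      also have "\<dots> = (\<Oplus>\<alpha>\<in>diff_roots n. co z \<alpha> \<otimes> gram n f \<alpha> \<beta>)"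
        using zv gram_closed[OF f _ \<beta>] by (rule finsum_vecs_diff)
      finally show ?thesis .
    qed
    have bc: "f (bracket R n z (root_vec R n \<beta>)) \<in> carrier R" if "\<beta> \<in> pos_roots n" for \<beta>
      by (rule dual_closed[OF f bracket_skew[OF zs root_vec_skew[OF that]]])
    have "(\<Oplus>\<beta>\<in>diff_roots n. c \<beta> \<otimes> (\<Oplus>\<alpha>\<in>diff_roots n. co z \<alpha> \<otimes> gram n f \<alpha> \<beta>)) =
        (\<Oplus>\<beta>\<in>diff_roots n. c \<beta> \<otimes> f (bracket R n z (root_vec R n \<beta>)))"
      using cc bc by (intro finsum_cong') (auto simp: inner[symmetric] pos_roots_split)
    also have "\<dots> = (\<Oplus>\<beta>\<in>pos_roots n. c \<beta> \<otimes> f (bracket R n z (root_vec R n \<beta>)))"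
      using cv bc by (rule finsum_vecs_diff[symmetric])
    also have "\<dots> = f (bracket R n z (root_comb n c))"
      using f zs cc by (rule dual_bracket_comb_right[symmetric])
    also have "\<dots> = \<zero>" using z(3)[OF K_K'[OF c]] dual_zero[OF f] by simp
    finally show "(\<Oplus>\<beta>\<in>diff_roots n. c \<beta> \<otimes> (\<Oplus>\<alpha>\<in>diff_roots n. co z \<alpha> \<otimes> gram n f \<alpha> \<beta>)) = \<zero>" .
  qed (rule zK(1))
qed

section \<open>Orbit dimensions from stabiliser sizes\<close>

lemma card_lker_gram:
  assumes f: "f \<in> dual_u R n" and fin: "finite (carrier R)"
  shows "card (lker R (pos_roots n) (pos_roots n) (gram n f)) =
      card (carrier R) ^ (2 * (n choose 2) + n - orbit_dim R n f)"
    and "orbit_dim R n f \<le> 2 * (n choose 2) + n"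
proof -
  have "orbit_dim R n f = matrix_rank R (pos_roots n) (pos_roots n) (gram n f)"
    by (simp add: orbit_dim_def gram_def[abs_def])
  then show "card (lker R (pos_roots n) (pos_roots n) (gram n f)) =
      card (carrier R) ^ (2 * (n choose 2) + n - orbit_dim R n f)"
    "orbit_dim R n f \<le> 2 * (n choose 2) + n"
    using card_lker_rank[OF finite_pos_roots fin gram_closed[OF f]] by (simp_all add: card_pos_roots)
qed

text \<open>The set \<open>K0\<close> is the radical of the form restricted to \<open>K\<close>. A
  trivial \<open>K\<close> leaves \<open>K0\<close> trivial; otherwise the multiples of a central
  element supply q elements of \<open>K0\<close>, which fill \<open>K\<close> when it has only q
  elements.\<close>

lemma orbit_dim_by_stab:
  assumes f: "f \<in> dual_u R n" and fin: "finite (carrier R)" and two: "\<one> \<oplus> \<one> \<noteq> \<zero>"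
  defines "k \<equiv> card (stab R {1..n} (sym_part n f))" and "q \<equiv> card (carrier R)"
  shows "k = 1 \<Longrightarrow> orbit_dim R n f = 2 * (n choose 2)"
    and "k = q \<Longrightarrow> orbit_dim R n f + 2 = 2 * (n choose 2)"
    and "k \<noteq> 1 \<Longrightarrow> k \<noteq> q \<Longrightarrow> orbit_dim R n f + 3 \<le> 2 * (n choose 2)"
proof -
  define N S T where "N = diff_roots n" and "S = sum_roots n" and "T = n choose 2"
  define K where "K = lker R N S (gram n f)"
  define K0 where "K0 = {c \<in> K. \<forall>c'\<in>K. (\<Oplus>b\<in>N. c' b \<otimes> (\<Oplus>a\<in>N. c a \<otimes> gram n f a b)) = \<zero>}"
  have q1: "q > 1" using card_carrier_gt_1[OF fin] by (simp add: q_def)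
  have fN: "finite N" by (simp add: N_def)
  have Gc: "gram n f a b \<in> carrier R" if "a \<in> N \<union> S" "b \<in> N \<union> S" for a b
    using gram_closed[OF f] that by (simp add: N_def S_def pos_roots_split)
  have k: "k = card K"
    unfolding k_def K_def N_def S_def using card_lker_stab[OF f two] by simp
  have "card (lker R (N \<union> S) (N \<union> S) (gram n f)) * q ^ card N = card K0 * card K * q ^ card S"
    unfolding K0_def K_def q_def
  proof (rule card_lker_block)
    show "gram n f a b = \<ominus> gram n f b a" if "a \<in> S" "b \<in> N" for a b
      using that by (intro gram_anti f) (auto simp: N_def S_def pos_roots_split)
  qed (use Gc fin diff_sum_disjoint gram_sum_sum[OF f] in \<open>auto simp: N_def S_def\<close>)
  \<comment> \<open>The exponent \<open>n\<close> is the excess of \<open>card S\<close> over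
    \<open>card N\<close>.\<close>
  then have main: "q ^ (2 * T + n - orbit_dim R n f) = card K0 * k * q ^ n"
    using card_lker_gram(1)[OF f fin] q1
    by (simp add: k N_def S_def T_def q_def pos_roots_split[symmetric] card_diff_roots card_sum_roots power_add)
  have le: "orbit_dim R n f \<le> 2 * T + n" using card_lker_gram(2)[OF f fin] by (simp add: T_def)
  have fK: "finite K" unfolding K_def using fN fin by (rule finite_lker)
  then have fK0: "finite K0" by (simp add: K0_def)
  have zK: "(\<lambda>_. \<zero>) \<in> K" unfolding K_def using Gc by (intro zero_lker) auto
  have zK0: "(\<lambda>_. \<zero>) \<in> K0"
  proof -
    have 1: "(\<Oplus>a\<in>N. \<zero> \<otimes> gram n f a b) = \<zero>" if "b \<in> N" for b
      using Gc that by (intro add.finprod_one_eqI) auto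
    have "(\<Oplus>b\<in>N. c' b \<otimes> (\<Oplus>a\<in>N. \<zero> \<otimes> gram n f a b)) = \<zero>" if "c' \<in> K" for c'
      using 1 vecs_closed[OF lker_vecs[OF that[unfolded K_def]]] by (intro add.finprod_one_eqI) auto
    then show ?thesis using zK by (simp add: K0_def)
  qed
  have K0K: "card K0 \<le> card K" using fK by (intro card_mono) (auto simp: K0_def)
  have K0pos: "card K0 \<ge> 1" using zK0 fK0 by (metis One_nat_def Suc_leI card_gt_0_iff empty_iff)
  have K0q: "card K0 \<ge> q" if "k \<noteq> 1"
  proof -
    have "K \<noteq> {\<lambda>_. \<zero>}" using that by (auto simp: k)
    then obtain z where z: "z \<in> K" "z \<noteq> (\<lambda>_. \<zero>)"
      "\<And>c. c \<in> K \<Longrightarrow> (\<Oplus>b\<in>N. c b \<otimes> (\<Oplus>a\<in>N. z a \<otimes> gram n f a b)) = \<zero>"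
      using exists_central[OF f] unfolding K_def N_def S_def by blast
    have zc: "z \<alpha> \<in> carrier R" for \<alpha> using z(1) by (auto simp: K_def lker_def vecs_def)
    obtain \<alpha> where \<alpha>: "z \<alpha> \<noteq> \<zero>" using z(2) by auto
    have "(\<lambda>a i. a \<otimes> z i) ` carrier R \<subseteq> K0"
    proof (intro image_subsetI)
      fix a assume a: "a \<in> carrier R"
      have az: "(\<lambda>i. a \<otimes> z i) \<in> K"
        unfolding K_def using fN Gc z(1) a by (intro lker_smult) (auto simp: K_def)
      have "(\<Oplus>b\<in>N. c b \<otimes> (\<Oplus>i\<in>N. a \<otimes> z i \<otimes> gram n f i b)) = \<zero>" if c: "c \<in> K" for c
      proof -
        have cc: "c \<alpha> \<in> carrier R" for \<alpha> using c by (auto simp: K_def lker_def vecs_def)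
        have i: "(\<Oplus>i\<in>N. a \<otimes> z i \<otimes> gram n f i b) = a \<otimes> (\<Oplus>i\<in>N. z i \<otimes> gram n f i b)" if "b \<in> N" for b
          using a zc Gc that fN by (subst finsum_rdistr) (auto simp: m_assoc intro!: finsum_cong')
        have ic: "(\<Oplus>i\<in>N. z i \<otimes> gram n f i b) \<in> carrier R" if "b \<in> N" for b
          using zc Gc that by (intro finsum_closed) auto
        have "(\<Oplus>b\<in>N. c b \<otimes> (\<Oplus>i\<in>N. a \<otimes> z i \<otimes> gram n f i b)) =
            (\<Oplus>b\<in>N. a \<otimes> (c b \<otimes> (\<Oplus>i\<in>N. z i \<otimes> gram n f i b)))"
          using a cc ic by (intro finsum_cong') (auto simp: i m_lcomm)
        also have "\<dots> = a \<otimes> (\<Oplus>b\<in>N. c b \<otimes> (\<Oplus>i\<in>N. z i \<otimes> gram n f i b))"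
          using a cc ic fN by (intro finsum_rdistr[symmetric]) auto
        also have "\<dots> = \<zero>" using z(3)[OF c] a by simp
        finally show ?thesis .
      qed
      then show "(\<lambda>i. a \<otimes> z i) \<in> K0" using az by (simp add: K0_def)
    qed
    moreover have "inj_on (\<lambda>a i. a \<otimes> z i) (carrier R)"
    proof (rule inj_onI)
      fix a b assume ab: "a \<in> carrier R" "b \<in> carrier R" and e: "(\<lambda>i. a \<otimes> z i) = (\<lambda>i. b \<otimes> z i)"
      have "a \<otimes> z \<alpha> = b \<otimes> z \<alpha>" using e by (rule fun_cong)
      then show "a = b" using ab zc \<alpha> m_rcancel by blast
    qed
    ultimately show ?thesis using fK0 unfolding q_def by (metis card_image card_mono)
  qed
  \<comment> \<open>As a power of q, \<open>k\<close> is at least q^2 as soon as it is neither 1 nor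
    q.\<close>
  have kpow: "k = q ^ (card N - matrix_rank R N S (gram n f))"
    unfolding k K_def q_def using fN fin Gc by (intro card_lker_rank(1)) auto
  show "orbit_dim R n f = 2 * (n choose 2)" if "k = 1"
  proof -
    have "card K0 = 1" using K0K K0pos that k by simp
    then have "q ^ (2 * T + n - orbit_dim R n f) = q ^ n" using main that by simp
    then have "2 * T + n - orbit_dim R n f = n" using q1 by (simp add: power_inject_exp)
    then show ?thesis using le by (simp add: T_def)
  qed
  show "orbit_dim R n f + 2 = 2 * (n choose 2)" if "k = q"
  proof -
    have "card K0 = q" using K0K K0q that q1 k by simp
    then have "q ^ (2 * T + n - orbit_dim R n f) = q ^ (n + 2)"
      using main that by (simp add: power_add power2_eq_square)
    then have "2 * T + n - orbit_dim R n f = n + 2" using q1 by (simp only: power_inject_exp)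
    then show ?thesis using le by (simp add: T_def)
  qed
  show "orbit_dim R n f + 3 \<le> 2 * (n choose 2)" if "k \<noteq> 1" "k \<noteq> q"
  proof -
    define e where "e = card N - matrix_rank R N S (gram n f)"
    have "e \<noteq> 0" "e \<noteq> 1" using that kpow by (auto simp: e_def)
    then have "q ^ 2 \<le> q ^ e" using q1 by (intro power_increasing) auto
    then have "q ^ 2 \<le> k" using kpow by (simp add: e_def)
    then have "q * q ^ 2 * q ^ n \<le> card K0 * k * q ^ n" using K0q[OF that(1)] by (intro mult_mono) auto
    then have "q ^ (n + 3) \<le> q ^ (2 * T + n - orbit_dim R n f)"
      unfolding main by (simp add: power_add power3_eq_cube power2_eq_square mult_ac)
    then have "n + 3 \<le> 2 * T + n - orbit_dim R n f" using q1 by (simp only: power_increasing_iff)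
    then show ?thesis by (simp add: T_def)
  qed
qed

section \<open>Coadjoint orbits and the Cayley transform\<close>

subsection \<open>Unitriangular matrices and the group \<open>U(C\<^sub>n)\<close>\<close>

text \<open>In noncommutative rings \<open>algebra\<close> does not cancel a right factor \<open>\<one>\<close>; the combination
  \<open>(algebra, (simp, algebra?)?)\<close> below makes up for this.\<close>

definition unitri :: "nat \<Rightarrow> (int \<Rightarrow> int \<Rightarrow> 'a) set" where
  "unitri n = {g \<in> carrier (gl R n). g \<ominus>\<^bsub>gl R n\<^esub> \<one>\<^bsub>gl R n\<^esub> \<in> tri R n 1}"

lemma unitri_closed: "g \<in> unitri n \<Longrightarrow> g \<in> carrier (gl R n)"
  by (simp add: unitri_def)

lemma one_tri: "\<one>\<^bsub>gl R n\<^esub> \<in> tri R n 0"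
  by (auto simp: tri_def gl_carrier gl_sel)

lemma one_plus_tri_unitri:
  assumes "x \<in> tri R n 1"
  shows "\<one>\<^bsub>gl R n\<^esub> \<oplus>\<^bsub>gl R n\<^esub> x \<in> unitri n" "\<one>\<^bsub>gl R n\<^esub> \<ominus>\<^bsub>gl R n\<^esub> x \<in> unitri n"
proof -
  interpret M: ring "gl R n" by (rule gl_ring)
  note c = M.one_closed tri_carrier[OF assms]
  have "\<one>\<^bsub>gl R n\<^esub> \<oplus>\<^bsub>gl R n\<^esub> x \<ominus>\<^bsub>gl R n\<^esub> \<one>\<^bsub>gl R n\<^esub> = x" using c by algebra
  then show "\<one>\<^bsub>gl R n\<^esub> \<oplus>\<^bsub>gl R n\<^esub> x \<in> unitri n" using c assms by (simp add: unitri_def)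
  have "\<one>\<^bsub>gl R n\<^esub> \<ominus>\<^bsub>gl R n\<^esub> x \<ominus>\<^bsub>gl R n\<^esub> \<one>\<^bsub>gl R n\<^esub> = \<ominus>\<^bsub>gl R n\<^esub> x" using c by algebra
  then show "\<one>\<^bsub>gl R n\<^esub> \<ominus>\<^bsub>gl R n\<^esub> x \<in> unitri n" using c tri_minus[OF assms] by (simp add: unitri_def)
qed

lemma unitri_tri: "g \<in> unitri n \<Longrightarrow> g \<in> tri R n 0"
proof -
  assume g: "g \<in> unitri n"
  interpret M: ring "gl R n" by (rule gl_ring)
  have "g = (g \<ominus>\<^bsub>gl R n\<^esub> \<one>\<^bsub>gl R n\<^esub>) \<oplus>\<^bsub>gl R n\<^esub> \<one>\<^bsub>gl R n\<^esub>"
    using unitri_closed[OF g] M.one_closed by algebra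
  moreover have "g \<ominus>\<^bsub>gl R n\<^esub> \<one>\<^bsub>gl R n\<^esub> \<in> tri R n 0"
    using g by (intro tri_mono[of _ R n 1 0]) (auto simp: unitri_def)
  ultimately show ?thesis using tri_add[OF _ one_tri] by metis
qed

lemma unitri_mult:
  assumes g: "g \<in> unitri n" and h: "h \<in> unitri n"
  shows "g \<otimes>\<^bsub>gl R n\<^esub> h \<in> unitri n"
proof -
  interpret M: ring "gl R n" by (rule gl_ring)
  note c = g[THEN unitri_closed] h[THEN unitri_closed] M.one_closed
  have "g \<otimes>\<^bsub>gl R n\<^esub> h \<ominus>\<^bsub>gl R n\<^esub> \<one>\<^bsub>gl R n\<^esub> =
    (g \<ominus>\<^bsub>gl R n\<^esub> \<one>\<^bsub>gl R n\<^esub>) \<otimes>\<^bsub>gl R n\<^esub> h \<oplus>\<^bsub>gl R n\<^esub> (h \<ominus>\<^bsub>gl R n\<^esub> \<one>\<^bsub>gl R n\<^esub>)"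
    using c by algebra
  moreover have "(g \<ominus>\<^bsub>gl R n\<^esub> \<one>\<^bsub>gl R n\<^esub>) \<otimes>\<^bsub>gl R n\<^esub> h \<in> tri R n (1 + 0)"
    using g by (intro tri_mult unitri_tri h) (simp add: unitri_def)
  ultimately show ?thesis using c h by (simp add: unitri_def tri_add)
qed

text \<open>Geometric series: g = 1 - x with x nilpotent. The partial sums s satisfy g s = s g = 1 -
  x^m, and x^(2n) = 0.\<close>

lemma unitri_inverse:
  assumes g: "g \<in> unitri n"
  shows "\<exists>y\<in>unitri n. g \<otimes>\<^bsub>gl R n\<^esub> y = \<one>\<^bsub>gl R n\<^esub> \<and> y \<otimes>\<^bsub>gl R n\<^esub> g = \<one>\<^bsub>gl R n\<^esub>"
proof -
  interpret M: ring "gl R n" by (rule gl_ring)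
  let ?M = "gl R n"
  define x where "x = \<one>\<^bsub>?M\<^esub> \<ominus>\<^bsub>?M\<^esub> g"
  note c = g[THEN unitri_closed] M.one_closed
  have "x = \<ominus>\<^bsub>?M\<^esub> (g \<ominus>\<^bsub>?M\<^esub> \<one>\<^bsub>?M\<^esub>)" unfolding x_def using c by algebra
  then have x: "x \<in> tri R n 1" using g by (simp add: unitri_def tri_minus)
  note xc = tri_carrier[OF x]
  have gx: "g = \<one>\<^bsub>?M\<^esub> \<ominus>\<^bsub>?M\<^esub> x" unfolding x_def using c by algebra
  have "\<exists>s\<in>tri R n 0. g \<otimes>\<^bsub>?M\<^esub> s = \<one>\<^bsub>?M\<^esub> \<ominus>\<^bsub>?M\<^esub> x [^]\<^bsub>?M\<^esub> m \<and> s \<otimes>\<^bsub>?M\<^esub> g = \<one>\<^bsub>?M\<^esub> \<ominus>\<^bsub>?M\<^esub> x [^]\<^bsub>?M\<^esub> m" for m :: nat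
  proof (induction m)
    case 0
    show ?case using tri_zero c by (intro bexI[of _ "\<zero>\<^bsub>?M\<^esub>"]) (auto simp: M.minus_eq M.r_neg)
  next
    case (Suc m)
    then obtain s where s: "s \<in> tri R n 0" "g \<otimes>\<^bsub>?M\<^esub> s = \<one>\<^bsub>?M\<^esub> \<ominus>\<^bsub>?M\<^esub> x [^]\<^bsub>?M\<^esub> m"
      "s \<otimes>\<^bsub>?M\<^esub> g = \<one>\<^bsub>?M\<^esub> \<ominus>\<^bsub>?M\<^esub> x [^]\<^bsub>?M\<^esub> m" by blast
    define p where "p = x [^]\<^bsub>?M\<^esub> m"
    have p: "p \<in> tri R n 0" unfolding p_def using tri_pow[OF x] by (rule tri_mono) simp
    note pc = tri_carrier[OF p] tri_carrier[OF s(1)]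
    have P: "x [^]\<^bsub>?M\<^esub> Suc m = p \<otimes>\<^bsub>?M\<^esub> x" "x [^]\<^bsub>?M\<^esub> Suc m = x \<otimes>\<^bsub>?M\<^esub> p"
      using xc by (simp add: p_def, simp only: p_def M.nat_pow_Suc2)
    have "g \<otimes>\<^bsub>?M\<^esub> (s \<oplus>\<^bsub>?M\<^esub> p) = g \<otimes>\<^bsub>?M\<^esub> s \<oplus>\<^bsub>?M\<^esub> g \<otimes>\<^bsub>?M\<^esub> p" using c pc by algebra
    also have "\<dots> = \<one>\<^bsub>?M\<^esub> \<ominus>\<^bsub>?M\<^esub> p \<oplus>\<^bsub>?M\<^esub> g \<otimes>\<^bsub>?M\<^esub> p" using s(2) by (simp add: p_def)
    also have "\<dots> = \<one>\<^bsub>?M\<^esub> \<ominus>\<^bsub>?M\<^esub> x \<otimes>\<^bsub>?M\<^esub> p" unfolding gx using c xc pc by algebra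
    finally have 1: "g \<otimes>\<^bsub>?M\<^esub> (s \<oplus>\<^bsub>?M\<^esub> p) = \<one>\<^bsub>?M\<^esub> \<ominus>\<^bsub>?M\<^esub> x [^]\<^bsub>?M\<^esub> Suc m" unfolding P(2) .
    have "(s \<oplus>\<^bsub>?M\<^esub> p) \<otimes>\<^bsub>?M\<^esub> g = s \<otimes>\<^bsub>?M\<^esub> g \<oplus>\<^bsub>?M\<^esub> p \<otimes>\<^bsub>?M\<^esub> g" using c pc by algebra
    also have "\<dots> = \<one>\<^bsub>?M\<^esub> \<ominus>\<^bsub>?M\<^esub> p \<oplus>\<^bsub>?M\<^esub> p \<otimes>\<^bsub>?M\<^esub> g" using s(3) by (simp add: p_def)
    also have "\<dots> = \<one>\<^bsub>?M\<^esub> \<ominus>\<^bsub>?M\<^esub> p \<otimes>\<^bsub>?M\<^esub> x" unfolding gx using c xc pc by (algebra, (simp, algebra?)?)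
    finally have 2: "(s \<oplus>\<^bsub>?M\<^esub> p) \<otimes>\<^bsub>?M\<^esub> g = \<one>\<^bsub>?M\<^esub> \<ominus>\<^bsub>?M\<^esub> x [^]\<^bsub>?M\<^esub> Suc m" unfolding P(1) .
    show ?case using 1 2 tri_add[OF s(1) p] by blast
  qed
  then obtain y where y: "y \<in> tri R n 0" "g \<otimes>\<^bsub>?M\<^esub> y = \<one>\<^bsub>?M\<^esub> \<ominus>\<^bsub>?M\<^esub> x [^]\<^bsub>?M\<^esub> (2 * n)"
    "y \<otimes>\<^bsub>?M\<^esub> g = \<one>\<^bsub>?M\<^esub> \<ominus>\<^bsub>?M\<^esub> x [^]\<^bsub>?M\<^esub> (2 * n)" by blast
  have "x [^]\<^bsub>?M\<^esub> (2 * n) = \<zero>\<^bsub>?M\<^esub>" using tri_pow[OF x, of "2 * n"] by (rule tri_top) simp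
  then have y1: "g \<otimes>\<^bsub>?M\<^esub> y = \<one>\<^bsub>?M\<^esub>" "y \<otimes>\<^bsub>?M\<^esub> g = \<one>\<^bsub>?M\<^esub>" using y by (auto simp: M.minus_eq)
  have yc: "y \<in> carrier ?M" using tri_carrier[OF y(1)] .
  have "y \<ominus>\<^bsub>?M\<^esub> \<one>\<^bsub>?M\<^esub> = y \<ominus>\<^bsub>?M\<^esub> y \<otimes>\<^bsub>?M\<^esub> g" using y1 by simp
  also have "\<dots> = y \<otimes>\<^bsub>?M\<^esub> x" unfolding x_def using yc c by (algebra, (simp, algebra?)?)
  finally have "y \<ominus>\<^bsub>?M\<^esub> \<one>\<^bsub>?M\<^esub> = y \<otimes>\<^bsub>?M\<^esub> x" .
  moreover have "y \<otimes>\<^bsub>?M\<^esub> x \<in> tri R n (0 + 1)" by (rule tri_mult[OF y(1) x])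
  ultimately have "y \<in> unitri n" using yc by (simp add: unitri_def)
  then show ?thesis using y1 by blast
qed

lemma unitri_unit:
  assumes "g \<in> unitri n"
  shows "g \<in> Units (gl R n)" "inv\<^bsub>gl R n\<^esub> g \<in> unitri n"
proof -
  interpret M: ring "gl R n" by (rule gl_ring)
  obtain y where y: "y \<in> unitri n" "g \<otimes>\<^bsub>gl R n\<^esub> y = \<one>\<^bsub>gl R n\<^esub>" "y \<otimes>\<^bsub>gl R n\<^esub> g = \<one>\<^bsub>gl R n\<^esub>"
    using unitri_inverse[OF assms] by blast
  note c = assms[THEN unitri_closed] y(1)[THEN unitri_closed]
  show "g \<in> Units (gl R n)" using y c unfolding Units_def by blast
  have "inv\<^bsub>gl R n\<^esub> g = y" using M.inv_unique' c y by metis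
  then show "inv\<^bsub>gl R n\<^esub> g \<in> unitri n" using y by simp
qed

lemma group_U_unitri: "group_U R n = {g \<in> unitri n. adj R g \<otimes>\<^bsub>gl R n\<^esub> g = \<one>\<^bsub>gl R n\<^esub>}"
  unfolding group_U_eq[OF is_cring] unitri_def by auto

lemma group_U_closed: "g \<in> group_U R n \<Longrightarrow> g \<in> carrier (gl R n)"
  by (simp add: group_U_unitri unitri_def)

lemma group_U_inv:
  assumes g: "g \<in> group_U R n"
  shows "inv\<^bsub>gl R n\<^esub> g = adj R g" "g \<otimes>\<^bsub>gl R n\<^esub> adj R g = \<one>\<^bsub>gl R n\<^esub>" "adj R g \<otimes>\<^bsub>gl R n\<^esub> g = \<one>\<^bsub>gl R n\<^esub>"
    "adj R g \<in> group_U R n"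
proof -
  interpret M: ring "gl R n" by (rule gl_ring)
  have u: "g \<in> unitri n" and a: "adj R g \<otimes>\<^bsub>gl R n\<^esub> g = \<one>\<^bsub>gl R n\<^esub>" using g by (auto simp: group_U_unitri)
  note c = unitri_closed[OF u]
  note U = unitri_unit[OF u]
  show i: "inv\<^bsub>gl R n\<^esub> g = adj R g"
    by (rule M.inv_char[symmetric, THEN sym, OF c adj_closed[OF c] _ a])
      (metis M.Units_inv_closed M.Units_r_inv M.Units_l_inv M.inv_unique U(1) a adj_closed c)
  show "g \<otimes>\<^bsub>gl R n\<^esub> adj R g = \<one>\<^bsub>gl R n\<^esub>" using M.Units_r_inv[OF U(1)] i by simp
  then show "adj R g \<in> group_U R n" using U(2) i c by (simp add: group_U_unitri adj_adj)
  show "adj R g \<otimes>\<^bsub>gl R n\<^esub> g = \<one>\<^bsub>gl R n\<^esub>" by (rule a)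
qed

lemma group_U_mult:
  assumes g: "g \<in> group_U R n" and h: "h \<in> group_U R n"
  shows "g \<otimes>\<^bsub>gl R n\<^esub> h \<in> group_U R n"
proof -
  interpret M: ring "gl R n" by (rule gl_ring)
  note c = g[THEN group_U_closed] h[THEN group_U_closed]
  have "adj R (g \<otimes>\<^bsub>gl R n\<^esub> h) \<otimes>\<^bsub>gl R n\<^esub> (g \<otimes>\<^bsub>gl R n\<^esub> h) =
      adj R h \<otimes>\<^bsub>gl R n\<^esub> ((adj R g \<otimes>\<^bsub>gl R n\<^esub> g) \<otimes>\<^bsub>gl R n\<^esub> h)"
    using c by (simp add: adj_mult adj_closed M.m_assoc)
  also have "\<dots> = \<one>\<^bsub>gl R n\<^esub>" using group_U_inv(3)[OF g] group_U_inv(3)[OF h] c by simp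
  finally show ?thesis using g h by (simp add: group_U_unitri unitri_mult)
qed

lemma group_U_one: "\<one>\<^bsub>gl R n\<^esub> \<in> group_U R n"
proof -
  interpret M: ring "gl R n" by (rule gl_ring)
  show ?thesis by (simp add: group_U_unitri unitri_def adj_one M.minus_eq M.r_neg tri_zero)
qed

lemma finite_group_U: "finite (carrier R) \<Longrightarrow> finite (group_U R n)"
  using finite_gl[of R n] by (rule rev_finite_subset) (auto simp: group_U_def)

section \<open>The coadjoint action and its orbits\<close>

lemma conj_skew:
  assumes g: "g \<in> group_U R n" and x: "x \<in> skew R n"
  shows "inv\<^bsub>gl R n\<^esub> g \<otimes>\<^bsub>gl R n\<^esub> x \<otimes>\<^bsub>gl R n\<^esub> g \<in> skew R n"
proof -
  interpret M: ring "gl R n" by (rule gl_ring)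
  let ?M = "gl R n"
  note c = group_U_closed[OF g] skew_carrier[OF x] adj_closed[OF group_U_closed[OF g]]
  have "adj R (adj R g \<otimes>\<^bsub>?M\<^esub> x \<otimes>\<^bsub>?M\<^esub> g) = \<ominus>\<^bsub>?M\<^esub> (adj R g \<otimes>\<^bsub>?M\<^esub> x \<otimes>\<^bsub>?M\<^esub> g)"
    using c by (simp add: adj_mult adj_adj skew_adj[OF x] M.m_assoc M.l_minus M.r_minus)
  moreover have "adj R g \<otimes>\<^bsub>?M\<^esub> x \<otimes>\<^bsub>?M\<^esub> g \<in> tri R n (0 + 1 + 0)"
    using g group_U_inv(4)[OF g] skew_tri[OF x] unfolding group_U_unitri
    by (intro tri_mult) (auto intro: unitri_tri)
  ultimately show ?thesis unfolding group_U_inv(1)[OF g] by (simp add: skew_def)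
qed

lemma coadj_dual:
  assumes g: "g \<in> group_U R n" and f: "f \<in> dual_u R n"
  shows "coadj R n g f \<in> dual_u R n"
proof -
  interpret M: ring "gl R n" by (rule gl_ring)
  let ?M = "gl R n"
  let ?c = "\<lambda>x. inv\<^bsub>?M\<^esub> g \<otimes>\<^bsub>?M\<^esub> x \<otimes>\<^bsub>?M\<^esub> g"
  have gc: "g \<in> carrier ?M" "inv\<^bsub>?M\<^esub> g \<in> carrier ?M"
    using group_U_closed[OF g] adj_closed group_U_inv(1)[OF g] by auto
  have a: "?c (x \<oplus>\<^bsub>?M\<^esub> y) = ?c x \<oplus>\<^bsub>?M\<^esub> ?c y" if "x \<in> carrier ?M" "y \<in> carrier ?M" for x y
    using that gc by (simp add: M.r_distr M.l_distr)
  have s: "?c (k \<odot>\<^bsub>?M\<^esub> x) = k \<odot>\<^bsub>?M\<^esub> ?c x" if "k \<in> carrier R" "x \<in> carrier ?M" for k x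
    using that gc by (simp add: gl_smult_one_mult)
  have v: "coadj R n g f x = f (?c x)" if "x \<in> skew R n" for x
    using that by (simp add: coadj_def lie_u_eq)
  have "coadj R n g f (x \<oplus>\<^bsub>?M\<^esub> y) = coadj R n g f x \<oplus> coadj R n g f y"
    if x: "x \<in> skew R n" and y: "y \<in> skew R n" for x y
    unfolding v[OF x] v[OF y] v[OF skew_add[OF x y]] a[OF skew_carrier[OF x] skew_carrier[OF y]]
    by (rule dual_add[OF f conj_skew[OF g x] conj_skew[OF g y]])
  moreover have "coadj R n g f (k \<odot>\<^bsub>?M\<^esub> x) = k \<otimes> coadj R n g f x"
    if k: "k \<in> carrier R" and x: "x \<in> skew R n" for k x
    unfolding v[OF x] v[OF skew_smult[OF k x]] s[OF k skew_carrier[OF x]]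
    by (rule dual_smult[OF f k conj_skew[OF g x]])
  moreover have "coadj R n g f x \<in> carrier R" if x: "x \<in> skew R n" for x
    unfolding v[OF x] by (rule dual_closed[OF f conj_skew[OF g x]])
  moreover have "coadj R n g f \<in> extensional (lie_u R n)" by (simp add: coadj_def)
  ultimately show ?thesis unfolding dual_u_def lie_u_eq by (auto simp: PiE_def)
qed

lemma coadj_mult:
  assumes g: "g \<in> group_U R n" and h: "h \<in> group_U R n"
  shows "coadj R n (g \<otimes>\<^bsub>gl R n\<^esub> h) f = coadj R n g (coadj R n h f)"
proof
  interpret M: ring "gl R n" by (rule gl_ring)
  fix x
  show "coadj R n (g \<otimes>\<^bsub>gl R n\<^esub> h) f x = coadj R n g (coadj R n h f) x"
  proof (cases "x \<in> skew R n")
    case True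
    note c = g[THEN group_U_closed] h[THEN group_U_closed] skew_carrier[OF True]
    have "inv\<^bsub>gl R n\<^esub> (g \<otimes>\<^bsub>gl R n\<^esub> h) = inv\<^bsub>gl R n\<^esub> h \<otimes>\<^bsub>gl R n\<^esub> inv\<^bsub>gl R n\<^esub> g"
      unfolding group_U_inv(1)[OF g] group_U_inv(1)[OF h] group_U_inv(1)[OF group_U_mult[OF g h]]
      using c by (simp add: adj_mult)
    then show ?thesis
      using True conj_skew[OF g True] c adj_closed[OF c(1)] adj_closed[OF c(2)]
      by (simp add: coadj_def lie_u_eq group_U_inv(1)[OF g] group_U_inv(1)[OF h] M.m_assoc)
  qed (simp add: coadj_def lie_u_eq)
qed

lemma coadj_one:
  assumes f: "f \<in> dual_u R n"
  shows "coadj R n \<one>\<^bsub>gl R n\<^esub> f = f"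
proof
  interpret M: ring "gl R n" by (rule gl_ring)
  fix x
  have "f \<in> extensional (lie_u R n)" using f by (auto simp: dual_u_def PiE_def)
  then show "coadj R n \<one>\<^bsub>gl R n\<^esub> f x = f x"
    using skew_carrier[of x n] by (auto simp: coadj_def lie_u_eq extensional_def)
qed

lemma coadj_orbit_self: "f \<in> dual_u R n \<Longrightarrow> f \<in> coadj_orbit R n f"
  unfolding coadj_orbit_def using coadj_one group_U_one by (metis imageI)

lemma coadj_orbit_eq:
  assumes f: "f \<in> dual_u R n" and f': "f' \<in> coadj_orbit R n f"
  shows "coadj_orbit R n f' = coadj_orbit R n f"
proof -
  interpret M: ring "gl R n" by (rule gl_ring)
  obtain g where g: "g \<in> group_U R n" "f' = coadj R n g f" using f' by (auto simp: coadj_orbit_def)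
  have "coadj R n h f' \<in> coadj_orbit R n f" if "h \<in> group_U R n" for h
    using coadj_mult[OF that g(1), of f] group_U_mult[OF that g(1)] g(2) unfolding coadj_orbit_def by (metis imageI)
  moreover have "coadj R n h f \<in> coadj_orbit R n f'" if h: "h \<in> group_U R n" for h
  proof -
    let ?k = "h \<otimes>\<^bsub>gl R n\<^esub> adj R g"
    have k: "?k \<in> group_U R n" using group_U_mult[OF h group_U_inv(4)[OF g(1)]] .
    have "?k \<otimes>\<^bsub>gl R n\<^esub> g = h"
      using group_U_inv(3)[OF g(1)] h[THEN group_U_closed] g(1)[THEN group_U_closed] adj_closed
      by (simp add: M.m_assoc)
    then have "coadj R n h f = coadj R n ?k f'" using coadj_mult[OF k g(1), of f] g(2) by simp
    then show ?thesis using k unfolding coadj_orbit_def by blast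
  qed
  ultimately show ?thesis unfolding coadj_orbit_def by blast
qed

lemma orbit_stabiliser:
  assumes f: "f \<in> dual_u R n" and fin: "finite (carrier R)"
  shows "card (group_U R n) = card (coadj_orbit R n f) * card {g \<in> group_U R n. coadj R n g f = f}"
proof -
  interpret M: ring "gl R n" by (rule gl_ring)
  let ?U = "group_U R n" and ?S = "{g \<in> group_U R n. coadj R n g f = f}"
  have fib: "card {g. g \<in> ?U \<and> coadj R n g f = f'} = card ?S" if f': "f' \<in> coadj_orbit R n f" for f'
  proof -
    obtain h where h: "h \<in> ?U" "f' = coadj R n h f" using f' by (auto simp: coadj_orbit_def)
    note hi = group_U_inv[OF h(1)]
    note hc = group_U_closed[OF h(1)] adj_closed[OF group_U_closed[OF h(1)]]
    have "bij_betw (\<lambda>g. h \<otimes>\<^bsub>gl R n\<^esub> g) ?S {g. g \<in> ?U \<and> coadj R n g f = f'}"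
    proof (rule bij_betw_byWitness[where f' = "\<lambda>g. adj R h \<otimes>\<^bsub>gl R n\<^esub> g"])
      show "\<forall>g\<in>?S. adj R h \<otimes>\<^bsub>gl R n\<^esub> (h \<otimes>\<^bsub>gl R n\<^esub> g) = g"
        using hc hi group_U_closed by (auto simp: M.m_assoc[symmetric])
      show "\<forall>g\<in>{g. g \<in> ?U \<and> coadj R n g f = f'}. h \<otimes>\<^bsub>gl R n\<^esub> (adj R h \<otimes>\<^bsub>gl R n\<^esub> g) = g"
        using hc hi group_U_closed by (auto simp: M.m_assoc[symmetric])
      show "(\<lambda>g. h \<otimes>\<^bsub>gl R n\<^esub> g) ` ?S \<subseteq> {g. g \<in> ?U \<and> coadj R n g f = f'}"
        using h by (auto simp: group_U_mult coadj_mult)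
      have "coadj R n (adj R h) f' = f"
        unfolding h(2) coadj_mult[OF hi(4) h(1), symmetric] hi(3) by (rule coadj_one[OF f])
      then show "(\<lambda>g. adj R h \<otimes>\<^bsub>gl R n\<^esub> g) ` {g. g \<in> ?U \<and> coadj R n g f = f'} \<subseteq> ?S"
        using hi(4) by (auto simp: group_U_mult coadj_mult)
    qed
    then show ?thesis by (simp add: bij_betw_same_card)
  qed
  have "card ?U = (\<Sum>f'\<in>(\<lambda>g. coadj R n g f) ` ?U. \<Sum>g\<in>{g. g \<in> ?U \<and> coadj R n g f = f'}. 1)"
    using sum.image_gen[OF finite_group_U[OF fin], of "\<lambda>_. 1 :: nat" n "\<lambda>g. coadj R n g f"] by simp
  also have "\<dots> = (\<Sum>f'\<in>coadj_orbit R n f. card ?S)"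
    unfolding coadj_orbit_def[symmetric] using fib by (intro sum.cong) auto
  finally show ?thesis by simp
qed

subsection \<open>The Cayley transform\<close>

definition cayley :: "nat \<Rightarrow> (int \<Rightarrow> int \<Rightarrow> 'a) \<Rightarrow> int \<Rightarrow> int \<Rightarrow> 'a" where
  "cayley n x = inv\<^bsub>gl R n\<^esub> (\<one>\<^bsub>gl R n\<^esub> \<ominus>\<^bsub>gl R n\<^esub> x) \<otimes>\<^bsub>gl R n\<^esub> (\<one>\<^bsub>gl R n\<^esub> \<oplus>\<^bsub>gl R n\<^esub> x)"

text \<open>For skew x the anti-automorphism \<open>adj\<close> exchanges 1 - x and 1 + x. As these
  commute with each other and with their inverses, \<open>adj\<close> sends (1 - x)^-1 (1 + x) to
  its inverse, which is the symplectic condition.\<close>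

lemma cayley_group_U:
  assumes x: "x \<in> skew R n"
  shows "cayley n x \<in> group_U R n"
proof -
  interpret M: ring "gl R n" by (rule gl_ring)
  let ?M = "gl R n"
  define a b y where "a = \<one>\<^bsub>?M\<^esub> \<ominus>\<^bsub>?M\<^esub> x" and "b = \<one>\<^bsub>?M\<^esub> \<oplus>\<^bsub>?M\<^esub> x" and "y = inv\<^bsub>?M\<^esub> a"
  note xc = skew_carrier[OF x]
  have u: "a \<in> unitri n" "b \<in> unitri n" unfolding a_def b_def using one_plus_tri_unitri[OF skew_tri[OF x]] by auto
  note c = u[THEN unitri_closed]
  have y: "y \<in> unitri n" "a \<otimes>\<^bsub>?M\<^esub> y = \<one>\<^bsub>?M\<^esub>" "y \<otimes>\<^bsub>?M\<^esub> a = \<one>\<^bsub>?M\<^esub>"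
    unfolding y_def using unitri_unit[OF u(1)] M.Units_r_inv M.Units_l_inv by auto
  note yc = unitri_closed[OF y(1)]
  have adj_ab: "adj R a = b" "adj R b = a"
    unfolding a_def b_def using xc by (simp_all add: adj_uminus adj_plus adj_one skew_adj[OF x] M.minus_eq)
  define y' where "y' = adj R y"
  have y'c: "y' \<in> carrier ?M" unfolding y'_def by (rule adj_closed[OF yc])
  have y': "y' \<otimes>\<^bsub>?M\<^esub> b = \<one>\<^bsub>?M\<^esub>" "b \<otimes>\<^bsub>?M\<^esub> y' = \<one>\<^bsub>?M\<^esub>"
    unfolding y'_def adj_ab(1)[symmetric] adj_mult[OF c(1) yc, symmetric] adj_mult[OF yc c(1), symmetric]
      y(2,3) adj_one by (rule refl)+
  have ab: "a \<otimes>\<^bsub>?M\<^esub> b = b \<otimes>\<^bsub>?M\<^esub> a" unfolding a_def b_def using xc M.one_closed by (algebra, (simp, algebra?)?)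
  have "y' \<otimes>\<^bsub>?M\<^esub> y = y \<otimes>\<^bsub>?M\<^esub> y'"
  proof -
    have "(y' \<otimes>\<^bsub>?M\<^esub> y) \<otimes>\<^bsub>?M\<^esub> (a \<otimes>\<^bsub>?M\<^esub> b) = y' \<otimes>\<^bsub>?M\<^esub> ((y \<otimes>\<^bsub>?M\<^esub> a) \<otimes>\<^bsub>?M\<^esub> b)"
      using c yc y'c by (simp only: M.m_assoc M.m_closed)
    then have l: "(y' \<otimes>\<^bsub>?M\<^esub> y) \<otimes>\<^bsub>?M\<^esub> (a \<otimes>\<^bsub>?M\<^esub> b) = \<one>\<^bsub>?M\<^esub>" using y y' c by simp
    have "(b \<otimes>\<^bsub>?M\<^esub> a) \<otimes>\<^bsub>?M\<^esub> (y \<otimes>\<^bsub>?M\<^esub> y') = b \<otimes>\<^bsub>?M\<^esub> ((a \<otimes>\<^bsub>?M\<^esub> y) \<otimes>\<^bsub>?M\<^esub> y')"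
      using c yc y'c by (simp only: M.m_assoc M.m_closed)
    then have r: "(a \<otimes>\<^bsub>?M\<^esub> b) \<otimes>\<^bsub>?M\<^esub> (y \<otimes>\<^bsub>?M\<^esub> y') = \<one>\<^bsub>?M\<^esub>" using y y' y'c ab by simp
    show ?thesis using M.inv_unique[OF l r] c yc y'c by simp
  qed
  then have "a \<otimes>\<^bsub>?M\<^esub> y' \<otimes>\<^bsub>?M\<^esub> (y \<otimes>\<^bsub>?M\<^esub> b) = (a \<otimes>\<^bsub>?M\<^esub> y) \<otimes>\<^bsub>?M\<^esub> (y' \<otimes>\<^bsub>?M\<^esub> b)"
    using c yc y'c by (metis M.m_assoc M.m_closed)
  then have "adj R (y \<otimes>\<^bsub>?M\<^esub> b) \<otimes>\<^bsub>?M\<^esub> (y \<otimes>\<^bsub>?M\<^esub> b) = \<one>\<^bsub>?M\<^esub>"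
    using y y' c yc by (simp add: adj_mult adj_ab y'_def)
  moreover have "y \<otimes>\<^bsub>?M\<^esub> b \<in> unitri n" using unitri_mult[OF y(1) u(2)] .
  ultimately have "y \<otimes>\<^bsub>?M\<^esub> b \<in> group_U R n" unfolding group_U_unitri by blast
  then show ?thesis by (simp only: cayley_def a_def b_def y_def)
qed

text \<open>Clears the denominator of the transform. The resulting equation is linear in x and can
  be solved for x once 1 + g is invertible.\<close>

lemma cayley_eq_iff:
  assumes x: "x \<in> skew R n" and g: "g \<in> carrier (gl R n)"
  shows "cayley n x = g \<longleftrightarrow>
    x \<otimes>\<^bsub>gl R n\<^esub> (\<one>\<^bsub>gl R n\<^esub> \<oplus>\<^bsub>gl R n\<^esub> g) = g \<ominus>\<^bsub>gl R n\<^esub> \<one>\<^bsub>gl R n\<^esub>"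
proof -
  interpret M: ring "gl R n" by (rule gl_ring)
  let ?M = "gl R n"
  define a b where "a = \<one>\<^bsub>?M\<^esub> \<ominus>\<^bsub>?M\<^esub> x" and "b = \<one>\<^bsub>?M\<^esub> \<oplus>\<^bsub>?M\<^esub> x"
  note xc = skew_carrier[OF x]
  have u: "a \<in> unitri n" unfolding a_def using one_plus_tri_unitri[OF skew_tri[OF x]] by auto
  have bc: "b \<in> carrier ?M" unfolding b_def using xc by simp
  note U = unitri_unit(1)[OF u]
  have "cayley n x = g \<longleftrightarrow> b = a \<otimes>\<^bsub>?M\<^esub> g"
    unfolding cayley_def a_def[symmetric] b_def[symmetric]
    using U bc g M.Units_closed[OF U] M.Units_inv_closed[OF U] M.Units_r_inv[OF U] M.Units_l_inv[OF U]
    by (metis M.l_one M.m_assoc)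
  also have "\<dots> \<longleftrightarrow> x \<otimes>\<^bsub>?M\<^esub> (\<one>\<^bsub>?M\<^esub> \<oplus>\<^bsub>?M\<^esub> g) = g \<ominus>\<^bsub>?M\<^esub> \<one>\<^bsub>?M\<^esub>"
  proof
    assume e: "b = a \<otimes>\<^bsub>?M\<^esub> g"
    have "x \<otimes>\<^bsub>?M\<^esub> (\<one>\<^bsub>?M\<^esub> \<oplus>\<^bsub>?M\<^esub> g) = b \<ominus>\<^bsub>?M\<^esub> a \<otimes>\<^bsub>?M\<^esub> g \<oplus>\<^bsub>?M\<^esub> (g \<ominus>\<^bsub>?M\<^esub> \<one>\<^bsub>?M\<^esub>)"
      unfolding a_def b_def using xc g M.one_closed by (algebra, (simp, algebra?)?)
    also have "\<dots> = g \<ominus>\<^bsub>?M\<^esub> \<one>\<^bsub>?M\<^esub>"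
      unfolding e[symmetric] using bc g by (simp add: M.minus_eq M.r_neg)
    finally show "x \<otimes>\<^bsub>?M\<^esub> (\<one>\<^bsub>?M\<^esub> \<oplus>\<^bsub>?M\<^esub> g) = g \<ominus>\<^bsub>?M\<^esub> \<one>\<^bsub>?M\<^esub>" .
  next
    assume e: "x \<otimes>\<^bsub>?M\<^esub> (\<one>\<^bsub>?M\<^esub> \<oplus>\<^bsub>?M\<^esub> g) = g \<ominus>\<^bsub>?M\<^esub> \<one>\<^bsub>?M\<^esub>"
    have "a \<otimes>\<^bsub>?M\<^esub> g = g \<oplus>\<^bsub>?M\<^esub> x \<ominus>\<^bsub>?M\<^esub> x \<otimes>\<^bsub>?M\<^esub> (\<one>\<^bsub>?M\<^esub> \<oplus>\<^bsub>?M\<^esub> g)"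
      unfolding a_def using xc g M.one_closed by (algebra, (simp, algebra?)?)
    also have "\<dots> = b" unfolding e b_def using xc g M.one_closed by algebra
    finally show "b = a \<otimes>\<^bsub>?M\<^esub> g" by simp
  qed
  finally show ?thesis .
qed

text \<open>1 + g is twice the unitriangular matrix 1 + (g - 1)/2.\<close>

lemma one_plus_unit:
  assumes two: "\<one> \<oplus> \<one> \<noteq> \<zero>" and g: "g \<in> unitri n"
  shows "\<exists>k\<in>tri R n 0. (\<one>\<^bsub>gl R n\<^esub> \<oplus>\<^bsub>gl R n\<^esub> g) \<otimes>\<^bsub>gl R n\<^esub> k = \<one>\<^bsub>gl R n\<^esub> \<and>
    k \<otimes>\<^bsub>gl R n\<^esub> (\<one>\<^bsub>gl R n\<^esub> \<oplus>\<^bsub>gl R n\<^esub> g) = \<one>\<^bsub>gl R n\<^esub>"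
proof -
  interpret M: ring "gl R n" by (rule gl_ring)
  let ?M = "gl R n"
  define half where "half = inv (\<one> \<oplus> \<one>)"
  have half: "half \<in> carrier R" "half \<oplus> half = \<one>"
  proof -
    show h: "half \<in> carrier R" using field_inv_closed[OF _ two] by (simp add: half_def)
    have "half \<oplus> half = (\<one> \<oplus> \<one>) \<otimes> half" using h by (simp add: l_distr)
    then show "half \<oplus> half = \<one>" using field_r_inv[OF _ two] by (simp add: half_def)
  qed
  note c = unitri_closed[OF g]
  define t where "t = half \<odot>\<^bsub>?M\<^esub> (g \<ominus>\<^bsub>?M\<^esub> \<one>\<^bsub>?M\<^esub>)"
  have t: "t \<in> tri R n 1" unfolding t_def using g half(1) by (intro tri_smult) (auto simp: unitri_def)
  have dbl: "half \<odot>\<^bsub>?M\<^esub> z \<oplus>\<^bsub>?M\<^esub> half \<odot>\<^bsub>?M\<^esub> z = z" if "z \<in> carrier ?M" for z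
  proof -
    have "half \<otimes> z a b \<oplus> half \<otimes> z a b = z a b" for a b
      using l_distr[OF half(1) half(1) gl_entry[OF that], symmetric] half(2) gl_entry[OF that] by simp
    then show ?thesis by (simp add: gl_sel)
  qed
  define h where "h = \<one>\<^bsub>?M\<^esub> \<oplus>\<^bsub>?M\<^esub> t"
  have h: "h \<in> unitri n" unfolding h_def using one_plus_tri_unitri(1)[OF t] .
  note hc = unitri_closed[OF h]
  have "half \<odot>\<^bsub>?M\<^esub> (\<one>\<^bsub>?M\<^esub> \<oplus>\<^bsub>?M\<^esub> g) = h"
  proof -
    have sa: "half \<odot>\<^bsub>?M\<^esub> (x \<oplus>\<^bsub>?M\<^esub> y) = half \<odot>\<^bsub>?M\<^esub> x \<oplus>\<^bsub>?M\<^esub> half \<odot>\<^bsub>?M\<^esub> y"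
      if "x \<in> carrier ?M" "y \<in> carrier ?M" for x y
      using half(1) that[THEN gl_entry] by (auto simp: gl_sel r_distr)
    have "\<one>\<^bsub>?M\<^esub> \<oplus>\<^bsub>?M\<^esub> g = (g \<ominus>\<^bsub>?M\<^esub> \<one>\<^bsub>?M\<^esub>) \<oplus>\<^bsub>?M\<^esub> (\<one>\<^bsub>?M\<^esub> \<oplus>\<^bsub>?M\<^esub> \<one>\<^bsub>?M\<^esub>)"
      using c M.one_closed by algebra
    then have "half \<odot>\<^bsub>?M\<^esub> (\<one>\<^bsub>?M\<^esub> \<oplus>\<^bsub>?M\<^esub> g) = t \<oplus>\<^bsub>?M\<^esub> \<one>\<^bsub>?M\<^esub>"
      using sa c dbl[OF M.one_closed] by (simp add: t_def)
    then show ?thesis using tri_carrier[OF t] by (simp add: h_def M.a_comm)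
  qed
  obtain y where y: "y \<in> unitri n" "h \<otimes>\<^bsub>?M\<^esub> y = \<one>\<^bsub>?M\<^esub>" "y \<otimes>\<^bsub>?M\<^esub> h = \<one>\<^bsub>?M\<^esub>"
    using unitri_inverse[OF h] by blast
  note yc = unitri_closed[OF y(1)]
  have "(\<one>\<^bsub>?M\<^esub> \<oplus>\<^bsub>?M\<^esub> g) \<otimes>\<^bsub>?M\<^esub> (half \<odot>\<^bsub>?M\<^esub> y) = \<one>\<^bsub>?M\<^esub>" "(half \<odot>\<^bsub>?M\<^esub> y) \<otimes>\<^bsub>?M\<^esub> (\<one>\<^bsub>?M\<^esub> \<oplus>\<^bsub>?M\<^esub> g) = \<one>\<^bsub>?M\<^esub>"
    using y \<open>half \<odot>\<^bsub>?M\<^esub> (\<one>\<^bsub>?M\<^esub> \<oplus>\<^bsub>?M\<^esub> g) = h\<close> half(1) c yc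
      gl_smult_one_mult[OF half(1), of "\<one>\<^bsub>?M\<^esub> \<oplus>\<^bsub>?M\<^esub> g" n y] gl_smult_one_mult[OF half(1), of y n "\<one>\<^bsub>?M\<^esub> \<oplus>\<^bsub>?M\<^esub> g"]
    by auto
  moreover have "half \<odot>\<^bsub>?M\<^esub> y \<in> tri R n 0" using unitri_tri[OF y(1)] half(1) by (intro tri_smult)
  ultimately show ?thesis by blast
qed

text \<open>The inverse map is g |-> (g - 1)(1 + g)^-1. Its values are skew because
  \<open>adj\<close> inverts the elements of the group.\<close>

lemma cayley_bij:
  assumes two: "\<one> \<oplus> \<one> \<noteq> \<zero>"
  shows "bij_betw (cayley n) (skew R n) (group_U R n)"
proof (rule bij_betw_imageI)
  interpret M: ring "gl R n" by (rule gl_ring)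
  let ?M = "gl R n"
  show "inj_on (cayley n) (skew R n)"
  proof (rule inj_onI)
    fix x y assume x: "x \<in> skew R n" and y: "y \<in> skew R n" and e: "cayley n x = cayley n y"
    define g where "g = cayley n y"
    have g: "g \<in> group_U R n" unfolding g_def by (rule cayley_group_U[OF y])
    have gu: "g \<in> unitri n" using g by (simp add: group_U_unitri)
    note gc = unitri_closed[OF gu]
    obtain k where k: "k \<in> tri R n 0" "(\<one>\<^bsub>?M\<^esub> \<oplus>\<^bsub>?M\<^esub> g) \<otimes>\<^bsub>?M\<^esub> k = \<one>\<^bsub>?M\<^esub>"
      using one_plus_unit[OF two gu] by blast
    have "x \<otimes>\<^bsub>?M\<^esub> (\<one>\<^bsub>?M\<^esub> \<oplus>\<^bsub>?M\<^esub> g) = y \<otimes>\<^bsub>?M\<^esub> (\<one>\<^bsub>?M\<^esub> \<oplus>\<^bsub>?M\<^esub> g)"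
      using cayley_eq_iff[OF x gc] cayley_eq_iff[OF y gc] e by (simp add: g_def)
    then have "x \<otimes>\<^bsub>?M\<^esub> ((\<one>\<^bsub>?M\<^esub> \<oplus>\<^bsub>?M\<^esub> g) \<otimes>\<^bsub>?M\<^esub> k) = y \<otimes>\<^bsub>?M\<^esub> ((\<one>\<^bsub>?M\<^esub> \<oplus>\<^bsub>?M\<^esub> g) \<otimes>\<^bsub>?M\<^esub> k)"
      using skew_carrier[OF x] skew_carrier[OF y] gc tri_carrier[OF k(1)]
      by (simp add: M.m_assoc[symmetric])
    then show "x = y" using k(2) skew_carrier[OF x] skew_carrier[OF y] by simp
  qed
  show "cayley n ` skew R n = group_U R n"
  proof (intro equalityI image_subsetI cayley_group_U subsetI)
    fix g assume g: "g \<in> group_U R n"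
    have gu: "g \<in> unitri n" using g by (simp add: group_U_unitri)
    note gc = unitri_closed[OF gu] and gi = group_U_inv[OF g]
    note ac = adj_closed[OF gc]
    obtain k where k: "k \<in> tri R n 0" "(\<one>\<^bsub>?M\<^esub> \<oplus>\<^bsub>?M\<^esub> g) \<otimes>\<^bsub>?M\<^esub> k = \<one>\<^bsub>?M\<^esub>" "k \<otimes>\<^bsub>?M\<^esub> (\<one>\<^bsub>?M\<^esub> \<oplus>\<^bsub>?M\<^esub> g) = \<one>\<^bsub>?M\<^esub>"
      using one_plus_unit[OF two gu] by blast
    note kc = tri_carrier[OF k(1)]
    define x where "x = (g \<ominus>\<^bsub>?M\<^esub> \<one>\<^bsub>?M\<^esub>) \<otimes>\<^bsub>?M\<^esub> k"
    have "x \<in> tri R n (1 + 0)" unfolding x_def using gu k(1) by (intro tri_mult) (auto simp: unitri_def)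
    then have xt: "x \<in> tri R n 1" by simp
    note xc = tri_carrier[OF xt]
    have xg: "x \<otimes>\<^bsub>?M\<^esub> (\<one>\<^bsub>?M\<^esub> \<oplus>\<^bsub>?M\<^esub> g) = g \<ominus>\<^bsub>?M\<^esub> \<one>\<^bsub>?M\<^esub>"
      unfolding x_def using gc kc k(3) by (simp add: M.m_assoc)
    have gx: "(\<one>\<^bsub>?M\<^esub> \<oplus>\<^bsub>?M\<^esub> g) \<otimes>\<^bsub>?M\<^esub> x = g \<ominus>\<^bsub>?M\<^esub> \<one>\<^bsub>?M\<^esub>"
    proof -
      have "(\<one>\<^bsub>?M\<^esub> \<oplus>\<^bsub>?M\<^esub> g) \<otimes>\<^bsub>?M\<^esub> x = (\<one>\<^bsub>?M\<^esub> \<oplus>\<^bsub>?M\<^esub> g) \<otimes>\<^bsub>?M\<^esub> (g \<ominus>\<^bsub>?M\<^esub> \<one>\<^bsub>?M\<^esub>) \<otimes>\<^bsub>?M\<^esub> k"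
        unfolding x_def using gc kc by (simp add: M.m_assoc)
      also have "(\<one>\<^bsub>?M\<^esub> \<oplus>\<^bsub>?M\<^esub> g) \<otimes>\<^bsub>?M\<^esub> (g \<ominus>\<^bsub>?M\<^esub> \<one>\<^bsub>?M\<^esub>) = (g \<ominus>\<^bsub>?M\<^esub> \<one>\<^bsub>?M\<^esub>) \<otimes>\<^bsub>?M\<^esub> (\<one>\<^bsub>?M\<^esub> \<oplus>\<^bsub>?M\<^esub> g)"
        using gc M.one_closed by (algebra, (simp, algebra?)?)
      also have "\<dots> \<otimes>\<^bsub>?M\<^esub> k = (g \<ominus>\<^bsub>?M\<^esub> \<one>\<^bsub>?M\<^esub>) \<otimes>\<^bsub>?M\<^esub> ((\<one>\<^bsub>?M\<^esub> \<oplus>\<^bsub>?M\<^esub> g) \<otimes>\<^bsub>?M\<^esub> k)"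
        using gc kc by (simp add: M.m_assoc)
      finally show ?thesis using k(2) gc by simp
    qed
    define x' where "x' = adj R x"
    have x'c: "x' \<in> carrier ?M" unfolding x'_def by (rule adj_closed[OF xc])
    \<comment> \<open>Applying \<open>adj\<close> to x (1 + g) = g - 1 and multiplying by g from the
      left gives (1 + g) x' = 1 - g, which is -(1 + g) x; then 1 + g is cancelled.\<close>
    have "adj R (x \<otimes>\<^bsub>?M\<^esub> (\<one>\<^bsub>?M\<^esub> \<oplus>\<^bsub>?M\<^esub> g)) = adj R (g \<ominus>\<^bsub>?M\<^esub> \<one>\<^bsub>?M\<^esub>)" using xg by simp
    then have e: "(\<one>\<^bsub>?M\<^esub> \<oplus>\<^bsub>?M\<^esub> adj R g) \<otimes>\<^bsub>?M\<^esub> x' = adj R g \<ominus>\<^bsub>?M\<^esub> \<one>\<^bsub>?M\<^esub>"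
      using xc gc by (simp add: adj_mult adj_plus adj_minus adj_one x'_def)
    have "(\<one>\<^bsub>?M\<^esub> \<oplus>\<^bsub>?M\<^esub> g) \<otimes>\<^bsub>?M\<^esub> x' = g \<otimes>\<^bsub>?M\<^esub> ((\<one>\<^bsub>?M\<^esub> \<oplus>\<^bsub>?M\<^esub> adj R g) \<otimes>\<^bsub>?M\<^esub> x')"
    proof -
      have "g \<otimes>\<^bsub>?M\<^esub> ((\<one>\<^bsub>?M\<^esub> \<oplus>\<^bsub>?M\<^esub> adj R g) \<otimes>\<^bsub>?M\<^esub> x') = (g \<oplus>\<^bsub>?M\<^esub> g \<otimes>\<^bsub>?M\<^esub> adj R g) \<otimes>\<^bsub>?M\<^esub> x'"
        using gc ac x'c by (simp add: M.m_assoc[symmetric] M.r_distr)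
      then show ?thesis using gi(2) gc by (simp add: M.a_comm)
    qed
    also have "\<dots> = g \<otimes>\<^bsub>?M\<^esub> adj R g \<ominus>\<^bsub>?M\<^esub> g" unfolding e using gc ac M.one_closed by (algebra, (simp, algebra?)?)
    also have "\<dots> = \<ominus>\<^bsub>?M\<^esub> ((\<one>\<^bsub>?M\<^esub> \<oplus>\<^bsub>?M\<^esub> g) \<otimes>\<^bsub>?M\<^esub> x)"
      unfolding gx gi(2) using gc M.one_closed by algebra
    finally have "k \<otimes>\<^bsub>?M\<^esub> ((\<one>\<^bsub>?M\<^esub> \<oplus>\<^bsub>?M\<^esub> g) \<otimes>\<^bsub>?M\<^esub> x') = k \<otimes>\<^bsub>?M\<^esub> ((\<one>\<^bsub>?M\<^esub> \<oplus>\<^bsub>?M\<^esub> g) \<otimes>\<^bsub>?M\<^esub> (\<ominus>\<^bsub>?M\<^esub> x))"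
      using gc xc by (simp add: M.r_minus)
    then have "x' = \<ominus>\<^bsub>?M\<^esub> x"
      using k(3) kc gc xc x'c by (simp add: M.m_assoc[symmetric])
    then have "x \<in> skew R n" using xt by (simp add: skew_def x'_def)
    moreover have "cayley n x = g" using cayley_eq_iff[OF calculation gc] xg by simp
    ultimately show "g \<in> cayley n ` skew R n" by blast
  qed
qed

text \<open>Substitute \<open>y = (1 + x) z (1 - x)\<close>: then \<open>g\<^sup>-\<^sup>1 y g = (1 - x) z (1 + x)\<close> for
  \<open>g = (1 - x)\<^sup>-\<^sup>1 (1 + x)\<close>, and the difference of the two is \<open>2 (x z - z x)\<close>.\<close>

lemma cayley_stabiliser:
  assumes f: "f \<in> dual_u R n" and two: "\<one> \<oplus> \<one> \<noteq> \<zero>" and x: "x \<in> skew R n"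
  shows "coadj R n (cayley n x) f = f \<longleftrightarrow> (\<forall>z\<in>skew R n. f (bracket R n x z) = \<zero>)"
proof -
  interpret M: ring "gl R n" by (rule gl_ring)
  let ?M = "gl R n"
  define g a b where "g = cayley n x" and "a = \<one>\<^bsub>?M\<^esub> \<ominus>\<^bsub>?M\<^esub> x" and "b = \<one>\<^bsub>?M\<^esub> \<oplus>\<^bsub>?M\<^esub> x"
  note xc = skew_carrier[OF x]
  have u: "a \<in> unitri n" "b \<in> unitri n" unfolding a_def b_def using one_plus_tri_unitri[OF skew_tri[OF x]] by auto
  note c = u[THEN unitri_closed] and U = u[THEN unitri_unit(1)]
  define a' b' where "a' = inv\<^bsub>?M\<^esub> a" and "b' = inv\<^bsub>?M\<^esub> b"
  have i: "a' \<in> unitri n" "b' \<in> unitri n" "a \<otimes>\<^bsub>?M\<^esub> a' = \<one>\<^bsub>?M\<^esub>" "a' \<otimes>\<^bsub>?M\<^esub> a = \<one>\<^bsub>?M\<^esub>"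
    "b \<otimes>\<^bsub>?M\<^esub> b' = \<one>\<^bsub>?M\<^esub>" "b' \<otimes>\<^bsub>?M\<^esub> b = \<one>\<^bsub>?M\<^esub>"
    unfolding a'_def b'_def using u[THEN unitri_unit(2)] U M.Units_r_inv M.Units_l_inv by auto
  note ic = i(1,2)[THEN unitri_closed]
  have gU: "g \<in> group_U R n" unfolding g_def by (rule cayley_group_U[OF x])
  note gc = group_U_closed[OF gU]
  have g: "g = a' \<otimes>\<^bsub>?M\<^esub> b" by (simp add: g_def cayley_def a'_def a_def b_def)
  have ab: "a \<otimes>\<^bsub>?M\<^esub> b = b \<otimes>\<^bsub>?M\<^esub> a" unfolding a_def b_def using xc M.one_closed by (algebra, (simp, algebra?)?)
  have adj_ab: "adj R a = b" "adj R b = a"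
    unfolding a_def b_def using xc by (simp_all add: adj_uminus adj_plus adj_one skew_adj[OF x] M.minus_eq)
  have adj_inv: "adj R a' = b'" "adj R b' = a'"
  proof -
    have e: "adj R a' \<otimes>\<^bsub>?M\<^esub> b = \<one>\<^bsub>?M\<^esub>"
      unfolding adj_ab(1)[symmetric] adj_mult[OF c(1) ic(1), symmetric] i(3) adj_one by (rule refl)
    show "adj R a' = b'" using M.inv_unique[OF e i(5)] c ic adj_closed by blast
    then show "adj R b' = a'" using adj_adj[OF ic(1)] by simp
  qed
  have gi: "inv\<^bsub>?M\<^esub> g = b' \<otimes>\<^bsub>?M\<^esub> a"
  proof -
    have "b' \<otimes>\<^bsub>?M\<^esub> a = b' \<otimes>\<^bsub>?M\<^esub> (a \<otimes>\<^bsub>?M\<^esub> b) \<otimes>\<^bsub>?M\<^esub> b'" using c ic i(5) by (simp add: M.m_assoc)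
    also have "\<dots> = (b' \<otimes>\<^bsub>?M\<^esub> b) \<otimes>\<^bsub>?M\<^esub> a \<otimes>\<^bsub>?M\<^esub> b'" unfolding ab using c ic by (simp add: M.m_assoc)
    finally have "b' \<otimes>\<^bsub>?M\<^esub> a = a \<otimes>\<^bsub>?M\<^esub> b'" using c i(6) by simp
    then show ?thesis
      unfolding group_U_inv(1)[OF gU] unfolding g using c ic by (simp add: adj_mult adj_ab adj_inv)
  qed
  have gi_ba: "inv\<^bsub>?M\<^esub> g \<otimes>\<^bsub>?M\<^esub> b = a"
  proof -
    have "b' \<otimes>\<^bsub>?M\<^esub> a \<otimes>\<^bsub>?M\<^esub> b = b' \<otimes>\<^bsub>?M\<^esub> (b \<otimes>\<^bsub>?M\<^esub> a)" using c ic by (simp add: M.m_assoc ab)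
    also have "\<dots> = (b' \<otimes>\<^bsub>?M\<^esub> b) \<otimes>\<^bsub>?M\<^esub> a" using c ic by (simp add: M.m_assoc)
    finally show ?thesis unfolding gi using i(6) c by simp
  qed
  have ag: "a \<otimes>\<^bsub>?M\<^esub> g = b"
    unfolding g using c ic i(3) by (simp add: M.m_assoc[symmetric])
  \<comment> \<open>As \<open>b\<close> is \<open>adj\<close> of \<open>a\<close>, the substitution
    preserves skewness; so does the reverse substitution by the inverses, for the same
    reason.\<close>
  have sub: "b \<otimes>\<^bsub>?M\<^esub> z \<otimes>\<^bsub>?M\<^esub> a \<in> skew R n" "b' \<otimes>\<^bsub>?M\<^esub> z \<otimes>\<^bsub>?M\<^esub> a' \<in> skew R n" if z: "z \<in> skew R n" for z
  proof -
    note zc = skew_carrier[OF z]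
    have "b \<otimes>\<^bsub>?M\<^esub> z \<otimes>\<^bsub>?M\<^esub> a \<in> tri R n (0 + 1 + 0)" "b' \<otimes>\<^bsub>?M\<^esub> z \<otimes>\<^bsub>?M\<^esub> a' \<in> tri R n (0 + 1 + 0)"
      by (rule tri_mult[OF tri_mult[OF unitri_tri[OF u(2)] skew_tri[OF z]] unitri_tri[OF u(1)]]
        tri_mult[OF tri_mult[OF unitri_tri[OF i(2)] skew_tri[OF z]] unitri_tri[OF i(1)]])+
    then show "b \<otimes>\<^bsub>?M\<^esub> z \<otimes>\<^bsub>?M\<^esub> a \<in> skew R n" "b' \<otimes>\<^bsub>?M\<^esub> z \<otimes>\<^bsub>?M\<^esub> a' \<in> skew R n"
      using c ic zc
      by (simp_all add: skew_def adj_mult adj_ab adj_inv skew_adj[OF z] M.m_assoc M.l_minus M.r_minus)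
  qed
  have val: "coadj R n g f (b \<otimes>\<^bsub>?M\<^esub> z \<otimes>\<^bsub>?M\<^esub> a) = f (a \<otimes>\<^bsub>?M\<^esub> z \<otimes>\<^bsub>?M\<^esub> b)
      \<and> a \<otimes>\<^bsub>?M\<^esub> z \<otimes>\<^bsub>?M\<^esub> b \<in> skew R n" if z: "z \<in> skew R n" for z
  proof -
    note zc = skew_carrier[OF z]
    have "inv\<^bsub>?M\<^esub> g \<otimes>\<^bsub>?M\<^esub> (b \<otimes>\<^bsub>?M\<^esub> z \<otimes>\<^bsub>?M\<^esub> a) \<otimes>\<^bsub>?M\<^esub> g =
        (inv\<^bsub>?M\<^esub> g \<otimes>\<^bsub>?M\<^esub> b) \<otimes>\<^bsub>?M\<^esub> z \<otimes>\<^bsub>?M\<^esub> (a \<otimes>\<^bsub>?M\<^esub> g)"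
      using c ic zc gc unfolding gi by (simp add: M.m_assoc)
    then have e: "inv\<^bsub>?M\<^esub> g \<otimes>\<^bsub>?M\<^esub> (b \<otimes>\<^bsub>?M\<^esub> z \<otimes>\<^bsub>?M\<^esub> a) \<otimes>\<^bsub>?M\<^esub> g = a \<otimes>\<^bsub>?M\<^esub> z \<otimes>\<^bsub>?M\<^esub> b"
      unfolding gi_ba ag .
    show ?thesis using conj_skew[OF gU sub(1)[OF z]] sub(1)[OF z] e by (simp add: coadj_def lie_u_eq)
  qed
  have diff: "f (b \<otimes>\<^bsub>?M\<^esub> z \<otimes>\<^bsub>?M\<^esub> a) = f (a \<otimes>\<^bsub>?M\<^esub> z \<otimes>\<^bsub>?M\<^esub> b) \<oplus> (f (bracket R n x z) \<oplus> f (bracket R n x z))"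
    if z: "z \<in> skew R n" for z
  proof -
    note zc = skew_carrier[OF z] and bs = bracket_skew[OF x z]
    have "b \<otimes>\<^bsub>?M\<^esub> z \<otimes>\<^bsub>?M\<^esub> a = a \<otimes>\<^bsub>?M\<^esub> z \<otimes>\<^bsub>?M\<^esub> b \<oplus>\<^bsub>?M\<^esub> (bracket R n x z \<oplus>\<^bsub>?M\<^esub> bracket R n x z)"
      unfolding a_def b_def bracket_def using xc zc M.one_closed by (algebra, (simp, algebra?)?)
    then show ?thesis using val[OF z] bs f by (simp add: dual_add skew_add)
  qed
  have dbl: "v \<oplus> (w \<oplus> w) = v \<longleftrightarrow> w = \<zero>" if "v \<in> carrier R" "w \<in> carrier R" for v w
  proof
    assume "v \<oplus> (w \<oplus> w) = v"
    then have "w \<oplus> w = \<zero>" using that by (metis a_closed r_neg1 l_neg)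
    moreover have "w \<oplus> w = (\<one> \<oplus> \<one>) \<otimes> w" using that by (simp add: l_distr)
    ultimately show "w = \<zero>" using two that integral_iff[of "\<one> \<oplus> \<one>" w] by simp
  qed (use that in simp)
  have fext: "f \<in> extensional (lie_u R n)" using f by (auto simp: dual_u_def PiE_def)
  \<comment> \<open>Invariance of f may be tested on the elements b z a alone, since every skew y
    has this form with z = b' y a'.\<close>
  have "coadj R n g f = f \<longleftrightarrow> (\<forall>z\<in>skew R n. coadj R n g f (b \<otimes>\<^bsub>?M\<^esub> z \<otimes>\<^bsub>?M\<^esub> a) = f (b \<otimes>\<^bsub>?M\<^esub> z \<otimes>\<^bsub>?M\<^esub> a))"
  proof (intro iffI ballI)
    assume all: "\<forall>z\<in>skew R n. coadj R n g f (b \<otimes>\<^bsub>?M\<^esub> z \<otimes>\<^bsub>?M\<^esub> a) = f (b \<otimes>\<^bsub>?M\<^esub> z \<otimes>\<^bsub>?M\<^esub> a)"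
    show "coadj R n g f = f"
    proof
      fix y
      show "coadj R n g f y = f y"
      proof (cases "y \<in> skew R n")
        case y: True
        note yc = skew_carrier[OF y]
        have "b \<otimes>\<^bsub>?M\<^esub> (b' \<otimes>\<^bsub>?M\<^esub> y \<otimes>\<^bsub>?M\<^esub> a') \<otimes>\<^bsub>?M\<^esub> a = (b \<otimes>\<^bsub>?M\<^esub> b') \<otimes>\<^bsub>?M\<^esub> y \<otimes>\<^bsub>?M\<^esub> (a' \<otimes>\<^bsub>?M\<^esub> a)"
          using c ic yc by (simp add: M.m_assoc)
        also have "\<dots> = y" using i yc by simp
        finally show ?thesis using all sub(2)[OF y] by force
      qed (use fext in \<open>simp add: coadj_def lie_u_eq extensional_def\<close>)
    qed
  qed simp
  also have "\<dots> \<longleftrightarrow> (\<forall>z\<in>skew R n. f (bracket R n x z) = \<zero>)"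
  proof (rule ball_cong[OF refl])
    fix z assume z: "z \<in> skew R n"
    show "coadj R n g f (b \<otimes>\<^bsub>?M\<^esub> z \<otimes>\<^bsub>?M\<^esub> a) = f (b \<otimes>\<^bsub>?M\<^esub> z \<otimes>\<^bsub>?M\<^esub> a) \<longleftrightarrow> f (bracket R n x z) = \<zero>"
      using val[OF z] diff[OF z] dbl[OF dual_closed[OF f conjunct2[OF val[OF z]]] dual_closed[OF f bracket_skew[OF x z]]]
      by metis
  qed
  finally show ?thesis by (simp only: g_def)
qed

text \<open>The transform gives the group as many elements as the Lie algebra, and the stabiliser as
  many as the radical. With D = dim of the Lie algebra, the orbit size is q^D divided by q^(D -
  d).\<close>

lemma card_coadj_orbit:
  assumes f: "f \<in> dual_u R n" and fin: "finite (carrier R)" and two: "\<one> \<oplus> \<one> \<noteq> \<zero>"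
  shows "card (coadj_orbit R n f) = card (carrier R) ^ orbit_dim R n f"
proof -
  let ?q = "card (carrier R)" and ?D = "2 * (n choose 2) + n"
  let ?Rad = "{x \<in> skew R n. \<forall>z\<in>skew R n. f (bracket R n x z) = \<zero>}"
  have q1: "?q > 1" using card_carrier_gt_1[OF fin] .
  have rc: "root_coeff x \<alpha> \<in> carrier R" if "x \<in> skew R n" for x \<alpha>
    using root_coeff_closed[OF skew_carrier[OF that]] .
  let ?co = "\<lambda>x \<alpha>. if \<alpha> \<in> pos_roots n then root_coeff x \<alpha> else \<zero>"
  have co: "?co x \<in> vecs R (pos_roots n) \<and> root_comb n (?co x) = x" if x: "x \<in> skew R n" for x
  proof
    interpret M: ring "gl R n" by (rule gl_ring)
    show "?co x \<in> vecs R (pos_roots n)" using rc[OF x] by (simp add: vecs_def)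
    have "root_comb n (?co x) = root_comb n (root_coeff x)"
      unfolding root_comb_def using rc[OF x] skew_carrier[OF root_vec_skew]
      by (intro M.finsum_cong') (auto intro: gl_smult_closed)
    then show "root_comb n (?co x) = x" using skew_root_comb[OF x] by simp
  qed
  have bij: "bij_betw (root_comb n) (vecs R (pos_roots n)) (skew R n)"
  proof (rule bij_betw_byWitness[where f' = ?co])
    show "\<forall>c\<in>vecs R (pos_roots n). ?co (root_comb n c) = c"
    proof (intro ballI ext)
      fix c \<alpha> assume c: "c \<in> vecs R (pos_roots n)"
      show "?co (root_comb n c) \<alpha> = c \<alpha>"
        using root_coeff_comb[where c = c, OF vecs_closed[OF c], of \<alpha> n] vecs_off[OF c, of \<alpha>] by simp
    qed
    show "root_comb n ` vecs R (pos_roots n) \<subseteq> skew R n"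
      by (intro image_subsetI root_comb_skew) (rule vecs_closed)
  qed (use co in auto)
  have cs: "card (skew R n) = ?q ^ ?D"
    using bij_betw_same_card[OF bij] by (simp add: card_vecs card_pos_roots)
  \<comment> \<open>In coordinates, the left kernel of the Gram matrix is the radical of the
    bilinear form.\<close>
  have "root_comb n ` lker R (pos_roots n) (pos_roots n) (gram n f) = ?Rad"
  proof -
    have iff: "root_comb n c \<in> ?Rad \<longleftrightarrow> c \<in> lker R (pos_roots n) (pos_roots n) (gram n f)"
      if c: "c \<in> vecs R (pos_roots n)" for c
    proof -
      have cc: "c \<alpha> \<in> carrier R" for \<alpha> using c by (rule vecs_closed)
      note s = root_comb_skew[where c = c and n = n, OF cc]
      have "(\<forall>z\<in>skew R n. f (bracket R n (root_comb n c) z) = \<zero>) \<longleftrightarrow>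
        (\<forall>\<beta>\<in>pos_roots n. f (bracket R n (root_comb n c) (root_vec R n \<beta>)) = \<zero>)"
      proof (intro iffI ballI)
        fix z assume all: "\<forall>\<beta>\<in>pos_roots n. f (bracket R n (root_comb n c) (root_vec R n \<beta>)) = \<zero>"
          and z: "z \<in> skew R n"
        have "f (bracket R n (root_comb n c) (root_comb n (root_coeff z))) =
          (\<Oplus>\<beta>\<in>pos_roots n. root_coeff z \<beta> \<otimes> f (bracket R n (root_comb n c) (root_vec R n \<beta>)))"
          using f s rc[OF z] by (rule dual_bracket_comb_right)
        also have "\<dots> = \<zero>" using all rc[OF z] by (intro add.finprod_one_eqI) simp
        finally show "f (bracket R n (root_comb n c) z) = \<zero>" unfolding skew_root_comb[OF z] .
      qed (simp add: root_vec_skew)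
      also have "\<dots> \<longleftrightarrow> (\<forall>\<beta>\<in>pos_roots n. (\<Oplus>\<alpha>\<in>pos_roots n. c \<alpha> \<otimes> gram n f \<alpha> \<beta>) = \<zero>)"
        unfolding gram_def using dual_bracket_comb_left[where c = c, OF f root_vec_skew cc] by simp
      finally show ?thesis using c s by (simp add: lker_def)
    qed
    show ?thesis
    proof (intro equalityI subsetI)
      fix x assume "x \<in> root_comb n ` lker R (pos_roots n) (pos_roots n) (gram n f)"
      then show "x \<in> ?Rad" using iff lker_vecs by blast
    next
      fix x assume x: "x \<in> ?Rad"
      then have "x \<in> skew R n" by blast
      then have "?co x \<in> lker R (pos_roots n) (pos_roots n) (gram n f)"
        using co[of x] iff[of "?co x"] x by simp
      then show "x \<in> root_comb n ` lker R (pos_roots n) (pos_roots n) (gram n f)"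
        by (rule image_eqI[where b = x and f = "root_comb n" and x = "?co x",
          OF conjunct2[OF co[OF \<open>x \<in> skew R n\<close>], symmetric]])
    qed
  qed
  moreover have "inj_on (root_comb n) (lker R (pos_roots n) (pos_roots n) (gram n f))"
    by (rule inj_on_subset[OF bij_betw_imp_inj_on[OF bij]]) (auto simp: lker_def)
  ultimately have cr: "card ?Rad = ?q ^ (?D - orbit_dim R n f)"
    using card_lker_gram(1)[OF f fin] card_image by metis
  have "bij_betw (cayley n) ?Rad {g \<in> group_U R n. coadj R n g f = f}"
    unfolding bij_betw_def
  proof
    show "inj_on (cayley n) ?Rad"
      by (rule inj_on_subset[OF bij_betw_imp_inj_on[OF cayley_bij[OF two]]]) auto
    have im: "cayley n ` skew R n = group_U R n" using cayley_bij[OF two] by (rule bij_betw_imp_surj_on)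
    show "cayley n ` ?Rad = {g \<in> group_U R n. coadj R n g f = f}"
      unfolding im[symmetric] using cayley_stabiliser[OF f two] by auto
  qed
  then have "card {g \<in> group_U R n. coadj R n g f = f} = ?q ^ (?D - orbit_dim R n f)"
    using cr by (simp add: bij_betw_same_card[symmetric])
  moreover have "card (group_U R n) = ?q ^ ?D"
    using bij_betw_same_card[OF cayley_bij[OF two]] cs by simp
  ultimately have "card (coadj_orbit R n f) * ?q ^ (?D - orbit_dim R n f) =
      ?q ^ orbit_dim R n f * ?q ^ (?D - orbit_dim R n f)"
    using orbit_stabiliser[OF f fin] card_lker_gram(2)[OF f fin] by (simp flip: power_add)
  then show ?thesis using q1 by simp
qed

subsection \<open>Counting the subregular orbits\<close>

lemma finite_dual: "finite (carrier R) \<Longrightarrow> finite (dual_u R n)"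
  using bij_betw_finite[OF dual_bij[of n]] finite_vecs[OF finite_pos_roots] by blast

text \<open>Write P for the value of the polynomial and T for n choose 2. There are q^T choices on
  \<open>diff_roots n\<close> and P q^(T-2) symmetric parts, hence P q^(2T-2) subregular forms.
  Dimension 2T - 1 does not occur, so the submaximal dimension is 2T - 2; every such orbit has
  q^(2T-2) elements, which leaves P orbits.\<close>

lemma card_submax_orbits:
  assumes fin: "finite (carrier R)" and two: "\<one> \<oplus> \<one> \<noteq> \<zero>" and n: "n \<ge> 2"
  shows "card (submax_orbits R n) = poly (subregular_poly n) (card (carrier R) - 1)"
proof -
  define q T where "q = card (carrier R)" and "T = n choose 2"
  define k where "k f = card (stab R {1..n} (sym_part n f))" for f
  have q1: "q > 1" using card_carrier_gt_1[OF fin] by (simp add: q_def)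
  note fD = finite_dual[OF fin, of n]
  have dim: "k f = 1 \<Longrightarrow> orbit_dim R n f = 2 * T" "k f = q \<Longrightarrow> orbit_dim R n f + 2 = 2 * T"
    "k f \<noteq> 1 \<Longrightarrow> k f \<noteq> q \<Longrightarrow> orbit_dim R n f + 3 \<le> 2 * T" if "f \<in> dual_u R n" for f
    using orbit_dim_by_stab[OF that fin two] by (auto simp: k_def q_def T_def)
  have count1: "card {f \<in> dual_u R n. k f = 1} = q ^ T * (poly (regular_poly n) (q - 1) * q ^ T)"
    unfolding k_def card_dual_sym_part[OF fin two, of n "\<lambda>\<sigma>. card (stab R {1..n} \<sigma>) = 1"]
    using card_symm_with_stab(1)[OF fin two, of "{1..n}" n] by (simp add: q_def T_def)
  have countq: "card {f \<in> dual_u R n. k f = q} * q ^ 2 = q ^ T * (poly (subregular_poly n) (q - 1) * q ^ T)"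
    unfolding k_def card_dual_sym_part[OF fin two, of n "\<lambda>\<sigma>. card (stab R {1..n} \<sigma>) = q"]
    using card_symm_with_stab(2)[OF fin two, of "{1..n}" n] by (simp add: q_def T_def mult.assoc)
  have "card {f \<in> dual_u R n. k f = 1} > 0" unfolding count1 using poly_regular_pos[of "q - 1" n] q1 by simp
  then obtain f1 where f1: "f1 \<in> dual_u R n" "k f1 = 1" by (auto simp: card_gt_0_iff)
  have "card {f \<in> dual_u R n. k f = q} * q ^ 2 > 0"
    unfolding countq using poly_subregular_pos[of "q - 1" n] q1 n by simp
  then obtain fq where fq: "fq \<in> dual_u R n" "k fq = q" by (auto simp: card_gt_0_iff)
  have le: "orbit_dim R n f \<le> 2 * T" if "f \<in> dual_u R n" for f
    using dim[OF that] by (cases "k f = 1"; cases "k f = q") auto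
  have max: "max_dim R n = 2 * T"
    unfolding max_dim_def using fD le dim(1)[OF f1] f1 by (intro Max_eqI) (auto intro: rev_image_eqI)
  have sub: "submax_dim R n = 2 * T - 2"
    unfolding submax_dim_def max
  proof (rule Max_eqI)
    show "finite {d \<in> orbit_dim R n ` dual_u R n. d < 2 * T}" using fD by simp
    show "2 * T - 2 \<in> {d \<in> orbit_dim R n ` dual_u R n. d < 2 * T}"
      using dim(2)[OF fq] fq(1) by (auto intro: rev_image_eqI)
    fix d assume "d \<in> {d \<in> orbit_dim R n ` dual_u R n. d < 2 * T}"
    then obtain f where f: "f \<in> dual_u R n" "d = orbit_dim R n f" "d < 2 * T" by auto
    show "d \<le> 2 * T - 2" using dim[OF f(1)] f(2,3) by (cases "k f = 1"; cases "k f = q") auto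
  qed
  have T2: "2 * T \<ge> 2" using dim(2)[OF fq] by simp
  define X where "X = {f \<in> dual_u R n. orbit_dim R n f = 2 * T - 2}"
  have X: "X = {f \<in> dual_u R n. k f = q}"
  proof (intro equalityI subsetI)
    fix f assume "f \<in> X"
    then have f: "f \<in> dual_u R n" "orbit_dim R n f = 2 * T - 2" by (auto simp: X_def)
    then show "f \<in> {f \<in> dual_u R n. k f = q}"
      using dim[OF f(1)] T2 by (cases "k f = 1"; cases "k f = q") auto
  next
    fix f assume "f \<in> {f \<in> dual_u R n. k f = q}"
    then show "f \<in> X" using dim(2)[of f] by (auto simp: X_def)
  qed
  have orb: "submax_orbits R n = coadj_orbit R n ` X"
    unfolding submax_orbits_def sub X_def by auto
  have fX: "finite X" unfolding X_def using fD by simp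
  \<comment> \<open>That the dimension is constant along an orbit is read off the orbit size, a
    power of q with the dimension as exponent.\<close>
  have orbX: "coadj_orbit R n f \<subseteq> X" if f: "f \<in> X" for f
  proof
    fix f' assume f': "f' \<in> coadj_orbit R n f"
    have fd: "f \<in> dual_u R n" using f by (simp add: X_def)
    have fd': "f' \<in> dual_u R n" using f' coadj_dual[OF _ fd] by (auto simp: coadj_orbit_def)
    have "q ^ orbit_dim R n f' = q ^ orbit_dim R n f"
      unfolding q_def card_coadj_orbit[OF fd fin two, symmetric] card_coadj_orbit[OF fd' fin two, symmetric]
        coadj_orbit_eq[OF fd f'] by (rule refl)
    then have "orbit_dim R n f' = orbit_dim R n f" using q1 by (simp only: power_inject_exp)
    then show "f' \<in> X" using fd' f by (simp add: X_def)
  qed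
  have un: "\<Union> (submax_orbits R n) = X"
    unfolding orb using orbX coadj_orbit_self by (fastforce simp: X_def)
  have "q ^ (2 * T - 2) * card (submax_orbits R n) = card (\<Union> (submax_orbits R n))"
  proof (rule card_partition)
    show "finite (submax_orbits R n)" unfolding orb using fX by simp
    show "finite (\<Union> (submax_orbits R n))" unfolding un by (rule fX)
    show "card c = q ^ (2 * T - 2)" if "c \<in> submax_orbits R n" for c
      using that card_coadj_orbit[OF _ fin two] by (auto simp: orb X_def q_def)
    show "c \<inter> d = {}" if cd: "c \<in> submax_orbits R n" "d \<in> submax_orbits R n" "c \<noteq> d" for c d
    proof -
      obtain f g where fg: "f \<in> dual_u R n" "g \<in> dual_u R n" "c = coadj_orbit R n f" "d = coadj_orbit R n g"
        using cd by (auto simp: orb X_def)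
      show ?thesis using coadj_orbit_eq[OF fg(1)] coadj_orbit_eq[OF fg(2)] fg(3,4) cd(3) by blast
    qed
  qed
  then have "q ^ (2 * T - 2) * card (submax_orbits R n) * q ^ 2 = q ^ T * (poly (subregular_poly n) (q - 1) * q ^ T)"
    unfolding un X countq[symmetric] by simp
  moreover have "q ^ (2 * T - 2) * card (submax_orbits R n) * q ^ 2 = q ^ (2 * T) * card (submax_orbits R n)"
  proof -
    have "2 * T = 2 * T - 2 + 2" using T2 by simp
    then have "q ^ (2 * T) = q ^ (2 * T - 2) * q ^ 2" by (metis power_add)
    then show ?thesis by (simp only: mult_ac)
  qed
  moreover have "q ^ T * (poly (subregular_poly n) (q - 1) * q ^ T) = q ^ (2 * T) * poly (subregular_poly n) (q - 1)"
    by (simp add: mult_2 power_add)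
  ultimately have "q ^ (2 * T) * card (submax_orbits R n) = q ^ (2 * T) * poly (subregular_poly n) (q - 1)" by simp
  then show ?thesis using q1 by (simp add: q_def)
qed

section \<open>From the characteristic to the invertibility of 2\<close>

lemma two_neq_zero_if_characteristic:
  assumes "characteristic R \<ge> 2" "characteristic R \<noteq> 2"
  shows "\<one> \<oplus> \<one> \<noteq> \<zero>"
proof
  assume "\<one> \<oplus> \<one> = \<zero>"
  then have "[(2 :: nat)] \<cdot> \<one> = \<zero>" by (simp add: numeral_2_eq_2 add_pow_def)
  then have "characteristic R dvd 2"
    using group.pow_eq_id[OF a_group, of \<one> 2] by (simp add: characteristic_def add_pow_def)
  then show False using assms by (auto dest: dvd_imp_le)
qed

end

theorem corollary3p3:
  fixes n :: nat
  assumes "n \<ge> 2"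
  shows "\<exists>P :: nat poly. \<forall>F :: 'a ring.
           field F \<and> finite (carrier F) \<and> characteristic F \<ge> n \<and> characteristic F \<noteq> 2 \<longrightarrow>
           card (submax_orbits F n) = poly P (card (carrier F) - 1)"
proof (intro exI allI impI)
  fix F :: "'a ring"
  assume F: "field F \<and> finite (carrier F) \<and> characteristic F \<ge> n \<and> characteristic F \<noteq> 2"
  then interpret field F by simp
  have "\<one>\<^bsub>F\<^esub> \<oplus>\<^bsub>F\<^esub> \<one>\<^bsub>F\<^esub> \<noteq> \<zero>\<^bsub>F\<^esub>"
    using F assms by (intro two_neq_zero_if_characteristic) auto
  then show "card (submax_orbits F n) = poly (subregular_poly n) (card (carrier F) - 1)"
    using F assms by (intro card_submax_orbits) auto
qed

end
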